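(* Let $\Delta$ be a finite set of finite-valued cost functions on $\mathbb{B}=\{0,1\}$. If $\mathrm{VCSP}(\Delta)$ is NP-hard, then $\mathrm{VCSP}(f_{\ne}) \le^{\mathrm{CV}} \mathrm{VCSP}(\Delta)$.
   Context: A finite-valued cost function on $\mathbb{B}$ is a function $f:\mathbb{B}^k\to\mathbb{Q}_{\ge 0}$ for some $k$. For a finite set $\Delta$ of such functions, an instance of $\mathrm{VCSP}(\Delta)$ consists of variables $V=\{x_1,\dots,x_n\}$ and an objective $f_I(x_1,\dots,x_n)=\sum_{i=1}^q w_i f_i(\mathbf{x}^i)$ where $f_i\in\Delta$, $\mathbf{x}^i$ is a tuple of variables from $V$ of length the arity of $f_i$, and $w_i\in\mathbb{Q}_{\ge0}$; the goal is to find $h:V\to\mathbb{B}$ minimizing $f_I(h(x_1),\dots,h(x_n))$. It is treated as a decision problem: given additionally $k$, is there an assignment of value at most $k$? $\mathrm{VCSP}(f)$ means $\mathrm{VCSP}(\{f\})$. The function $f_{\ne}:\mathbb{B}^2\to\mathbb{Q}_{\ge0}$ is given by $f_{\ne}(0,0)=f_{\ne}(1,1)=1$, $f_{\ne}(0,1)=f_{\ne}(1,0)=0$. The variable set of an instance $I$ is $\mathrm{var}(I)$. A CV-reduction from problem $A_1$ to problem $A_2$ is a function $f$ from instances of $A_1$ to instances of $A_2$, computable in time polynomial in the size of $I$, such that $I$ is a yes-instance iff $f(I)$ is, and $|\mathrm{var}(f(I))|=|\mathrm{var}(I)|+O(1)$; write $A_1\le^{\mathrm{CV}}A_2$ if one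 exists. *)

theory Defs
  imports "HOL-Library.FuncSet" "HOL-Computational_Algebra.Polynomial"
begin

section \<open>Polynomial time\<close>

text \<open>
  Deterministic multi-tape Turing machines with two-way infinite tapes. States are the numbers
  below \<open>nstates\<close>, state 0 is initial and state 1 is halting. Tape symbols are the numbers below
  \<open>nsyms\<close>: 0 is the blank, 1 and 2 represent the bits. The input is on tape 0, the output on
  tape 1. A transition yields the new state and, for each tape, the symbol to write and the
  head movement.
\<close>

record tm =
  ntapes :: nat
  nstates :: nat
  nsyms :: nat
  trans :: "nat \<Rightarrow> nat list \<Rightarrow> nat \<times> (nat \<times> int) list"

definition wf_tm :: "tm \<Rightarrow> bool" where
  "wf_tm M \<longleftrightarrow> 2 \<le> ntapes M \<and> 2 \<le> nstates M \<and> 3 \<le> nsyms M \<and>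
     (\<forall>q < nstates M. \<forall>ss. length ss = ntapes M \<and> set ss \<subseteq> {..<nsyms M} \<longrightarrow>
        (case trans M q ss of (q', acts) \<Rightarrow>
           q' < nstates M \<and> length acts = ntapes M \<and>
           set acts \<subseteq> {..<nsyms M} \<times> {-1, 0, 1}))"

record config =
  state :: nat
  tape :: "nat \<Rightarrow> int \<Rightarrow> nat"
  head :: "nat \<Rightarrow> int"

definition tm_step :: "tm \<Rightarrow> config \<Rightarrow> config" where
  "tm_step M c =
     (if state c = 1 then c
      else (case trans M (state c) (map (\<lambda>j. tape c j (head c j)) [0..<ntapes M]) of (q', acts) \<Rightarrow>
        \<lparr>state = q',
         tape = (\<lambda>j. if j < ntapes M then (tape c j)(head c j := fst (acts ! j)) else tape c j),
         head = (\<lambda>j. if j < ntapes M then head c j + snd (acts ! j) else head c j)\<rparr>))"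

definition word_tape :: "bool list \<Rightarrow> int \<Rightarrow> nat" where
  "word_tape w i =
     (if 0 \<le> i \<and> i < int (length w) then (if w ! nat i then 2 else 1) else 0)"

definition init_config :: "bool list \<Rightarrow> config" where
  "init_config w =
     \<lparr>state = 0, tape = (\<lambda>j. if j = 0 then word_tape w else (\<lambda>_. 0)), head = (\<lambda>_. 0)\<rparr>"

definition outputs_within :: "tm \<Rightarrow> bool list \<Rightarrow> nat \<Rightarrow> bool list \<Rightarrow> bool" where
  "outputs_within M w t v \<longleftrightarrow>
     (let c = (tm_step M ^^ t) (init_config w)
      in state c = 1 \<and> (\<forall>i \<ge> 0. tape c 1 i = word_tape v i))"

definition polytime_computable ::
  "'a set \<Rightarrow> ('a \<Rightarrow> bool list) \<Rightarrow> ('b \<Rightarrow> bool list) \<Rightarrow> ('a \<Rightarrow> 'b) \<Rightarrow> bool" where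
  "polytime_computable D enc1 enc2 f \<longleftrightarrow>
     (\<exists>M (p :: nat poly). wf_tm M \<and>
        (\<forall>x\<in>D. outputs_within M (enc1 x) (poly p (length (enc1 x))) (enc2 (f x))))"

section \<open>NP and decision problems\<close>

definition class_P :: "bool list set set" where
  "class_P = {L. polytime_computable UNIV id (\<lambda>b. [b]) (\<lambda>w. w \<in> L)}"

definition pair_word :: "bool list \<Rightarrow> bool list \<Rightarrow> bool list" where
  "pair_word x y = concat (map (\<lambda>b. [b, b]) x) @ [False, True] @ y"

definition class_NP :: "bool list set set" where
  "class_NP = {L. \<exists>R \<in> class_P. \<exists>p :: nat poly.
     L = {x. \<exists>y. length y \<le> poly p (length x) \<and> pair_word x y \<in> R}}"

record 'a problem =
  instances :: "'a set"
  yes_instance :: "'a \<Rightarrow> bool"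
  encoding :: "'a \<Rightarrow> bool list"
  var :: "'a \<Rightarrow> nat set"

text \<open>NP-hardness is with respect to polynomial-time many-one reductions.\<close>

definition np_hard :: "'a problem \<Rightarrow> bool" where
  "np_hard A \<longleftrightarrow>
     (\<forall>L \<in> class_NP. \<exists>f. f \<in> UNIV \<rightarrow> instances A \<and>
        polytime_computable UNIV id (encoding A) f \<and>
        (\<forall>w. w \<in> L \<longleftrightarrow> yes_instance A (f w)))"

definition cv_reduction :: "'a problem \<Rightarrow> 'b problem \<Rightarrow> ('a \<Rightarrow> 'b) \<Rightarrow> bool" where
  "cv_reduction A B f \<longleftrightarrow>
     f \<in> instances A \<rightarrow> instances B \<and>
     polytime_computable (instances A) (encoding A) (encoding B) f \<and>
     (\<forall>I \<in> instances A. yes_instance A I \<longleftrightarrow> yes_instance B (f I)) \<and>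
     (\<exists>C. \<forall>I \<in> instances A. \<bar>int (card (var B (f I))) - int (card (var A I))\<bar> \<le> C)"

definition cv_reducible :: "'a problem \<Rightarrow> 'b problem \<Rightarrow> bool"  (infix "\<le>\<^sub>C\<^sub>V" 50) where
  "A \<le>\<^sub>C\<^sub>V B \<longleftrightarrow> (\<exists>f. cv_reduction A B f)"

section \<open>Boolean finite-valued VCSPs\<close>

text \<open>A cost function is given by its arity and its values on the words of that length.\<close>

type_synonym cost_fun = "nat \<times> (bool list \<Rightarrow> rat)"

definition finite_valued_cost_functions :: "cost_fun set" where
  "finite_valued_cost_functions = (SIGMA k:UNIV. {t. length t = k} \<rightarrow>\<^sub>E {0..})"

definition f_neq :: cost_fun where
  "f_neq = (2, \<lambda>t\<in>{t. length t = 2}. if t ! 0 = t ! 1 then 1 else 0)"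

text \<open>
  The variables of an instance are \<open>0, \<dots>, nvars - 1\<close>. A constraint \<open>(w, f, xs)\<close> contributes
  the term \<open>w f(xs)\<close> to the objective; \<open>bound\<close> is the threshold of the decision problem.
\<close>

record vcsp_instance =
  nvars :: nat
  constraints :: "(rat \<times> cost_fun \<times> nat list) list"
  bound :: rat

definition vcsp_instances :: "cost_fun set \<Rightarrow> vcsp_instance set" where
  "vcsp_instances \<Delta> = {I. \<forall>(w, f, xs) \<in> set (constraints I).
     0 \<le> w \<and> f \<in> \<Delta> \<and> length xs = fst f \<and> set xs \<subseteq> {..<nvars I}}"

definition objective :: "vcsp_instance \<Rightarrow> (nat \<Rightarrow> bool) \<Rightarrow> rat" where
  "objective I h = (\<Sum>(w, f, xs) \<leftarrow> constraints I. w * snd f (map h xs))"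

text \<open>
  Instances are written as words in a prefix-free way: numbers in binary, cost functions as
  value tables, and the number of variables in unary, so that the size of an instance is at
  least its number of variables.
\<close>

fun bin :: "nat \<Rightarrow> bool list" where
  "bin n = (if n = 0 then [] else odd n # bin (n div 2))"

declare bin.simps [simp del]

definition enc_list :: "('a \<Rightarrow> bool list) \<Rightarrow> 'a list \<Rightarrow> bool list" where
  "enc_list e xs = concat (map (\<lambda>x. True # e x) xs) @ [False]"

definition enc_nat :: "nat \<Rightarrow> bool list" where
  "enc_nat n = enc_list (\<lambda>b. [b]) (bin n)"

definition enc_rat :: "rat \<Rightarrow> bool list" where
  "enc_rat r = (case quotient_of r of (a, b) \<Rightarrow>
     (a < 0) # enc_nat (nat \<bar>a\<bar>) @ enc_nat (nat b))"

definition enc_cost_fun :: "cost_fun \<Rightarrow> bool list" where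
  "enc_cost_fun f =
     enc_nat (fst f) @ enc_list enc_rat (map (snd f) (List.n_lists (fst f) [False, True]))"

definition enc_constraint :: "rat \<times> cost_fun \<times> nat list \<Rightarrow> bool list" where
  "enc_constraint = (\<lambda>(w, f, xs). enc_rat w @ enc_cost_fun f @ enc_list enc_nat xs)"

definition enc_instance :: "vcsp_instance \<Rightarrow> bool list" where
  "enc_instance I =
     replicate (nvars I) True @ [False] @
     enc_list enc_constraint (constraints I) @ enc_rat (bound I)"

definition VCSP :: "cost_fun set \<Rightarrow> vcsp_instance problem" where
  "VCSP \<Delta> =
     \<lparr>instances = vcsp_instances \<Delta>,
      yes_instance = (\<lambda>I. \<exists>h. objective I h \<le> bound I),
      encoding = enc_instance,
      var = (\<lambda>I. {..<nvars I})\<rparr>"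

end

theory Submission imports Defs begin

text \<open>
  Suppose first that some function of \<open>\<Delta>\<close> is not minimal at the all-0 tuple, some function is not
  minimal at the all-1 tuple, and some function is not submodular. Up to exchanging 0 and 1, the
  first two provide a weighted sum on two variables that is minimal exactly when they carry the
  constants 0 and 1 (only up to complement if all functions of \<open>\<Delta>\<close> are invariant under it, which does
  no harm). With these constants a violation of submodularity becomes a multiple of
  \<open>f\<^sub>\<noteq>\<close> plus a constant, after symmetrisation and correction by unary terms. Replacing every
  constraint by this gadget costs two extra variables.

  Otherwise \<open>VCSP(\<Delta>)\<close> is in P: either a constant assignment is optimal, or the objective is a
  submodular function. The latter is minimised by scaling the weights bit by bit. The state is a
  base of the sum in which different arguments are not yet identified, with integer components; it
  is improved by pushing single units along exchange paths from positive to negative vertices, and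
  a minimiser is read off when no such path exists. Each doubling spoils optimality by
  a linear amount only. Since maximum cut is in NP, NP-hardness of \<open>VCSP(\<Delta>)\<close> reduces it to
  \<open>VCSP(\<Delta>)\<close>; deciding the image turns this into a reduction to a trivial instance with the
  original variables.

  Polynomial time is established by a small imperative language that compiles to Turing machines,
  binary trees as universal data, and closure properties of the functions computed on them.
\<close>

section \<open>Structured programs on tapes\<close>

text \<open>P = NP is not excluded, so NP-hardness does not rule out that \<Delta> is tractable, and
  tractable languages need a reduction as well. The reduction that NP-hardness provides may change
  the number of variables at will; it helps only if its result is decided at once. Hence a
  minimisation algorithm has to be proved correct and polynomial down to the level of Turing
  machines, and this shapes it. Since \<Delta> is finite, a constraint has boundedly many argument
  positions. If positions of different constraints are kept apart, the objective is a direct sum of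
  functions with tables of constant size, and membership in the base polytope as well as
  exchangeability can be tested constraint by constraint. The identification of positions enters
  only through the sum of the base over all positions that carry a variable. Single units keep all
  data integral; scaling keeps the number of moves polynomial although weights are binary. In the
  hard case only nonnegative weights are at hand, so every correction must be an addition of
  constraints: a value that is too small is raised, never the other one lowered.\<close>

datatype com =
    Act "(nat \<Rightarrow> nat) \<Rightarrow> nat \<Rightarrow> nat \<times> int"
  | Seq com com
  | Cond "(nat \<Rightarrow> nat) \<Rightarrow> bool" com com
  | While "(nat \<Rightarrow> nat) \<Rightarrow> bool" com

type_synonym mem = "(nat \<Rightarrow> int \<Rightarrow> nat) \<times> (nat \<Rightarrow> int)"

definition view :: "mem \<Rightarrow> nat \<Rightarrow> nat" where
  "view m j = fst m j (snd m j)"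

definition act :: "((nat \<Rightarrow> nat) \<Rightarrow> nat \<Rightarrow> nat \<times> int) \<Rightarrow> mem \<Rightarrow> mem" where
  "act f m = ((\<lambda>j. (fst m j)(snd m j := fst (f (view m) j))), (\<lambda>j. snd m j + snd (f (view m) j)))"

inductive run :: "com \<Rightarrow> mem \<Rightarrow> nat \<Rightarrow> mem \<Rightarrow> bool" where
  Act: "run (Act f) m 1 (act f m)"
| Seq: "run a m t m' \<Longrightarrow> run b m' u m'' \<Longrightarrow> run (Seq a b) m (Suc (t + u)) m''"
| CondT: "P (view m) \<Longrightarrow> run a m t m' \<Longrightarrow> run (Cond P a b) m (Suc t) m'"
| CondF: "\<not> P (view m) \<Longrightarrow> run b m t m' \<Longrightarrow> run (Cond P a b) m (Suc t) m'"
| WhileF: "\<not> P (view m) \<Longrightarrow> run (While P a) m 1 m"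
| WhileT: "P (view m) \<Longrightarrow> run a m t m' \<Longrightarrow> run (While P a) m' u m'' \<Longrightarrow>
    run (While P a) m (Suc (t + u)) m''"

text \<open>
  The control state of a running program is the list of commands that remain to be executed.
  Only finitely many such lists are reachable, so they serve as the states of the machine.
\<close>

fun csucc :: "com list \<Rightarrow> (nat \<Rightarrow> nat) \<Rightarrow> com list" where
  "csucc [] s = []"
| "csucc (Act f # K) s = K"
| "csucc (Seq a b # K) s = a # b # K"
| "csucc (Cond P a b # K) s = (if P s then a else b) # K"
| "csucc (While P a # K) s = (if P s then a # While P a # K else K)"

text \<open>Control steps write back what they read and stay put, so that every transition of the
  machine has the same shape.\<close>

fun cact :: "com list \<Rightarrow> (nat \<Rightarrow> nat) \<Rightarrow> nat \<Rightarrow> nat \<times> int" where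
  "cact (Act f # K) s j = f s j"
| "cact K s j = (s j, 0)"

definition cstep :: "com list \<times> mem \<Rightarrow> com list \<times> mem" where
  "cstep km = (csucc (fst km) (view (snd km)), act (cact (fst km)) (snd km))"

lemma act_nop: "(\<And>j. f (view m) j = (view m j, 0)) \<Longrightarrow> act f m = m"
  by (cases m) (simp add: act_def view_def)

lemma cstep_simps:
  "cstep (Act f # K, m) = (K, act f m)"
  "cstep (Seq a b # K, m) = (a # b # K, m)"
  "cstep (Cond P a b # K, m) = ((if P (view m) then a else b) # K, m)"
  "cstep (While P a # K, m) = (if P (view m) then a # While P a # K else K, m)"
  by (auto simp: cstep_def act_nop) (auto simp: act_def)

lemma run_cstep: "run c m t m' \<Longrightarrow> (cstep ^^ t) (c # K, m) = (K, m')"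
proof (induction arbitrary: K rule: run.induct)
  case (Seq a m t m' b u m'')
  have "(cstep ^^ Suc (t + u)) (Seq a b # K, m) = (cstep ^^ (u + t)) (a # b # K, m)"
    by (simp add: funpow_Suc_right cstep_simps add.commute del: funpow.simps)
  then show ?case using Seq by (simp add: funpow_add)
next
  case (WhileT P m a t m' u m'')
  have "(cstep ^^ Suc (t + u)) (While P a # K, m) = (cstep ^^ (u + t)) (a # While P a # K, m)"
    using WhileT by (simp add: funpow_Suc_right cstep_simps add.commute del: funpow.simps)
  then show ?case using WhileT by (simp add: funpow_add)
qed (simp_all add: cstep_simps funpow_Suc_right del: funpow.simps(2))

text \<open>A loop re-enters itself through its own continuation, which is why the set stays
  finite.\<close>

fun conts :: "com \<Rightarrow> com list \<Rightarrow> com list set" where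
  "conts (Act f) K = {Act f # K}"
| "conts (Seq a b) K = insert (Seq a b # K) (conts a (b # K) \<union> conts b K)"
| "conts (Cond P a b) K = insert (Cond P a b # K) (conts a K \<union> conts b K)"
| "conts (While P a) K = insert (While P a # K) (conts a (While P a # K))"

lemma finite_conts: "finite (conts c K)"
  by (induction c arbitrary: K) auto

lemma conts_self: "c # K \<in> conts c K"
  by (cases c) auto

lemma Nil_notin_conts: "[] \<notin> conts c K"
  by (induction c arbitrary: K) auto

lemma csucc_conts: "X \<in> conts c K \<Longrightarrow> csucc X s \<in> insert K (conts c K)"
proof (induction c arbitrary: K)
  case (Seq a b)
  show ?case
    using Seq.prems Seq.IH(1)[of "b # K"] Seq.IH(2)[of K] conts_self[of a "b # K"] conts_self[of b K] by auto
next
  case (Cond P a b)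
  show ?case
    using Cond.prems Cond.IH(1)[of K] Cond.IH(2)[of K] conts_self[of a K] conts_self[of b K] by auto
next
  case (While P a)
  show ?case using While.prems While.IH[of "While P a # K"] conts_self[of a "While P a # K"]
    by (auto split: if_splits)
qed auto

text \<open>Blank tapes from \<open>k\<close> on must stay blank and unmoved; then a program over
  infinitely many tapes is a program over \<open>k\<close> tapes.\<close>

definition ok_act :: "nat \<Rightarrow> nat \<Rightarrow> ((nat \<Rightarrow> nat) \<Rightarrow> nat \<Rightarrow> nat \<times> int) \<Rightarrow> bool" where
  "ok_act k n f \<longleftrightarrow> (\<forall>s. (\<forall>j. s j < n) \<and> (\<forall>j\<ge>k. s j = 0) \<longrightarrow>
     (\<forall>j<k. fst (f s j) < n \<and> snd (f s j) \<in> {-1, 0, 1}) \<and> (\<forall>j\<ge>k. f s j = (0, 0)))"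

fun wfc :: "nat \<Rightarrow> nat \<Rightarrow> com \<Rightarrow> bool" where
  "wfc k n (Act f) \<longleftrightarrow> ok_act k n f"
| "wfc k n (Seq a b) \<longleftrightarrow> wfc k n a \<and> wfc k n b"
| "wfc k n (Cond P a b) \<longleftrightarrow> wfc k n a \<and> wfc k n b"
| "wfc k n (While P a) \<longleftrightarrow> wfc k n a"

lemma ok_act_nop: "ok_act k n (\<lambda>s j. (s j, 0))"
  by (simp add: ok_act_def)

lemma ok_cact_conts: "X \<in> conts c K \<Longrightarrow> wfc k n c \<Longrightarrow> ok_act k n (cact X)"
proof (induction c arbitrary: K)
  case (Act f)
  then show ?case by (simp add: ok_act_def)
qed (auto simp: ok_act_def)

section \<open>Compilation to Turing machines\<close>

definition init_mem :: "bool list \<Rightarrow> mem" where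
  "init_mem w = (tape (init_config w), head (init_config w))"

text \<open>A state is the index of a continuation in \<open>ks\<close>, which begins with
  \<open>[c]\<close> and \<open>[]\<close> because 0 is the initial and 1 the halting state. The
  empty continuation changes nothing, so the result persists at all later times. Thus an upper bound
  on the running time suffices for \<open>outputs_within\<close>, which inspects the configuration
  after an exact number of steps.\<close>

lemma run_to_tm:
  assumes wf: "wfc k n c" and k: "2 \<le> k" and n: "3 \<le> n"
  shows "\<exists>M. wf_tm M \<and> (\<forall>w t m'. run c (init_mem w) t m' \<longrightarrow>
     (\<forall>t'\<ge>t. state ((tm_step M ^^ t') (init_config w)) = 1 \<and>
        tape ((tm_step M ^^ t') (init_config w)) = fst m'))"
proof -
  define S where "S = conts c [] - {[c]}"
  have finS: "finite S" by (simp add: S_def finite_conts)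
  obtain zs where zs: "set zs = S" "distinct zs" using finite_distinct_list[OF finS] by blast
  define ks where "ks = [c] # [] # zs"
  have dist: "distinct ks" using zs Nil_notin_conts[of c "[]"] by (auto simp: ks_def S_def)
  have setks: "set ks = insert [] (conts c [])"
    using zs conts_self[of c "[]"] by (auto simp: ks_def S_def)
  define idx where "idx K = (THE i. i < length ks \<and> ks ! i = K)" for K
  have idx: "idx K < length ks \<and> ks ! idx K = K" if K: "K \<in> set ks" for K
  proof -
    obtain i where "i < length ks" "ks ! i = K" using K by (meson in_set_conv_nth)
    then have "\<exists>!i. i < length ks \<and> ks ! i = K"
      using nth_eq_iff_index_eq[OF dist] by blast
    then show ?thesis 
      unfolding idx_def using theI'[of "\<lambda>i. i < length ks \<and> ks ! i = K"] by blast
  qed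
  have idx_nth: "idx (ks ! i) = i" if "i < length ks" for i
    using idx[of "ks ! i"] that nth_eq_iff_index_eq[OF dist] nth_mem by blast
  have idx0: "idx [c] = 0" using idx_nth[of 0] by (simp add: ks_def)
  have idx1: "idx [] = 1" using idx_nth[of 1] by (simp add: ks_def)
  have succ: "csucc K s \<in> set ks" if "K \<in> set ks" for K s
    using that csucc_conts[of K c "[]" s] by (auto simp: setks)
  have oka: "ok_act k n (cact K)" if "K \<in> set ks" for K
    using that ok_cact_conts[of K c "[]" k n] wf by (auto simp: setks ok_act_def)
  define M where "M = \<lparr>ntapes = k, nstates = length ks, nsyms = n,
    trans = (\<lambda>q ss. let s = (\<lambda>j. if j < k then ss ! j else 0) in
      (idx (csucc (ks ! q) s), map (cact (ks ! q) s) [0..<k]))\<rparr>"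
  have wfM: "wf_tm M"
  proof -
    have main: "case trans M q ss of (q', acts) \<Rightarrow> q' < nstates M \<and> length acts = ntapes M \<and>
           set acts \<subseteq> {..<nsyms M} \<times> {-1, 0, 1}"
      if q: "q < nstates M" and ss: "length ss = ntapes M" "set ss \<subseteq> {..<nsyms M}" for q ss
    proof -
      define s where "s = (\<lambda>j. if j < k then ss ! j else 0)"
      have qk: "ks ! q \<in> set ks" using q by (simp add: M_def)
      have "s j < n" for j using ss n nth_mem[of j ss] by (auto simp: s_def M_def subset_iff)
      moreover have "\<forall>j\<ge>k. s j = 0" by (simp add: s_def)
      ultimately have "\<forall>j<k. fst (cact (ks ! q) s j) < n \<and> snd (cact (ks ! q) s j) \<in> {-1, 0, 1}"
        using oka[OF qk] unfolding ok_act_def by blast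
      then have "set (map (cact (ks ! q) s) [0..<k]) \<subseteq> {..<n} \<times> {-1, 0, 1}"
        unfolding set_map image_subset_iff mem_Times_iff by simp
      moreover have "idx (csucc (ks ! q) s) < length ks" using idx succ qk by blast
      ultimately show ?thesis by (simp add: M_def s_def[symmetric] Let_def)
    qed
    have "2 \<le> nstates M" "ntapes M = k" "nsyms M = n" by (simp_all add: M_def ks_def)
    then show ?thesis unfolding wf_tm_def using k n main by simp
  qed
  \<comment> \<open>Tapes from \<open>k\<close> on stay blank, so the finitely many symbols read by
    the machine determine the whole view.\<close>
  define good where "good m \<longleftrightarrow> (\<forall>j i. fst m j i < n) \<and> (\<forall>j\<ge>k. \<forall>i. fst m j i = 0)" for m :: mem
  define rel where "rel cf km \<longleftrightarrow> fst km \<in> set ks \<and> good (snd km) \<and>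
    state cf = idx (fst km) \<and> tape cf = fst (snd km) \<and> head cf = snd (snd km)"
    for cf :: config and km :: "com list \<times> mem"
  have stp: "rel (tm_step M cf) (cstep km)" if r: "rel cf km" for cf km
  proof -
    obtain K m where km: "km = (K, m)" by (cases km)
    obtain T h where m: "m = (T, h)" by (cases m)
    have K: "K \<in> set ks" and g: "good m" and st: "state cf = idx K" and tp: "tape cf = T"
      and hd: "head cf = h" using r by (auto simp: rel_def km m)
    have vw: "(\<lambda>j. if j < k then map (\<lambda>j. T j (h j)) [0..<k] ! j else 0) = view m"
      using g by (simp add: view_def m good_def fun_eq_iff)
    have v: "\<forall>j. view m j < n" "\<forall>j\<ge>k. view m j = 0" using g by (auto simp: good_def view_def)
    have o: "\<forall>j<k. fst (cact K (view m) j) < n" "\<forall>j\<ge>k. cact K (view m) j = (0, 0)"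
      using oka[OF K] v unfolding ok_act_def by blast+
    have o': "fst (cact K (view m) j) < n" for j
      using o n by (cases "j < k") auto
    have g': "good (act (cact K) m)"
      using g o o' by (simp add: good_def act_def)
    show ?thesis
    proof (cases "K = []")
      case True
      then have "cstep km = km" by (auto simp: km cstep_def act_nop)
      moreover have "tm_step M cf = cf" using st True idx1 by (simp add: tm_step_def)
      ultimately show ?thesis using r by simp
    next
      case False
      then have "state cf \<noteq> 1" using st idx1 idx[OF K] idx[of "[]"] setks by auto
      moreover have "ks ! idx K = K" using idx K by blast
      ultimately have e: "tm_step M cf = \<lparr>state = idx (csucc K (view m)),
         tape = (\<lambda>j. if j < k then (T j)(h j := fst (cact K (view m) j)) else T j),
         head = (\<lambda>j. if j < k then h j + snd (cact K (view m) j) else h j)\<rparr>"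
        unfolding tm_step_def st tp hd
        by (simp add: M_def Let_def vw fun_eq_iff)
      have "(if j < k then (T j)(h j := fst (cact K (view m) j)) else T j) =
          (T j)(h j := fst (cact K (view m) j))" for j
        using g o by (auto simp: good_def m fun_eq_iff)
      moreover have "(if j < k then h j + snd (cact K (view m) j) else h j) =
          h j + snd (cact K (view m) j)" for j
        using o by simp
      ultimately show ?thesis unfolding e
        using g' succ[OF K] by (simp add: rel_def km cstep_def) (simp add: act_def m)
    qed
  qed
  have it: "rel ((tm_step M ^^ t) cf) ((cstep ^^ t) km)" if "rel cf km" for t cf km
    using that by (induction t) (auto intro: stp)
  have init: "rel (init_config w) ([c], init_mem w)" for w
    using n k conts_self[of c "[]"]
    by (auto simp: rel_def init_mem_def init_config_def good_def word_tape_def setks idx0)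
  have "state ((tm_step M ^^ t') (init_config w)) = 1 \<and>
        tape ((tm_step M ^^ t') (init_config w)) = fst m'"
    if r: "run c (init_mem w) t m'" and t: "t' \<ge> t" for w t m' t'
  proof -
    have "(cstep ^^ u) ([], m') = ([], m')" for u
      by (induction u) (auto simp: cstep_def act_nop)
    then have "(cstep ^^ ((t' - t) + t)) ([c], init_mem w) = ([], m')"
      using run_cstep[OF r, of "[]"] by (simp only: funpow_add o_apply)
    then have "(cstep ^^ t') ([c], init_mem w) = ([], m')" using t by simp
    then show ?thesis using it[OF init, of t' w] by (auto simp: rel_def idx1)
  qed
  then show ?thesis using wfM by blast
qed

section \<open>Tapes as stacks\<close>

text \<open>
  A stack is the word that starts at the head, so the input tape is initially such a stack.
  What lies to the left of the head is irrelevant.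
\<close>

definition stk :: "(int \<Rightarrow> nat) \<Rightarrow> int \<Rightarrow> bool list \<Rightarrow> bool" where
  "stk T h w \<longleftrightarrow> (\<forall>i\<ge>0. T (h + i) = word_tape w i)"

definition rep :: "nat set \<Rightarrow> mem \<Rightarrow> (nat \<Rightarrow> bool list) \<Rightarrow> bool" where
  "rep R m st \<longleftrightarrow> (\<forall>r\<in>R. stk (fst m r) (snd m r) (st r))"

definition same_outside :: "nat set \<Rightarrow> mem \<Rightarrow> mem \<Rightarrow> bool" where
  "same_outside R m m' \<longleftrightarrow> (\<forall>j. j \<notin> R \<longrightarrow> fst m' j = fst m j \<and> snd m' j = snd m j)"

text \<open>A Hoare triple with a time bound. The frame condition covers cells and heads outside
  \<open>R\<close>; it protects the output tape and the tapes of a simulated machine.\<close>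

definition exec :: "nat set \<Rightarrow> com \<Rightarrow> (nat \<Rightarrow> bool list) \<Rightarrow> nat \<Rightarrow> (nat \<Rightarrow> bool list) \<Rightarrow> bool" where
  "exec R c st t st' \<longleftrightarrow> (\<forall>m. rep R m st \<longrightarrow>
     (\<exists>m' u. u \<le> t \<and> run c m u m' \<and> rep R m' st' \<and> same_outside R m m'))"

lemma same_outside_refl: "same_outside R m m"
  by (simp add: same_outside_def)

lemma same_outside_trans: "same_outside R m m' \<Longrightarrow> same_outside R m' m'' \<Longrightarrow> same_outside R m m''"
  by (simp add: same_outside_def)

lemma word_tape_Nil [simp]: "word_tape [] i = 0"
  by (simp add: word_tape_def)

lemma word_tape_Cons_0 [simp]: "word_tape (b # w) 0 = (if b then 2 else 1)"
  by (simp add: word_tape_def)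

lemma word_tape_Cons: "i > 0 \<Longrightarrow> word_tape (b # w) i = word_tape w (i - 1)"
  by (auto simp: word_tape_def nth_Cons' nat_diff_distrib)

lemma stk_push: "stk T h w \<Longrightarrow> stk (T(h - 1 := if b then 2 else 1)) (h - 1) (b # w)"
  unfolding stk_def
proof (intro allI impI)
  fix i :: int
  assume a: "\<forall>i\<ge>0. T (h + i) = word_tape w i" and i: "0 \<le> i"
  show "(T(h - 1 := if b then 2 else 1)) (h - 1 + i) = word_tape (b # w) i"
  proof (cases "i = 0")
    case False
    then show ?thesis using i a[rule_format, of "i - 1"] by (simp add: word_tape_Cons algebra_simps)
  qed simp
qed

lemma stk_pop: "stk T h w \<Longrightarrow> stk T (h + 1) (tl w)"
  unfolding stk_def
proof (intro allI impI)
  fix i :: int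
  assume a: "\<forall>i\<ge>0. T (h + i) = word_tape w i" and i: "0 \<le> i"
  then show "T (h + 1 + i) = word_tape (tl w) i"
    using a[rule_format, of "i + 1"] by (cases w) (simp_all add: word_tape_Cons algebra_simps)
qed

lemma stk_head: "stk T h w \<Longrightarrow> T h = (case w of [] \<Rightarrow> 0 | b # _ \<Rightarrow> if b then 2 else 1)"
  unfolding stk_def by (drule spec[of _ 0]) (auto split: list.split)

lemma rep_view: "rep R m st \<Longrightarrow> r \<in> R \<Longrightarrow>
    view m r = (case st r of [] \<Rightarrow> 0 | b # _ \<Rightarrow> if b then 2 else 1)"
  by (auto simp: rep_def view_def dest: stk_head)

section \<open>Elementary stack programs\<close>

definition skip :: com where
  "skip = Act (\<lambda>s j. (s j, 0))"

definition push :: "nat \<Rightarrow> bool \<Rightarrow> com" where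
  "push r b = Seq (Act (\<lambda>s j. (s j, if j = r then -1 else 0)))
     (Act (\<lambda>s j. (if j = r then if b then 2 else 1 else s j, 0)))"

definition pop :: "nat \<Rightarrow> com" where
  "pop r = Act (\<lambda>s j. (s j, if j = r then 1 else 0))"

text \<open>The second branch serves both a False on top and an empty stack.\<close>

definition iftop :: "nat \<Rightarrow> com \<Rightarrow> com \<Rightarrow> com" where
  "iftop r = Cond (\<lambda>s. s r = 2)"

definition while_ne :: "nat \<Rightarrow> com \<Rightarrow> com" where
  "while_ne r = While (\<lambda>s. s r \<noteq> 0)"

lemma exec_conv: "exec R c st t s1 \<Longrightarrow> t \<le> u \<Longrightarrow> s1 = s2 \<Longrightarrow> exec R c st u s2"
  unfolding exec_def by (meson order_trans)

lemma exec_skip: "exec R skip st 1 st"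
  unfolding exec_def
proof (intro allI impI)
  fix m assume "rep R m st"
  moreover have "run skip m 1 m"
    using run.Act[of "\<lambda>s j. (s j, 0)" m] by (simp add: skip_def act_nop)
  ultimately show "\<exists>m' u. u \<le> 1 \<and> run skip m u m' \<and> rep R m' st \<and> same_outside R m m'"
    using same_outside_refl by blast
qed

lemma exec_pop:
  assumes "r \<in> R"
  shows "exec R (pop r) st 1 (st(r := tl (st r)))"
  unfolding exec_def
proof (intro allI impI)
  fix m assume m: "rep R m st"
  let ?f = "\<lambda>(s::nat \<Rightarrow> nat) j. (s j, if j = r then 1 else (0::int))"
  have "run (pop r) m 1 (act ?f m)" unfolding pop_def by (rule run.Act)
  moreover have "rep R (act ?f m) (st(r := tl (st r)))"
    using m stk_pop by (auto simp: rep_def act_def view_def)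
  moreover have "same_outside R m (act ?f m)"
    using assms by (auto simp: same_outside_def act_def view_def)
  ultimately show "\<exists>m' u. u \<le> 1 \<and> run (pop r) m u m' \<and> rep R m' (st(r := tl (st r))) \<and> same_outside R m m'"
    by blast
qed

lemma exec_push:
  assumes "r \<in> R"
  shows "exec R (push r b) st 3 (st(r := b # st r))"
  unfolding exec_def
proof (intro allI impI)
  fix m assume m: "rep R m st"
  let ?f = "\<lambda>(s::nat \<Rightarrow> nat) j. (s j, if j = r then -1 else (0::int))"
  let ?g = "\<lambda>(s::nat \<Rightarrow> nat) j. (if j = r then if b then 2 else 1 else s j, 0::int)"
  have "run (push r b) m (Suc (1 + 1)) (act ?g (act ?f m))"
    unfolding push_def by (rule run.Seq[OF run.Act run.Act])
  moreover have "rep R (act ?g (act ?f m)) (st(r := b # st r))"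
    using m stk_push[of "fst m r" "snd m r" "st r" b] by (auto simp: rep_def act_def view_def)
  moreover have "same_outside R m (act ?g (act ?f m))"
    using assms by (auto simp: same_outside_def act_def view_def)
  ultimately show "\<exists>m' u. u \<le> 3 \<and> run (push r b) m u m' \<and> rep R m' (st(r := b # st r)) \<and> same_outside R m m'"
    by (intro exI[of _ "act ?g (act ?f m)"] exI[of _ 3]) (simp add: numeral_3_eq_3)
qed

lemma exec_seq:
  assumes "exec R a st t st1" "exec R b st1 u st2"
  shows "exec R (Seq a b) st (Suc (t + u)) st2"
  unfolding exec_def
proof (intro allI impI)
  fix m assume m: "rep R m st"
  obtain m1 x where 1: "x \<le> t" "run a m x m1" "rep R m1 st1" "same_outside R m m1"
    using assms(1) m unfolding exec_def by blast
  obtain m2 y where 2: "y \<le> u" "run b m1 y m2" "rep R m2 st2" "same_outside R m1 m2"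
    using assms(2) 1(3) unfolding exec_def by blast
  have "run (Seq a b) m (Suc (x + y)) m2" using 1(2) 2(2) by (rule run.Seq)
  moreover have "Suc (x + y) \<le> Suc (t + u)" using 1(1) 2(1) by simp
  ultimately show "\<exists>m' v. v \<le> Suc (t + u) \<and> run (Seq a b) m v m' \<and> rep R m' st2 \<and> same_outside R m m'"
    using 2(3) same_outside_trans[OF 1(4) 2(4)] by blast
qed

lemma exec_iftop:
  assumes "r \<in> R" "st r \<noteq> [] \<and> hd (st r) \<Longrightarrow> exec R a st t st'"
    "\<not> (st r \<noteq> [] \<and> hd (st r)) \<Longrightarrow> exec R b st t st'"
  shows "exec R (iftop r a b) st (Suc t) st'"
  unfolding exec_def iftop_def
proof (intro allI impI)
  fix m assume m: "rep R m st"
  have v: "view m r = 2 \<longleftrightarrow> st r \<noteq> [] \<and> hd (st r)"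
    using rep_view[OF m assms(1)] by (auto split: list.splits)
  show "\<exists>m' u. u \<le> Suc t \<and> run (Cond (\<lambda>s. s r = 2) a b) m u m' \<and> rep R m' st' \<and> same_outside R m m'"
  proof (cases "view m r = 2")
    case True
    then have "exec R a st t st'" using assms(2) v by blast
    then obtain m' u where "u \<le> t" "run a m u m'" "rep R m' st'" "same_outside R m m'"
      using m unfolding exec_def by blast
    then show ?thesis using True run.CondT[of "\<lambda>s. s r = 2" m a u m' b] by (meson Suc_le_mono)
  next
    case False
    then have "exec R b st t st'" using assms(3) v by blast
    then obtain m' u where "u \<le> t" "run b m u m'" "rep R m' st'" "same_outside R m m'"
      using m unfolding exec_def by blast
    then show ?thesis using False run.CondF[of "\<lambda>s. s r = 2" m b u m' a] by (meson Suc_le_mono)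
  qed
qed

lemma exec_while_end:
  assumes "r \<in> R" "st r = []"
  shows "exec R (while_ne r c) st 1 st"
  unfolding exec_def while_ne_def
proof (intro allI impI)
  fix m assume m: "rep R m st"
  have "view m r = 0" using rep_view[OF m assms(1)] assms(2) by simp
  then have "run (While (\<lambda>s. s r \<noteq> 0) c) m 1 m" by (intro run.WhileF) simp
  then show "\<exists>m' u. u \<le> 1 \<and> run (While (\<lambda>s. s r \<noteq> 0) c) m u m' \<and> rep R m' st \<and> same_outside R m m'"
    using m same_outside_refl by blast
qed

lemma exec_while_step:
  assumes "r \<in> R" "st r \<noteq> []" "exec R c st t st1" "exec R (while_ne r c) st1 u st2"
  shows "exec R (while_ne r c) st (Suc (t + u)) st2"
  unfolding exec_def
proof (intro allI impI)
  fix m assume m: "rep R m st"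
  have v: "view m r \<noteq> 0" using rep_view[OF m assms(1)] assms(2) by (auto split: list.splits)
  obtain m1 x where 1: "x \<le> t" "run c m x m1" "rep R m1 st1" "same_outside R m m1"
    using assms(3) m unfolding exec_def by blast
  obtain m2 y where 2: "y \<le> u" "run (while_ne r c) m1 y m2" "rep R m2 st2" "same_outside R m1 m2"
    using assms(4) 1(3) unfolding exec_def by blast
  have "run (while_ne r c) m (Suc (x + y)) m2"
    unfolding while_ne_def using v 1(2) 2(2) by (intro run.WhileT) (auto simp: while_ne_def)
  moreover have "Suc (x + y) \<le> Suc (t + u)" using 1(1) 2(1) by simp
  ultimately show "\<exists>m' u'. u' \<le> Suc (t + u) \<and> run (while_ne r c) m u' m' \<and> rep R m' st2 \<and> same_outside R m m'"
    using 2(3) same_outside_trans[OF 1(4) 2(4)] by blast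
qed

text \<open>The number of tapes and the alphabet are fixed only when a complete program is compiled,
  so its parts must be well formed for all sufficiently many tapes and every alphabet of at least
  three symbols.\<close>

definition wfs :: "com \<Rightarrow> bool" where
  "wfs c \<longleftrightarrow> (\<exists>k0. \<forall>k\<ge>k0. \<forall>n\<ge>3. wfc k n c)"

lemma wfs_seq: "wfs a \<Longrightarrow> wfs b \<Longrightarrow> wfs (Seq a b)"
  unfolding wfs_def
proof (elim exE)
  fix k1 k2 assume "\<forall>k\<ge>k1. \<forall>n\<ge>3. wfc k n a" "\<forall>k\<ge>k2. \<forall>n\<ge>3. wfc k n b"
  then have "\<forall>k\<ge>max k1 k2. \<forall>n\<ge>3. wfc k n (Seq a b)" by simp
  then show "\<exists>k0. \<forall>k\<ge>k0. \<forall>n\<ge>3. wfc k n (Seq a b)" ..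
qed

lemma wfs_iftop: "wfs a \<Longrightarrow> wfs b \<Longrightarrow> wfs (iftop r a b)"
  using wfs_seq[of a b] by (simp add: wfs_def iftop_def)

lemma wfs_while: "wfs a \<Longrightarrow> wfs (while_ne r a)"
  by (simp add: wfs_def while_ne_def)

lemma wfs_skip: "wfs skip"
  by (simp add: wfs_def skip_def ok_act_nop)

lemma wfs_pop: "wfs (pop r)"
  unfolding wfs_def pop_def by (rule exI[of _ "Suc r"]) (auto simp: ok_act_def)

lemma wfs_push: "wfs (push r b)"
  unfolding wfs_def push_def by (rule exI[of _ "Suc r"]) (auto simp: ok_act_def)

lemmas wfs_intros = wfs_seq wfs_iftop wfs_while wfs_skip wfs_pop wfs_push

definition push_top :: "nat \<Rightarrow> nat \<Rightarrow> com" where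
  "push_top a b = iftop a (push b True) (push b False)"

lemma exec_push_top:
  assumes "a \<in> R" "b \<in> R" "st a \<noteq> []"
  shows "exec R (push_top a b) st 4 (st(b := hd (st a) # st b))"
proof -
  have "exec R (push_top a b) st (Suc 3) (st(b := hd (st a) # st b))"
    unfolding push_top_def using assms exec_push[of b R True st] exec_push[of b R False st]
    by (intro exec_iftop) auto
  then show ?thesis by (rule exec_conv) auto
qed

definition mv :: "nat \<Rightarrow> nat \<Rightarrow> com" where
  "mv a b = while_ne a (Seq (push_top a b) (pop a))"

lemma exec_mv:
  assumes "a \<in> R" "b \<in> R" "a \<noteq> b"
  shows "exec R (mv a b) st (7 * length (st a) + 1) (st(a := [], b := rev (st a) @ st b))"
proof (induction "st a" arbitrary: st)
  case Nil
  then show ?case unfolding mv_def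
    by (intro exec_conv[OF exec_while_end]) (auto simp: assms fun_eq_iff)
next
  case (Cons x w)
  let ?s1 = "st(b := hd (st a) # st b)"
  let ?s2 = "?s1(a := tl (?s1 a))"
  have body: "exec R (Seq (push_top a b) (pop a)) st (Suc (4 + 1)) ?s2"
    using assms Cons(2) by (intro exec_seq[OF exec_push_top exec_pop]) auto
  have "exec R (mv a b) ?s2 (7 * length (?s2 a) + 1) (?s2(a := [], b := rev (?s2 a) @ ?s2 b))"
    using Cons(2)[symmetric] assms by (intro Cons(1)) auto
  then have "exec R (mv a b) st (Suc (Suc (4 + 1) + (7 * length (?s2 a) + 1)))
      (?s2(a := [], b := rev (?s2 a) @ ?s2 b))"
    unfolding mv_def using assms Cons(2) body by (intro exec_while_step[OF _ _ body]) auto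
  then show ?case using Cons(2)[symmetric] assms by (elim exec_conv) (auto simp: fun_eq_iff)
qed

definition clr :: "nat \<Rightarrow> com" where
  "clr a = while_ne a (pop a)"

lemma exec_clr:
  assumes "a \<in> R"
  shows "exec R (clr a) st (7 * length (st a) + 1) (st(a := []))"
proof (induction "st a" arbitrary: st)
  case Nil
  then show ?case unfolding clr_def
    by (intro exec_conv[OF exec_while_end]) (auto simp: assms fun_eq_iff)
next
  case (Cons x w)
  let ?s2 = "st(a := tl (st a))"
  have "exec R (clr a) ?s2 (7 * length (?s2 a) + 1) (?s2(a := []))"
    using Cons(2)[symmetric] assms by (intro Cons(1)) auto
  then have "exec R (clr a) st (Suc (1 + (7 * length (?s2 a) + 1))) (?s2(a := []))"
    unfolding clr_def using assms Cons(2) by (intro exec_while_step[OF _ _ exec_pop]) auto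
  then show ?case using Cons(2)[symmetric] by (elim exec_conv) (auto simp: fun_eq_iff)
qed

definition unmv :: "nat \<Rightarrow> nat \<Rightarrow> nat \<Rightarrow> com" where
  "unmv c a b = while_ne c (Seq (push_top c a) (Seq (push_top c b) (pop c)))"

lemma exec_unmv:
  assumes "a \<in> R" "b \<in> R" "c \<in> R" "a \<noteq> b" "a \<noteq> c" "b \<noteq> c"
  shows "exec R (unmv c a b) st (12 * length (st c) + 1)
    (st(c := [], a := rev (st c) @ st a, b := rev (st c) @ st b))"
proof (induction "st c" arbitrary: st)
  case Nil
  then show ?case unfolding unmv_def
    by (intro exec_conv[OF exec_while_end]) (auto simp: assms fun_eq_iff)
next
  case (Cons x w)
  let ?s1 = "st(a := hd (st c) # st a)"
  let ?s2 = "?s1(b := hd (?s1 c) # ?s1 b)"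
  let ?s3 = "?s2(c := tl (?s2 c))"
  have body: "exec R (Seq (push_top c a) (Seq (push_top c b) (pop c))) st (Suc (4 + Suc (4 + 1))) ?s3"
    using assms Cons(2) by (intro exec_seq[OF exec_push_top exec_seq[OF exec_push_top exec_pop]]) auto
  have "exec R (unmv c a b) ?s3 (12 * length (?s3 c) + 1)
      (?s3(c := [], a := rev (?s3 c) @ ?s3 a, b := rev (?s3 c) @ ?s3 b))"
    using Cons(2)[symmetric] assms by (intro Cons(1)) auto
  then have "exec R (unmv c a b) st (Suc (Suc (4 + Suc (4 + 1)) + (12 * length (?s3 c) + 1)))
      (?s3(c := [], a := rev (?s3 c) @ ?s3 a, b := rev (?s3 c) @ ?s3 b))"
    unfolding unmv_def using assms Cons(2) by (intro exec_while_step[OF _ _ body]) auto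
  then show ?case using Cons(2)[symmetric] assms by (elim exec_conv) (auto simp: fun_eq_iff)
qed

text \<open>\<open>mv\<close> reverses the word, and \<open>unmv\<close> reverses it back onto both
  targets.\<close>

definition dup :: "nat \<Rightarrow> nat \<Rightarrow> nat \<Rightarrow> com" where
  "dup a b c = Seq (mv a c) (unmv c a b)"

lemma exec_dup:
  assumes "a \<in> R" "b \<in> R" "c \<in> R" "a \<noteq> b" "a \<noteq> c" "b \<noteq> c" "st c = []"
  shows "exec R (dup a b c) st (19 * length (st a) + 3) (st(b := st a @ st b))"
  unfolding dup_def
  using assms by (intro exec_conv[OF exec_seq[OF exec_mv exec_unmv]]) (auto simp: fun_eq_iff)

fun push_word :: "nat \<Rightarrow> bool list \<Rightarrow> com" where
  "push_word r [] = skip"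
| "push_word r (b # w) = Seq (push_word r w) (push r b)"

lemma exec_push_word:
  assumes "r \<in> R"
  shows "exec R (push_word r w) st (4 * length w + 1) (st(r := w @ st r))"
proof (induction w)
  case Nil
  have "exec R skip st 1 (st(r := [] @ st r))" by (rule exec_conv[OF exec_skip]) auto
  then show ?case by simp
next
  case (Cons b w)
  show ?case unfolding push_word.simps
    by (rule exec_conv[OF exec_seq[OF Cons exec_push]]) (auto simp: assms)
qed

lemma wfs_push_word: "wfs (push_word r w)"
  by (induction w) (auto intro: wfs_intros)

lemma wfs_moves: "wfs (push_top a b)" "wfs (mv a b)" "wfs (clr a)" "wfs (unmv a b c)" "wfs (dup a b c)"
  unfolding push_top_def mv_def clr_def unmv_def dup_def by (intro wfs_intros)+

section \<open>Polynomial-time functions on binary trees\<close>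

datatype tree = L | N tree tree

text \<open>Preorder is prefix-free, so several trees can lie on one stack and be separated
  again.\<close>

fun enc :: "tree \<Rightarrow> bool list" where
  "enc L = [False]"
| "enc (N a b) = True # enc a @ enc b"

fun tsz :: "tree \<Rightarrow> nat" where
  "tsz L = 1"
| "tsz (N a b) = 1 + tsz a + tsz b"

lemma length_enc [simp]: "length (enc T) = tsz T"
  by (induction T) auto

lemma tsz_pos [simp]: "tsz T > 0"
  by (induction T) auto

lemma enc_ne [simp]: "enc T \<noteq> []"
  by (cases T) auto

lemma hd_enc [simp]: "hd (enc T) \<longleftrightarrow> T \<noteq> L"
  by (cases T) auto

fun left :: "tree \<Rightarrow> tree" where
  "left L = L"
| "left (N a b) = a"

fun right :: "tree \<Rightarrow> tree" where
  "right L = L"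
| "right (N a b) = b"

lemma poly_mono_nat: "x \<le> y \<Longrightarrow> poly p x \<le> poly p (y :: nat)"
  by (induction p) (auto intro!: add_mono mult_mono)

section \<open>Programs that compute tree functions\<close>

definition regs :: "nat \<Rightarrow> nat set \<Rightarrow> bool" where
  "regs K R \<longleftrightarrow> {..<K} - {1} \<subseteq> R"

definition clean :: "nat \<Rightarrow> (nat \<Rightarrow> bool list) \<Rightarrow> bool" where
  "clean K st \<longleftrightarrow> (\<forall>j. 1 < j \<and> j < K \<longrightarrow> st j = [])"

lemma regsD: "regs K R \<Longrightarrow> j < K \<Longrightarrow> j \<noteq> 1 \<Longrightarrow> j \<in> R"
  by (auto simp: regs_def)

lemma regs_le: "regs K R \<Longrightarrow> K' \<le> K \<Longrightarrow> regs K' R"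
  by (auto simp: regs_def subset_iff)

lemma clean_le: "clean K st \<Longrightarrow> K' \<le> K \<Longrightarrow> clean K' st"
  by (auto simp: clean_def)

lemma cleanD: "clean K st \<Longrightarrow> 1 < j \<Longrightarrow> j < K \<Longrightarrow> st j = []"
  by (auto simp: clean_def)

text \<open>
  Tape 1 is reserved for the output, so the registers of a program are tape 0 and the tapes
  from 2 on.
\<close>

definition computes :: "com \<Rightarrow> nat \<Rightarrow> nat poly \<Rightarrow> tree set \<Rightarrow> (tree \<Rightarrow> tree) \<Rightarrow> bool" where
  "computes c K p D F \<longleftrightarrow> wfs c \<and> 4 \<le> K \<and> (\<forall>T\<in>D. tsz (F T) \<le> poly p (tsz T) \<and>
     (\<forall>R st. regs K R \<longrightarrow> clean K st \<longrightarrow> st 0 = enc T \<longrightarrow>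
        exec R c st (poly p (tsz T)) (st(0 := enc (F T)))))"

definition TP :: "tree set \<Rightarrow> (tree \<Rightarrow> tree) \<Rightarrow> bool" where
  "TP D F \<longleftrightarrow> (\<exists>c K p. computes c K p D F)"

lemma computesD:
  assumes "computes c K p D F" "regs K R" "clean K st" "T \<in> D" "st 0 = enc T"
  shows "exec R c st (poly p (tsz T)) (st(0 := enc (F T)))"
  using assms unfolding computes_def by blast

lemma computes_size: "computes c K p D F \<Longrightarrow> T \<in> D \<Longrightarrow> tsz (F T) \<le> poly p (tsz T)"
  unfolding computes_def by blast

lemma TP_id: "TP D (\<lambda>T. T)"
proof -
  have "exec R skip st (poly [:1, 1:] (tsz T)) (st(0 := enc T))" if "st 0 = enc T" for R st T
    by (rule exec_conv[OF exec_skip]) (use that in auto)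
  then have "computes skip 4 [:1, 1:] D (\<lambda>T. T)" by (auto simp: computes_def wfs_skip)
  then show ?thesis unfolding TP_def by blast
qed

text \<open>The bound on the output size that \<open>computes\<close> carries is what makes the time
  of the second program polynomial in the original input.\<close>

lemma TP_comp:
  assumes "TP D F" "TP E G" and FD: "\<And>T. T \<in> D \<Longrightarrow> F T \<in> E"
  shows "TP D (\<lambda>T. G (F T))"
proof -
  obtain c K p where 1: "computes c K p D F" using assms(1) TP_def by blast
  obtain d J q where 2: "computes d J q E G" using assms(2) TP_def by blast
  let ?p = "1 + p + pcompose q p"
  have le: "poly q (tsz (F T)) \<le> poly q (poly p (tsz T))" if "T \<in> D" for T
    using computes_size[OF 1 that] by (rule poly_mono_nat)
  have "exec R (Seq c d) st (poly ?p (tsz T)) (st(0 := enc (G (F T))))"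
    if R: "regs (max K J) R" and cl: "clean (max K J) st" and st: "st 0 = enc T" and TD: "T \<in> D" for R st T
  proof -
    have e1: "exec R c st (poly p (tsz T)) (st(0 := enc (F T)))"
      by (rule computesD[OF 1]) (use R cl st TD in \<open>auto intro: regs_le clean_le\<close>)
    have e2: "exec R d (st(0 := enc (F T))) (poly q (tsz (F T))) ((st(0 := enc (F T)))(0 := enc (G (F T))))"
      by (rule computesD[OF 2]) (use R cl FD[OF TD] in \<open>auto simp: clean_def intro: regs_le\<close>)
    show ?thesis by (rule exec_conv[OF exec_seq[OF e1 e2]]) (use le[OF TD] in \<open>auto simp: poly_pcompose\<close>)
  qed
  moreover have "tsz (G (F T)) \<le> poly ?p (tsz T)" if "T \<in> D" for T
    using computes_size[OF 2 FD[OF that]] le[OF that] by (simp add: poly_pcompose)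
  ultimately have "computes (Seq c d) (max K J) ?p D (\<lambda>T. G (F T))"
    using 1 2 unfolding computes_def by (auto intro: wfs_seq)
  then show ?thesis unfolding TP_def by blast
qed

lemma TP_const: "TP D (\<lambda>_. C)"
proof -
  let ?p = "[:4 * tsz C + 3, 7:]"
  have "exec R (Seq (clr 0) (push_word 0 (enc C))) st (poly ?p (tsz T)) (st(0 := enc C))"
    if R: "regs 4 R" and st: "st 0 = enc T" and TD: "T \<in> D" for R st T
    by (rule exec_conv[OF exec_seq[OF exec_clr exec_push_word]]) (use st regsD[OF R] in auto)
  moreover have "tsz C \<le> poly ?p (tsz T)" for T by simp
  ultimately have "computes (Seq (clr 0) (push_word 0 (enc C))) 4 ?p D (\<lambda>_. C)"
    unfolding computes_def by (auto intro!: wfs_seq wfs_moves wfs_push_word)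
  then show ?thesis unfolding TP_def by blast
qed

text \<open>Register 3 counts the subtrees that are still to be read, in unary.\<close>

definition split_body :: com where
  "split_body = iftop 0 (Seq (push 2 True) (Seq (pop 0) (push 3 True)))
     (Seq (push 2 False) (Seq (pop 0) (pop 3)))"

definition split :: com where
  "split = Seq (push 3 True) (while_ne 3 split_body)"

text \<open>The loop also reads the subtrees that follow \<open>T\<close>, so its run cannot be cut
  off behind \<open>T\<close>. The run from the state in which \<open>T\<close> has been consumed is
  therefore a hypothesis, and the induction prepends the reading of \<open>T\<close> to it.\<close>

lemma exec_split_loop:
  assumes "0 \<in> R" "2 \<in> R" "3 \<in> R" "st 0 = enc T @ w" "st 3 = x # cs"
    "exec R (while_ne 3 split_body) (st(0 := w, 2 := rev (enc T) @ st 2, 3 := cs)) u st'"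
  shows "exec R (while_ne 3 split_body) st (u + 12 * tsz T) st'"
  using assms
proof (induction T arbitrary: st w x cs u st')
  case L
  have body: "exec R split_body st (Suc (Suc (3 + Suc (1 + 1)))) (st(0 := w, 2 := rev (enc L) @ st 2, 3 := cs))"
    unfolding split_body_def
  proof (rule exec_iftop)
    show "exec R (Seq (push 2 False) (Seq (pop 0) (pop 3))) st (Suc (3 + Suc (1 + 1)))
       (st(0 := w, 2 := rev (enc L) @ st 2, 3 := cs))"
      using L by (intro exec_conv[OF exec_seq[OF exec_push exec_seq[OF exec_pop exec_pop]]])
        (auto simp: fun_eq_iff)
  qed (use L in auto)
  have "exec R (while_ne 3 split_body) st (Suc (Suc (Suc (3 + Suc (1 + 1))) + u)) st'"
    by (rule exec_while_step[OF _ _ body L(6)]) (use L in auto)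
  then show ?case by (rule exec_conv) auto
next
  case (N a b)
  let ?s1 = "st(0 := enc a @ enc b @ w, 2 := True # st 2, 3 := True # st 3)"
  have body: "exec R split_body st (Suc (Suc (3 + Suc (1 + 3)))) ?s1"
    unfolding split_body_def
  proof (rule exec_iftop)
    show "exec R (Seq (push 2 True) (Seq (pop 0) (push 3 True))) st (Suc (3 + Suc (1 + 3))) ?s1"
      using N.prems by (intro exec_conv[OF exec_seq[OF exec_push exec_seq[OF exec_pop exec_push]]])
        (auto simp: fun_eq_iff)
  qed (use N.prems in auto)
  let ?s2 = "?s1(0 := enc b @ w, 2 := rev (enc a) @ ?s1 2, 3 := st 3)"
  have eq: "?s2(0 := w, 2 := rev (enc b) @ ?s2 2, 3 := cs) = st(0 := w, 2 := rev (enc (N a b)) @ st 2, 3 := cs)"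
    by (auto simp: fun_eq_iff)
  have e2: "exec R (while_ne 3 split_body) (?s2(0 := w, 2 := rev (enc b) @ ?s2 2, 3 := cs)) u st'"
    unfolding eq by (rule N.prems(6))
  have e1: "exec R (while_ne 3 split_body) ?s2 (u + 12 * tsz b) st'"
    by (rule N.IH(2)[OF _ _ _ _ _ e2]) (use N.prems in auto)
  have "exec R (while_ne 3 split_body) ?s1 (u + 12 * tsz b + 12 * tsz a) st'"
    by (rule N.IH(1)[OF _ _ _ _ _ e1]) (use N.prems in auto)
  then have "exec R (while_ne 3 split_body) st (Suc (Suc (Suc (3 + Suc (1 + 3))) + (u + 12 * tsz b + 12 * tsz a))) st'"
    using N.prems by (intro exec_while_step[OF _ _ body]) auto
  then show ?case by (rule exec_conv) auto
qed

lemma exec_split: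
  assumes "0 \<in> R" "2 \<in> R" "3 \<in> R" "st 0 = enc T @ w" "st 3 = []"
  shows "exec R split st (12 * tsz T + 5) (st(0 := w, 2 := rev (enc T) @ st 2))"
proof -
  let ?s1 = "st(3 := True # st 3)"
  let ?s2 = "?s1(0 := w, 2 := rev (enc T) @ ?s1 2, 3 := [])"
  have "exec R (while_ne 3 split_body) ?s2 1 ?s2" by (rule exec_while_end) (use assms in auto)
  then have "exec R (while_ne 3 split_body) ?s1 (1 + 12 * tsz T) ?s2"
    by (intro exec_split_loop) (use assms in auto)
  then show ?thesis unfolding split_def
    using assms by (intro exec_conv[OF exec_seq[OF exec_push]]) (auto simp: fun_eq_iff)
qed

lemma wfs_split: "wfs split"
  unfolding split_def split_body_def by (intro wfs_intros)

lemma TP_left: "TP D left"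
proof -
  let ?c = "iftop 0 (Seq (pop 0) (Seq split (Seq (clr 0) (mv 2 0)))) skip"
  let ?p = "[:20, 40:]"
  have "exec R ?c st (poly ?p (tsz T)) (st(0 := enc (left T)))"
    if R: "regs 4 R" and cl: "clean 4 st" and st: "st 0 = enc T" and TD: "T \<in> D" for R st T
  proof -
    note r = regsD[OF R]
    have "exec R ?c st (Suc (19 + 40 * tsz T)) (st(0 := enc (left T)))"
    proof (rule exec_iftop)
      assume "st 0 \<noteq> [] \<and> hd (st 0)"
      then obtain a b where T: "T = N a b" using st by (cases T) auto
      show "exec R (Seq (pop 0) (Seq split (Seq (clr 0) (mv 2 0)))) st (19 + 40 * tsz T) (st(0 := enc (left T)))"
        by (rule exec_conv[OF exec_seq[OF exec_pop exec_seq[OF exec_split[of _ _ a "enc b"] exec_seq[OF exec_clr exec_mv]]]])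
          (use st r cleanD[OF cl] T in \<open>auto simp: fun_eq_iff\<close>)
    next
      assume "\<not> (st 0 \<noteq> [] \<and> hd (st 0))"
      then have "T = L" using st by simp
      then show "exec R skip st (19 + 40 * tsz T) (st(0 := enc (left T)))"
        by (intro exec_conv[OF exec_skip]) (use st in auto)
    qed (use r in simp)
    then show ?thesis by (rule exec_conv) auto
  qed
  moreover have "tsz (left T) \<le> poly ?p (tsz T)" for T by (cases T) auto
  ultimately have "computes ?c 4 ?p D left"
    unfolding computes_def by (auto intro!: wfs_intros wfs_moves wfs_split)
  then show ?thesis unfolding TP_def by blast
qed

lemma TP_right: "TP D right"
proof -
  let ?c = "iftop 0 (Seq (pop 0) (Seq split (clr 2))) skip"
  let ?p = "[:20, 40:]"
  have "exec R ?c st (poly ?p (tsz T)) (st(0 := enc (right T)))"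
    if R: "regs 4 R" and cl: "clean 4 st" and st: "st 0 = enc T" and TD: "T \<in> D" for R st T
  proof -
    note r = regsD[OF R]
    have "exec R ?c st (Suc (19 + 40 * tsz T)) (st(0 := enc (right T)))"
    proof (rule exec_iftop)
      assume "st 0 \<noteq> [] \<and> hd (st 0)"
      then obtain a b where T: "T = N a b" using st by (cases T) auto
      show "exec R (Seq (pop 0) (Seq split (clr 2))) st (19 + 40 * tsz T) (st(0 := enc (right T)))"
        by (rule exec_conv[OF exec_seq[OF exec_pop exec_seq[OF exec_split[of _ _ a "enc b"] exec_clr]]])
          (use st r cleanD[OF cl] T in \<open>auto simp: fun_eq_iff\<close>)
    next
      assume "\<not> (st 0 \<noteq> [] \<and> hd (st 0))"
      then have "T = L" using st by simp
      then show "exec R skip st (19 + 40 * tsz T) (st(0 := enc (right T)))"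
        by (intro exec_conv[OF exec_skip]) (use st in auto)
    qed (use r in simp)
    then show ?thesis by (rule exec_conv) auto
  qed
  moreover have "tsz (right T) \<le> poly ?p (tsz T)" for T by (cases T) auto
  ultimately have "computes ?c 4 ?p D right"
    unfolding computes_def by (auto intro!: wfs_intros wfs_moves wfs_split)
  then show ?thesis unfolding TP_def by blast
qed

text \<open>The registers \<open>K\<close> to \<open>K + 2\<close> lie above those of both programs.
  They keep the input during the first computation and the first result during the second. A
  transfer reverses a word, which is why the saved input is moved twice, while the saved result is
  reversed back when it returns to tape 0.\<close>

lemma TP_pair:
  assumes "TP D F" "TP D G"
  shows "TP D (\<lambda>T. N (F T) (G T))"
proof -
  obtain c K1 p where 1: "computes c K1 p D F" using assms(1) TP_def by blast
  obtain d K2 q where 2: "computes d K2 q D G" using assms(2) TP_def by blast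
  define K where "K = max K1 K2"
  have K4: "4 \<le> K" using 1 unfolding K_def computes_def by auto
  let ?c = "Seq (dup 0 K (K+1)) (Seq c (Seq (mv 0 (K+2)) (Seq (mv K (K+1)) (Seq (mv (K+1) 0)
     (Seq d (Seq (mv (K+2) 0) (push 0 True)))))))"
  let ?p = "[:30, 40:] + 20 * p + q"
  have "exec R ?c st (poly ?p (tsz T)) (st(0 := enc (N (F T) (G T))))"
    if R: "regs (K+3) R" and cl: "clean (K+3) st" and st: "st 0 = enc T" and TD: "T \<in> D" for R st T
  proof -
    have r: "0 \<in> R" "K \<in> R" "Suc K \<in> R" "Suc (Suc K) \<in> R" using regsD[OF R] K4 by auto
    have z: "st K = []" "st (Suc K) = []" "st (Suc (Suc K)) = []" using cleanD[OF cl] K4 by auto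
    define s1 where "s1 = st(K := enc T)"
    have e1: "exec R (dup 0 K (K+1)) st (19 * tsz T + 3) s1"
      by (rule exec_conv[OF exec_dup]) (use r z K4 st in \<open>auto simp: s1_def\<close>)
    have e2: "exec R c s1 (poly p (tsz T)) (s1(0 := enc (F T)))"
      by (rule computesD[OF 1]) (use R cl st K4 TD in \<open>auto simp: s1_def clean_def K_def intro: regs_le\<close>)
    define s3 where "s3 = s1(0 := [], K+2 := rev (enc (F T)))"
    have e3: "exec R (mv 0 (K+2)) (s1(0 := enc (F T))) (7 * tsz (F T) + 1) s3"
      by (rule exec_conv[OF exec_mv]) (use r z K4 in \<open>auto simp: s1_def s3_def fun_eq_iff\<close>)
    define s4 where "s4 = s3(K := [], K+1 := rev (enc T))"
    have e4: "exec R (mv K (K+1)) s3 (7 * tsz T + 1) s4"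
      by (rule exec_conv[OF exec_mv]) (use r z K4 in \<open>auto simp: s1_def s3_def s4_def fun_eq_iff\<close>)
    define s5 where "s5 = s4(K+1 := [], 0 := enc T)"
    have e5: "exec R (mv (K+1) 0) s4 (7 * tsz T + 1) s5"
      by (rule exec_conv[OF exec_mv]) (use r z K4 in \<open>auto simp: s1_def s3_def s4_def s5_def fun_eq_iff\<close>)
    have e6: "exec R d s5 (poly q (tsz T)) (s5(0 := enc (G T)))"
      by (rule computesD[OF 2]) (use R cl st K4 TD in \<open>auto simp: s1_def s3_def s4_def s5_def clean_def K_def intro: regs_le\<close>)
    define s7 where "s7 = s5(K+2 := [], 0 := enc (F T) @ enc (G T))"
    have e7: "exec R (mv (K+2) 0) (s5(0 := enc (G T))) (7 * tsz (F T) + 1) s7"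
      by (rule exec_conv[OF exec_mv]) (use r z K4 in \<open>auto simp: s1_def s3_def s4_def s5_def s7_def fun_eq_iff\<close>)
    have e8: "exec R (push 0 True) s7 3 (s7(0 := True # s7 0))"
      by (rule exec_push) (use r in simp)
    have eq: "s7(0 := True # s7 0) = st(0 := enc (N (F T) (G T)))"
      using z K4 by (auto simp: s1_def s3_def s4_def s5_def s7_def fun_eq_iff)
    show ?thesis
      by (rule exec_conv[OF exec_seq[OF e1 exec_seq[OF e2 exec_seq[OF e3 exec_seq[OF e4 exec_seq[OF e5
        exec_seq[OF e6 exec_seq[OF e7 e8]]]]]]] _ eq]) (use computes_size[OF 1 TD] in simp)
  qed
  moreover have "tsz (N (F T) (G T)) \<le> poly ?p (tsz T)" if "T \<in> D" for T
    using computes_size[OF 1 that] computes_size[OF 2 that] by simp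
  ultimately have "computes ?c (K+3) ?p D (\<lambda>T. N (F T) (G T))"
    using 1 2 K4 unfolding computes_def by (auto intro!: wfs_intros wfs_moves)
  then show ?thesis unfolding TP_def by blast
qed

lemma TP_if:
  assumes "TP D P" "TP D F" "TP D G"
  shows "TP D (\<lambda>T. if P T = L then F T else G T)"
proof -
  obtain b K0 e where 0: "computes b K0 e D P" using assms(1) TP_def by blast
  obtain c K1 p where 1: "computes c K1 p D F" using assms(2) TP_def by blast
  obtain d K2 q where 2: "computes d K2 q D G" using assms(3) TP_def by blast
  define K where "K = max K0 (max K1 K2)"
  have K4: "4 \<le> K" using 1 unfolding K_def computes_def by auto
  let ?r = "\<lambda>e. Seq (clr 0) (Seq (mv K (K+1)) (Seq (mv (K+1) 0) e))"
  let ?c = "Seq (dup 0 K (K+1)) (Seq b (iftop 0 (?r d) (?r c)))"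
  let ?p = "[:30, 40:] + 10 * e + p + q"
  have "exec R ?c st (poly ?p (tsz T)) (st(0 := enc (if P T = L then F T else G T)))"
    if R: "regs (K+3) R" and cl: "clean (K+3) st" and st: "st 0 = enc T" and TD: "T \<in> D" for R st T
  proof -
    have r: "0 \<in> R" "K \<in> R" "Suc K \<in> R" using regsD[OF R] K4 by auto
    have z: "st K = []" "st (Suc K) = []" using cleanD[OF cl] K4 by auto
    define s1 where "s1 = st(K := enc T)"
    have e1: "exec R (dup 0 K (K+1)) st (19 * tsz T + 3) s1"
      by (rule exec_conv[OF exec_dup]) (use r z K4 st in \<open>auto simp: s1_def\<close>)
    define s2 where "s2 = s1(0 := enc (P T))"
    have e2: "exec R b s1 (poly e (tsz T)) s2"
      unfolding s2_def by (rule computesD[OF 0]) (use R cl st K4 TD in \<open>auto simp: s1_def clean_def K_def intro: regs_le\<close>)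
    have e3: "exec R (?r x) s2 (7 * tsz (P T) + 14 * tsz T + 6 + u) (st(0 := w))"
      if x: "exec R x st u (st(0 := w))" for x u w
    proof -
      have eq: "(((s2(0 := []))(K := [], K+1 := rev (enc T)))(K+1 := [], 0 := enc T)) = st"
        using z K4 st by (auto simp: s1_def s2_def fun_eq_iff)
      have a: "exec R (clr 0) s2 (7 * tsz (P T) + 1) (s2(0 := []))"
        by (rule exec_conv[OF exec_clr]) (use r in \<open>auto simp: s2_def\<close>)
      have b: "exec R (mv K (K+1)) (s2(0 := [])) (7 * tsz T + 1) ((s2(0 := []))(K := [], K+1 := rev (enc T)))"
        by (rule exec_conv[OF exec_mv]) (use r z K4 in \<open>auto simp: s1_def s2_def fun_eq_iff\<close>)
      have c: "exec R (mv (K+1) 0) ((s2(0 := []))(K := [], K+1 := rev (enc T))) (7 * tsz T + 1) st"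
        by (rule exec_conv[OF exec_mv _ _ ]) (use r z K4 st in \<open>auto simp: s1_def s2_def fun_eq_iff\<close>)
      show ?thesis by (rule exec_conv[OF exec_seq[OF a exec_seq[OF b exec_seq[OF c x]]]]) auto
    qed
    have d1: "exec R d st (poly q (tsz T)) (st(0 := enc (G T)))"
      by (rule computesD[OF 2]) (use R cl st TD in \<open>auto simp: K_def clean_def intro: regs_le\<close>)
    have c1: "exec R c st (poly p (tsz T)) (st(0 := enc (F T)))"
      by (rule computesD[OF 1]) (use R cl st TD in \<open>auto simp: K_def clean_def intro: regs_le\<close>)
    have e4: "exec R (iftop 0 (?r d) (?r c)) s2 (Suc (7 * tsz (P T) + 14 * tsz T + 6 + poly p (tsz T) + poly q (tsz T)))
       (st(0 := enc (if P T = L then F T else G T)))"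
    proof (rule exec_iftop)
      assume "s2 0 \<noteq> [] \<and> hd (s2 0)"
      then have "P T \<noteq> L" by (simp add: s2_def)
      then show "exec R (?r d) s2 (7 * tsz (P T) + 14 * tsz T + 6 + poly p (tsz T) + poly q (tsz T))
         (st(0 := enc (if P T = L then F T else G T)))"
        by (intro exec_conv[OF e3[OF d1]]) auto
    next
      assume "\<not> (s2 0 \<noteq> [] \<and> hd (s2 0))"
      then have "P T = L" by (simp add: s2_def)
      then show "exec R (?r c) s2 (7 * tsz (P T) + 14 * tsz T + 6 + poly p (tsz T) + poly q (tsz T))
         (st(0 := enc (if P T = L then F T else G T)))"
        by (intro exec_conv[OF e3[OF c1]]) auto
    qed (rule r)
    show ?thesis
      by (rule exec_conv[OF exec_seq[OF e1 exec_seq[OF e2 e4]]]) (use computes_size[OF 0 TD] in auto)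
  qed
  moreover have "tsz (if P T = L then F T else G T) \<le> poly ?p (tsz T)" if "T \<in> D" for T
    using computes_size[OF 1 that] computes_size[OF 2 that] by simp
  ultimately have "computes ?c (K+3) ?p D (\<lambda>T. if P T = L then F T else G T)"
    using 0 1 2 K4 unfolding computes_def by (auto intro!: wfs_intros wfs_moves)
  then show ?thesis unfolding TP_def by blast
qed

text \<open>The code of the left component is itself the loop counter, one symbol being popped per
  round. This makes the number of rounds the size of that tree, so any datum can serve as a clock. A
  bound on all intermediate states is required because a polynomial iterated that often may leave
  the polynomials.\<close>

lemma TP_iter:
  assumes "TP E F" and ND: "\<And>T. T \<in> D \<Longrightarrow> \<exists>n s. T = N n s"
    and DE: "\<And>n s i. N n s \<in> D \<Longrightarrow> i < tsz n \<Longrightarrow> (F ^^ i) s \<in> E"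
    and q: "\<And>n s i. N n s \<in> D \<Longrightarrow> i \<le> tsz n \<Longrightarrow> tsz ((F ^^ i) s) \<le> poly q (tsz n + tsz s)"
  shows "TP D (\<lambda>T. (F ^^ tsz (left T)) (right T))"
proof -
  obtain c K p where 1: "computes c K p E F" using assms(1) TP_def by blast
  have K4: "4 \<le> K" using 1 unfolding computes_def by auto
  let ?b = "Seq (pop K) c"
  let ?c = "Seq (pop 0) (Seq split (Seq (mv 2 K) (while_ne K ?b)))"
  let ?p = "[:40, 40:] + [:2, 1:] * (pcompose p q + [:4:]) + q + p"
  have "exec R ?c st (poly ?p (tsz T)) (st(0 := enc ((F ^^ tsz (left T)) (right T))))"
    if R: "regs (K+1) R" and cl: "clean (K+1) st" and st: "st 0 = enc T" and TD: "T \<in> D" for R st T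
  proof -
    obtain n s where T: "T = N n s" using ND[OF TD] by blast
    have r: "0 \<in> R" "2 \<in> R" "3 \<in> R" "K \<in> R" using regsD[OF R] K4 by auto
    have z: "st 2 = []" "st 3 = []" "st K = []" using cleanD[OF cl] K4 by auto
    have loop: "exec R (while_ne K ?b) (st(0 := enc s, K := w)) (length w * (B + 4) + 1)
        (st(0 := enc ((F ^^ length w) s)))"
      if B: "\<And>i. i < length w \<Longrightarrow> (F ^^ i) s \<in> E \<and> poly p (tsz ((F ^^ i) s)) \<le> B" for w s B
      using B
    proof (induction w arbitrary: s)
      case Nil
      show ?case by (rule exec_conv[OF exec_while_end]) (use r z K4 in \<open>auto simp: fun_eq_iff\<close>)
    next
      case (Cons x w)
      let ?s = "st(0 := enc s, K := x # w)"
      have B0: "s \<in> E" "poly p (tsz s) \<le> B" using Cons.prems[of 0] by simp_all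
      have a: "exec R (pop K) ?s 1 (st(0 := enc s, K := w))"
        by (rule exec_conv[OF exec_pop]) (use r in \<open>auto simp: fun_eq_iff\<close>)
      have b: "exec R c (st(0 := enc s, K := w)) (poly p (tsz s)) (st(0 := enc (F s), K := w))"
        by (rule exec_conv[OF computesD[OF 1]]) (use R cl K4 B0 in \<open>auto simp: clean_def fun_eq_iff intro: regs_le\<close>)
      have ih: "exec R (while_ne K ?b) (st(0 := enc (F s), K := w)) (length w * (B + 4) + 1)
        (st(0 := enc ((F ^^ length w) (F s))))"
      proof (rule Cons.IH)
        fix i assume "i < length w"
        then show "(F ^^ i) (F s) \<in> E \<and> poly p (tsz ((F ^^ i) (F s))) \<le> B"
          using Cons.prems[of "Suc i"] by (simp add: funpow_swap1)
      qed
      show ?case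
        by (rule exec_conv[OF exec_while_step[OF _ _ exec_seq[OF a b] ih]])
          (use r B0 in \<open>auto simp: fun_eq_iff funpow_swap1\<close>)
    qed
    let ?B = "poly p (poly q (tsz T))"
    let ?s1 = "st(0 := enc n @ enc s)"
    have a: "exec R (pop 0) st 1 ?s1"
      by (rule exec_conv[OF exec_pop]) (use r st T in \<open>auto simp: fun_eq_iff\<close>)
    have b: "exec R split ?s1 (12 * tsz n + 5) (st(0 := enc s, 2 := rev (enc n)))"
      by (rule exec_conv[OF exec_split[of _ _ n "enc s"]]) (use r z in \<open>auto simp: fun_eq_iff\<close>)
    have c: "exec R (mv 2 K) (st(0 := enc s, 2 := rev (enc n))) (7 * tsz n + 1) (st(0 := enc s, K := enc n))"
      by (rule exec_conv[OF exec_mv]) (use r z K4 in \<open>auto simp: fun_eq_iff\<close>)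
    have "exec R (while_ne K ?b) (st(0 := enc s, K := enc n)) (length (enc n) * (?B + 4) + 1)
        (st(0 := enc ((F ^^ length (enc n)) s)))"
    proof (rule loop)
      fix i assume i: "i < length (enc n)"
      have "tsz ((F ^^ i) s) \<le> poly q (tsz n + tsz s)" using i TD T by (intro q) auto
      also have "\<dots> \<le> poly q (tsz T)" by (auto simp: T intro: poly_mono_nat)
      finally show "(F ^^ i) s \<in> E \<and> poly p (tsz ((F ^^ i) s)) \<le> ?B"
        using DE i TD T by (auto intro: poly_mono_nat)
    qed
    then have d: "exec R (while_ne K ?b) (st(0 := enc s, K := enc n)) (tsz n * (?B + 4) + 1)
        (st(0 := enc ((F ^^ tsz n) s)))" by simp
    show ?thesis
      by (rule exec_conv[OF exec_seq[OF a exec_seq[OF b exec_seq[OF c d]]]])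
        (auto simp: T poly_pcompose algebra_simps)
  qed
  moreover have "tsz ((F ^^ tsz (left T)) (right T)) \<le> poly ?p (tsz T)" if "T \<in> D" for T
  proof -
    obtain n s where T: "T = N n s" using ND[OF \<open>T \<in> D\<close>] by blast
    have "tsz ((F ^^ tsz (left T)) (right T)) \<le> poly q (tsz n + tsz s)" using q[of n s] that T by simp
    also have "\<dots> \<le> poly q (tsz T)" by (auto simp: T intro: poly_mono_nat)
    finally show ?thesis by simp
  qed
  ultimately have "computes ?c (K+1) ?p D (\<lambda>T. (F ^^ tsz (left T)) (right T))"
    using 1 K4 unfolding computes_def by (auto intro!: wfs_intros wfs_moves wfs_split)
  then show ?thesis unfolding TP_def by blast
qed

section \<open>From tree functions to Turing machines\<close>

text \<open>Chosen to agree with the tree of a \<open>bool list\<close> in the type class below, so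
  that words on tapes can be handed to typed functions.\<close>

fun trw :: "bool list \<Rightarrow> tree" where
  "trw [] = L"
| "trw (b # w) = N (if b then N L L else L) (trw w)"

lemma tsz_trw: "length w < tsz (trw w) \<and> tsz (trw w) \<le> 4 * length w + 1"
  by (induction w) auto

text \<open>The pushed words are a list node together with the code of its element True or False.
  Reading the reversed word builds the list from its end.\<close>

definition to_tree :: "nat \<Rightarrow> com" where
  "to_tree a = Seq (mv a 2) (Seq (push 0 False) (while_ne 2 (Seq
     (iftop 2 (push_word 0 [True, True, False, False]) (push_word 0 [True, False])) (pop 2))))"

lemma exec_to_tree:
  assumes r: "0 \<in> R" "2 \<in> R" "a \<in> R" "a \<noteq> 0" "a \<noteq> 2" and st: "st 2 = []"
  shows "exec R (to_tree a) st (50 * length (st a) + 20) (st(a := [], 0 := enc (trw (st a)) @ st 0))"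
proof -
  let ?b = "Seq (iftop 2 (push_word 0 [True, True, False, False]) (push_word 0 [True, False])) (pop 2)"
  have loop: "exec R (while_ne 2 ?b) (s(2 := w, 0 := enc (trw v) @ u)) (40 * length w + 1)
      (s(2 := [], 0 := enc (trw (rev w @ v)) @ u))" for s w v u
  proof (induction w arbitrary: v)
    case Nil
    show ?case by (rule exec_conv[OF exec_while_end]) (use r in auto)
  next
    case (Cons x w)
    let ?s = "s(2 := x # w, 0 := enc (trw v) @ u)"
    let ?s1 = "s(2 := x # w, 0 := enc (trw (x # v)) @ u)"
    have "exec R (iftop 2 (push_word 0 [True, True, False, False]) (push_word 0 [True, False])) ?s (Suc 17) ?s1"
    proof (rule exec_iftop)
      assume "?s 2 \<noteq> [] \<and> hd (?s 2)"
      then show "exec R (push_word 0 [True, True, False, False]) ?s 17 ?s1"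
        by (intro exec_conv[OF exec_push_word]) (use r in \<open>auto simp: fun_eq_iff\<close>)
    next
      assume "\<not> (?s 2 \<noteq> [] \<and> hd (?s 2))"
      then show "exec R (push_word 0 [True, False]) ?s 17 ?s1"
        by (intro exec_conv[OF exec_push_word]) (use r in \<open>auto simp: fun_eq_iff\<close>)
    qed (rule r)
    then have "exec R ?b ?s (Suc (Suc 17 + 1)) (?s1(2 := tl (?s1 2)))"
      by (rule exec_seq[OF _ exec_pop]) (rule r)
    then have b: "exec R ?b ?s (Suc (Suc 17 + 1)) (s(2 := w, 0 := enc (trw (x # v)) @ u))"
      by (rule exec_conv) (auto simp: fun_eq_iff)
    show ?case
      by (rule exec_conv[OF exec_while_step[OF _ _ b Cons]]) (use r in auto)
  qed
  have 1: "exec R (mv a 2) st (7 * length (st a) + 1) (st(a := [], 2 := rev (st a)))"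
    by (rule exec_conv[OF exec_mv]) (use r st in auto)
  let ?s = "st(a := [])"
  have 2: "exec R (push 0 False) (st(a := [], 2 := rev (st a))) 3 (?s(2 := rev (st a), 0 := enc (trw []) @ st 0))"
    by (rule exec_conv[OF exec_push]) (use r in \<open>auto simp: fun_eq_iff\<close>)
  show ?thesis unfolding to_tree_def
    by (rule exec_conv[OF exec_seq[OF 1 exec_seq[OF 2 loop]]]) (use r st in \<open>auto simp: fun_eq_iff\<close>)
qed

definition of_tree :: com where
  "of_tree = while_ne 0 (iftop 0
     (Seq (pop 0) (iftop 0 (Seq (push 2 True) (Seq (pop 0) (Seq (pop 0) (pop 0)))) (Seq (push 2 False) (pop 0))))
     (pop 0))"

lemma exec_of_tree:
  assumes r: "0 \<in> R" "2 \<in> R"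
  shows "exec R of_tree (st(0 := enc (trw v), 2 := u)) (20 * length v + 20) (st(0 := [], 2 := rev v @ u))"
proof (induction v arbitrary: u)
  case Nil
  have b: "exec R (iftop 0
     (Seq (pop 0) (iftop 0 (Seq (push 2 True) (Seq (pop 0) (Seq (pop 0) (pop 0)))) (Seq (push 2 False) (pop 0))))
     (pop 0)) (st(0 := enc (trw []), 2 := u)) (Suc 1) (st(0 := [], 2 := u))"
  proof (rule exec_iftop)
    show "exec R (pop 0) (st(0 := enc (trw []), 2 := u)) 1 (st(0 := [], 2 := u))"
      by (rule exec_conv[OF exec_pop]) (use r in \<open>auto simp: fun_eq_iff\<close>)
  qed (use r in auto)
  show ?case unfolding of_tree_def
    by (rule exec_conv[OF exec_while_step[OF _ _ b exec_while_end]]) (use r in auto)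
next
  case (Cons x v)
  let ?s = "st(0 := enc (trw (x # v)), 2 := u)"
  let ?t = "st(0 := tl (enc (trw (x # v))), 2 := u)"
  let ?e = "st(0 := enc (trw v), 2 := x # u)"
  have i: "exec R (iftop 0 (Seq (push 2 True) (Seq (pop 0) (Seq (pop 0) (pop 0)))) (Seq (push 2 False) (pop 0))) ?t (Suc 9) ?e"
  proof (rule exec_iftop)
    assume "?t 0 \<noteq> [] \<and> hd (?t 0)"
    then have "x" by (auto split: if_splits)
    then show "exec R (Seq (push 2 True) (Seq (pop 0) (Seq (pop 0) (pop 0)))) ?t 9 ?e"
      by (intro exec_conv[OF exec_seq[OF exec_push exec_seq[OF exec_pop exec_seq[OF exec_pop exec_pop]]]])
        (use r in \<open>auto simp: fun_eq_iff\<close>)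
  next
    assume "\<not> (?t 0 \<noteq> [] \<and> hd (?t 0))"
    then have "\<not> x" by (auto split: if_splits)
    then show "exec R (Seq (push 2 False) (pop 0)) ?t 9 ?e"
      by (intro exec_conv[OF exec_seq[OF exec_push exec_pop]])
        (use r in \<open>auto simp: fun_eq_iff\<close>)
  qed (rule r)
  have p: "exec R (pop 0) ?s 1 ?t"
    by (rule exec_conv[OF exec_pop]) (use r in \<open>auto simp: fun_eq_iff\<close>)
  have b: "exec R (iftop 0
     (Seq (pop 0) (iftop 0 (Seq (push 2 True) (Seq (pop 0) (Seq (pop 0) (pop 0)))) (Seq (push 2 False) (pop 0))))
     (pop 0)) ?s (Suc (Suc (1 + Suc 9))) ?e"
  proof (rule exec_iftop)
    show "exec R (Seq (pop 0) (iftop 0 (Seq (push 2 True) (Seq (pop 0) (Seq (pop 0) (pop 0)))) (Seq (push 2 False) (pop 0))))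
      ?s (Suc (1 + Suc 9)) ?e" by (rule exec_seq[OF p i])
  qed (use r in auto)
  show ?case unfolding of_tree_def
    by (rule exec_conv[OF exec_while_step[OF _ _ b Cons[unfolded of_tree_def]]]) (use r in auto)
qed

lemma wfs_to_tree: "wfs (to_tree a)" and wfs_of_tree: "wfs of_tree"
  unfolding to_tree_def of_tree_def by (intro wfs_intros wfs_moves wfs_push_word)+

section \<open>Transfer to a simulated machine and to the output tape\<close>

lemma run_time_eq: "run c m t m' \<Longrightarrow> t = t' \<Longrightarrow> run c m t' m'"
  by simp

text \<open>A machine may run to the left of its input, so its input tape has to be blank there as
  well, which \<open>stk\<close> does not guarantee.\<close>

definition fstk :: "(int \<Rightarrow> nat) \<Rightarrow> int \<Rightarrow> bool list \<Rightarrow> bool" where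
  "fstk T h w \<longleftrightarrow> (\<forall>i. T (h + i) = word_tape w i)"

lemma fstk_push: "fstk T h w \<Longrightarrow> fstk (T(h - 1 := if b then 2 else 1)) (h - 1) (b # w)"
  unfolding fstk_def
proof
  fix i :: int
  assume a: "\<forall>i. T (h + i) = word_tape w i"
  show "(T(h - 1 := if b then 2 else 1)) (h - 1 + i) = word_tape (b # w) i"
  proof -
    consider "i = 0" | "i > 0" | "i < 0" by linarith
    then show ?thesis
    proof cases
      case 2
      then show ?thesis using a[rule_format, of "i - 1"] by (simp add: word_tape_Cons algebra_simps)
    next
      case 3
      then show ?thesis using a[rule_format, of "i - 1"] by (simp add: word_tape_def algebra_simps)
    qed simp
  qed
qed

definition feed :: "nat \<Rightarrow> nat \<Rightarrow> com" where
  "feed a b = While (\<lambda>s. s a \<noteq> 0) (Seq (Act (\<lambda>s j. (s j, if j = b then -1 else 0)))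
     (Act (\<lambda>s j. (if j = b then s a else s j, if j = a then 1 else 0))))"

lemma run_feed:
  assumes "a \<noteq> b" "stk (fst m a) (snd m a) v" "fstk (fst m b) (snd m b) u"
  shows "\<exists>m'. run (feed a b) m (4 * length v + 1) m' \<and> stk (fst m' a) (snd m' a) [] \<and>
    fstk (fst m' b) (snd m' b) (rev v @ u) \<and> same_outside {a, b} m m'"
  using assms
proof (induction v arbitrary: m u)
  case Nil
  have "view m a = 0" using stk_head[OF Nil(2)] by (simp add: view_def)
  then have "run (feed a b) m 1 m" unfolding feed_def by (intro run.WhileF) simp
  then show ?case using Nil same_outside_refl by (intro exI[of _ m]) simp
next
  case (Cons x v)
  let ?f = "\<lambda>(s::nat \<Rightarrow> nat) j. (s j, if j = b then -1 else (0::int))"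
  let ?g = "\<lambda>(s::nat \<Rightarrow> nat) j. (if j = b then s a else s j, if j = a then 1 else (0::int))"
  define m1 where "m1 = act ?g (act ?f m)"
  have v: "view m a = (if x then 2 else 1)" using stk_head[OF Cons(3)] by (simp add: view_def)
  have 1: "run (Seq (Act ?f) (Act ?g)) m (Suc (1 + 1)) m1"
    unfolding m1_def by (rule run.Seq[OF run.Act run.Act])
  have b: "fst m1 b = (fst m b)(snd m b - 1 := if x then 2 else 1)" "snd m1 b = snd m b - 1"
    using Cons(2) v by (auto simp: m1_def act_def view_def)
  have a: "fst m1 a = fst m a" "snd m1 a = snd m a + 1"
    using Cons(2) v by (auto simp: m1_def act_def view_def)
  have o: "same_outside {a, b} m m1" by (auto simp: same_outside_def m1_def act_def view_def)
  have "stk (fst m1 a) (snd m1 a) v" unfolding a using stk_pop[OF Cons(3)] by simp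
  moreover have "fstk (fst m1 b) (snd m1 b) (x # u)" unfolding b by (rule fstk_push[OF Cons(4)])
  ultimately obtain m' where m': "run (feed a b) m1 (4 * length v + 1) m'" "stk (fst m' a) (snd m' a) []"
    "fstk (fst m' b) (snd m' b) (rev v @ x # u)" "same_outside {a, b} m1 m'"
    using Cons.IH[of m1 "x # u"] Cons(2) by blast
  have "run (feed a b) m (Suc (Suc (1 + 1) + (4 * length v + 1))) m'"
    unfolding feed_def using v 1 m'(1) by (intro run.WhileT) (auto simp: feed_def)
  then have "run (feed a b) m (4 * length (x # v) + 1) m'" by (rule run_time_eq) simp
  then show ?case using m' same_outside_trans[OF o m'(4)] by (intro exI[of _ m']) simp
qed

text \<open>The output must stand on tape 1 from the absolute cell 0 on, so it is written from left
  to right, unlike the stacks, which grow to the left.\<close>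

definition emit :: "nat \<Rightarrow> com" where
  "emit a = While (\<lambda>s. s a \<noteq> 0)
     (Act (\<lambda>s j. (if j = 1 then s a else s j, if j = 1 \<or> j = a then 1 else 0)))"

lemma run_emit:
  assumes "a \<noteq> 1" "stk (fst m a) (snd m a) v" "fst m 1 = word_tape u" "snd m 1 = int (length u)"
  shows "\<exists>m'. run (emit a) m (2 * length v + 1) m' \<and> fst m' 1 = word_tape (u @ v)"
  using assms
proof (induction v arbitrary: m u)
  case Nil
  have "view m a = 0" using stk_head[OF Nil(2)] by (simp add: view_def)
  then have "run (emit a) m 1 m" unfolding emit_def by (intro run.WhileF) simp
  then show ?case using Nil by (intro exI[of _ m]) simp
next
  case (Cons x v)
  let ?f = "\<lambda>(s::nat \<Rightarrow> nat) j. (if j = 1 then s a else s j, if j = 1 \<or> j = a then 1 else (0::int))"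
  define m1 where "m1 = act ?f m"
  have v: "view m a = (if x then 2 else 1)" using stk_head[OF Cons(3)] by (simp add: view_def)
  have "fst m1 1 = word_tape (u @ [x])" "snd m1 1 = int (length (u @ [x]))"
    using Cons(4,5) v by (auto simp: m1_def act_def word_tape_def fun_eq_iff nth_append)
  moreover have "stk (fst m1 a) (snd m1 a) v"
    using stk_pop[OF Cons(3)] Cons(2) by (auto simp: m1_def act_def view_def)
  ultimately obtain m' where m': "run (emit a) m1 (2 * length v + 1) m'" "fst m' 1 = word_tape ((u @ [x]) @ v)"
    using Cons.IH[of m1 "u @ [x]"] Cons(2) by blast
  have "run (emit a) m (Suc (1 + (2 * length v + 1))) m'"
    unfolding emit_def using v run.Act[of ?f m] m'(1) by (intro run.WhileT) (auto simp: emit_def m1_def)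
  then have "run (emit a) m (2 * length (x # v) + 1) m'" by (rule run_time_eq) simp
  then show ?case using m' by (intro exI[of _ m']) simp
qed

text \<open>
  Running a given machine \<open>M\<close> as a subroutine: its tapes are the tapes from \<open>B + 2\<close> on, tape \<open>B\<close>
  holds its state, and tape \<open>B + 1\<close> records the moves of its output head so that they can be undone.
\<close>

locale subroutine =
  fixes M :: tm and B :: nat
  assumes wfM: "wf_tm M" and B: "4 \<le> B"
begin

definition okv :: "(nat \<Rightarrow> nat) \<Rightarrow> bool" where
  "okv s \<longleftrightarrow> s B < nstates M \<and> (\<forall>j<ntapes M. s (B + 2 + j) < nsyms M)"

definition nxt :: "(nat \<Rightarrow> nat) \<Rightarrow> nat \<times> (nat \<times> int) list" where
  "nxt s = trans M (s B) (map (\<lambda>j. s (B + 2 + j)) [0..<ntapes M])"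

text \<open>A move d is logged as d + 2, which is never the blank 0, so a blank marks the end of the
  log. On views outside the states and symbols of \<open>M\<close> nothing happens, which keeps the
  action well formed everywhere.\<close>

definition bbf :: "(nat \<Rightarrow> nat) \<Rightarrow> nat \<Rightarrow> nat \<times> int" where
  "bbf s j = (if \<not> okv s then (s j, 0)
     else if j = B then (fst (nxt s), 0)
     else if j = B + 1 then (nat (snd (snd (nxt s) ! 1) + 2), -1)
     else if B + 2 \<le> j \<and> j < B + 2 + ntapes M then snd (nxt s) ! (j - (B + 2))
     else (s j, 0))"

definition undof :: "(nat \<Rightarrow> nat) \<Rightarrow> nat \<Rightarrow> nat \<times> int" where
  "undof s j = (s j, if j = B + 1 then 1 else if j = B + 3 then
     (if s (B + 1) = 1 then 1 else if s (B + 1) = 3 then -1 else 0) else 0)"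

definition bb :: com where
  "bb = While (\<lambda>s. s B \<noteq> 1) (Act bbf)"

definition undo :: com where
  "undo = Seq (Act (\<lambda>s j. (s j, if j = B + 1 then 1 else 0))) (While (\<lambda>s. s (B + 1) \<noteq> 0) (Act undof))"

definition okc :: "config \<Rightarrow> bool" where
  "okc cf \<longleftrightarrow> state cf < nstates M \<and> (\<forall>j<ntapes M. \<forall>i. tape cf j i < nsyms M)"

definition logged :: "mem \<Rightarrow> int \<Rightarrow> int list \<Rightarrow> bool" where
  "logged m h ds \<longleftrightarrow> set ds \<subseteq> {-1, 0, 1} \<and>
     (\<forall>i\<ge>0. fst m (B + 1) (h + i) = (if i < int (length ds) then nat (ds ! nat i + 2) else 0))"

lemma loggedD: "logged m h ds \<Longrightarrow> 0 \<le> i \<Longrightarrow>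
    fst m (B + 1) (h + i) = (if i < int (length ds) then nat (ds ! nat i + 2) else 0)"
  unfolding logged_def by blast

text \<open>\<open>off j\<close> is the cell that plays cell 0 of tape \<open>j\<close>. The logged
  moves sum to the position of the output head, so undoing them returns this head to its cell
  0.\<close>

definition sim :: "(nat \<Rightarrow> int) \<Rightarrow> config \<Rightarrow> int list \<Rightarrow> mem \<Rightarrow> bool" where
  "sim off cf ds m \<longleftrightarrow> okc cf \<and> view m B = state cf \<and>
     (\<forall>j<ntapes M. snd m (B + 2 + j) = off j + head cf j \<and>
        (\<forall>i. fst m (B + 2 + j) (off j + i) = tape cf j i)) \<and>
     logged m (snd m (B + 1) + 1) ds \<and> head cf 1 = sum_list ds"

definition Z :: "nat set" where
  "Z = {B..<B + 2 + ntapes M}"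

lemma nt: "2 \<le> ntapes M"
  using wfM by (simp add: wf_tm_def)

lemma trans_ok:
  assumes "q < nstates M" "length ss = ntapes M" "set ss \<subseteq> {..<nsyms M}"
  shows "fst (trans M q ss) < nstates M" "length (snd (trans M q ss)) = ntapes M"
    "set (snd (trans M q ss)) \<subseteq> {..<nsyms M} \<times> {-1, 0, 1}"
proof -
  have "case trans M q ss of (q', acts) \<Rightarrow> q' < nstates M \<and> length acts = ntapes M \<and>
     set acts \<subseteq> {..<nsyms M} \<times> {-1, 0, 1}"
    using wfM assms unfolding wf_tm_def by simp
  then show "fst (trans M q ss) < nstates M" "length (snd (trans M q ss)) = ntapes M"
    "set (snd (trans M q ss)) \<subseteq> {..<nsyms M} \<times> {-1, 0, 1}"
    unfolding case_prod_beta by blast+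
qed

lemma nxt_ok:
  assumes "okv s"
  shows "fst (nxt s) < nstates M" "length (snd (nxt s)) = ntapes M"
    "j < ntapes M \<Longrightarrow> fst (snd (nxt s) ! j) < nsyms M"
    "j < ntapes M \<Longrightarrow> snd (snd (nxt s) ! j) \<in> {-1, 0, 1}"
proof -
  have a: "s B < nstates M" "set (map (\<lambda>j. s (B + 2 + j)) [0..<ntapes M]) \<subseteq> {..<nsyms M}"
    using assms by (auto simp: okv_def)
  show "fst (nxt s) < nstates M" and l: "length (snd (nxt s)) = ntapes M"
    unfolding nxt_def by (rule trans_ok[OF a(1) _ a(2)]; simp)+
  have s: "set (snd (nxt s)) \<subseteq> {..<nsyms M} \<times> {-1, 0, 1}"
    unfolding nxt_def by (rule trans_ok(3)[OF a(1) _ a(2)]) simp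
  assume "j < ntapes M"
  then have "snd (nxt s) ! j \<in> {..<nsyms M} \<times> {-1, 0, 1}" using l nth_mem[of j "snd (nxt s)"] s by auto
  then show "fst (snd (nxt s) ! j) < nsyms M" "snd (snd (nxt s) ! j) \<in> {-1, 0, 1}"
    unfolding mem_Times_iff by auto
qed

lemma wfc_bb:
  assumes "B + 2 + ntapes M \<le> k" "4 \<le> n" "nsyms M \<le> n" "nstates M \<le> n"
  shows "wfc k n bb" "wfc k n undo"
proof -
  have "ok_act k n bbf"
    unfolding ok_act_def
  proof (intro allI impI conjI)
    fix s j assume s: "(\<forall>j. s j < n) \<and> (\<forall>j\<ge>k. s j = 0)" and j: "j < k"
    have d: "snd (snd (nxt s) ! 1) \<in> {-1, 0, 1}" if "okv s" using nxt_ok(4)[OF that, of 1] nt by simp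
    have jj: "j - (B + 2) < ntapes M" if "B + 2 \<le> j \<and> j < B + 2 + ntapes M" using that by arith
    have w: "fst (snd (nxt s) ! (j - (B + 2))) < n" if "okv s" "B + 2 \<le> j \<and> j < B + 2 + ntapes M"
      using nxt_ok(3)[OF that(1) jj[OF that(2)]] assms by linarith
    have w': "snd (snd (nxt s) ! (j - (B + 2))) \<in> {-1, 0, 1}" if "okv s" "B + 2 \<le> j \<and> j < B + 2 + ntapes M"
      using nxt_ok(4)[OF that(1) jj[OF that(2)]] .
    have l: "nat (snd (snd (nxt s) ! 1) + 2) < n" if "okv s" using d[OF that] assms by auto
    have q: "fst (nxt s) < n" if "okv s" using nxt_ok(1)[OF that] assms by simp
    show "fst (bbf s j) < n" unfolding bbf_def using s w l q by simp
    show "snd (bbf s j) \<in> {-1, 0, 1}" unfolding bbf_def using w' by simp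
  next
    fix s j assume "(\<forall>j. s j < n) \<and> (\<forall>j\<ge>k. s j = 0)" "k \<le> j"
    then show "bbf s j = (0, 0)" using assms by (auto simp: bbf_def)
  qed
  then show "wfc k n bb" by (simp add: bb_def)
  show "wfc k n undo" using assms nt by (auto simp: undo_def ok_act_def undof_def)
qed

lemma sim_step:
  assumes s: "sim off cf ds m" and ne: "state cf \<noteq> 1"
  shows "\<exists>d. sim off (tm_step M cf) (d # ds) (act bbf m)" "same_outside Z m (act bbf m)"
proof -
  have ok: "okv (view m)" using s unfolding sim_def okv_def okc_def view_def by (auto; metis)
  have "(\<lambda>j. view m (B + 2 + j)) j = tape cf j (head cf j)" if "j < ntapes M" for j
    using s that by (simp add: sim_def view_def)
  then have e: "map (\<lambda>j. view m (B + 2 + j)) [0..<ntapes M] = map (\<lambda>j. tape cf j (head cf j)) [0..<ntapes M]"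
    by simp
  have st: "view m B = state cf" using s by (simp add: sim_def)
  have n: "nxt (view m) = trans M (state cf) (map (\<lambda>j. tape cf j (head cf j)) [0..<ntapes M])"
    unfolding nxt_def st e ..
  obtain q' acts where qa: "nxt (view m) = (q', acts)" by (cases "nxt (view m)")
  have step: "tm_step M cf = \<lparr>state = q',
         tape = (\<lambda>j. if j < ntapes M then (tape cf j)(head cf j := fst (acts ! j)) else tape cf j),
         head = (\<lambda>j. if j < ntapes M then head cf j + snd (acts ! j) else head cf j)\<rparr>"
    using ne qa unfolding tm_step_def n[symmetric] by simp
  note nok = nxt_ok[OF ok, unfolded qa, simplified]
  define d where "d = snd (acts ! 1)"
  have d: "d \<in> {-1, 0, 1}" using nok(4)[of 1] nt by (simp add: d_def)
  have okc': "okc (tm_step M cf)"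
    using s nok by (auto simp: step okc_def sim_def)
  have v': "view (act bbf m) B = q'" using ok qa by (simp add: view_def act_def bbf_def)
  have tp: "snd (act bbf m) (B + 2 + j) = off j + head (tm_step M cf) j \<and>
        (\<forall>i. fst (act bbf m) (B + 2 + j) (off j + i) = tape (tm_step M cf) j i)" if j: "j < ntapes M" for j
  proof -
    have h: "snd m (B + 2 + j) = off j + head cf j" "\<forall>i. fst m (B + 2 + j) (off j + i) = tape cf j i"
      using s j by (auto simp: sim_def)
    have "bbf (view m) (B + 2 + j) = acts ! j" using ok qa j by (simp add: bbf_def)
    then show ?thesis using h j by (auto simp: act_def step)
  qed
  have lg: "logged (act bbf m) (snd (act bbf m) (B + 1) + 1) (d # ds)"
  proof -
    have l: "logged m (snd m (B + 1) + 1) ds" using s by (simp add: sim_def)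
    have b: "bbf (view m) (B + 1) = (nat (d + 2), -1)" using ok qa by (simp add: bbf_def d_def)
    show ?thesis unfolding logged_def
    proof (intro conjI allI impI)
      show "set (d # ds) \<subseteq> {-1, 0, 1}" using d l by (simp add: logged_def)
      fix i :: int assume i: "0 \<le> i"
      show "fst (act bbf m) (B + 1) (snd (act bbf m) (B + 1) + 1 + i) =
         (if i < int (length (d # ds)) then nat ((d # ds) ! nat i + 2) else 0)"
      proof (cases "i = 0")
        case True
        then show ?thesis using b by (simp add: act_def)
      next
        case False
        then have "fst m (B + 1) (snd m (B + 1) + 1 + (i - 1)) =
          (if i - 1 < int (length ds) then nat (ds ! nat (i - 1) + 2) else 0)"
          using i by (intro loggedD[OF l]) simp
        then show ?thesis using b False i by (simp add: act_def nth_Cons' nat_diff_distrib algebra_simps)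
      qed
    qed
  qed
  have "head (tm_step M cf) 1 = sum_list (d # ds)" using s nt by (simp add: step sim_def d_def)
  then have "sim off (tm_step M cf) (d # ds) (act bbf m)"
    using okc' v' tp lg by (simp add: sim_def step)
  then show "\<exists>d. sim off (tm_step M cf) (d # ds) (act bbf m)" ..
  show "same_outside Z m (act bbf m)"
    by (auto simp: same_outside_def Z_def act_def bbf_def view_def)
qed

lemma run_bb:
  assumes "sim off cf ds m" "state ((tm_step M ^^ t) cf) = 1"
  shows "\<exists>m' u ds'. u \<le> 2 * t + 1 \<and> run bb m u m' \<and> sim off ((tm_step M ^^ t) cf) ds' m' \<and>
    length ds' \<le> length ds + t \<and> same_outside Z m m'"
  using assms
proof (induction t arbitrary: cf ds m)
  case 0
  then have "view m B = 1" by (simp add: sim_def)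
  then have "run bb m 1 m" unfolding bb_def by (intro run.WhileF) simp
  then show ?case using 0 same_outside_refl
    by (intro exI[of _ m] exI[of _ 1] exI[of _ ds]) simp
next
  case (Suc t)
  show ?case
  proof (cases "state cf = 1")
    case True
    have "tm_step M cf = cf" using True by (simp add: tm_step_def)
    then have e: "(tm_step M ^^ u) cf = cf" for u by (induction u) auto
    have "view m B = 1" using Suc.prems(1) True by (simp add: sim_def)
    then have "run bb m 1 m" unfolding bb_def by (intro run.WhileF) simp
    then show ?thesis using Suc.prems e same_outside_refl
      by (intro exI[of _ m] exI[of _ 1] exI[of _ ds]) (simp del: funpow.simps)
  next
    case False
    obtain d where d: "sim off (tm_step M cf) (d # ds) (act bbf m)" using sim_step[OF Suc.prems(1) False] by blast
    have e: "(tm_step M ^^ t) (tm_step M cf) = (tm_step M ^^ Suc t) cf" by (simp add: funpow_swap1)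
    obtain m' u ds' where u: "u \<le> 2 * t + 1" "run bb (act bbf m) u m'"
      "sim off ((tm_step M ^^ Suc t) cf) ds' m'" "length ds' \<le> length (d # ds) + t" "same_outside Z (act bbf m) m'"
      using Suc.IH[OF d] Suc.prems(2) unfolding e by blast
    have "view m B \<noteq> 1" using Suc.prems(1) False by (simp add: sim_def)
    then have "run bb m (Suc (1 + u)) m'"
      using u(2) unfolding bb_def by (intro run.WhileT[OF _ run.Act]) auto
    moreover have "same_outside Z m m'"
      using u(5) by (rule same_outside_trans[OF sim_step(2)[OF Suc.prems(1) False]])
    ultimately show ?thesis using u
      by (intro exI[of _ m'] exI[of _ "Suc (1 + u)"] exI[of _ ds']) (simp del: funpow.simps)
  qed
qed

lemma run_undo_loop:
  assumes "logged m (snd m (B + 1)) ds"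
  shows "\<exists>m'. run (While (\<lambda>s. s (B + 1) \<noteq> 0) (Act undof)) m (2 * length ds + 1) m' \<and> fst m' = fst m \<and>
    snd m' (B + 3) = snd m (B + 3) - sum_list ds \<and> same_outside {B + 1, B + 3} m m'"
  using assms
proof (induction ds arbitrary: m)
  case Nil
  then have "fst m (B + 1) (snd m (B + 1) + 0) = 0" using loggedD[OF Nil, of 0] by simp
  then have "view m (B + 1) = 0" by (simp add: view_def)
  then have "run (While (\<lambda>s. s (B + 1) \<noteq> 0) (Act undof)) m 1 m" by (intro run.WhileF) simp
  then show ?case using same_outside_refl by (intro exI[of _ m]) simp
next
  case (Cons d ds)
  have "fst m (B + 1) (snd m (B + 1) + 0) = nat (d + 2)"
    using loggedD[OF Cons.prems, of 0] by simp
  then have v: "view m (B + 1) = nat (d + 2)" by (simp add: view_def)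
  have d: "d \<in> {-1, 0, 1}" using Cons.prems by (auto simp: logged_def)
  let ?m = "act undof m"
  have f: "fst ?m = fst m" by (simp add: act_def undof_def view_def)
  have h: "snd ?m (B + 1) = snd m (B + 1) + 1" by (simp add: act_def undof_def)
  have "logged ?m (snd ?m (B + 1)) ds"
    unfolding logged_def f h
  proof (intro conjI allI impI)
    show "set ds \<subseteq> {-1, 0, 1}" using Cons.prems by (simp add: logged_def)
    fix i :: int assume i: "0 \<le> i"
    then have "fst m (B + 1) (snd m (B + 1) + (i + 1)) =
      (if i + 1 < int (length (d # ds)) then nat ((d # ds) ! nat (i + 1) + 2) else 0)"
      by (intro loggedD[OF Cons.prems]) simp
    then show "fst m (B + 1) (snd m (B + 1) + 1 + i) = (if i < int (length ds) then nat (ds ! nat i + 2) else 0)"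
      using i by (simp add: nat_add_distrib algebra_simps)
  qed
  from Cons.IH[OF this] obtain m' where m': "run (While (\<lambda>s. s (B + 1) \<noteq> 0) (Act undof)) ?m (2 * length ds + 1) m'"
    "fst m' = fst ?m" "snd m' (B + 3) = snd ?m (B + 3) - sum_list ds" "same_outside {B + 1, B + 3} ?m m'" by blast
  have "run (While (\<lambda>s. s (B + 1) \<noteq> 0) (Act undof)) m (Suc (1 + (2 * length ds + 1))) m'"
    using v d m'(1) by (intro run.WhileT[OF _ run.Act]) auto
  then have "run (While (\<lambda>s. s (B + 1) \<noteq> 0) (Act undof)) m (2 * length (d # ds) + 1) m'"
    by (rule run_time_eq) simp
  moreover have "snd ?m (B + 3) = snd m (B + 3) - d" using v d by (auto simp: act_def undof_def)
  moreover have "same_outside {B + 1, B + 3} m ?m" by (auto simp: same_outside_def act_def undof_def view_def)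
  ultimately show ?case using m' f same_outside_trans[OF _ m'(4)] by (intro exI[of _ m']) simp
qed

lemma run_undo:
  assumes "sim off cf ds m"
  shows "\<exists>m'. run undo m (2 * length ds + 3) m' \<and> fst m' = fst m \<and> snd m' (B + 3) = off 1 \<and>
     same_outside {B + 1, B + 3} m m'"
proof -
  let ?f = "\<lambda>(s::nat \<Rightarrow> nat) j. (s j, if j = B + 1 then 1 else (0::int))"
  let ?m = "act ?f m"
  have f: "fst ?m = fst m" by (simp add: act_def view_def)
  have h: "snd ?m (B + 1) = snd m (B + 1) + 1" by (simp add: act_def)
  have "logged ?m (snd ?m (B + 1)) ds" 
    unfolding logged_def f h using assms unfolding sim_def logged_def by blast
  from run_undo_loop[OF this] obtain m' where m': "run (While (\<lambda>s. s (B + 1) \<noteq> 0) (Act undof)) ?m (2 * length ds + 1) m'"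
    "fst m' = fst ?m" "snd m' (B + 3) = snd ?m (B + 3) - sum_list ds" "same_outside {B + 1, B + 3} ?m m'" by blast
  have "run undo m (Suc (1 + (2 * length ds + 1))) m'"
    unfolding undo_def by (rule run.Seq[OF run.Act m'(1)])
  then have "run undo m (2 * length ds + 3) m'" by (rule run_time_eq) simp
  moreover have "1 < ntapes M" using nt by simp
  then have "snd m (B + 2 + 1) = off 1 + head cf 1 \<and> head cf 1 = sum_list ds"
    using assms unfolding sim_def by blast
  then have "snd ?m (B + 3) = off 1 + sum_list ds" by (simp add: act_def numeral_3_eq_3)
  moreover have "same_outside {B + 1, B + 3} m ?m" by (auto simp: same_outside_def act_def view_def)
  ultimately show ?thesis using m' f same_outside_trans[OF _ m'(4)] by (intro exI[of _ m']) simp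
qed

end

context subroutine
begin

lemma okc_step:
  assumes "okc cf"
  shows "okc (tm_step M cf)" "head (tm_step M cf) 1 \<le> head cf 1 + 1"
    "i \<noteq> head cf 1 \<Longrightarrow> tape (tm_step M cf) 1 i = tape cf 1 i"
proof -
  let ?ss = "map (\<lambda>j. tape cf j (head cf j)) [0..<ntapes M]"
  obtain q' acts where qa: "trans M (state cf) ?ss = (q', acts)" by (cases "trans M (state cf) ?ss")
  have "set ?ss \<subseteq> {..<nsyms M}" "state cf < nstates M" using assms by (auto simp: okc_def)
  then have t: "q' < nstates M" "length acts = ntapes M" "set acts \<subseteq> {..<nsyms M} \<times> {-1, 0, 1}"
    using trans_ok[of "state cf" ?ss] qa by auto
  have a: "fst (acts ! j) < nsyms M" "snd (acts ! j) \<le> 1" if "j < ntapes M" for j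
  proof -
    have "acts ! j \<in> {..<nsyms M} \<times> {-1, 0, 1}" 
      by (rule subsetD[OF t(3) nth_mem]) (simp add: t(2) that)
    then show "fst (acts ! j) < nsyms M" "snd (acts ! j) \<le> 1" unfolding mem_Times_iff by auto
  qed
  show "okc (tm_step M cf)"
    using assms t a by (auto simp: okc_def tm_step_def qa)
  show "head (tm_step M cf) 1 \<le> head cf 1 + 1"
    using a(2)[of 1] nt by (auto simp: tm_step_def qa)
  show "i \<noteq> head cf 1 \<Longrightarrow> tape (tm_step M cf) 1 i = tape cf 1 i"
    using nt by (auto simp: tm_step_def qa)
qed

lemma okc_init: "okc (init_config w)"
  using wfM by (auto simp: okc_def init_config_def wf_tm_def word_tape_def)

text \<open>The output head advances by at most one cell per step, hence cell \<open>t\<close> is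
  still blank after \<open>t\<close> steps.\<close>

lemma output_length:
  assumes "outputs_within M w t v"
  shows "length v \<le> t"
proof -
  have "okc ((tm_step M ^^ t) (init_config w)) \<and> head ((tm_step M ^^ t) (init_config w)) 1 \<le> int t \<and>
    (\<forall>i\<ge>int t. tape ((tm_step M ^^ t) (init_config w)) 1 i = 0)" for t
  proof (induction t)
    case 0
    then show ?case by (simp add: okc_init) (simp add: init_config_def)
  next
    case (Suc t)
    let ?c = "(tm_step M ^^ t) (init_config w)"
    have "tape (tm_step M ?c) 1 i = 0" if "i \<ge> int (Suc t)" for i
      using okc_step(3)[of ?c i] Suc that by auto
    then show ?case using Suc okc_step[of ?c] by auto
  qed
  moreover have "tape ((tm_step M ^^ t) (init_config w)) 1 (int t) = word_tape v (int t)"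
    using assms by (simp add: outputs_within_def Let_def)
  ultimately have "word_tape v (int t) = 0" by (metis order_refl)
  then show ?thesis by (auto simp: word_tape_def split: if_splits)
qed

end

text \<open>Postprocessing of a machine by a function that sees the original input beside the
  output. A reduction can so be altered in a way that depends on the number of variables it started
  from.\<close>

theorem TP_to_TM:
  assumes wf: "wf_tm M" and out: "\<And>w. outputs_within M w (poly q (length w)) (G w)"
    and TP: "TP D F" and D: "\<And>w. N (trw w) (trw (G w)) \<in> D" and F: "\<And>w. F (N (trw w) (trw (G w))) = trw (P w)"
  shows "\<exists>M' p. wf_tm M' \<and> (\<forall>w. outputs_within M' w (poly p (length w)) (P w))"
proof -
  obtain c B p where c: "computes c B p D F" using TP TP_def by blast
  have B4: "4 \<le> B" using c by (simp add: computes_def)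
  interpret subroutine M B using wf B4 by unfold_locales
  \<comment> \<open>The copy on tape 2 is reversed because feeding it to the simulated machine
    reverses it once more; tape 3 keeps the input.\<close>
  define pre where "pre = Seq (dup 0 3 2) (mv 0 2)"
  define post where "post = Seq (to_tree (B+3)) (Seq (to_tree 3) (Seq (push 0 True) (Seq c (Seq of_tree (mv 2 3)))))"
  define prog where "prog = Seq pre (Seq (feed 2 (B+2)) (Seq bb (Seq undo (Seq post (emit 3)))))"
  have "wfs pre" unfolding pre_def by (intro wfs_intros wfs_moves)
  then obtain k1 where k1: "\<And>k n. k \<ge> k1 \<Longrightarrow> n \<ge> 3 \<Longrightarrow> wfc k n pre" unfolding wfs_def by blast
  have "wfs post" unfolding post_def using c
    by (intro wfs_intros wfs_moves wfs_to_tree wfs_of_tree) (simp add: computes_def)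
  then obtain k2 where k2: "\<And>k n. k \<ge> k2 \<Longrightarrow> n \<ge> 3 \<Longrightarrow> wfc k n post" unfolding wfs_def by blast
  define k where "k = k1 + k2 + B + 2 + ntapes M"
  define n where "n = 4 + nsyms M + nstates M"
  have "wfc k n (feed 2 (B+2))" using nt B4 by (auto simp: feed_def ok_act_def k_def n_def)
  moreover have "wfc k n (emit 3)" using B4 by (auto simp: emit_def ok_act_def k_def n_def)
  moreover have "wfc k n bb" "wfc k n undo" by (rule wfc_bb; simp add: k_def n_def)+
  moreover have "wfc k n pre" "wfc k n post" by (rule k1 k2; simp add: k_def n_def)+
  ultimately have wfp: "wfc k n prog" by (simp add: prog_def)
  define pp where "pp = [:200, 100:] + 60 * q + 40 * pcompose p ([:3, 4:] + 4 * q)"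
  have main: "\<exists>u m'. u \<le> poly pp (length w) \<and> run prog (init_mem w) u m' \<and> fst m' 1 = word_tape (P w)" for w
  proof -
    define t where "t = poly q (length w)"
    define g where "g = G w"
    define v where "v = P w"
    define s where "s = tsz (N (trw w) (trw g))"
    have lg: "length g \<le> t" unfolding g_def t_def by (rule output_length[OF out])
    have s: "s \<le> 3 + 4 * length w + 4 * t" using tsz_trw[of w] tsz_trw[of g] lg by (simp add: s_def)
    have "tsz (trw v) \<le> poly p s" using computes_size[OF c D[of w]] by (simp add: s_def v_def g_def F)
    then have lv: "length v \<le> poly p s" using tsz_trw[of v] by simp
    have ps: "poly p s \<le> poly (pcompose p ([:3, 4:] + 4 * q)) (length w)"
      unfolding poly_pcompose using s by (intro poly_mono_nat) (simp add: t_def algebra_simps)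
    define R0 where "R0 = {j. j < B \<and> j \<noteq> 1}"
    define s0 where "s0 = (\<lambda>_::nat. [] :: bool list)(0 := w)"
    define s1 where "s1 = (\<lambda>_::nat. [] :: bool list)(2 := rev w, 3 := w)"
    define s2 where "s2 = (\<lambda>_::nat. [] :: bool list)(3 := w, B+3 := g)"
    define s3 where "s3 = (\<lambda>_::nat. [] :: bool list)(3 := v)"
    let ?m0 = "init_mem w"
    have i: "fst ?m0 j = (if j = 0 then word_tape w else (\<lambda>_. 0))" "snd ?m0 j = 0" for j
      by (simp_all add: init_mem_def init_config_def)
    have r0: "rep R0 ?m0 s0" by (auto simp: rep_def stk_def s0_def i)
    have r: "0 \<in> R0" "2 \<in> R0" "3 \<in> R0" using B4 by (auto simp: R0_def)
    have a: "exec R0 (dup 0 3 2) s0 (19 * length w + 3) (s0(3 := w))"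
      by (rule exec_conv[OF exec_dup]) (use r in \<open>auto simp: s0_def\<close>)
    have b: "exec R0 (mv 0 2) (s0(3 := w)) (7 * length w + 1) s1"
      by (rule exec_conv[OF exec_mv]) (use r in \<open>auto simp: s0_def s1_def fun_eq_iff\<close>)
    obtain m1 u1 where 1: "u1 \<le> Suc ((19 * length w + 3) + (7 * length w + 1))" "run pre ?m0 u1 m1"
      "rep R0 m1 s1" "same_outside R0 ?m0 m1"
      using exec_seq[OF a b] r0 unfolding exec_def pre_def by blast
    have o1: "fst m1 j = (\<lambda>_. 0)" "snd m1 j = 0" if "j \<ge> B \<or> j = 1" for j
      using 1(4) that B4 by (auto simp: same_outside_def R0_def i)
    have f2: "stk (fst m1 2) (snd m1 2) (rev w)" using 1(3) r by (auto simp: rep_def s1_def)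
    have "fstk (fst m1 (B+2)) (snd m1 (B+2)) []" using o1[of "B+2"] by (simp add: fstk_def)
    from run_feed[OF _ f2 this] obtain m2 where 2: "run (feed 2 (B+2)) m1 (4 * length w + 1) m2"
      "stk (fst m2 2) (snd m2 2) []" "fstk (fst m2 (B+2)) (snd m2 (B+2)) w" "same_outside {2, B+2} m1 m2"
      using B4 by auto
    have o2: "fst m2 j = (\<lambda>_. 0)" "snd m2 j = 0" if "(j \<ge> B \<or> j = 1) \<and> j \<noteq> B + 2" for j
      using 2(4) that o1[of j] B4 by (auto simp: same_outside_def)
    define off where "off j = snd m2 (B + 2 + j)" for j
    have "sim off (init_config w) [] m2"
      unfolding sim_def
    proof (intro conjI allI impI)
      show "view m2 B = state (init_config w)" using o2[of B] by (simp add: view_def init_config_def)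
      show "logged m2 (snd m2 (B + 1) + 1) []" using o2[of "B + 1"] by (simp add: logged_def)
      fix j assume "j < ntapes M"
      show "snd m2 (B + 2 + j) = off j + head (init_config w) j" by (simp add: off_def init_config_def)
      fix i show "fst m2 (B + 2 + j) (off j + i) = tape (init_config w) j i"
        using 2(3) o2[of "B + 2 + j"] by (cases "j = 0") (auto simp: off_def init_config_def fstk_def)
    qed (rule okc_init, simp add: init_config_def)
    moreover have st1: "state ((tm_step M ^^ t) (init_config w)) = 1"
      and tp1: "\<forall>i\<ge>0. tape ((tm_step M ^^ t) (init_config w)) 1 i = word_tape g i"
      using out[of w] by (auto simp: outputs_within_def Let_def t_def g_def)
    ultimately obtain m3 u3 ds where 3: "u3 \<le> 2 * t + 1" "run bb m2 u3 m3"
      "sim off ((tm_step M ^^ t) (init_config w)) ds m3" "length ds \<le> t" "same_outside Z m2 m3"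
      using run_bb[of off "init_config w" "[]" m2 t] by auto
    obtain m4 where 4: "run undo m3 (2 * length ds + 3) m4" "fst m4 = fst m3" "snd m4 (B + 3) = off 1"
     "same_outside {B + 1, B + 3} m3 m4" using run_undo[OF 3(3)] by blast
    have low: "fst m4 j = fst m2 j \<and> snd m4 j = snd m2 j" if "j < B" for j
      using 3(5) 4(4) that by (auto simp: same_outside_def Z_def)
    \<comment> \<open>With its head back at cell 0, the output tape of the simulated machine is a
      stack and joins the registers.\<close>
    define R2 where "R2 = insert (B+3) R0"
    have nt1: "1 < ntapes M" using nt by simp
    have "rep R2 m4 s2"
      unfolding rep_def
    proof
      fix j assume j: "j \<in> R2"
      have "\<forall>i. fst m3 (B + 2 + 1) (off 1 + i) = tape ((tm_step M ^^ t) (init_config w)) 1 i"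
        using 3(3) nt1 unfolding sim_def by blast
      then have g4: "stk (fst m4 (B+3)) (snd m4 (B+3)) g"
        using tp1 4(2,3) by (simp add: stk_def numeral_3_eq_3)
      consider "j = B + 3" | "j = 2" | "j \<in> R0" "j \<noteq> 2" using j R2_def by blast
      then show "stk (fst m4 j) (snd m4 j) (s2 j)"
      proof cases
        case 1
        then show ?thesis using g4 by (simp add: s2_def)
      next
        case two: 2
        then show ?thesis using 2(2) low[of 2] B4 by (simp add: s2_def)
      next
        case 3
        then have "stk (fst m1 j) (snd m1 j) (s1 j)" "fst m2 j = fst m1 j" "snd m2 j = snd m1 j" "j < B"
          using 1(3) 2(4) by (auto simp: rep_def same_outside_def R0_def)
        then show ?thesis using low[of j] 3 by (cases "j = 3") (simp_all add: s2_def s1_def)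
      qed
    qed
    moreover have rr: "0 \<in> R2" "2 \<in> R2" "3 \<in> R2" "B + 3 \<in> R2" using r by (auto simp: R2_def)
    have p1: "exec R2 (to_tree (B+3)) s2 (50 * length g + 20) (s2(B+3 := [], 0 := enc (trw g)))"
      by (rule exec_conv[OF exec_to_tree]) (use rr B4 in \<open>auto simp: s2_def fun_eq_iff\<close>)
    have p2: "exec R2 (to_tree 3) (s2(B+3 := [], 0 := enc (trw g))) (50 * length w + 20)
       ((\<lambda>_. [])(0 := enc (trw w) @ enc (trw g)))"
      by (rule exec_conv[OF exec_to_tree]) (use rr B4 in \<open>auto simp: s2_def fun_eq_iff\<close>)
    have p3: "exec R2 (push 0 True) ((\<lambda>_. [])(0 := enc (trw w) @ enc (trw g))) 3
       ((\<lambda>_. [])(0 := enc (N (trw w) (trw g))))"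
      by (rule exec_conv[OF exec_push]) (use rr in \<open>auto simp: fun_eq_iff\<close>)
    have p4: "exec R2 c ((\<lambda>_. [])(0 := enc (N (trw w) (trw g)))) (poly p s) ((\<lambda>_. [])(0 := enc (trw v)))"
      unfolding s_def by (rule exec_conv[OF computesD[OF c]])
        (use D[of w] in \<open>auto simp: regs_def clean_def R2_def R0_def F g_def v_def fun_eq_iff\<close>)
    have p5: "exec R2 of_tree ((\<lambda>_. [])(0 := enc (trw v))) (20 * length v + 20) ((\<lambda>_. [])(2 := rev v))"
    proof -
      have e1: "((\<lambda>_::nat. [])(0 := enc (trw v))) = ((\<lambda>_. [])(0 := enc (trw v), 2 := []))"
        and e2: "(\<lambda>_::nat. [])(0 := [], 2 := rev v @ []) = (\<lambda>_. [])(2 := rev v)" by (auto simp: fun_eq_iff)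
      show ?thesis by (subst e1, rule exec_conv[OF exec_of_tree _ e2]) (use rr in auto)
    qed
    have p6: "exec R2 (mv 2 3) ((\<lambda>_. [])(2 := rev v)) (7 * length v + 1) s3"
      by (rule exec_conv[OF exec_mv]) (use rr in \<open>auto simp: s3_def fun_eq_iff\<close>)
    have "exec R2 post s2 (Suc (50 * length g + 20 + Suc (50 * length w + 20 + Suc (3 + Suc (poly p s +
      Suc (20 * length v + 20 + (7 * length v + 1))))))) s3"
      unfolding post_def by (rule exec_seq[OF p1 exec_seq[OF p2 exec_seq[OF p3 exec_seq[OF p4 exec_seq[OF p5 p6]]]]])
    ultimately obtain m5 u5 where 5: "u5 \<le> Suc (50 * length g + 20 + Suc (50 * length w + 20 + Suc (3 + Suc (poly p s +
      Suc (20 * length v + 20 + (7 * length v + 1))))))" "run post m4 u5 m5" "rep R2 m5 s3" "same_outside R2 m4 m5"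
      unfolding exec_def by blast
    have st5: "stk (fst m5 3) (snd m5 3) v" using 5(3) rr by (auto simp: rep_def s3_def)
    have "fst m5 1 = fst m4 1" "snd m5 1 = snd m4 1"
      using 5(4) by (auto simp: same_outside_def R2_def R0_def)
    then have o5: "fst m5 1 = word_tape []" "snd m5 1 = int (length ([]::bool list))"
      using low[of 1] o2[of 1] B4 by (auto simp: fun_eq_iff)
    obtain m6 where 6: "run (emit 3) m5 (2 * length v + 1) m6" "fst m6 1 = word_tape v"
      using run_emit[OF _ st5 o5] by auto
    let ?u = "Suc (u1 + Suc ((4 * length w + 1) + Suc (u3 + Suc ((2 * length ds + 3) + Suc (u5 + (2 * length v + 1))))))"
    have "run prog ?m0 ?u m6"
      unfolding prog_def
      by (rule run.Seq[OF 1(2) run.Seq[OF 2(1) run.Seq[OF 3(2) run.Seq[OF 4(1) run.Seq[OF 5(2) 6(1)]]]]])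
    moreover have "?u \<le> poly pp (length w)"
      using 1(1) 3(1,4) 5(1) lg lv ps by (simp add: pp_def t_def[symmetric])
    ultimately show ?thesis using 6(2) v_def by blast
  qed
  obtain M' where M': "wf_tm M'" "\<And>w t m' t'. run prog (init_mem w) t m' \<Longrightarrow> t \<le> t' \<Longrightarrow>
     state ((tm_step M' ^^ t') (init_config w)) = 1 \<and> tape ((tm_step M' ^^ t') (init_config w)) = fst m'"
    using run_to_tm[OF wfp] B4 by (force simp: k_def n_def)
  have "outputs_within M' w (poly pp (length w)) (P w)" for w
  proof -
    obtain u m' where u: "u \<le> poly pp (length w)" "run prog (init_mem w) u m'" "fst m' 1 = word_tape (P w)"
      using main by blast
    show ?thesis using M'(2)[OF u(2,1)] u(3) by (simp add: outputs_within_def Let_def)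
  qed
  then show ?thesis using M'(1) by blast
qed

section \<open>Polynomial-time functions on typed data\<close>

text \<open>
  The size of a number in binary notation depends on how many of its digits are 1. The weight
  counts both digits alike, so that increasing a number by one adds at most a constant to it.
\<close>

class treeable =
  fixes tr :: "'a \<Rightarrow> tree" and wt :: "'a \<Rightarrow> nat"
  assumes tr_inj: "tr x = tr y \<Longrightarrow> x = y"
    and tsz_le_wt: "tsz (tr x) \<le> wt x" and wt_le_tsz: "wt x \<le> 3 * tsz (tr x)"

instantiation bool :: treeable
begin
definition "tr b = (if b then N L L else L)"
definition "wt (b :: bool) = 3"
instance by standard (auto simp: tr_bool_def wt_bool_def split: if_splits)
end

instantiation prod :: (treeable, treeable) treeable
begin
definition "tr p = N (tr (fst p)) (tr (snd p))"
definition "wt p = 1 + wt (fst p) + wt (snd p)"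
instance
proof
  fix x y :: "'a \<times> 'b"
  show "tr x = tr y \<Longrightarrow> x = y" by (auto simp: tr_prod_def intro: prod_eqI tr_inj)
  show "tsz (tr x) \<le> wt x" using tsz_le_wt[of "fst x"] tsz_le_wt[of "snd x"]
    by (simp add: tr_prod_def wt_prod_def)
  show "wt x \<le> 3 * tsz (tr x)" using wt_le_tsz[of "fst x"] wt_le_tsz[of "snd x"]
    by (simp add: tr_prod_def wt_prod_def)
qed
end

instantiation list :: (treeable) treeable
begin
primrec tr_list :: "'a list \<Rightarrow> tree" where
  "tr_list [] = L"
| "tr_list (x # xs) = N (tr x) (tr_list xs)"
primrec wt_list :: "'a list \<Rightarrow> nat" where
  "wt_list [] = 1"
| "wt_list (x # xs) = 1 + wt x + wt_list xs"
instance
proof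
  fix x y :: "'a list"
  show "tr x = tr y \<Longrightarrow> x = y"
  proof (induction x arbitrary: y)
    case Nil
    then show ?case by (cases y) auto
  next
    case (Cons a x)
    then show ?case by (cases y) (auto dest: tr_inj)
  qed
  show "tsz (tr x) \<le> wt x"
  proof (induction x)
    case (Cons a x)
    then show ?case using tsz_le_wt[of a] by simp
  qed simp
  show "wt x \<le> 3 * tsz (tr x)"
  proof (induction x)
    case (Cons a x)
    then show ?case using wt_le_tsz[of a] by simp
  qed simp
qed
end

fun val :: "bool list \<Rightarrow> nat" where
  "val [] = 0"
| "val (b # bs) = of_bool b + 2 * val bs"

lemma val_bin [simp]: "val (bin n) = n"
proof (induction n rule: bin.induct)
  case (1 n)
  then show ?case by (cases "n = 0") (auto simp: bin.simps elim!: oddE evenE)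
qed

instantiation nat :: treeable
begin
definition "tr n = tr (bin n)"
definition "wt n = wt (bin n)"
instance
proof
  fix x y :: nat
  show "tr x = tr y \<Longrightarrow> x = y" unfolding tr_nat_def by (metis tr_inj val_bin)
qed (simp_all add: tr_nat_def wt_nat_def tsz_le_wt wt_le_tsz)
end

lemma tr_word: "tr (w :: bool list) = trw w"
  by (induction w) (auto simp: tr_bool_def)

lemma wt_pos [simp]: "wt x > 0"
  using tsz_le_wt[of x] tsz_pos[of "tr x"] by linarith

lemma wt_Pair [simp]: "wt (a, b) = 1 + wt a + wt b"
  by (simp add: wt_prod_def)

lemma wt_bool [simp]: "wt (b :: bool) = 3"
  by (simp add: wt_bool_def)

definition TPF :: "(tree \<Rightarrow> tree) \<Rightarrow> ('a::treeable \<Rightarrow> 'b::treeable) \<Rightarrow> bool" where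
  "TPF F f \<longleftrightarrow> TP (range (tr :: 'a \<Rightarrow> tree)) F \<and> (\<forall>x. F (tr x) = tr (f x))"

definition polyf :: "('a::treeable \<Rightarrow> 'b::treeable) \<Rightarrow> bool" where
  "polyf f \<longleftrightarrow> (\<exists>F. TPF F f)"

lemma polyf_cong: "polyf f \<Longrightarrow> (\<And>x. f x = g x) \<Longrightarrow> polyf g"
  by (metis ext)

lemma polyf_size:
  assumes "polyf f"
  obtains q where "\<And>x. wt (f x) \<le> poly q (wt x)"
proof -
  obtain F c K p where F: "\<forall>x. F (tr x) = tr (f x)" and c: "computes c K p (range (tr :: 'a \<Rightarrow> tree)) F"
    using assms unfolding polyf_def TPF_def TP_def by blast
  have "wt (f x) \<le> poly (3 * p) (wt x)" for x
  proof -
    have "tsz (F (tr x)) \<le> poly p (tsz (tr x))" by (rule computes_size[OF c]) simp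
    also have "\<dots> \<le> poly p (wt x)" by (rule poly_mono_nat[OF tsz_le_wt])
    finally show ?thesis using wt_le_tsz[of "f x"] F by simp
  qed
  then show ?thesis using that by blast
qed

lemma polyf_id: "polyf (\<lambda>x. x)"
  unfolding polyf_def TPF_def using TP_id by (intro exI[of _ "\<lambda>x. x"]) auto

lemma polyf_const: "polyf (\<lambda>x. c)"
  unfolding polyf_def TPF_def using TP_const by (intro exI[of _ "\<lambda>x. tr c"]) auto

lemma polyf_comp:
  fixes f :: "'b::treeable \<Rightarrow> 'c::treeable" and g :: "'a::treeable \<Rightarrow> 'b"
  assumes "polyf f" "polyf g"
  shows "polyf (\<lambda>x. f (g x))"
proof -
  obtain F G where F0: "TPF F f" and G0: "TPF G g"
    using assms unfolding polyf_def by blast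
  note F = F0[unfolded TPF_def, THEN conjunct1] F0[unfolded TPF_def, THEN conjunct2] and G = G0[unfolded TPF_def, THEN conjunct1] G0[unfolded TPF_def, THEN conjunct2]
  have "TP (range (tr :: 'a \<Rightarrow> tree)) (\<lambda>T. F (G T))" by (rule TP_comp[OF G(1) F(1)]) (use G(2) in auto)
  then show ?thesis unfolding polyf_def TPF_def using F(2) G(2) by (intro exI[of _ "\<lambda>T. F (G T)"]) auto
qed

lemma polyf_Pair:
  assumes "polyf f" "polyf g"
  shows "polyf (\<lambda>x. (f x, g x))"
proof -
  obtain F G where F0: "TPF F f" and G0: "TPF G g"
    using assms unfolding polyf_def by blast
  note F = F0[unfolded TPF_def, THEN conjunct1] F0[unfolded TPF_def, THEN conjunct2] and G = G0[unfolded TPF_def, THEN conjunct1] G0[unfolded TPF_def, THEN conjunct2]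
  then show ?thesis unfolding polyf_def TPF_def
    using TP_pair[OF F(1) G(1)] by (intro exI[of _ "\<lambda>T. N (F T) (G T)"]) (auto simp: tr_prod_def)
qed

lemma polyf_fst: "polyf f \<Longrightarrow> polyf (\<lambda>x. fst (f x))"
  by (rule polyf_comp) (auto simp: polyf_def TPF_def tr_prod_def intro!: exI[of _ left] TP_left)

lemma polyf_snd: "polyf f \<Longrightarrow> polyf (\<lambda>x. snd (f x))"
  by (rule polyf_comp) (auto simp: polyf_def TPF_def tr_prod_def intro!: exI[of _ right] TP_right)

lemma polyf_if:
  assumes "polyf b" "polyf f" "polyf g"
  shows "polyf (\<lambda>x. if b x then f x else g x)"
proof -
  obtain B F G where B0: "TPF B b"
    and F0: "TPF F f" and G0: "TPF G g"
    using assms unfolding polyf_def by blast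
  note B = B0[unfolded TPF_def, THEN conjunct1] B0[unfolded TPF_def, THEN conjunct2] and F = F0[unfolded TPF_def, THEN conjunct1] F0[unfolded TPF_def, THEN conjunct2] and G = G0[unfolded TPF_def, THEN conjunct1] G0[unfolded TPF_def, THEN conjunct2]
  show ?thesis unfolding polyf_def TPF_def
    using TP_if[OF B(1) G(1) F(1)] B(2) F(2) G(2)
    by (intro exI[of _ "\<lambda>T. if B T = L then G T else F T"]) (auto simp: tr_bool_def)
qed

lemma polyf_Not: "polyf b \<Longrightarrow> polyf (\<lambda>x. \<not> b x)"
  by (rule polyf_cong[OF polyf_if[OF _ polyf_const polyf_const, of b False True]]) auto

lemma polyf_conj: "polyf b \<Longrightarrow> polyf c \<Longrightarrow> polyf (\<lambda>x. b x \<and> c x)"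
  by (rule polyf_cong[OF polyf_if[OF _ _ polyf_const, of b c False]]) auto

lemma polyf_disj: "polyf b \<Longrightarrow> polyf c \<Longrightarrow> polyf (\<lambda>x. b x \<or> c x)"
  by (rule polyf_cong[OF polyf_if[OF _ polyf_const, of b c True]]) auto

lemma polyf_bool_eq: "polyf b \<Longrightarrow> polyf c \<Longrightarrow> polyf (\<lambda>x. b x = (c x :: bool))"
  by (rule polyf_cong[OF polyf_if[OF _ _ polyf_Not, of b c c]]) auto

lemma polyf_Cons:
  assumes "polyf f" "polyf g"
  shows "polyf (\<lambda>x. f x # g x)"
proof -
  obtain F G where F0: "TPF F f" and G0: "TPF G g"
    using assms unfolding polyf_def by blast
  note F = F0[unfolded TPF_def, THEN conjunct1] F0[unfolded TPF_def, THEN conjunct2] and G = G0[unfolded TPF_def, THEN conjunct1] G0[unfolded TPF_def, THEN conjunct2]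
  then show ?thesis unfolding polyf_def TPF_def
    using TP_pair[OF F(1) G(1)] by (intro exI[of _ "\<lambda>T. N (F T) (G T)"]) auto
qed

lemma polyf_case_list:
  fixes xs :: "'a::treeable \<Rightarrow> 'e::treeable list" and n :: "'a \<Rightarrow> 'b::treeable"
  assumes "polyf xs" "polyf n" "polyf (\<lambda>p. c (fst p) (fst (snd p)) (snd (snd p)))"
  shows "polyf (\<lambda>x. case xs x of [] \<Rightarrow> n x | y # ys \<Rightarrow> c x y ys)"
proof -
  obtain X where X0: "TPF X xs" using assms(1) unfolding polyf_def by blast
  note X = X0[unfolded TPF_def, THEN conjunct1] X0[unfolded TPF_def, THEN conjunct2]
  obtain F where F0: "TPF F n" using assms(2) unfolding polyf_def by blast
  note F = F0[unfolded TPF_def, THEN conjunct1] F0[unfolded TPF_def, THEN conjunct2]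
  obtain C where C0: "TPF C (\<lambda>p. c (fst p) (fst (snd p)) (snd (snd p)))"
    using assms(3) unfolding polyf_def by blast
  note C = C0[unfolded TPF_def, THEN conjunct1] C0[unfolded TPF_def, THEN conjunct2]
  \<comment> \<open>For an empty list the argument is the code of an arbitrary triple, so that
    \<open>C\<close> is applied to valid codes only; its result is then discarded.\<close>
  let ?a = "\<lambda>T. if X T = L then tr (undefined :: 'a \<times> 'e \<times> 'e list) else N T (N (left (X T)) (right (X T)))"
  have "TP (range (tr :: 'a \<Rightarrow> tree)) ?a"
    by (intro TP_if TP_pair X TP_const TP_id TP_comp[OF X(1) TP_left] TP_comp[OF X(1) TP_right]) auto
  then have "TP (range (tr :: 'a \<Rightarrow> tree)) (\<lambda>T. C (?a T))"
  proof (rule TP_comp[OF _ C(1)])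
    fix T :: tree assume "T \<in> range (tr :: 'a \<Rightarrow> tree)"
    then obtain x :: 'a where x: "T = tr x" by blast
    show "?a T \<in> range (tr :: 'a \<times> 'e \<times> 'e list \<Rightarrow> tree)"
    proof (cases "xs x")
      case Nil
      then show ?thesis using X(2) x by simp
    next
      case (Cons y ys)
      then have "?a T = tr (x, (y, ys))" using X(2) x by (simp add: tr_prod_def)
      then show ?thesis by blast
    qed
  qed
  then have "TP (range (tr :: 'a \<Rightarrow> tree)) (\<lambda>T. if X T = L then F T else C (?a T))"
    by (intro TP_if X F)
  moreover have "(if X (tr x) = L then F (tr x) else C (?a (tr x))) =
      tr (case xs x of [] \<Rightarrow> n x | y # ys \<Rightarrow> c x y ys)" for x
    using X(2) F(2) C(2)[rule_format, of "(x, hd (xs x), tl (xs x))"]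
    by (cases "xs x") (auto simp: tr_prod_def)
  ultimately show ?thesis unfolding polyf_def TPF_def by blast
qed

lemma polyf_iterate:
  fixes g :: "'s::treeable \<Rightarrow> 's" and n :: "'a::treeable \<Rightarrow> 'n::treeable" and i :: "'a \<Rightarrow> 's"
  assumes g: "polyf g" and "polyf n" "polyf i"
    and q: "\<And>x k. k \<le> tsz (tr (n x)) \<Longrightarrow> wt ((g ^^ k) (i x)) \<le> poly q (wt (n x) + wt (i x))"
  shows "polyf (\<lambda>x. (g ^^ tsz (tr (n x))) (i x))"
proof -
  obtain G where G0: "TPF G g" using assms(1) unfolding polyf_def by blast
  note G = G0[unfolded TPF_def, THEN conjunct1] G0[unfolded TPF_def, THEN conjunct2]
  obtain J where J0: "TPF J n" using assms(2) unfolding polyf_def by blast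
  note J = J0[unfolded TPF_def, THEN conjunct1] J0[unfolded TPF_def, THEN conjunct2]
  obtain S where S0: "TPF S i" using assms(3) unfolding polyf_def by blast
  note S = S0[unfolded TPF_def, THEN conjunct1] S0[unfolded TPF_def, THEN conjunct2]
  have Gk: "(G ^^ k) (tr s) = tr ((g ^^ k) s)" for k and s :: 's by (induction k) (use G(2) in auto)
  let ?D = "range (\<lambda>x. N (tr (n x)) (tr (i x)))"
  have "TP ?D (\<lambda>T. (G ^^ tsz (left T)) (right T))"
  proof (rule TP_iter[OF G(1), where q = "pcompose q [:0, 3:]"])
    fix m s k assume "N m s \<in> ?D" and k: "k \<le> tsz m"
    then obtain x where x: "m = tr (n x)" "s = tr (i x)" by auto
    have "tsz ((G ^^ k) s) \<le> wt ((g ^^ k) (i x))" unfolding x Gk by (rule tsz_le_wt)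
    also have "\<dots> \<le> poly q (wt (n x) + wt (i x))" using q k x by simp
    also have "\<dots> \<le> poly (pcompose q [:0, 3:]) (tsz m + tsz s)"
      unfolding poly_pcompose x using wt_le_tsz[of "n x"] wt_le_tsz[of "i x"]
      by (intro poly_mono_nat) simp
    finally show "tsz ((G ^^ k) s) \<le> poly (pcompose q [:0, 3:]) (tsz m + tsz s)" .
  qed (use Gk in auto)
  then have "TP (range (tr :: 'a \<Rightarrow> tree)) (\<lambda>T. (G ^^ tsz (left (N (J T) (S T)))) (right (N (J T) (S T))))"
    by (intro TP_comp[OF TP_pair[OF J(1) S(1)], where G = "\<lambda>T. (G ^^ tsz (left T)) (right T)"])
      (use J(2) S(2) in auto)
  then show ?thesis unfolding polyf_def TPF_def
    by (intro exI[of _ "\<lambda>T. (G ^^ tsz (left (N (J T) (S T)))) (right (N (J T) (S T)))"])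
      (auto simp: J(2) S(2) Gk)
qed

section \<open>Folds with polynomial growth\<close>

lemma length_lt_tsz: "length xs < tsz (tr xs)"
  by (induction xs) (auto intro: less_le_trans)

lemma length_lt_wt: "length xs < wt xs"
  by (induction xs) auto

lemma wt_drop: "wt (drop k xs) \<le> wt xs"
proof (induction xs arbitrary: k)
  case (Cons a xs)
  then show ?case using Cons[of "k - 1"] by (cases k) (auto simp: le_SucI trans_le_add2)
qed simp

lemma wt_mem: "e \<in> set xs \<Longrightarrow> wt e < wt xs"
  by (induction xs) (auto simp: less_Suc_eq_le)

text \<open>The fold becomes the iteration of one step on the parameter, the accumulator and the
  unread list. The step is idle once the list is empty, so the tree size of the list, which exceeds
  its length, can serve as the number of rounds.\<close>

lemma polyf_foldl_gen:
  assumes st: "polyf (\<lambda>p. step (fst p) (fst (snd p)) (snd (snd p)))"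
    and "polyf i" "polyf xs"
    and q: "\<And>x k. wt (foldl (step x) (i x) (take k (xs x))) \<le> poly q (wt x)"
  shows "polyf (\<lambda>x. foldl (step x) (i x) (xs x))"
proof -
  let ?c = "\<lambda>p y ys. (fst p, (step (fst p) (fst (snd p)) y, ys))"
  define g where "g p = (case snd (snd p) of [] \<Rightarrow> p | y # ys \<Rightarrow> ?c p y ys)" for p
  have g01: "g (x, (s, [])) = (x, (s, []))" "g (x, (s, e # es)) = (x, (step x s e, es))" for x s e es
    by (simp_all add: g_def)
  have gk: "(g ^^ k) (x, (s, es)) = (x, (foldl (step x) s (take k es), drop k es))" for k x s es
  proof (induction k arbitrary: s es)
    case (Suc k)
    have "(g ^^ Suc k) (x, (s, es)) = (g ^^ k) (g (x, (s, es)))" by (simp add: funpow_swap1)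
    then show ?case by (cases es) (simp_all del: funpow.simps add: Suc g01)
  qed simp
  have pg: "polyf g"
  proof -
    have 1: "polyf (\<lambda>t. step (fst (fst t)) (fst (snd (fst t))) (fst (snd t)))"
      using polyf_comp[OF st, of "\<lambda>t. (fst (fst t), (fst (snd (fst t)), fst (snd t)))"]
      by (simp add: polyf_Pair polyf_fst polyf_snd polyf_id)
    have "polyf (\<lambda>t. ?c (fst t) (fst (snd t)) (snd (snd t)))"
      by (intro polyf_Pair polyf_fst polyf_snd polyf_id 1)
    then show ?thesis unfolding g_def[abs_def] by (intro polyf_case_list polyf_snd polyf_id)
  qed
  obtain r where r: "\<And>x. wt (xs x) \<le> poly r (wt x)" using polyf_size[OF assms(3)] by blast
  let ?i = "\<lambda>x. (x, (i x, xs x))"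
  have "polyf (\<lambda>x. (g ^^ tsz (tr (xs x))) (?i x))"
  proof (rule polyf_iterate[OF pg assms(3), where q = "[:2, 1:] + q + r"])
    show "polyf ?i" by (intro polyf_Pair polyf_id assms)
    fix x k
    have "poly q (wt x) \<le> poly q (wt (xs x) + wt (?i x))" "poly r (wt x) \<le> poly r (wt (xs x) + wt (?i x))"
      by (rule poly_mono_nat; simp)+
    then show "wt ((g ^^ k) (?i x)) \<le> poly ([:2, 1:] + q + r) (wt (xs x) + wt (?i x))"
      unfolding gk using q[of x k] wt_drop[of k "xs x"] r[of x] by simp
  qed
  then have "polyf (\<lambda>x. fst (snd ((g ^^ tsz (tr (xs x))) (?i x))))" by (intro polyf_fst polyf_snd)
  then show ?thesis by (rule polyf_cong) (simp add: gk length_lt_tsz less_imp_le)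
qed

lemma wt_foldl:
  assumes "\<And>s e. e \<in> set es \<Longrightarrow> wt (f s e) \<le> wt s + b"
  shows "wt (foldl f s es) \<le> wt s + length es * b"
  using assms
proof (induction es arbitrary: s)
  case (Cons e es)
  have "wt (foldl f (f s e) es) \<le> wt (f s e) + length es * b" using Cons by auto
  then show ?case using Cons.prems[of e s] by simp
qed simp

text \<open>The increment may depend on the parameter but not on the accumulator. This excludes
  repeated squaring and makes the total growth a product of two polynomials.\<close>

definition additive :: "('a::treeable \<Rightarrow> 's::treeable \<Rightarrow> 'e \<Rightarrow> 's) \<Rightarrow> ('a \<Rightarrow> 'e list) \<Rightarrow> bool" where
  "additive step xs \<longleftrightarrow> (\<exists>q. \<forall>x s e. e \<in> set (xs x) \<longrightarrow> wt (step x s e) \<le> wt s + poly q (wt x))"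

lemma polyf_foldl:
  assumes st: "polyf (\<lambda>p. step (fst p) (fst (snd p)) (snd (snd p)))"
    and i: "polyf i" and xs: "polyf xs" and "additive step xs"
  shows "polyf (\<lambda>x. foldl (step x) (i x) (xs x))"
proof -
  obtain q where q: "\<And>x s e. e \<in> set (xs x) \<Longrightarrow> wt (step x s e) \<le> wt s + poly q (wt x)"
    using assms(4) unfolding additive_def by blast
  obtain r where r: "\<And>x. wt (xs x) \<le> poly r (wt x)" using polyf_size[OF xs] by blast
  obtain p where p: "\<And>x. wt (i x) \<le> poly p (wt x)" using polyf_size[OF i] by blast
  show ?thesis
  proof (rule polyf_foldl_gen[OF st i xs, where q = "p + r * q"])
    fix x k
    have "wt (foldl (step x) (i x) (take k (xs x))) \<le> wt (i x) + length (take k (xs x)) * poly q (wt x)"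
      by (intro wt_foldl q) (meson in_set_takeD)
    also have "length (take k (xs x)) \<le> poly r (wt x)" using length_lt_wt[of "xs x"] r[of x] by auto
    finally show "wt (foldl (step x) (i x) (take k (xs x))) \<le> poly (p + r * q) (wt x)"
      using p[of x] by (simp add: add_mono)
  qed
qed

lemma polyf_elem_size:
  assumes h: "polyf (\<lambda>p. h (fst p) (snd p))" and xs: "polyf xs"
  obtains q where "\<And>x e. e \<in> set (xs x) \<Longrightarrow> wt (h x e) \<le> poly q (wt x)"
proof -
  obtain r where r: "\<And>x. wt (xs x) \<le> poly r (wt x)" using polyf_size[OF xs] by blast
  obtain p where p: "\<And>t. wt (h (fst t) (snd t)) \<le> poly p (wt t)" using polyf_size[OF h] by blast
  have "wt (h x e) \<le> poly (pcompose p ([:1, 1:] + r)) (wt x)" if "e \<in> set (xs x)" for x e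
  proof -
    have "wt (h x e) \<le> poly p (wt (x, e))" using p[of "(x, e)"] by simp
    also have "\<dots> \<le> poly (pcompose p ([:1, 1:] + r)) (wt x)"
      unfolding poly_pcompose using r[of x] wt_mem[OF that] by (intro poly_mono_nat) simp
    finally show ?thesis .
  qed
  then show ?thesis using that by blast
qed

section \<open>Closure under list operations\<close>

named_theorems polyf_intros

lemmas [polyf_intros] = polyf_id polyf_const polyf_Pair polyf_fst polyf_snd polyf_if polyf_Not
  polyf_conj polyf_disj polyf_bool_eq polyf_Cons polyf_case_list

lemma additiveI: "(\<And>x s e. e \<in> set (xs x) \<Longrightarrow> wt (step x s e) \<le> wt s + poly q (wt x)) \<Longrightarrow> additive step xs"
  unfolding additive_def by blast

lemma polyf_rev [polyf_intros]:
  assumes "polyf xs"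
  shows "polyf (\<lambda>x. rev (xs x))"
proof -
  obtain q where q: "\<And>x e. e \<in> set (xs x) \<Longrightarrow> wt e \<le> poly q (wt x)"
    using polyf_elem_size[of "\<lambda>x e. e", OF _ assms] polyf_snd polyf_id by blast
  have "polyf (\<lambda>x. foldl (\<lambda>s e. e # s) [] (xs x))"
  proof (rule polyf_foldl)
    show "additive (\<lambda>_ s e. e # s) xs"
      by (rule additiveI[where q = "1 + q"]) (use q in auto)
  qed (intro polyf_intros assms)+
  then show ?thesis by (simp add: foldl_conv_fold rev_conv_fold)
qed

lemma foldl_snoc_map: "foldl (\<lambda>s e. f e # s) acc xs = rev (map f xs) @ acc"
  by (induction xs arbitrary: acc) auto

lemma polyf_map [polyf_intros]:
  assumes f: "polyf (\<lambda>p. f (fst p) (snd p))" and xs: "polyf xs"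
  shows "polyf (\<lambda>x. map (f x) (xs x))"
proof -
  obtain q where q: "\<And>x e. e \<in> set (xs x) \<Longrightarrow> wt (f x e) \<le> poly q (wt x)"
    using polyf_elem_size[OF f xs] by blast
  have 1: "polyf (\<lambda>p. f (fst p) (snd (snd p)))"
    using polyf_comp[OF f, of "\<lambda>p. (fst p, snd (snd p))"] by (simp add: polyf_intros)
  have "polyf (\<lambda>x. foldl (\<lambda>s e. f x e # s) [] (xs x))"
  proof (rule polyf_foldl)
    show "additive (\<lambda>x s e. f x e # s) xs"
      by (rule additiveI[where q = "1 + q"]) (use q in auto)
  qed (intro polyf_intros xs 1)+
  then have "polyf (\<lambda>x. rev (foldl (\<lambda>s e. f x e # s) [] (xs x)))" by (rule polyf_rev)
  then show ?thesis by (simp add: foldl_snoc_map)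
qed

lemma wt_append: "wt (xs @ ys) + 1 = wt xs + wt ys"
  by (induction xs) auto

lemma foldl_Cons_append: "foldl (\<lambda>s e. e # s) ys xs = rev xs @ ys"
  by (induction xs arbitrary: ys) auto

lemma polyf_append [polyf_intros]:
  assumes xs: "polyf xs" and ys: "polyf ys"
  shows "polyf (\<lambda>x. xs x @ ys x)"
proof -
  have rx: "polyf (\<lambda>x. rev (xs x))" by (intro polyf_intros xs)
  obtain q where q: "\<And>x e. e \<in> set (rev (xs x)) \<Longrightarrow> wt e \<le> poly q (wt x)"
    using polyf_elem_size[of "\<lambda>x e. e", OF _ rx] polyf_snd polyf_id by blast
  have "polyf (\<lambda>x. foldl (\<lambda>s e. e # s) (ys x) (rev (xs x)))"
  proof (rule polyf_foldl)
    show "additive (\<lambda>_ s e. e # s) (\<lambda>x. rev (xs x))"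
      by (rule additiveI[where q = "1 + q"]) (use q in auto)
  qed (intro polyf_intros ys rx)+
  then show ?thesis by (simp add: foldl_Cons_append)
qed

lemma foldl_append_concat: "foldl (\<lambda>s e. s @ f e) acc xs = acc @ concat (map f xs)"
  by (induction xs arbitrary: acc) auto

lemma polyf_concat_map [polyf_intros]:
  assumes f: "polyf (\<lambda>p. f (fst p) (snd p))" and xs: "polyf xs"
  shows "polyf (\<lambda>x. concat (map (f x) (xs x)))"
proof -
  obtain q where q: "\<And>x e. e \<in> set (xs x) \<Longrightarrow> wt (f x e) \<le> poly q (wt x)"
    using polyf_elem_size[OF f xs] by blast
  have 1: "polyf (\<lambda>p. f (fst p) (snd (snd p)))"
    using polyf_comp[OF f, of "\<lambda>p. (fst p, snd (snd p))"] by (simp add: polyf_intros)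
  have "polyf (\<lambda>x. foldl (\<lambda>s e. s @ f x e) [] (xs x))"
  proof (rule polyf_foldl)
    show "additive (\<lambda>x s e. s @ f x e) xs"
    proof (rule additiveI[where q = q])
      fix x s e assume "e \<in> set (xs x)"
      then show "wt (s @ f x e) \<le> wt s + poly q (wt x)" using q[of e x] wt_append[of s "f x e"] by simp
    qed
  qed (intro polyf_intros xs 1)+
  then show ?thesis by (simp add: foldl_append_concat)
qed

lemma polyf_filter [polyf_intros]:
  assumes "polyf (\<lambda>p. P (fst p) (snd p))" and xs: "polyf xs"
  shows "polyf (\<lambda>x. filter (P x) (xs x))"
proof -
  have "polyf (\<lambda>x. concat (map (\<lambda>e. if P x e then [e] else []) (xs x)))"
    by (intro polyf_intros assms)
  moreover have "concat (map (\<lambda>e. if Q e then [e] else []) ys) = filter Q ys" for Q and ys :: "'b list"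
    by (induction ys) auto
  ultimately show ?thesis by simp
qed

lemma polyf_null [polyf_intros]: "polyf xs \<Longrightarrow> polyf (\<lambda>x. xs x = [])"
  using polyf_cong[OF polyf_case_list[of xs "\<lambda>_. True" "\<lambda>_ _ _. False"]]
  by (auto simp: polyf_const split: list.splits)

lemma polyf_list_ex [polyf_intros]:
  assumes "polyf (\<lambda>p. P (fst p) (snd p))" and xs: "polyf xs"
  shows "polyf (\<lambda>x. list_ex (P x) (xs x))"
proof -
  have "polyf (\<lambda>x. \<not> filter (P x) (xs x) = [])" by (intro polyf_intros assms)
  then show ?thesis by (rule polyf_cong) (auto simp: list_ex_iff filter_empty_conv)
qed

lemma polyf_list_all [polyf_intros]:
  assumes "polyf (\<lambda>p. P (fst p) (snd p))" and xs: "polyf xs"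
  shows "polyf (\<lambda>x. list_all (P x) (xs x))"
proof -
  have "polyf (\<lambda>x. \<not> list_ex (\<lambda>e. \<not> P x e) (xs x))" by (intro polyf_intros assms)
  then show ?thesis by (rule polyf_cong) (auto simp: list_ex_iff list_all_iff)
qed

lemma polyf_tl [polyf_intros]: "polyf xs \<Longrightarrow> polyf (\<lambda>x. tl (xs x))"
proof -
  assume a: "polyf xs"
  have "polyf (\<lambda>x. case xs x of [] \<Rightarrow> [] | y # ys \<Rightarrow> ys)" by (intro polyf_intros a)
  then show ?thesis by (rule polyf_cong) (auto split: list.splits)
qed

lemma polyf_zip [polyf_intros]:
  fixes xs :: "'a::treeable \<Rightarrow> 'b::treeable list" and ys :: "'a \<Rightarrow> 'c::treeable list"
  assumes xs: "polyf xs" and ys: "polyf ys"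
  shows "polyf (\<lambda>x. zip (xs x) (ys x))"
proof -
  let ?step = "\<lambda>s e. case snd s of [] \<Rightarrow> s | y # t \<Rightarrow> ((e, y) # fst s, t)"
  obtain q where q: "\<And>x e. e \<in> set (xs x) \<Longrightarrow> wt e \<le> poly q (wt x)"
    using polyf_elem_size[of "\<lambda>x e. e", OF _ xs] polyf_snd polyf_id by blast
  have "polyf (\<lambda>x. foldl ?step ([], ys x) (xs x))"
  proof (rule polyf_foldl)
    show "additive (\<lambda>_. ?step) xs"
    proof (rule additiveI[where q = "2 + q"])
      fix x s e assume "e \<in> set (xs x)"
      then show "wt (?step s e) \<le> wt s + poly (2 + q) (wt x)"
        using q[of e x] by (cases s) (auto split: list.splits)
    qed
  qed (intro polyf_intros xs ys)+
  then have "polyf (\<lambda>x. rev (fst (foldl ?step ([], ys x) (xs x))))" by (intro polyf_intros)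
  moreover have "fst (foldl ?step (acc, v) u) = rev (zip u v) @ acc" for acc and u :: "'b list" and v :: "'c list"
  proof (induction u arbitrary: acc v)
    case (Cons a u)
    then show ?case by (cases v) auto
  qed simp
  ultimately show ?thesis by simp
qed

lemma foldl_tl: "foldl (\<lambda>l _. tl l) l u = drop (length u) l"
  by (induction u arbitrary: l) (auto simp: drop_Suc)

lemma wt_tl: "wt (tl l) \<le> wt l"
  by (cases l) auto

lemma polyf_drop [polyf_intros]:
  assumes "polyf u" "polyf l"
  shows "polyf (\<lambda>x. drop (length (u x)) (l x))"
proof -
  have "polyf (\<lambda>x. foldl (\<lambda>l _. tl l) (l x) (u x))"
  proof (rule polyf_foldl)
    show "additive (\<lambda>_ l _. tl l) u" by (rule additiveI[where q = 0]) (simp add: wt_tl)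
  qed (intro polyf_intros assms)+
  then show ?thesis by (simp add: foldl_tl)
qed

section \<open>Binary arithmetic\<close>

text \<open>A number is stored as its digit list, so \<open>bin\<close> is the identity on trees. In
  the other direction \<open>val\<close> has to remove leading zeros first.\<close>

lemma polyf_bin [polyf_intros]: "polyf f \<Longrightarrow> polyf (\<lambda>x. bin (f x))"
  by (rule polyf_comp) (auto simp: polyf_def TPF_def tr_nat_def intro!: exI[of _ "\<lambda>x. x"] TP_id)

definition trim :: "bool list \<Rightarrow> bool list" where
  "trim l = foldl (\<lambda>s b. if \<not> b \<and> s = [] then [] else b # s) [] (rev l)"

lemma trim_Cons: "trim (b # l) = (if \<not> b \<and> trim l = [] then [] else b # trim l)"
  by (simp add: trim_def)

lemma bin_0 [simp]: "bin 0 = []"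
  by (simp add: bin.simps)

lemma bin_eq_Nil [simp]: "bin n = [] \<longleftrightarrow> n = 0"
  by (simp add: bin.simps)

lemma bin_val: "bin (val l) = trim l"
proof (induction l)
  case Nil
  then show ?case by (simp add: trim_def)
next
  case (Cons b l)
  have "bin (of_bool b + 2 * val l) = (if \<not> b \<and> val l = 0 then [] else b # bin (val l))"
    by (subst bin.simps) auto
  then show ?case using Cons bin_eq_Nil[of "val l"] by (auto simp: trim_Cons)
qed

lemma polyf_trim: "polyf trim"
  unfolding trim_def[abs_def]
proof (rule polyf_foldl)
  show "additive (\<lambda>_ s b. if \<not> b \<and> s = [] then [] else b # s) rev"
    by (rule additiveI[where q = 4]) auto
qed (intro polyf_intros)+

lemma polyf_val [polyf_intros]:
  assumes "polyf f"
  shows "polyf (\<lambda>x. val (f x))"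
proof -
  have "polyf (\<lambda>x. trim (f x))" by (rule polyf_comp[OF polyf_trim assms])
  then show ?thesis by (simp add: polyf_def TPF_def tr_nat_def bin_val)
qed

lemma wt_word: "wt (w :: bool list) = 4 * length w + 1"
  by (induction w) auto

lemma wt_nat: "wt n = 4 * length (bin n) + 1"
  by (simp add: wt_nat_def wt_word)

lemma length_bin_le: "length (bin n) \<le> k \<longleftrightarrow> n < 2 ^ k"
proof (induction k arbitrary: n)
  case (Suc k)
  show ?case
  proof (cases "n = 0")
    case False
    then have "length (bin n) = Suc (length (bin (n div 2)))" by (simp add: bin.simps)
    then show ?thesis using Suc[of "n div 2"] by (simp add: less_mult_imp_div_less) linarith
  qed simp
qed simp

lemma less_two_power_length_bin: "n < 2 ^ length (bin n)"
  using length_bin_le by blast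

lemma wt_add: "wt (m + n) \<le> wt m + wt n + (3 :: nat)" for m n :: nat
proof -
  let ?a = "length (bin m)" and ?b = "length (bin n)"
  have "m + n < 2 ^ ?a + 2 ^ ?b" using less_two_power_length_bin add_strict_mono by blast
  also have "\<dots> \<le> 2 ^ (?a + ?b) + 2 ^ (?a + ?b)" by (intro add_mono power_increasing) auto
  also have "\<dots> = 2 ^ (?a + ?b + 1)" by simp
  finally have "length (bin (m + n)) \<le> ?a + ?b + 1" using length_bin_le by blast
  then show ?thesis by (simp add: wt_nat)
qed

lemma wt_mult: "wt (m * n) \<le> wt m + (wt n :: nat)" for m n :: nat
proof -
  let ?a = "length (bin m)" and ?b = "length (bin n)"
  have "m * n < 2 ^ ?a * 2 ^ ?b"
    by (intro mult_strict_mono less_two_power_length_bin) auto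
  then have "length (bin (m * n)) \<le> ?a + ?b" using length_bin_le by (simp add: power_add)
  then show ?thesis by (simp add: wt_nat)
qed

fun addz :: "bool \<Rightarrow> (bool \<times> bool) list \<Rightarrow> bool list" where
  "addz c [] = [c]"
| "addz c (ab # zs) = (fst ab \<noteq> (snd ab \<noteq> c)) # addz (if fst ab = snd ab then fst ab else c) zs"

lemma val_addz: "val (addz c zs) = of_bool c + val (map fst zs) + val (map snd zs)"
  by (induction zs arbitrary: c) auto

lemma val_append_False: "val (a @ map (\<lambda>_. False) b) = val a"
proof (induction a)
  case Nil
  show ?case by (induction b) auto
qed simp

text \<open>Each word is padded by the length of the other, so \<open>zip\<close> loses no
  digit.\<close>

definition padzip :: "bool list \<Rightarrow> bool list \<Rightarrow> (bool \<times> bool) list" where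
  "padzip a b = zip (a @ map (\<lambda>_. False) b) (b @ map (\<lambda>_. False) a)"

lemma padzip: "val (map fst (padzip a b)) = val a" "val (map snd (padzip a b)) = val b"
  by (simp_all add: padzip_def val_append_False)

lemma polyf_padzip [polyf_intros]: "polyf a \<Longrightarrow> polyf b \<Longrightarrow> polyf (\<lambda>x. padzip (a x) (b x))"
  unfolding padzip_def by (intro polyf_intros)

lemma polyf_add [polyf_intros]:
  fixes a b :: "'a::treeable \<Rightarrow> nat"
  assumes "polyf a" "polyf b"
  shows "polyf (\<lambda>x. a x + b x)"
proof -
  let ?step = "\<lambda>s ab. (if fst ab = snd ab then fst ab else fst s, (fst ab \<noteq> (snd ab \<noteq> fst s)) # snd s)"
  let ?z = "\<lambda>x. padzip (bin (a x)) (bin (b x))"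
  have "polyf (\<lambda>x. foldl ?step (False, []) (?z x))"
  proof (rule polyf_foldl)
    show "additive (\<lambda>_. ?step) ?z"
    proof (rule additiveI[where q = 4])
      fix x and s :: "bool \<times> bool list" and e :: "bool \<times> bool"
      show "wt (?step s e) \<le> wt s + poly 4 (wt x)" by (cases s) simp
    qed
  qed (intro polyf_intros assms)+
  then have "polyf (\<lambda>x. val (rev (snd (foldl ?step (False, []) (?z x))) @ [fst (foldl ?step (False, []) (?z x))]))"
    by (intro polyf_intros)
  moreover have "rev (snd (foldl ?step (c, acc) zs)) @ [fst (foldl ?step (c, acc) zs)] = rev acc @ addz c zs" for c acc zs
    by (induction zs arbitrary: c acc) auto
  ultimately show ?thesis by (simp add: val_addz padzip)
qed

text \<open>Digits come lowest first, so each unequal pair overrides the verdict of the pairs before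
  it.\<close>

lemma polyf_le [polyf_intros]:
  fixes a b :: "'a::treeable \<Rightarrow> nat"
  assumes "polyf a" "polyf b"
  shows "polyf (\<lambda>x. a x \<le> b x)"
proof -
  let ?step = "\<lambda>r ab. if fst ab = snd ab then r else snd ab"
  let ?z = "\<lambda>x. padzip (bin (a x)) (bin (b x))"
  have "polyf (\<lambda>x. foldl ?step True (?z x))"
  proof (rule polyf_foldl)
    show "additive (\<lambda>_. ?step) ?z" by (rule additiveI[where q = 4]) simp
  qed (intro polyf_intros assms)+
  moreover have "foldl ?step r zs \<longleftrightarrow> val (map fst zs) < val (map snd zs) \<or>
      val (map fst zs) = val (map snd zs) \<and> r" for r zs
  proof (induction zs arbitrary: r)
    case (Cons ab zs)
    show ?case by (simp add: Cons; cases ab; auto; presburger)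
  qed simp
  ultimately show ?thesis by (elim polyf_cong) (auto simp: padzip)
qed

lemma polyf_less [polyf_intros]:
  fixes a b :: "'a::treeable \<Rightarrow> nat"
  assumes "polyf a" "polyf b"
  shows "polyf (\<lambda>x. a x < b x)"
proof -
  have "polyf (\<lambda>x. \<not> b x \<le> a x)" by (intro polyf_intros assms)
  then show ?thesis by (simp add: not_le)
qed

lemma polyf_nat_eq [polyf_intros]:
  fixes a b :: "'a::treeable \<Rightarrow> nat"
  assumes "polyf a" "polyf b"
  shows "polyf (\<lambda>x. a x = b x)"
proof -
  have "polyf (\<lambda>x. a x \<le> b x \<and> b x \<le> a x)" by (intro polyf_intros assms)
  then show ?thesis by (rule polyf_cong) auto
qed

lemma foldl_horner: "foldl (\<lambda>s b. 2 * s + (if b then a else 0)) 0 (rev bs) = a * val bs"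
  by (induction bs) (auto simp: algebra_simps)

lemma polyf_mult [polyf_intros]:
  fixes a b :: "'a::treeable \<Rightarrow> nat"
  assumes "polyf a" "polyf b"
  shows "polyf (\<lambda>x. a x * b x)"
proof -
  obtain p where p: "\<And>x. wt (a x) \<le> poly p (wt x)" using polyf_size[OF assms(1)] by blast
  have 1: "polyf (\<lambda>t. a (fst t))" by (rule polyf_comp[OF assms(1)]) (intro polyf_intros)
  \<comment> \<open>Horner's scheme from the highest digit. Doubling adds one digit, so in each
    round the weight grows by a constant and the weight of a factor, as \<open>additive\<close>
    demands.\<close>
  have "polyf (\<lambda>x. foldl (\<lambda>s d. (s + s) + (if d then a x else 0)) 0 (rev (bin (b x))))"
  proof (rule polyf_foldl)
    show "additive (\<lambda>x s d. (s + s) + (if d then a x else 0)) (\<lambda>x. rev (bin (b x)))"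
    proof (rule additiveI[where q = "20 + p"])
      fix x and s :: nat and d :: bool
      have "wt (s + s) \<le> wt s + 4" 
        using length_bin_le[of "s + s" "Suc (length (bin s))"] less_two_power_length_bin[of s] by (simp add: wt_nat)
      then show "wt (s + s + (if d then a x else 0)) \<le> wt s + poly (20 + p) (wt x)"
        using wt_add[of "s + s" "if d then a x else 0"] p[of x] by (auto simp: wt_nat)
    qed
  qed (intro polyf_intros assms 1)+
  then show ?thesis by (rule polyf_cong) (simp add: foldl_horner mult_2[symmetric])
qed

lemma polyf_sum_list [polyf_intros]:
  fixes xs :: "'a::treeable \<Rightarrow> nat list"
  assumes "polyf xs"
  shows "polyf (\<lambda>x. sum_list (xs x))"
proof -
  obtain q where q: "\<And>x e. e \<in> set (xs x) \<Longrightarrow> wt e \<le> poly q (wt x)"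
    using polyf_elem_size[of "\<lambda>x e. e", OF _ assms] polyf_snd polyf_id by blast
  have "polyf (\<lambda>x. foldl (+) 0 (xs x))"
  proof (rule polyf_foldl)
    show "additive (\<lambda>_. (+)) xs"
    proof (rule additiveI[where q = "3 + q"])
      fix x and s e :: nat assume "e \<in> set (xs x)"
      then show "wt (s + e) \<le> wt s + poly (3 + q) (wt x)" using q[of e x] wt_add[of s e] by simp
    qed
  qed (intro polyf_intros assms)+
  moreover have "foldl (+) c ys = c + sum_list ys" for c and ys :: "nat list"
    by (induction ys arbitrary: c) auto
  ultimately show ?thesis by simp
qed

lemma polyf_prod_list [polyf_intros]:
  fixes xs :: "'a::treeable \<Rightarrow> nat list"
  assumes "polyf xs"
  shows "polyf (\<lambda>x. prod_list (xs x))"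
proof -
  obtain q where q: "\<And>x e. e \<in> set (xs x) \<Longrightarrow> wt e \<le> poly q (wt x)"
    using polyf_elem_size[of "\<lambda>x e. e", OF _ assms] polyf_snd polyf_id by blast
  have "polyf (\<lambda>x. foldl (*) 1 (xs x))"
  proof (rule polyf_foldl)
    show "additive (\<lambda>_. (*)) xs"
    proof (rule additiveI[where q = "q"])
      fix x and s e :: nat assume "e \<in> set (xs x)"
      then show "wt (s * e) \<le> wt s + poly q (wt x)" using q[of e x] wt_mult[of s e] by simp
    qed
  qed (intro polyf_intros assms)+
  moreover have "foldl (*) c ys = c * prod_list ys" for c and ys :: "nat list"
    by (induction ys arbitrary: c) auto
  ultimately show ?thesis by simp
qed

lemma polyf_remove1 [polyf_intros]:
  fixes xs :: "'a::treeable \<Rightarrow> nat list"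
  assumes d: "polyf d" and xs: "polyf xs"
  shows "polyf (\<lambda>x. remove1 (d x) (xs x))"
proof -
  have 1: "polyf (\<lambda>t. d (fst t))" by (rule polyf_comp[OF d]) (intro polyf_intros)
  obtain q where q: "\<And>x e. e \<in> set (xs x) \<Longrightarrow> wt e \<le> poly q (wt x)"
    using polyf_elem_size[of "\<lambda>x e. e", OF _ xs] polyf_snd polyf_id by blast
  let ?step = "\<lambda>x s e. if \<not> fst s \<and> e = d x then (True, snd s) else (fst s, e # snd s)"
  have "polyf (\<lambda>x. foldl (?step x) (False, []) (xs x))"
  proof (rule polyf_foldl)
    show "additive ?step xs"
    proof (rule additiveI[where q = "1 + q"])
      fix x and s :: "bool \<times> nat list" and e assume "e \<in> set (xs x)"
      then show "wt (?step x s e) \<le> wt s + poly (1 + q) (wt x)" using q[of e x] by (cases s) auto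
    qed
  qed (intro polyf_intros xs 1)+
  then have "polyf (\<lambda>x. rev (snd (foldl (?step x) (False, []) (xs x))))" by (intro polyf_intros)
  moreover have "snd (foldl (?step x) (f, acc) ys) = rev (if f then ys else remove1 (d x) ys) @ acc" for x f acc ys
    by (induction ys arbitrary: f acc) auto
  ultimately show ?thesis by simp
qed

text \<open>Recursion over the tree of the constant composes a fixed number of projections and
  tests. Injectivity of \<open>tr\<close> turns equality of trees into equality of values.\<close>

lemma polyf_eq_const [polyf_intros]:
  fixes c :: "'b::treeable"
  assumes "polyf f"
  shows "polyf (\<lambda>x. f x = c)"
proof -
  have t: "\<exists>E. TP UNIV E \<and> (\<forall>T. E T = (if T = C then N L L else L))" for C
  proof (induction C)
    case L
    have "TP UNIV (\<lambda>T. if T = L then N L L else L)" by (intro TP_if TP_id TP_const)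
    then show ?case by blast
  next
    case (N a b)
    then obtain A B where A: "TP UNIV A" "\<forall>T. A T = (if T = a then N L L else L)"
      and B: "TP UNIV B" "\<forall>T. B T = (if T = b then N L L else L)" by blast
    have "TP UNIV (\<lambda>T. if T = L then L else if A (left T) = L then L else B (right T))"
      by (intro TP_if TP_id TP_const TP_comp[OF TP_left A(1)] TP_comp[OF TP_right B(1)]) auto
    moreover have "(if T = L then L else if A (left T) = L then L else B (right T)) =
      (if T = N a b then N L L else L)" for T
      by (cases T) (auto simp: A(2) B(2))
    ultimately show ?case by blast
  qed
  obtain E where E: "TP UNIV E" "\<forall>T. E T = (if T = tr c then N L L else L)" using t by blast
  obtain F where F: "TPF F f" using assms polyf_def by blast
  have "TP (range (tr :: 'a \<Rightarrow> tree)) (\<lambda>T. E (F T))"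
    by (rule TP_comp[OF _ E(1)]) (use F in \<open>auto simp: TPF_def\<close>)
  moreover have "E (F (tr x)) = tr (f x = c)" for x
    using F E(2) by (auto simp: TPF_def tr_bool_def dest: tr_inj)
  ultimately show ?thesis unfolding polyf_def TPF_def by blast
qed

section \<open>Reading and writing instances\<close>

text \<open>
  A parser returns what it has read, translated by \<open>\<rho>\<close>, together with the unread rest. The
  size of the result is linear in the number of symbols read, which keeps iterated parsers
  polynomial on arbitrary, possibly ill-formed, words.
\<close>

definition parser :: "('x \<Rightarrow> bool list) \<Rightarrow> ('x \<Rightarrow> 'r::treeable) \<Rightarrow> (bool list \<Rightarrow> 'r \<times> bool list) \<Rightarrow> bool" where
  "parser e \<rho> P \<longleftrightarrow> polyf P \<and>
     (\<exists>K. \<forall>w. length (snd (P w)) \<le> length w \<and> wt (fst (P w)) + K * length (snd (P w)) \<le> K * length w + K) \<and>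
     (\<forall>x r. P (e x @ r) = (\<rho> x, r))"

definition parsable :: "('x \<Rightarrow> bool list) \<Rightarrow> ('x \<Rightarrow> 'r::treeable) \<Rightarrow> bool" where
  "parsable e \<rho> \<longleftrightarrow> (\<exists>P. parser e \<rho> P)"

lemma parsable_bit: "parsable (\<lambda>b. [b]) (\<lambda>b. b)"
proof -
  let ?P = "\<lambda>w. case w of [] \<Rightarrow> (False, []) | b # r \<Rightarrow> (b, r)"
  have "parser (\<lambda>b. [b]) (\<lambda>b. b) ?P"
    unfolding parser_def
  proof (intro conjI exI[of _ 3] allI)
    show "polyf ?P" by (intro polyf_intros)
  qed (auto split: list.splits)
  then show ?thesis unfolding parsable_def by blast
qed

text \<open>Makes the unary number of variables a list whose elements have empty codes, so that the
  list parser reads it.\<close>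

lemma parsable_empty: "parsable (\<lambda>_. []) (\<lambda>_. False)"
proof -
  have "parser (\<lambda>_. []) (\<lambda>_. False) (\<lambda>w. (False, w))"
    unfolding parser_def
  proof (intro conjI exI[of _ 3] allI)
    show "polyf (\<lambda>w :: bool list. (False, w))" by (intro polyf_intros)
  qed auto
  then show ?thesis unfolding parsable_def by blast
qed

lemma parsable_append:
  assumes "parsable e1 \<rho>1" "parsable e2 \<rho>2"
  shows "parsable (\<lambda>x. e1 (f x) @ e2 (g x)) (\<lambda>x. (\<rho>1 (f x), \<rho>2 (g x)))"
proof -
  obtain P1 P2 where P: "parser e1 \<rho>1 P1" "parser e2 \<rho>2 P2" using assms unfolding parsable_def by blast
  obtain K1 K2 where
    1: "\<And>w. length (snd (P1 w)) \<le> length w" "\<And>w. wt (fst (P1 w)) + K1 * length (snd (P1 w)) \<le> K1 * length w + K1" and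
    2: "\<And>w. length (snd (P2 w)) \<le> length w" "\<And>w. wt (fst (P2 w)) + K2 * length (snd (P2 w)) \<le> K2 * length w + K2"
    using P unfolding parser_def by blast
  have p1: "polyf P1" and p2: "polyf P2" using P unfolding parser_def by blast+
  let ?P = "\<lambda>w. ((fst (P1 w), fst (P2 (snd (P1 w)))), snd (P2 (snd (P1 w))))"
  have "polyf (\<lambda>w. P2 (snd (P1 w)))" by (rule polyf_comp[OF p2 polyf_snd[OF p1]])
  then have "polyf ?P" by (intro polyf_intros p1)
  moreover have "length (snd (?P w)) \<le> length w \<and>
     wt (fst (?P w)) + (K1 + K2 + 1) * length (snd (?P w)) \<le> (K1 + K2 + 1) * length w + (K1 + K2 + 1)" for w
  proof -
    let ?v = "snd (P1 w)"
    have a: "K1 * length (snd (P2 ?v)) \<le> K1 * length ?v" "K2 * length ?v \<le> K2 * length w"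
      using 1(1)[of w] 2(1)[of ?v] by simp_all
    have "length (snd (P2 ?v)) \<le> length w" using 1(1)[of w] 2(1)[of ?v] by simp
    moreover have "wt (fst (P1 w)) + wt (fst (P2 ?v)) + (K1 * length (snd (P2 ?v)) + K2 * length (snd (P2 ?v)))
        \<le> K1 * length w + K2 * length w + (K1 + K2)"
      using 1(2)[of w] 2(2)[of ?v] a by linarith
    ultimately have "1 + wt (fst (P1 w)) + wt (fst (P2 ?v)) + (K1 * length (snd (P2 ?v)) + K2 * length (snd (P2 ?v)) + length (snd (P2 ?v)))
        \<le> K1 * length w + K2 * length w + length w + (K1 + K2 + 1)"
      by linarith
    then show ?thesis using \<open>length (snd (P2 ?v)) \<le> length w\<close>
      by (simp only: fst_conv snd_conv wt_Pair distrib_right mult_1 simp_thms)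
  qed
  moreover have "?P ((e1 (f x) @ e2 (g x)) @ r) = ((\<rho>1 (f x), \<rho>2 (g x)), r)" for x r
    using P unfolding parser_def by simp
  ultimately show ?thesis unfolding parsable_def parser_def by blast
qed

lemma parsable_map:
  assumes "parsable e \<rho>" "polyf h" "\<And>y. wt (h y) \<le> wt y"
  shows "parsable e (\<lambda>x. h (\<rho> x))"
proof -
  obtain P where P: "parser e \<rho> P" using assms unfolding parsable_def by blast
  obtain K where K: "\<And>w. length (snd (P w)) \<le> length w" "\<And>w. wt (fst (P w)) + K * length (snd (P w)) \<le> K * length w + K"
    using P unfolding parser_def by blast
  have p: "polyf P" using P unfolding parser_def by blast
  let ?P = "\<lambda>w. (h (fst (P w)), snd (P w))"
  have "polyf (\<lambda>w. h (fst (P w)))" by (rule polyf_comp[OF assms(2) polyf_fst[OF p]])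
  then have "polyf ?P" by (intro polyf_intros p)
  moreover have "length (snd (?P w)) \<le> length w \<and>
     wt (fst (?P w)) + K * length (snd (?P w)) \<le> K * length w + K" for w
    using K[of w] assms(3)[of "fst (P w)"] by simp
  moreover have "?P (e x @ r) = (h (\<rho> x), r)" for x r using P unfolding parser_def by simp
  ultimately show ?thesis unfolding parsable_def parser_def by blast
qed

lemma wt_rev: "wt (rev xs) = wt xs"
proof (induction xs)
  case (Cons a xs)
  then show ?case using wt_append[of "rev xs" "[a]"] by simp
qed simp

lemma foldl_funpow: "foldl (\<lambda>s _. f s) s u = (f ^^ length u) s"
  by (induction u arbitrary: s) (auto simp: funpow_swap1)

lemma parsable_list:
  fixes \<rho> :: "'x \<Rightarrow> 'r::treeable"
  assumes "parsable e \<rho>"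
  shows "parsable (enc_list e) (map \<rho>)"
proof -
  obtain P where P: "parser e \<rho> P" using assms unfolding parsable_def by blast
  obtain K where K: "\<And>w. length (snd (P w)) \<le> length w" "\<And>w. wt (fst (P w)) + K * length (snd (P w)) \<le> K * length w + K"
    using P unfolding parser_def by blast
  have p: "polyf P" and Pe: "\<And>x r. P (e x @ r) = (\<rho> x, r)" using P unfolding parser_def by blast+
  \<comment> \<open>The flag records that the end marker has been read. The word itself is the clock
    of the fold: a state that has finished or run out of input is idle.\<close>
  define step where "step s = (if snd (snd s) then s else case fst (snd s) of [] \<Rightarrow> s
     | b # r \<Rightarrow> if b then (fst (P r) # fst s, (snd (P r), False)) else (fst s, (r, True)))"
    for s :: "'r list \<times> bool list \<times> bool"
  have ps: "polyf step"
  proof -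
    have "polyf (\<lambda>t. P (snd (snd t)))" by (rule polyf_comp[OF p]) (intro polyf_intros)
    then show ?thesis unfolding step_def[abs_def] by (intro polyf_intros)
  qed
  \<comment> \<open>A potential that no step raises: the marker bit in front of an element pays for
    the list cell and for the additive constant of the element parser.\<close>
  let ?m = "\<lambda>s. wt (fst s) + (K + 1) * length (fst (snd s))"
  have m: "?m (step s) \<le> ?m s" for s
  proof -
    obtain acc w d where s: "s = (acc, w, d)" by (cases s) auto
    show ?thesis
    proof (cases w)
      case (Cons b r)
      show ?thesis using K[of r] by (simp add: s step_def Cons algebra_simps)
    qed (simp add: s step_def)
  qed
  have mk: "?m ((step ^^ k) s) \<le> ?m s" for k s
  proof (induction k)
    case (Suc k)
    then show ?case using m[of "(step ^^ k) s"] by simp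
  qed simp
  define PL where "PL w = (let s = foldl (\<lambda>s _. step s) ([], (w, False)) w in (rev (fst s), fst (snd s)))"
    for w :: "bool list"
  have m0: "?m ((step ^^ k) ([], (w, False))) \<le> (K + 1) * length w + 1" for k w
    using mk[of k "([], (w, False))"] by simp
  have "polyf (\<lambda>w. foldl (\<lambda>s _. step s) ([], (w, False)) w)"
  proof (rule polyf_foldl_gen[where q = "[:50, 4 * (K + 1) + 50:]"])
    have "polyf (\<lambda>t. step (fst (snd t)))" by (rule polyf_comp[OF ps]) (intro polyf_intros)
    then show "polyf (\<lambda>t :: bool list \<times> ('r list \<times> bool list \<times> bool) \<times> bool. step (fst (snd t)))" .
    fix w :: "bool list" and k
    let ?s = "(step ^^ length (take k w)) ([], (w, False))"
    define X where X: "X = (K + 1) * length w + 1"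
    have "length (fst (snd ?s)) * 1 \<le> (K + 1) * length (fst (snd ?s))" by simp
    then have h: "length (fst (snd ?s)) \<le> (K + 1) * length w + 1" "wt (fst ?s) \<le> (K + 1) * length w + 1"
      using m0[of "length (take k w)" w] by linarith+
    have "wt ?s = 2 + wt (fst ?s) + (4 * length (fst (snd ?s)) + 1) + 3"
      by (simp add: wt_prod_def wt_word)
    then have "wt ?s \<le> 5 * X + 6" using h[folded X] by linarith
    then have "wt ?s \<le> 5 * ((K + 1) * length w + 1) + 6" by (simp add: X)
    also have "\<dots> \<le> poly [:50, 4 * (K + 1) + 50:] (wt w)" by (simp add: wt_word algebra_simps)
    finally show "wt (foldl (\<lambda>s _. step s) ([], w, False) (take k w)) \<le> poly [:50, 4 * (K + 1) + 50:] (wt w)"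
      unfolding foldl_funpow .
  qed (intro polyf_intros)+
  then have "polyf PL" unfolding PL_def[abs_def] Let_def by (intro polyf_intros)
  moreover have "length (snd (PL w)) \<le> length w \<and>
     wt (fst (PL w)) + (K + 1) * length (snd (PL w)) \<le> (K + 1) * length w + (K + 1)" for w
  proof -
    have len: "length (fst (snd (step s))) \<le> length (fst (snd s))" for s
    proof -
      obtain acc v d where s: "s = (acc, v, d)" by (cases s) auto
      show ?thesis using K(1) by (cases v) (auto simp: s step_def le_SucI)
    qed
    have "length (fst (snd ((step ^^ k) s))) \<le> length (fst (snd s))" for k s
    proof (induction k)
      case (Suc k)
      then show ?case using len[of "(step ^^ k) s"] by simp
    qed simp
    from this[of "length w" "([], (w, False))"] show ?thesis
      using m0[of "length w" w] by (simp add: PL_def Let_def wt_rev foldl_funpow)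
  qed
  moreover have "PL (enc_list e xs @ r) = (map \<rho> xs, r)" for xs r
  proof -
    have fin: "(step ^^ k) (acc, (v, True)) = (acc, (v, True))" for k acc v
      by (induction k) (auto simp: step_def)
    have "(step ^^ (Suc (length ys) + k)) (acc, (enc_list e ys @ r, False)) = (rev (map \<rho> ys) @ acc, (r, True))"
      for ys k acc
    proof (induction ys arbitrary: acc)
      case Nil
      have "step (acc, (enc_list e [] @ r, False)) = (acc, (r, True))"
        by (simp add: step_def enc_list_def)
      then show ?case by (simp add: funpow_Suc_right fin del: funpow.simps)
    next
      case (Cons y ys)
      have "step (acc, (enc_list e (y # ys) @ r, False)) = (\<rho> y # acc, (enc_list e ys @ r, False))"
        by (simp add: step_def enc_list_def Pe)
      then show ?case using Cons[of "\<rho> y # acc"] by (simp add: funpow_Suc_right del: funpow.simps)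
    qed
    note steps = this
    have "Suc (length xs) \<le> length (enc_list e xs @ r)" unfolding enc_list_def
      by (induction xs) auto
    then obtain k where k: "length (enc_list e xs @ r) = Suc (length xs) + k"
      using nat_le_iff_add by blast
    show ?thesis unfolding PL_def Let_def foldl_funpow k steps by simp
  qed
  ultimately show ?thesis unfolding parsable_def parser_def by blast
qed

lemma wt_val: "wt (val l) \<le> wt l"
proof -
  have "length (trim l) \<le> length l" by (induction l) (auto simp: trim_Cons, simp add: trim_def)
  then show ?thesis by (simp add: wt_nat_def bin_val wt_word)
qed

lemma parsable_nat: "parsable enc_nat (\<lambda>n. n)"
proof -
  have "parsable (enc_list (\<lambda>b. [b])) (\<lambda>l. val (map (\<lambda>b. b) l))"
    by (rule parsable_map[OF parsable_list[OF parsable_bit]]) (auto intro: polyf_intros simp: wt_val)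
  then show ?thesis unfolding parsable_def parser_def enc_nat_def by (metis list.map_ident val_bin)
qed

definition rho_rat :: "rat \<Rightarrow> bool \<times> nat \<times> nat" where
  "rho_rat r = (fst (quotient_of r) < 0, (nat \<bar>fst (quotient_of r)\<bar>, nat (snd (quotient_of r))))"

lemma parsable_rat: "parsable enc_rat rho_rat"
proof -
  have "parsable (\<lambda>r. (\<lambda>b. [b]) (fst (quotient_of r) < 0) @ (\<lambda>r. enc_nat (nat \<bar>fst (quotient_of r)\<bar>) @ enc_nat (nat (snd (quotient_of r)))) r)
    (\<lambda>r. (fst (quotient_of r) < 0, (\<lambda>r. (nat \<bar>fst (quotient_of r)\<bar>, nat (snd (quotient_of r)))) r))"
    by (intro parsable_append parsable_bit parsable_nat
        parsable_append[OF parsable_bit parsable_append[OF parsable_nat parsable_nat, of "\<lambda>r. nat \<bar>fst (quotient_of r)\<bar>" "\<lambda>r. nat (snd (quotient_of r))"]])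
  then show ?thesis
    by (simp add: rho_rat_def[abs_def] enc_rat_def[abs_def] case_prod_beta)
qed

definition rho_fun :: "cost_fun \<Rightarrow> nat \<times> (bool \<times> nat \<times> nat) list" where
  "rho_fun f = (fst f, map rho_rat (map (snd f) (List.n_lists (fst f) [False, True])))"

lemma parsable_fun: "parsable enc_cost_fun rho_fun"
  using parsable_append[OF parsable_nat parsable_list[OF parsable_rat], of fst
      "\<lambda>f. map (snd f) (List.n_lists (fst f) [False, True])"]
  by (simp add: rho_fun_def[abs_def] enc_cost_fun_def[abs_def])

definition rho_con :: "rat \<times> cost_fun \<times> nat list \<Rightarrow> (bool \<times> nat \<times> nat) \<times> (nat \<times> (bool \<times> nat \<times> nat) list) \<times> nat list" where
  "rho_con c = (rho_rat (fst c), (rho_fun (fst (snd c)), snd (snd c)))"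

lemma parsable_con: "parsable enc_constraint rho_con"
proof -
  have "parsable (\<lambda>c. enc_rat (fst c) @ (\<lambda>p. enc_cost_fun (fst p) @ enc_list enc_nat (snd p)) (snd c))
    (\<lambda>c. (rho_rat (fst c), (\<lambda>p. (rho_fun (fst p), map (\<lambda>n. n) (snd p))) (snd c)))"
    by (rule parsable_append[OF parsable_rat parsable_append[OF parsable_fun parsable_list[OF parsable_nat]]])
  moreover have "enc_constraint = (\<lambda>c. enc_rat (fst c) @ enc_cost_fun (fst (snd c)) @ enc_list enc_nat (snd (snd c)))"
    by (auto simp: enc_constraint_def fun_eq_iff)
  ultimately show ?thesis by (simp add: rho_con_def[abs_def])
qed

type_synonym pinst = "bool list \<times> ((bool \<times> nat \<times> nat) \<times> (nat \<times> (bool \<times> nat \<times> nat) list) \<times> nat list) list \<times> (bool \<times> nat \<times> nat)"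

definition rho_inst :: "vcsp_instance \<Rightarrow> pinst" where
  "rho_inst I = (map (\<lambda>_. False) [0..<nvars I], (map rho_con (constraints I), rho_rat (bound I)))"

lemma parsable_instance: "parsable enc_instance rho_inst"
proof -
  have "parsable (\<lambda>I. enc_list (\<lambda>_. []) [0..<nvars I] @ (\<lambda>I. enc_list enc_constraint (constraints I) @ enc_rat (bound I)) I)
    (\<lambda>I. (map (\<lambda>_. False) [0..<nvars I], (\<lambda>I. (map rho_con (constraints I), rho_rat (bound I))) I))"
    by (rule parsable_append[OF parsable_list[OF parsable_empty], where g = "\<lambda>I. I"])
      (rule parsable_append[OF parsable_list[OF parsable_con] parsable_rat])
  moreover have "enc_list (\<lambda>_. []) [0..<n] = replicate n True @ [False]" for n
    by (induction n) (auto simp: enc_list_def replicate_append_same)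
  ultimately show ?thesis by (simp add: rho_inst_def[abs_def] enc_instance_def[abs_def])
qed

lemma parsable_function:
  assumes "parsable e \<rho>"
  obtains P where "polyf P" "\<And>x. P (e x) = \<rho> x"
proof -
  obtain P where P: "parser e \<rho> P" using assms unfolding parsable_def by blast
  have "polyf (\<lambda>w. fst (P w))" using P unfolding parser_def by (intro polyf_fst) blast
  moreover have "fst (P (e x)) = \<rho> x" for x
    using P unfolding parser_def by (metis append_Nil2 fst_conv)
  ultimately show ?thesis using that by blast
qed

lemma polyf_enc_list [polyf_intros]:
  assumes "polyf (\<lambda>p. e (fst p) (snd p))" "polyf xs"
  shows "polyf (\<lambda>x. enc_list (e x) (xs x))"
  unfolding enc_list_def by (intro polyf_intros assms)

lemma polyf_enc_nat [polyf_intros]: "polyf f \<Longrightarrow> polyf (\<lambda>x. enc_nat (f x))"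
  unfolding enc_nat_def by (intro polyf_intros)

lemma enc_rat_of_nat: "enc_rat (of_nat n) = False # enc_nat n @ enc_nat 1"
  using quotient_of_int[of "int n"] by (simp add: enc_rat_def)

section \<open>Minimising a submodular function with identified arguments\<close>

text \<open>The elements of \<open>U\<close> are argument positions and \<pi> sends each to its
  variable; \<open>F\<close> knows nothing of the identification.\<close>

locale submodular =
  fixes U :: "'e set" and F :: "'e set \<Rightarrow> int" and \<pi> :: "'e \<Rightarrow> 'v"
  assumes fin: "finite U" and F_empty: "F {} = 0"
    and sub: "A \<subseteq> U \<Longrightarrow> B \<subseteq> U \<Longrightarrow> F (A \<union> B) + F (A \<inter> B) \<le> F A + F B"
begin

text \<open>The integer points of the base polytope of \<open>F\<close>.\<close>

definition base :: "('e \<Rightarrow> int) \<Rightarrow> bool" where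
  "base y \<longleftrightarrow> (\<forall>A\<subseteq>U. sum y A \<le> F A) \<and> sum y U = F U"

definition ex :: "('e \<Rightarrow> int) \<Rightarrow> 'v \<Rightarrow> int" where
  "ex y v = sum y {e \<in> U. \<pi> e = v}"

definition Vs :: "'v set" where "Vs = \<pi> ` U"

definition pre :: "'v set \<Rightarrow> 'e set" where "pre S = {e \<in> U. \<pi> e \<in> S}"

text \<open>The dual objective in Edmonds' min-max formula for the minimum of a submodular
  function.\<close>

definition xm :: "('e \<Rightarrow> int) \<Rightarrow> int" where
  "xm y = (\<Sum>v\<in>Vs. min (ex y v) 0)"

text \<open>\<open>exch y s t\<close>: a unit may be moved from \<open>s\<close> to \<open>t\<close> without leaving the base polytope.\<close>

definition exch :: "('e \<Rightarrow> int) \<Rightarrow> 'e \<Rightarrow> 'e \<Rightarrow> bool" where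
  "exch y s t \<longleftrightarrow> (\<forall>A\<subseteq>U. t \<in> A \<and> s \<notin> A \<longrightarrow> sum y A < F A)"

definition move :: "('e \<Rightarrow> int) \<Rightarrow> 'e \<Rightarrow> 'e \<Rightarrow> 'e \<Rightarrow> int" where
  "move y s t = (\<lambda>e. y e + of_bool (e = t) - of_bool (e = s))"

lemma finVs: "finite Vs" using fin by (simp add: Vs_def)

lemma pre_sub: "pre S \<subseteq> U" by (auto simp: pre_def)

lemma sum_pre: "sum y (pre S) = (\<Sum>v\<in>Vs \<inter> S. ex y v)"
proof -
  have "sum y (pre S) = (\<Sum>v\<in>Vs \<inter> S. sum y {e \<in> pre S. \<pi> e = v})"
    using fin finVs by (intro sum.group[symmetric]) (auto simp: pre_def Vs_def)
  also have "\<dots> = (\<Sum>v\<in>Vs \<inter> S. ex y v)"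
    unfolding ex_def by (intro sum.cong refl arg_cong2[where f = sum]) (auto simp: pre_def)
  finally show ?thesis .
qed

text \<open>Weak duality: dropping the minimum inside \<open>S\<close> and the nonpositive terms
  outside only raises the sum, which then is the value of \<open>y\<close> on
  \<open>pre S\<close>.\<close>

lemma xm_le: "base y \<Longrightarrow> xm y \<le> F (pre S)"
proof -
  assume b: "base y"
  have "xm y = (\<Sum>v\<in>Vs \<inter> S. min (ex y v) 0) + (\<Sum>v\<in>Vs - S. min (ex y v) 0)"
    unfolding xm_def using finVs by (simp add: sum.Int_Diff[of Vs _ S])
  also have "\<dots> \<le> (\<Sum>v\<in>Vs \<inter> S. ex y v) + 0"
    by (intro add_mono sum_mono sum_nonpos) auto
  also have "\<dots> \<le> F (pre S)" using b pre_sub[of S] by (simp add: sum_pre[symmetric] base_def)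
  finally show ?thesis .
qed

text \<open>Uncrossing: the slacks of union and intersection are nonnegative and together at most
  the sum of the two given slacks, which is 0.\<close>

lemma tight_Un_Int:
  assumes "base y" "A \<subseteq> U" "B \<subseteq> U" "sum y A = F A" "sum y B = F B"
  shows "sum y (A \<union> B) = F (A \<union> B)" "sum y (A \<inter> B) = F (A \<inter> B)"
proof -
  have f: "finite A" "finite B" using assms fin finite_subset by blast+
  have "sum y (A \<union> B) + sum y (A \<inter> B) = sum y A + sum y B" by (rule sum.union_inter[OF f])
  moreover have "sum y (A \<union> B) \<le> F (A \<union> B)" "sum y (A \<inter> B) \<le> F (A \<inter> B)"
    using assms unfolding base_def by (simp_all add: le_infI1)
  ultimately show "sum y (A \<union> B) = F (A \<union> B)" "sum y (A \<inter> B) = F (A \<inter> B)"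
    using sub[OF assms(2,3)] assms(4,5) by linarith+
qed

text \<open>Strong duality. For \<open>s\<close> outside and \<open>t\<close> inside
  \<open>pre R\<close> the missing arc yields a tight set that contains \<open>t\<close> but not
  \<open>s\<close>. Intersecting over \<open>s\<close> and then uniting over \<open>t\<close> shows
  that \<open>pre R\<close> is tight, and the sign conditions turn its \<open>y\<close>-value into
  \<open>xm y\<close>.\<close>

lemma closed_optimal:
  assumes b: "base y"
    and cl: "\<And>s t. s \<in> U \<Longrightarrow> t \<in> U \<Longrightarrow> exch y s t \<Longrightarrow> \<pi> t \<in> R \<Longrightarrow> \<pi> s \<in> R"
    and neg: "\<And>v. v \<in> Vs \<Longrightarrow> ex y v < 0 \<Longrightarrow> v \<in> R" and pos: "\<And>v. v \<in> Vs \<Longrightarrow> v \<in> R \<Longrightarrow> ex y v \<le> 0"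
  shows "F (pre R) = xm y"
proof -
  let ?T = "pre R"
  define tight where "tight A \<longleftrightarrow> A \<subseteq> U \<and> sum y A = F A" for A
  have U: "tight U" using b by (simp add: tight_def base_def)
  have 1: "\<exists>B. tight B \<and> t \<in> B \<and> B \<inter> S = {}" if "finite S" "S \<subseteq> U - ?T" and t: "t \<in> ?T" for S t
    using that(1,2)
  proof (induction S)
    case empty
    then show ?case using U t by (auto simp: pre_def)
  next
    case (insert s S)
    then obtain B where B: "tight B" "t \<in> B" "B \<inter> S = {}" by auto
    have "\<not> exch y s t" using cl[of s t] insert.prems t by (auto simp: pre_def)
    then obtain A where A: "A \<subseteq> U" "t \<in> A" "s \<notin> A" "\<not> sum y A < F A" unfolding exch_def by blast
    have "sum y A \<le> F A" using b A(1) by (simp add: base_def)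
    then have "tight A" using A(1,4) by (simp add: tight_def)
    then have "tight (A \<inter> B)" using B tight_Un_Int(2)[OF b, of A B] by (auto simp: tight_def)
    then show ?case using A B by (intro exI[of _ "A \<inter> B"]) auto
  qed
  have 2: "\<exists>C. tight C \<and> S \<subseteq> C \<and> C \<subseteq> ?T" if "finite S" "S \<subseteq> ?T" for S
    using that
  proof (induction S)
    case empty
    then show ?case by (intro exI[of _ "{}"]) (simp add: tight_def F_empty)
  next
    case (insert t S)
    then obtain C where C: "tight C" "S \<subseteq> C" "C \<subseteq> ?T" by auto
    obtain B where B: "tight B" "t \<in> B" "B \<inter> (U - ?T) = {}" using 1[of "U - ?T" t] fin insert.prems by auto
    have "tight (B \<union> C)" using B C tight_Un_Int(1)[OF b, of B C] by (auto simp: tight_def)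
    then show ?case using B C by (intro exI[of _ "B \<union> C"]) (auto simp: tight_def)
  qed
  obtain C where "tight C" "?T \<subseteq> C" "C \<subseteq> ?T" using 2[of ?T] fin finite_subset[OF pre_sub] by blast
  then have "F ?T = sum y ?T" by (auto simp: tight_def)
  also have "\<dots> = (\<Sum>v\<in>Vs \<inter> R. ex y v)" by (rule sum_pre)
  also have "\<dots> = (\<Sum>v\<in>Vs. if v \<in> R then ex y v else 0)" using finVs by (simp add: sum.inter_restrict)
  also have "\<dots> = xm y" unfolding xm_def by (intro sum.cong refl) (use neg pos in \<open>force simp: min_def\<close>)
  finally show ?thesis .
qed

section \<open>Exchange moves and shortest exchange paths\<close>

lemma sum_move:
  assumes "A \<subseteq> U"
  shows "sum (move y s t) A = sum y A + of_bool (t \<in> A) - of_bool (s \<in> A)"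
proof -
  have f: "finite A" using assms fin finite_subset by blast
  have "(\<Sum>e\<in>A. of_bool (e = r) :: int) = of_bool (r \<in> A)" for r
    using f by (simp add: of_bool_def sum.delta)
  then show ?thesis by (simp add: move_def sum.distrib sum_subtractf)
qed

lemma base_move:
  assumes b: "base y" and e: "exch y s t" and st: "s \<in> U" "t \<in> U"
  shows "base (move y s t)"
  unfolding base_def
proof (intro conjI allI impI)
  fix A assume A: "A \<subseteq> U"
  have "sum y A \<le> F A" using b A by (simp add: base_def)
  moreover have "sum y A < F A" if "t \<in> A" "s \<notin> A" using e A that by (simp add: exch_def)
  ultimately show "sum (move y s t) A \<le> F A" by (auto simp: sum_move[OF A])
next
  show "sum (move y s t) U = F U" using b st by (simp add: sum_move base_def)
qed

text \<open>If the move made a set A tight that contains \<open>c\<close> but not \<open>a\<close>,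
  then A contained \<open>v\<close>, not \<open>u\<close>, and had slack 1. A tight set B separates
  \<open>c\<close> from \<open>u\<close>. The two given arcs force slack at least 1 on both the
  intersection and the union of A and B, but submodularity leaves only 1 for the two
  together.\<close>

lemma exch_persists:
  assumes b: "base y" and uv: "exch y u v" and ab: "exch y a c" and n: "\<not> exch y u c"
  shows "exch (move y u v) a c"
  unfolding exch_def
proof (intro allI impI)
  fix A assume A: "A \<subseteq> U" and ca: "c \<in> A \<and> a \<notin> A"
  obtain B where B: "B \<subseteq> U" "c \<in> B" "u \<notin> B" "sum y B = F B"
    using n b unfolding exch_def base_def by (metis linorder_not_less order_antisym)
  have sA: "sum y A < F A" using ab A ca by (auto simp: exch_def)
  show "sum (move y u v) A < F A"
  proof (rule ccontr)
    assume "\<not> ?thesis"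
    then have vu: "v \<in> A" "u \<notin> A" "sum y A + 1 = F A"
      using sA by (auto simp: sum_move[OF A] of_bool_def split: if_splits)
    have f: "finite A" "finite B" using A B fin finite_subset by blast+
    have "sum y (A \<inter> B) < F (A \<inter> B)" using ab A B ca by (auto simp: exch_def le_infI1)
    moreover have "sum y (A \<union> B) < F (A \<union> B)" using uv A B vu by (auto simp: exch_def)
    moreover have "sum y (A \<union> B) + sum y (A \<inter> B) = sum y A + sum y B" by (rule sum.union_inter[OF f])
    ultimately show False using sub[OF A B(1)] vu B(4) by linarith
  qed
qed

text \<open>Breadth-first search against the arcs: the vertices that reach a negative vertex along
  at most \<open>k\<close> arcs.\<close>

primrec lev :: "('e \<Rightarrow> int) \<Rightarrow> nat \<Rightarrow> 'v set" where
  "lev y 0 = {v \<in> Vs. ex y v < 0}"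
| "lev y (Suc k) = {v \<in> Vs. v \<in> lev y k \<or> (\<exists>s\<in>U. \<exists>t\<in>U. \<pi> s = v \<and> \<pi> t \<in> lev y k \<and> exch y s t)}"

definition hit :: "('e \<Rightarrow> int) \<Rightarrow> nat \<Rightarrow> 'e \<Rightarrow> 'e \<Rightarrow> bool" where
  "hit y k s t \<longleftrightarrow> s \<in> U \<and> t \<in> U \<and> 0 < ex y (\<pi> s) \<and> \<pi> t \<in> lev y k \<and> exch y s t"

definition hits :: "('e \<Rightarrow> int) \<Rightarrow> nat \<Rightarrow> bool" where
  "hits y k \<longleftrightarrow> (\<exists>s t. hit y k s t)"

lemma lev_sub: "lev y k \<subseteq> Vs"
  by (cases k) auto

lemma lev_Suc: "lev y k \<subseteq> lev y (Suc k)"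
  using lev_sub[of y k] by auto

text \<open>Once two consecutive levels agree the sequence is constant, so a change after
  \<open>n\<close> needs \<open>n + 1\<close> strict inclusions inside \<open>Vs\<close>.\<close>

lemma lev_stable: "card Vs \<le> n \<Longrightarrow> lev y (Suc n) = lev y n"
proof (rule ccontr)
  assume n: "card Vs \<le> n" and ne: "lev y (Suc n) \<noteq> lev y n"
  have eq: "lev y (Suc (Suc k)) = lev y (Suc k)" if "lev y (Suc k) = lev y k" for k
    using that by auto
  have ne: "lev y (Suc (n - k)) \<noteq> lev y (n - k)" if "k \<le> n" for k
    using that
  proof (induction k)
    case (Suc k)
    have "Suc (n - Suc k) = n - k" using Suc.prems by simp
    then show ?case using Suc eq[of "n - Suc k"] by (metis Suc_leD)
  qed (simp add: ne del: lev.simps)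
  have "k \<le> card (lev y k)" if "k \<le> Suc n" for k
    using that
  proof (induction k)
    case (Suc k)
    have "lev y k \<subset> lev y (Suc k)" using lev_Suc[of y k] ne[of "n - k"] Suc.prems by auto
    then have "card (lev y k) < card (lev y (Suc k))"
      using finite_subset[OF lev_sub finVs] by (intro psubset_card_mono)
    then show ?case using Suc by simp
  qed simp
  from this[of "Suc n"] have "Suc n \<le> card (lev y (Suc n))" by simp
  also have "\<dots> \<le> card Vs" by (rule card_mono[OF finVs lev_sub])
  finally show False using n by simp
qed

lemma lev_stable_le: "card Vs \<le> n \<Longrightarrow> lev y n = lev y (card Vs)"
proof (induction n rule: dec_induct)
  case (step n)
  then show ?case using lev_stable[of n y] by simp
qed simp

lemma hits_le: "hits y k \<Longrightarrow> \<exists>j\<le>card Vs. hits y j"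
  using lev_stable_le[of k y] by (cases "k \<le> card Vs") (auto simp: hits_def hit_def)

lemma no_hits_nonpos:
  assumes "\<And>j. j < k \<Longrightarrow> \<not> hits y j" "v \<in> lev y k"
  shows "ex y v \<le> 0"
  using assms
proof (induction k)
  case (Suc k)
  show ?case
  proof (cases "v \<in> lev y k")
    case False
    then obtain s t where "s \<in> U" "t \<in> U" "\<pi> s = v" "\<pi> t \<in> lev y k" "exch y s t" using Suc.prems by auto
    then show ?thesis using Suc.prems(1)[of k] by (force simp: hits_def hit_def)
  qed (use Suc in auto)
qed simp

lemma no_hits_optimal:
  assumes b: "base y" and h: "\<And>j. j \<le> card Vs \<Longrightarrow> \<not> hits y j" and n: "card Vs \<le> n"
  shows "F (pre (lev y n)) = xm y"
proof (rule closed_optimal[OF b])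
  have h': "\<not> hits y j" for j using hits_le[of y j] h by blast
  show "\<And>s t. s \<in> U \<Longrightarrow> t \<in> U \<Longrightarrow> exch y s t \<Longrightarrow> \<pi> t \<in> lev y n \<Longrightarrow> \<pi> s \<in> lev y n"
    using lev_stable[OF n, of y] by (auto simp: Vs_def)
  have "lev y 0 \<subseteq> lev y n" by (rule lift_Suc_mono_le[of "lev y"]) (use lev_Suc in auto)
  then show "\<And>v. v \<in> Vs \<Longrightarrow> ex y v < 0 \<Longrightarrow> v \<in> lev y n" by auto
  show "\<And>v. v \<in> Vs \<Longrightarrow> v \<in> lev y n \<Longrightarrow> ex y v \<le> 0" using no_hits_nonpos h' by blast
qed

lemma ex_move:
  assumes "s \<in> U" "t \<in> U"
  shows "ex (move y s t) v = ex y v + of_bool (v = \<pi> t) - of_bool (v = \<pi> s)"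
  unfolding ex_def using assms by (subst sum_move) (auto simp: of_bool_def)

text \<open>A unit travels along a shortest path, one arc per move. If the target is negative, the
  unit is absorbed and \<open>xm\<close> rises. Otherwise the target had excess 0, becomes positive,
  and has an arc to the next lower level; this arc survives the move because a shorter way from
  \<open>s\<close> would contradict the choice of \<open>k\<close>.\<close>

lemma progress:
  assumes b: "base y" and st: "hit y k s t" and mn: "\<And>j. j < k \<Longrightarrow> \<not> hits y j"
  shows "base (move y s t)" and "k = 0 \<Longrightarrow> xm (move y s t) = xm y + 1"
    and "k > 0 \<Longrightarrow> xm (move y s t) = xm y \<and> hits (move y s t) (k - 1)"
proof -
  have U: "s \<in> U" "t \<in> U" and sp: "0 < ex y (\<pi> s)" and tl: "\<pi> t \<in> lev y k" and e: "exch y s t"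
    using st by (auto simp: hit_def)
  show "base (move y s t)" by (rule base_move[OF b e U])
  have tn: "ex y (\<pi> t) \<le> 0" using no_hits_nonpos[OF mn tl] .
  have ne: "\<pi> s \<noteq> \<pi> t" using sp tn by auto
  have Vst: "\<pi> s \<in> Vs" "\<pi> t \<in> Vs" using U by (auto simp: Vs_def)
  note ex = ex_move[OF U, of y]
  have xm: "xm (move y s t) = xm y + of_bool (ex y (\<pi> t) < 0)"
  proof -
    have "min (ex (move y s t) v) 0 = min (ex y v) 0 + of_bool (v = \<pi> t \<and> ex y v < 0)" for v
      using sp tn ne by (auto simp: ex of_bool_def min_def)
    then have "xm (move y s t) = xm y + (\<Sum>v\<in>Vs. of_bool (v = \<pi> t \<and> ex y v < 0))"
      by (simp add: xm_def sum.distrib)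
    also have "(\<Sum>v\<in>Vs. of_bool (v = \<pi> t \<and> ex y v < 0) :: int) = (\<Sum>v\<in>Vs. if v = \<pi> t then of_bool (ex y (\<pi> t) < 0) else 0)"
      by (intro sum.cong) auto
    also have "\<dots> = of_bool (ex y (\<pi> t) < 0)" using finVs Vst by (simp add: sum.delta)
    finally show ?thesis .
  qed
  show "k = 0 \<Longrightarrow> xm (move y s t) = xm y + 1" using tl xm by simp
  assume k: "k > 0"
  then obtain k' where k': "k = Suc k'" by (cases k) auto
  have nt: "\<pi> t \<notin> lev y k'" using mn[of k'] U sp e k' by (auto simp: hits_def hit_def)
  have "lev y 0 \<subseteq> lev y k'" by (rule lift_Suc_mono_le[of "lev y"]) (use lev_Suc in auto)
  then have "\<not> ex y (\<pi> t) < 0" using nt Vst by auto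
  \<comment> \<open>The target goes from 0 to 1 and the source was positive, so the set of negative
    vertices, which is level 0, does not change.\<close>
  then have t0: "ex y (\<pi> t) = 0" using tn by simp
  have l0: "lev (move y s t) 0 = lev y 0"
    using sp t0 ne by (auto simp: ex of_bool_def split: if_splits)
  \<comment> \<open>An arc from \<open>s\<close> to \<open>c\<close> would be a hit at level
    \<open>j\<close>, below the least level \<open>k\<close>.\<close>
  have persist: "exch (move y s t) a c" if "exch y a c" "c \<in> U" "\<pi> c \<in> lev y j" "j < k" for a c j
  proof (rule exch_persists[OF b e that(1)])
    show "\<not> exch y s c" using mn[OF that(4)] that(2,3) U sp by (auto simp: hits_def hit_def)
  qed
  have lv: "lev y j \<subseteq> lev (move y s t) j" if "j \<le> k" for j
    using that
  proof (induction j)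
    case (Suc j)
    then have ih: "lev y j \<subseteq> lev (move y s t) j" and j: "j < k" by auto
    show ?case
    proof
      fix v assume v: "v \<in> lev y (Suc j)"
      show "v \<in> lev (move y s t) (Suc j)"
      proof (cases "v \<in> lev y j")
        case True
        then show ?thesis using ih lev_Suc by blast
      next
        case False
        then obtain a c where "a \<in> U" "c \<in> U" "\<pi> a = v" "\<pi> c \<in> lev y j" "exch y a c" "v \<in> Vs"
          using v by auto
        then show ?thesis using ih persist[OF _ _ _ j, of a c] by auto
      qed
    qed
  qed (simp only: l0)
  obtain a c where ac: "a \<in> U" "c \<in> U" "\<pi> a = \<pi> t" "\<pi> c \<in> lev y k'" "exch y a c" using tl nt k' by auto
  have "exch (move y s t) a c" using persist[OF ac(5,2,4)] k' by simp
  moreover have "\<pi> c \<in> lev (move y s t) k'" using lv[of k'] ac(4) k' by auto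
  moreover have "0 < ex (move y s t) (\<pi> a)" using t0 ne ac(3) by (simp add: ex)
  ultimately have "hits (move y s t) k'" unfolding hits_def hit_def using ac(1,2) by blast
  then show "xm (move y s t) = xm y \<and> hits (move y s t) (k - 1)" using xm t0 k' by simp
qed

definition stuck :: "('e \<Rightarrow> int) \<Rightarrow> bool" where
  "stuck y \<longleftrightarrow> (\<forall>j\<le>card Vs. \<not> hits y j)"

definition augments :: "('e \<Rightarrow> int) \<Rightarrow> ('e \<Rightarrow> int) \<Rightarrow> bool" where
  "augments y y' \<longleftrightarrow> (if stuck y then y' = y
     else \<exists>k s t. hit y k s t \<and> (\<forall>j<k. \<not> hits y j) \<and> y' = move y s t)"

text \<open>The potential multiplies the duality gap to a fixed \<open>S\<close> by |Vs| + 1 and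
  adds the least hit level. A hit at level 0 closes one unit of the gap, which pays for any new
  level up to |Vs|; any other move lowers the level. Weak duality keeps the potential nonnegative,
  so at most g(|Vs| + 1) + |Vs| moves are made.\<close>

lemma augment_until_stuck:
  assumes f: "\<And>i. base (ys i) \<Longrightarrow> augments (ys i) (ys (Suc i))" and b: "base (ys 0)"
    and g: "F (pre S) - xm (ys 0) \<le> int g" and m: "g * (card Vs + 1) + card Vs < m"
  shows "base (ys m) \<and> stuck (ys m)"
proof -
  let ?n = "card Vs"
  define k where "k y = (LEAST j. hits y j)" for y
  define \<phi> where "\<phi> y = (F (pre S) - xm y) * (int ?n + 1) + int (k y)" for y
  have kle: "k y \<le> ?n" "hits y (k y)" "j < k y \<Longrightarrow> \<not> hits y j" if ns: "\<not> stuck y" for y j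
  proof -
    obtain i where i: "i \<le> ?n" "hits y i" using ns by (auto simp: stuck_def)
    show "hits y (k y)" unfolding k_def by (rule LeastI[of _ i]) (rule i)
    show "k y \<le> ?n" unfolding k_def using Least_le[of "hits y" i] i by linarith
    show "j < k y \<Longrightarrow> \<not> hits y j" unfolding k_def by (rule not_less_Least)
  qed
  have dec: "base y' \<and> (stuck y' \<or> \<phi> y' < \<phi> y)" if y: "base y" "\<not> stuck y" "augments y y'" for y y'
  proof -
    obtain k0 s t where h: "hit y k0 s t" "\<forall>j<k0. \<not> hits y j" "y' = move y s t"
      using y unfolding augments_def by metis
    have k0: "k0 = k y" unfolding k_def
      by (rule Least_equality[symmetric]) (use h in \<open>auto simp: hits_def not_less[symmetric]\<close>)
    have p: "base (move y s t)" "k0 = 0 \<Longrightarrow> xm (move y s t) = xm y + 1"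
      "k0 > 0 \<Longrightarrow> xm (move y s t) = xm y \<and> hits (move y s t) (k0 - 1)"
      using progress[OF y(1) h(1)] h(2) by blast+
    have "\<phi> y' < \<phi> y" if ns: "\<not> stuck y'"
    proof (cases "k0 = 0")
      case True
      then have "\<phi> y' = (F (pre S) - xm y) * (int ?n + 1) - (int ?n + 1) + int (k y')"
        using p(2) h(3) by (simp add: \<phi>_def algebra_simps)
      then show ?thesis using kle(1)[OF ns] by (simp add: \<phi>_def)
    next
      case False
      have "k y' \<le> k0 - 1" unfolding k_def by (rule Least_le) (use p(3) False h(3) in simp)
      then show ?thesis using p(3) False h(3) k0 by (simp add: \<phi>_def)
    qed
    then show ?thesis using p(1) h(3) by auto
  qed
  have it: "base (ys i) \<and> (stuck (ys i) \<or> \<phi> (ys i) + int i \<le> \<phi> (ys 0))" for i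
  proof (induction i)
    case (Suc i)
    let ?z = "ys i"
    show ?case
    proof (cases "stuck ?z")
      case True
      then have "ys (Suc i) = ?z" using f[of i] Suc by (auto simp: augments_def)
      then show ?thesis using Suc True by simp
    next
      case False
      then show ?thesis using dec[of ?z "ys (Suc i)"] f[of i] Suc by auto
    qed
  qed (use b in simp)
  show ?thesis
  proof (cases "stuck (ys m)")
    case False
    have "0 \<le> (F (pre S) - xm (ys m)) * (int ?n + 1)"
      using xm_le[of "ys m" S] it[of m] by simp
    then have "0 \<le> \<phi> (ys m)" by (simp add: \<phi>_def)
    then have "int m \<le> \<phi> (ys 0)" using it[of m] False by simp
    moreover have "\<phi> (ys 0) \<le> int g * (int ?n + 1) + int ?n"
    proof (cases "stuck (ys 0)")
      case True
      have "ys i = ys 0" for i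
      proof (induction i)
        case (Suc i)
        then show ?case using f[of i] b True by (auto simp: augments_def)
      qed simp
      then show ?thesis using False True by metis
    next
      case False
      then show ?thesis unfolding \<phi>_def using g kle(1)[OF False] by (intro add_mono mult_right_mono) auto
    qed
    moreover have "int (g * (?n + 1) + ?n) = int g * (int ?n + 1) + int ?n" by (simp add: algebra_simps)
    ultimately show ?thesis using m by linarith
  qed (use it in blast)
qed

end

section \<open>The minimisation algorithm on lists\<close>

text \<open>
  Integers are differences of two naturals. An item describes a weighted constraint: for every
  ordered pair of argument positions its two indicator words and the table of the values at the
  words that contain the second but not the first, then the value at the zero word, a base,
  the full table, the argument list and the weight.
\<close>

type_synonym exch_row = "bool list \<times> bool list \<times> (bool list \<times> nat) list"
type_synonym item = "(exch_row list \<times> nat \<times> (nat \<times> nat) list \<times> (bool list \<times> nat) list) \<times> nat list \<times> nat"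

abbreviation it_rows :: "item \<Rightarrow> exch_row list" where "it_rows t \<equiv> fst (fst t)"
abbreviation it_zero :: "item \<Rightarrow> nat" where "it_zero t \<equiv> fst (snd (fst t))"
abbreviation it_base :: "item \<Rightarrow> (nat \<times> nat) list" where "it_base t \<equiv> fst (snd (snd (fst t)))"
abbreviation it_tab :: "item \<Rightarrow> (bool list \<times> nat) list" where "it_tab t \<equiv> snd (snd (snd (fst t)))"
abbreviation it_args :: "item \<Rightarrow> nat list" where "it_args t \<equiv> fst (snd t)"
abbreviation it_wt :: "item \<Rightarrow> nat" where "it_wt t \<equiv> snd (snd t)"

definition dota :: "bool list \<Rightarrow> (nat \<times> nat) list \<Rightarrow> nat" where
  "dota A y = sum_list (map (\<lambda>z. if fst z then fst (snd z) else 0) (zip A y))"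

definition dotb :: "bool list \<Rightarrow> (nat \<times> nat) list \<Rightarrow> nat" where
  "dotb A y = sum_list (map (\<lambda>z. if fst z then snd (snd z) else 0) (zip A y))"

text \<open>The strict inequality between the value of \<open>y\<close> on a set and its bound
  there, rearranged so that naturals are never subtracted.\<close>

definition movable :: "nat \<Rightarrow> nat \<Rightarrow> (bool list \<times> nat) list \<Rightarrow> (nat \<times> nat) list \<Rightarrow> bool" where
  "movable w z As y = list_all (\<lambda>t. dota (fst t) y + 1 + w * z \<le> w * snd t + dotb (fst t) y) As"

definition exa :: "item list \<Rightarrow> (nat \<times> nat) list list \<Rightarrow> nat \<Rightarrow> nat" where
  "exa its Y v = sum_list (map (\<lambda>z. sum_list (map (\<lambda>u. if fst u = v then fst (snd u) else 0)
     (zip (it_args (fst z)) (snd z)))) (zip its Y))"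

definition exb :: "item list \<Rightarrow> (nat \<times> nat) list list \<Rightarrow> nat \<Rightarrow> nat" where
  "exb its Y v = sum_list (map (\<lambda>z. sum_list (map (\<lambda>u. if fst u = v then snd (snd u) else 0)
     (zip (it_args (fst z)) (snd z)))) (zip its Y))"

definition elem :: "nat \<Rightarrow> nat list \<Rightarrow> bool" where
  "elem v R = list_ex (\<lambda>u. u = v) R"

definition sel :: "bool list \<Rightarrow> nat list \<Rightarrow> nat list" where
  "sel m xs = map snd (filter fst (zip m xs))"

text \<open>\<open>D\<close> acts through its length, the number of low binary digits still left out
  of account.\<close>

definition scaled :: "bool list \<Rightarrow> item \<Rightarrow> nat" where
  "scaled D t = val (drop (length D) (bin (it_wt t)))"

definition cands :: "item list \<Rightarrow> bool list \<Rightarrow> (nat \<times> nat) list list \<Rightarrow> nat list \<Rightarrow> item \<Rightarrow> (nat \<times> nat) list \<Rightarrow> exch_row list" where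
  "cands its D Y R t y = filter (\<lambda>r. movable (scaled D t) (it_zero t) (snd (snd r)) y \<and>
     list_ex (\<lambda>u. exb its Y u < exa its Y u) (sel (fst r) (it_args t)) \<and>
     list_ex (\<lambda>u. elem u R) (sel (fst (snd r)) (it_args t))) (it_rows t)"

text \<open>The donor loses a unit by an increase of its second component. Both components only
  grow, so no subtraction occurs and the size increases by an additive amount.\<close>

definition push_unit :: "exch_row \<Rightarrow> (nat \<times> nat) list \<Rightarrow> (nat \<times> nat) list" where
  "push_unit r y = map (\<lambda>z. (fst (snd (snd z)) + (if fst (snd z) then 1 else 0),
     snd (snd (snd z)) + (if fst z then 1 else 0))) (zip (fst r) (zip (fst (snd r)) y))"

text \<open>At most one item is changed per pass, since a second move would rely on excesses that
  the first one has altered.\<close>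

definition try_push :: "item list \<Rightarrow> bool list \<Rightarrow> (nat \<times> nat) list list \<Rightarrow> nat list \<Rightarrow> bool \<times> (nat \<times> nat) list list" where
  "try_push its D Y R = foldl (\<lambda>s z. case (if fst s then [] else cands its D Y R (fst z) (snd z)) of
      [] \<Rightarrow> (fst s, snd z # snd s) | r # _ \<Rightarrow> (True, push_unit r (snd z) # snd s)) (False, []) (zip its Y)"

definition expand :: "item list \<Rightarrow> bool list \<Rightarrow> (nat \<times> nat) list list \<Rightarrow> nat list \<Rightarrow> nat list \<Rightarrow> nat list" where
  "expand its D Y R V = filter (\<lambda>v. elem v R \<or> list_ex (\<lambda>z. list_ex (\<lambda>r.
     movable (scaled D (fst z)) (it_zero (fst z)) (snd (snd r)) (snd z) \<and>
     elem v (sel (fst r) (it_args (fst z))) \<and>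
     list_ex (\<lambda>u. elem u R) (sel (fst (snd r)) (it_args (fst z)))) (it_rows (fst z))) (zip its Y)) V"

definition search_step :: "item list \<Rightarrow> bool list \<Rightarrow> nat list \<Rightarrow> bool \<times> (nat \<times> nat) list list \<times> nat list \<Rightarrow> bool \<times> (nat \<times> nat) list list \<times> nat list" where
  "search_step its D V s = (if fst s then s
     else if fst (try_push its D (fst (snd s)) (snd (snd s)))
     then (True, (rev (snd (try_push its D (fst (snd s)) (snd (snd s)))), snd (snd s)))
     else (False, (fst (snd s), expand its D (fst (snd s)) (snd (snd s)) V)))"

text \<open>\<open>0 # V\<close> is a clock of length |V| + 1: the levels 0 to |V| are tested, and
  levels are constant from the number of distinct variables on.\<close>

definition search :: "item list \<Rightarrow> bool list \<Rightarrow> nat list \<Rightarrow> (nat \<times> nat) list list \<Rightarrow> bool \<times> (nat \<times> nat) list list \<times> nat list" where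
  "search its D V Y = foldl (\<lambda>s _. search_step its D V s)
     (False, (Y, filter (\<lambda>v. exa its Y v < exb its Y v) V)) (0 # V)"

definition lowbit :: "nat \<Rightarrow> bool" where
  "lowbit n = (case bin n of [] \<Rightarrow> False | b # _ \<Rightarrow> b)"

definition double :: "item list \<Rightarrow> bool list \<Rightarrow> (nat \<times> nat) list list \<Rightarrow> (nat \<times> nat) list list" where
  "double its D Y = map (\<lambda>z. map (\<lambda>u.
     (fst (snd u) + fst (snd u) + (if lowbit (scaled D (fst z)) then fst (fst u) else 0),
      snd (snd u) + snd (snd u) + (if lowbit (scaled D (fst z)) then snd (fst u) else 0)))
     (zip (it_base (fst z)) (snd z))) (zip its Y)"

text \<open>A unary clock that, for \<open>C\<close> long enough, exceeds the number of unit moves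
  that one doubling can make necessary.\<close>

definition rounds :: "item list \<Rightarrow> nat list \<Rightarrow> bool list \<Rightarrow> bool list" where
  "rounds its V C = concat (map (\<lambda>_. concat (map (\<lambda>_. C) (0 # V))) (True # map (\<lambda>_. True) its))"

definition phase :: "item list \<Rightarrow> nat list \<Rightarrow> bool list \<Rightarrow> bool list \<times> (nat \<times> nat) list list \<Rightarrow> bool list \<times> (nat \<times> nat) list list" where
  "phase its V C s = (tl (fst s), foldl (\<lambda>Y _. fst (snd (search its (tl (fst s)) V Y)))
     (double its (tl (fst s)) (snd s)) (rounds its V C))"

text \<open>A clock that is at least as long as the binary expansion of every single weight.\<close>

definition bits :: "item list \<Rightarrow> bool list" where
  "bits its = concat (map (\<lambda>t. bin (it_wt t)) its)"

definition solve :: "item list \<Rightarrow> nat list \<Rightarrow> bool list \<Rightarrow> bool list \<times> (nat \<times> nat) list list" where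
  "solve its V C = foldl (\<lambda>s _. phase its V C s)
     (bits its, map (\<lambda>t. map (\<lambda>_. (0, 0)) (it_base t)) its) (bits its)"

definition minset :: "item list \<Rightarrow> nat list \<Rightarrow> bool list \<Rightarrow> nat list" where
  "minset its V C = snd (snd (search its [] V (snd (solve its V C))))"

section \<open>Tables, blocks of argument positions and their set functions\<close>

definition mask :: "nat \<Rightarrow> nat \<Rightarrow> bool list" where
  "mask k p = map (\<lambda>r. r = p) [0..<k]"

definition value_table :: "nat \<Rightarrow> (bool list \<Rightarrow> nat) \<Rightarrow> (bool list \<times> nat) list" where
  "value_table k g = map (\<lambda>A. (A, g A)) (List.n_lists k [False, True])"

definition rows :: "nat \<Rightarrow> (bool list \<Rightarrow> nat) \<Rightarrow> exch_row list" where
  "rows k g = concat (map (\<lambda>p. map (\<lambda>r. (mask k p, (mask k r,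
     filter (\<lambda>t. fst t ! r \<and> \<not> fst t ! p) (value_table k g)))) [0..<k]) [0..<k])"

definition dv :: "bool list \<Rightarrow> (nat \<times> nat) list \<Rightarrow> int" where
  "dv A y = int (dota A y) - int (dotb A y)"

lemma sum_list_zip_if:
  "length A = length y \<Longrightarrow> sum_list (map (\<lambda>z. if fst z then f (snd z) else 0) (zip A y)) =
     (\<Sum>p<length y. if A ! p then f (y ! p) else (0 :: nat))"
  by (subst interv_sum_list_conv_sum_set_nat[symmetric] sum_list_sum_nth)
    (auto simp: atLeast0LessThan intro!: sum.cong)

lemma dv_sum: "length A = length y \<Longrightarrow>
    dv A y = (\<Sum>p<length y. if A ! p then int (fst (y ! p)) - int (snd (y ! p)) else 0)"
  unfolding dv_def dota_def dotb_def sum_list_zip_if[of A y fst] sum_list_zip_if[of A y snd] of_nat_sum sum_subtractf[symmetric]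
  by (intro sum.cong) auto

lemma lowbit: "lowbit n = odd n"
  by (simp add: lowbit_def bin.simps[of n])

lemma elem: "elem v R \<longleftrightarrow> v \<in> set R"
  by (auto simp: elem_def list_ex_iff)

lemma set_sel_mask:
  assumes "length xs = k" "p < k"
  shows "set (sel (mask k p) xs) = {xs ! p}"
proof -
  have "zip (mask k p) xs = map (\<lambda>r. (r = p, xs ! r)) [0..<k]"
    by (rule nth_equalityI) (use assms in \<open>simp_all add: mask_def\<close>)
  then show ?thesis using assms by (auto simp: sel_def filter_map o_def)
qed

lemma val_drop: "val (drop d l) = val l div 2 ^ d"
proof (induction d arbitrary: l)
  case (Suc d)
  show ?case
  proof (cases l)
    case (Cons b l')
    have "val l div 2 ^ Suc d = (val l div 2) div 2 ^ d" by (simp add: div_mult2_eq)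
    then show ?thesis using Suc[of l'] Cons by simp
  qed simp
qed simp

lemma scaled: "scaled D t = it_wt t div 2 ^ length D"
  by (simp add: scaled_def val_drop)

definition submodl :: "nat \<Rightarrow> (bool list \<Rightarrow> nat) \<Rightarrow> bool" where
  "submodl k g \<longleftrightarrow> (\<forall>A B. length A = k \<longrightarrow> length B = k \<longrightarrow>
     g (map2 (\<or>) A B) + g (map2 (\<and>) A B) \<le> g A + g B)"

definition basel :: "nat \<Rightarrow> (bool list \<Rightarrow> nat) \<Rightarrow> (nat \<times> nat) list \<Rightarrow> bool" where
  "basel k g z \<longleftrightarrow> length z = k \<and>
     (\<forall>A. length A = k \<longrightarrow> dv A z \<le> int (g A) - int (g (replicate k False))) \<and>
     dv (replicate k True) z = int (g (replicate k True)) - int (g (replicate k False))"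

text \<open>The number \<open>c\<close> bounds what one constraint of weight 1 can contribute to the
  error of a doubling, on either side of the duality.\<close>

locale item_list =
  fixes q :: nat and k :: "nat \<Rightarrow> nat" and g :: "nat \<Rightarrow> bool list \<Rightarrow> nat"
    and z :: "nat \<Rightarrow> (nat \<times> nat) list" and x :: "nat \<Rightarrow> nat list" and W :: "nat \<Rightarrow> nat" and c :: nat
  assumes len_x: "i < q \<Longrightarrow> length (x i) = k i" and sm: "i < q \<Longrightarrow> submodl (k i) (g i)"
    and bz: "i < q \<Longrightarrow> basel (k i) (g i) (z i)"
    and cg: "i < q \<Longrightarrow> length A = k i \<Longrightarrow> g i A \<le> c"
    and cz: "i < q \<Longrightarrow> (\<Sum>p<k i. \<bar>int (fst (z i ! p)) - int (snd (z i ! p))\<bar>) \<le> int c"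
begin

definition its :: "item list" where
  "its = map (\<lambda>i. ((rows (k i) (g i), (g i (replicate (k i) False), (z i, value_table (k i) (g i)))), (x i, W i))) [0..<q]"

definition U :: "(nat \<times> nat) set" where "U = (SIGMA i:{..<q}. {..<k i})"

definition pv :: "nat \<times> nat \<Rightarrow> nat" where "pv e = x (fst e) ! snd e"

definition bl :: "nat \<Rightarrow> (nat \<times> nat) set \<Rightarrow> bool list" where
  "bl i A = map (\<lambda>p. (i, p) \<in> A) [0..<k i]"

definition G :: "nat \<Rightarrow> bool list \<Rightarrow> int" where
  "G i A = int (g i A) - int (g i (replicate (k i) False))"

definition F :: "(nat \<Rightarrow> nat) \<Rightarrow> (nat \<times> nat) set \<Rightarrow> int" where
  "F w A = (\<Sum>i<q. int (w i) * G i (bl i A))"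

definition absY :: "(nat \<times> nat) list list \<Rightarrow> nat \<times> nat \<Rightarrow> int" where
  "absY Y e = (if e \<in> U then int (fst (Y ! fst e ! snd e)) - int (snd (Y ! fst e ! snd e)) else 0)"

definition shape :: "(nat \<times> nat) list list \<Rightarrow> bool" where
  "shape Y \<longleftrightarrow> length Y = q \<and> (\<forall>i<q. length (Y ! i) = k i)"

lemma shapeD: "shape Y \<Longrightarrow> length Y = q" "shape Y \<Longrightarrow> i < q \<Longrightarrow> length (Y ! i) = k i"
  by (auto simp: shape_def)

lemma finU: "finite U" by (simp add: U_def)

lemma length_bl [simp]: "length (bl i A) = k i" by (simp add: bl_def)

lemma length_its [simp]: "length its = q" by (simp add: its_def)

lemma its_nth: "i < q \<Longrightarrow> its ! i =
    ((rows (k i) (g i), (g i (replicate (k i) False), (z i, value_table (k i) (g i)))), (x i, W i))"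
  by (simp add: its_def)

lemma bl_nth: "p < k i \<Longrightarrow> bl i A ! p \<longleftrightarrow> (i, p) \<in> A" by (simp add: bl_def)

lemma G_zero [simp]: "G i (replicate (k i) False) = 0" by (simp add: G_def)

lemma bl_empty: "bl i {} = replicate (k i) False"
  by (rule nth_equalityI) (auto simp: bl_nth)

lemma bl_Un: "bl i (A \<union> B) = map2 (\<or>) (bl i A) (bl i B)" and bl_Int: "bl i (A \<inter> B) = map2 (\<and>) (bl i A) (bl i B)"
  by (rule nth_equalityI; simp add: bl_nth)+

lemma submod: "submodular U (F w)"
proof
  show "finite U" by (rule finU)
  show "F w {} = 0" by (simp add: F_def bl_empty)
  fix A B
  have "G i (bl i (A \<union> B)) + G i (bl i (A \<inter> B)) \<le> G i (bl i A) + G i (bl i B)" if "i < q" for i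
    using sm[OF that] unfolding submodl_def bl_Un bl_Int G_def
    by (smt (verit) length_bl of_nat_add of_nat_le_iff)
  then have "int (w i) * G i (bl i (A \<union> B)) + int (w i) * G i (bl i (A \<inter> B)) \<le>
      int (w i) * G i (bl i A) + int (w i) * G i (bl i B)" if "i < q" for i
    using that unfolding distrib_left[symmetric] by (intro mult_left_mono) auto
  then show "F w (A \<union> B) + F w (A \<inter> B) \<le> F w A + F w B"
    unfolding F_def sum.distrib[symmetric] by (intro sum_mono) auto
qed

lemma sum_absY:
  assumes "shape Y" "A \<subseteq> U"
  shows "sum (absY Y) A = (\<Sum>i<q. dv (bl i A) (Y ! i))"
proof -
  have "sum (absY Y) A = (\<Sum>e\<in>U. if e \<in> A then absY Y e else 0)"
    using assms finU by (simp add: sum.inter_restrict[symmetric] Int_absorb1)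
  also have "\<dots> = (\<Sum>i<q. \<Sum>p<k i. if (i, p) \<in> A then absY Y (i, p) else 0)"
    unfolding U_def by (subst sum.Sigma) (auto simp: U_def)
  also have "\<dots> = (\<Sum>i<q. dv (bl i A) (Y ! i))"
  proof (intro sum.cong refl)
    fix i assume "i \<in> {..<q}"
    then show "(\<Sum>p<k i. if (i, p) \<in> A then absY Y (i, p) else 0) = dv (bl i A) (Y ! i)"
      by (subst dv_sum) (auto simp add: shapeD[OF assms(1)] bl_nth absY_def U_def intro!: sum.cong)
  qed
  finally show ?thesis .
qed

definition bset :: "nat \<Rightarrow> bool list \<Rightarrow> (nat \<times> nat) set" where
  "bset i A = {(i, p) | p. p < k i \<and> A ! p}"

lemma bset_sub: "i < q \<Longrightarrow> bset i A \<subseteq> U" by (auto simp: bset_def U_def)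

lemma bl_bset: "length A = k i \<Longrightarrow> bl j (bset i A) = (if j = i then A else replicate (k j) False)"
  by (auto intro!: nth_equalityI simp: bl_nth bset_def)

lemma dv_zero: "dv (replicate n False) y = 0"
proof -
  have "zip (replicate n False) y = map (\<lambda>t. (False, t)) (take n y)"
    by (induction n arbitrary: y) (auto, case_tac y, auto)
  then show ?thesis by (simp add: dv_def dota_def dotb_def o_def)
qed

lemma sum_bset:
  assumes "shape Y" "i < q" "length A = k i"
  shows "sum (absY Y) (bset i A) = dv A (Y ! i)"
proof -
  have "sum (absY Y) (bset i A) = (\<Sum>j<q. if j = i then dv A (Y ! i) else 0)"
    unfolding sum_absY[OF assms(1) bset_sub[OF assms(2)]]
    using assms by (intro sum.cong) (auto simp: bl_bset dv_zero)
  then show ?thesis using assms by simp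
qed

lemma F_bset:
  assumes "i < q" "length A = k i"
  shows "F w (bset i A) = int (w i) * G i A"
proof -
  have "F w (bset i A) = (\<Sum>j<q. if j = i then int (w i) * G i A else 0)"
    unfolding F_def using assms by (intro sum.cong) (auto simp: bl_bset)
  then show ?thesis using assms by simp
qed

context
  fixes w :: "nat \<Rightarrow> nat"
begin

interpretation S: submodular U "F w" pv by (rule submod)

lemma block_le:
  assumes "S.base (absY Y)" "shape Y" "i < q" "length A = k i"
  shows "dv A (Y ! i) \<le> int (w i) * G i A"
  using assms(1) bset_sub[OF assms(3), of A] sum_bset[OF assms(2-4)] F_bset[OF assms(3,4)]
  unfolding S.base_def by metis

text \<open>The blocks are disjoint, so the inequalities separate. Equality on all of
  \<open>U\<close> then leaves no slack on any full block.\<close>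

lemma base_iff:
  assumes "shape Y"
  shows "S.base (absY Y) \<longleftrightarrow> (\<forall>i<q. (\<forall>A. length A = k i \<longrightarrow> dv A (Y ! i) \<le> int (w i) * G i A) \<and>
     dv (replicate (k i) True) (Y ! i) = int (w i) * G i (replicate (k i) True))"
proof -
  have blU: "bl i U = replicate (k i) True" if "i < q" for i
    using that by (intro nth_equalityI) (auto simp: bl_nth U_def)
  show ?thesis
  proof
    assume b: "S.base (absY Y)"
    have le: "dv A (Y ! i) \<le> int (w i) * G i A" if "i < q" "length A = k i" for i A
      using block_le[OF b assms that] .
    have "(\<Sum>i<q. dv (bl i U) (Y ! i)) = (\<Sum>i<q. int (w i) * G i (bl i U))"
      using b unfolding S.base_def sum_absY[OF assms order_refl] F_def by blast
    moreover have "(\<Sum>i<q. dv (bl i U) (Y ! i)) = (\<Sum>i<q. dv (replicate (k i) True) (Y ! i))"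
      by (intro sum.cong) (simp_all add: blU)
    moreover have "(\<Sum>i<q. int (w i) * G i (bl i U)) = (\<Sum>i<q. int (w i) * G i (replicate (k i) True))"
      by (intro sum.cong) (simp_all add: blU)
    ultimately have "(\<Sum>i<q. int (w i) * G i (replicate (k i) True) - dv (replicate (k i) True) (Y ! i)) = 0"
      unfolding sum_subtractf by simp
    then have "int (w i) * G i (replicate (k i) True) - dv (replicate (k i) True) (Y ! i) = 0" if "i < q" for i
      using sum_nonneg_eq_0_iff[of "{..<q}" "\<lambda>i. int (w i) * G i (replicate (k i) True) - dv (replicate (k i) True) (Y ! i)"] le that
      by simp
    then show "\<forall>i<q. (\<forall>A. length A = k i \<longrightarrow> dv A (Y ! i) \<le> int (w i) * G i A) \<and>
      dv (replicate (k i) True) (Y ! i) = int (w i) * G i (replicate (k i) True)" using le by auto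
  next
    assume a: "\<forall>i<q. (\<forall>A. length A = k i \<longrightarrow> dv A (Y ! i) \<le> int (w i) * G i A) \<and>
      dv (replicate (k i) True) (Y ! i) = int (w i) * G i (replicate (k i) True)"
    show "S.base (absY Y)" unfolding S.base_def
    proof (intro conjI allI impI)
      fix A assume A: "A \<subseteq> U"
      show "sum (absY Y) A \<le> F w A" unfolding sum_absY[OF assms A] F_def using a by (intro sum_mono) auto
    next
      show "sum (absY Y) U = F w U" unfolding sum_absY[OF assms order_refl] F_def
        using a by (intro sum.cong) (auto simp: blU)
    qed
  qed
qed

text \<open>In a base every full block is tight, and the block of the receiver contains no position
  of another block, so units never cross blocks. Within a block, a set splits into its part there
  and parts elsewhere, where the inequality holds anyway.\<close>

lemma exch_iff:
  assumes b: "S.base (absY Y)" and sh: "shape Y" and i: "i < q" "p < k i" "j < q" "r < k j"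
  shows "S.exch (absY Y) (i, p) (j, r) \<longleftrightarrow> i = j \<and>
    (\<forall>A. length A = k i \<longrightarrow> A ! r \<longrightarrow> \<not> A ! p \<longrightarrow> dv A (Y ! i) < int (w i) * G i A)"
proof
  assume e: "S.exch (absY Y) (i, p) (j, r)"
  have ij: "i = j"
  proof (rule ccontr)
    assume ne: "i \<noteq> j"
    let ?A = "bset j (replicate (k j) True)"
    have "(j, r) \<in> ?A" "(i, p) \<notin> ?A" "?A \<subseteq> U" using i ne by (auto simp: bset_def U_def)
    then have "sum (absY Y) ?A < F w ?A" using e unfolding S.exch_def by blast
    then show False using b i by (simp add: sum_bset[OF sh] F_bset base_iff[OF sh])
  qed
  moreover have "dv A (Y ! i) < int (w i) * G i A" if A: "length A = k i" "A ! r" "\<not> A ! p" for A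
  proof -
    have "(j, r) \<in> bset i A" "(i, p) \<notin> bset i A" "bset i A \<subseteq> U" using i A ij by (auto simp: bset_def U_def)
    then have "sum (absY Y) (bset i A) < F w (bset i A)" using e unfolding S.exch_def by blast
    then show ?thesis using i A by (simp add: sum_bset[OF sh] F_bset)
  qed
  ultimately show "i = j \<and> (\<forall>A. length A = k i \<longrightarrow> A ! r \<longrightarrow> \<not> A ! p \<longrightarrow> dv A (Y ! i) < int (w i) * G i A)"
    by blast
next
  assume a: "i = j \<and> (\<forall>A. length A = k i \<longrightarrow> A ! r \<longrightarrow> \<not> A ! p \<longrightarrow> dv A (Y ! i) < int (w i) * G i A)"
  show "S.exch (absY Y) (i, p) (j, r)" unfolding S.exch_def
  proof (intro allI impI)
    fix A assume A: "A \<subseteq> U" "(j, r) \<in> A \<and> (i, p) \<notin> A"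
    have "dv (bl i A) (Y ! i) < int (w i) * G i (bl i A)" using a A i by (auto simp: bl_nth)
    then show "sum (absY Y) A < F w A" unfolding sum_absY[OF sh A(1)] F_def
      using i block_le[OF b sh] by (intro sum_strict_mono_ex1) auto
  qed
qed

lemma ex_eq:
  assumes sh: "shape Y"
  shows "S.ex (absY Y) v = int (exa its Y v) - int (exb its Y v)"
proof -
  have zz: "zip its Y = map (\<lambda>i. (its ! i, Y ! i)) [0..<q]"
    by (rule nth_equalityI) (simp_all add: shapeD[OF sh])
  have inner: "sum_list (map (\<lambda>u. if fst u = v then f (snd u) else 0) (zip (x i) (Y ! i))) =
      (\<Sum>p<k i. if x i ! p = v then f (Y ! i ! p) else 0)" if "i < q" for i and f :: "nat \<times> nat \<Rightarrow> nat"
    by (subst sum_list_sum_nth)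
      (auto simp add: shapeD[OF sh] len_x[OF that] that atLeast0LessThan intro!: sum.cong)
  have outer: "sum_list (map (\<lambda>z. sum_list (map (\<lambda>u. if fst u = v then f (snd u) else 0) (zip (it_args (fst z)) (snd z)))) (zip its Y))
     = (\<Sum>i<q. \<Sum>p<k i. if x i ! p = v then f (Y ! i ! p) else 0)" for f :: "nat \<times> nat \<Rightarrow> nat"
    unfolding zz by (simp add: o_def interv_sum_list_conv_sum_set_nat atLeast0LessThan)
      (intro sum.cong refl, simp add: its_nth inner)
  have "{e \<in> U. pv e = v} \<subseteq> U" by auto
  then have "S.ex (absY Y) v = (\<Sum>e\<in>U. if pv e = v then absY Y e else 0)"
    unfolding S.ex_def using finU by (simp add: sum.inter_filter)
  also have "\<dots> = (\<Sum>i<q. \<Sum>p<k i. if x i ! p = v then absY Y (i, p) else 0)"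
    unfolding U_def by (subst sum.Sigma) (auto simp: pv_def intro!: sum.cong)
  also have "\<dots> = (\<Sum>i<q. \<Sum>p<k i. (if x i ! p = v then int (fst (Y ! i ! p)) else 0) - (if x i ! p = v then int (snd (Y ! i ! p)) else 0))"
    by (intro sum.cong refl) (auto simp: absY_def U_def)
  also have "\<dots> = int (exa its Y v) - int (exb its Y v)"
    unfolding exa_def exb_def outer sum_subtractf of_nat_sum by (simp add: if_distrib cong: if_cong)
  finally show ?thesis .
qed

end

end

lemma set_rows: "r \<in> set (rows k g) \<longleftrightarrow> (\<exists>p<k. \<exists>s<k. r = (mask k p, (mask k s,
     filter (\<lambda>t. fst t ! s \<and> \<not> fst t ! p) (value_table k g))))"
proof -
  have "set (rows k g) = (\<Union>p\<in>{..<k}. (\<lambda>s. (mask k p, (mask k s,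
     filter (\<lambda>t. fst t ! s \<and> \<not> fst t ! p) (value_table k g)))) ` {..<k})"
    by (simp add: rows_def atLeast0LessThan)
  then show ?thesis by blast
qed

lemma list_ex_map_iff: "list_ex P (map f xs) \<longleftrightarrow> (\<exists>x\<in>set xs. P (f x))"
  by (induction xs) auto

lemma movable_iff:
  "movable w (g Z) (filter (\<lambda>t. fst t ! s \<and> \<not> fst t ! p) (value_table k g)) y \<longleftrightarrow>
    (\<forall>A. length A = k \<longrightarrow> A ! s \<longrightarrow> \<not> A ! p \<longrightarrow> dv A y < int w * (int (g A) - int (g Z)))"
proof -
  have "a + 1 + w * m \<le> w * n + b \<longleftrightarrow> int a - int b < int w * (int n - int m)" for a b m n
  proof -
    have "a + 1 + w * m \<le> w * n + b \<longleftrightarrow> int (a + 1 + w * m) \<le> int (w * n + b)" by (simp only: of_nat_le_iff)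
    then show ?thesis by (simp add: algebra_simps) linarith
  qed
  then have "movable w (g Z) (filter (\<lambda>t. fst t ! s \<and> \<not> fst t ! p) (value_table k g)) y \<longleftrightarrow>
     (\<forall>A \<in> set (List.n_lists k [False, True]). A ! s \<and> \<not> A ! p \<longrightarrow> dv A y < int w * (int (g A) - int (g Z)))"
    by (auto simp: movable_def list_all_iff value_table_def dv_def)
  then show ?thesis by (auto simp: set_n_lists)
qed

lemma foldl_first:
  fixes C :: "'z \<Rightarrow> 'r list" and P :: "'r \<Rightarrow> 'z \<Rightarrow> 'y" and h :: "'z \<Rightarrow> 'y"
  defines "step \<equiv> (\<lambda>s z. case (if fst s then [] else C z) of [] \<Rightarrow> (fst s, h z # snd s) | r # _ \<Rightarrow> (True, P r z # snd s))"
  shows "foldl step (True, acc) zs = (True, rev (map h zs) @ acc)"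
    and "(\<forall>z\<in>set zs. C z = []) \<and> foldl step (False, acc) zs = (False, rev (map h zs) @ acc) \<or>
      (\<exists>n<length zs. C (zs ! n) \<noteq> [] \<and> foldl step (False, acc) zs =
         (True, rev ((map h zs)[n := P (hd (C (zs ! n))) (zs ! n)]) @ acc))"
proof -
  show t: "foldl step (True, acc) zs = (True, rev (map h zs) @ acc)" for acc zs
    by (induction zs arbitrary: acc) (auto simp: step_def)
  show "(\<forall>z\<in>set zs. C z = []) \<and> foldl step (False, acc) zs = (False, rev (map h zs) @ acc) \<or>
      (\<exists>n<length zs. C (zs ! n) \<noteq> [] \<and> foldl step (False, acc) zs =
         (True, rev ((map h zs)[n := P (hd (C (zs ! n))) (zs ! n)]) @ acc))"
  proof (induction zs arbitrary: acc)
    case (Cons z zs)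
    show ?case
    proof (cases "C z")
      case Nil
      then have s: "foldl step (False, acc) (z # zs) = foldl step (False, h z # acc) zs" by (simp add: step_def)
      from Cons[of "h z # acc"] show ?thesis
      proof
        assume "(\<forall>z\<in>set zs. C z = []) \<and> foldl step (False, h z # acc) zs = (False, rev (map h zs) @ h z # acc)"
        then show ?thesis using Nil s by simp
      next
        assume "\<exists>n<length zs. C (zs ! n) \<noteq> [] \<and> foldl step (False, h z # acc) zs =
         (True, rev ((map h zs)[n := P (hd (C (zs ! n))) (zs ! n)]) @ h z # acc)"
        then obtain n where "n < length zs" "C (zs ! n) \<noteq> []" "foldl step (False, h z # acc) zs =
         (True, rev ((map h zs)[n := P (hd (C (zs ! n))) (zs ! n)]) @ h z # acc)" by blast
        then show ?thesis using s by (intro disjI2 exI[of _ "Suc n"]) simp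
      qed
    next
      case (Cons r rs)
      then have "foldl step (False, acc) (z # zs) = foldl step (True, P r z # acc) zs" by (simp add: step_def)
      then show ?thesis using Cons t[of "P r z # acc" zs] by (intro disjI2 exI[of _ 0]) simp
    qed
  qed simp
qed

section \<open>Correctness of one search\<close>

context item_list
begin

lemma zip_its: "shape Y \<Longrightarrow> zip its Y = map (\<lambda>i. (its ! i, Y ! i)) [0..<q]"
  by (rule nth_equalityI) (simp_all add: shapeD)

definition sw :: "bool list \<Rightarrow> nat \<Rightarrow> nat" where
  "sw D i = W i div 2 ^ length D"

lemma scaled_its: "i < q \<Longrightarrow> scaled D (its ! i) = sw D i"
  by (simp add: scaled its_nth sw_def)

lemma push_unit_mask:
  assumes "length y = n" "p < n" "s < n"
  shows "push_unit (mask n p, mask n s, As) y = map (\<lambda>j. (fst (y ! j) + (if j = s then 1 else 0),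
     snd (y ! j) + (if j = p then 1 else 0))) [0..<n]"
  by (rule nth_equalityI) (use assms in \<open>simp_all add: push_unit_def mask_def\<close>)

lemma pv_U: "pv ` U = (\<Union>i<q. set (x i))"
  by (auto simp: U_def pv_def in_set_conv_nth len_x image_iff) (use len_x in force)+

context
  fixes D :: "bool list" and V :: "nat list"
  assumes V: "set V = (\<Union>i<q. set (x i))"
begin

interpretation S: submodular U "F (sw D)" pv by (rule submod)

lemma Vs: "S.Vs = set V"
  by (simp add: S.Vs_def pv_U V)

lemma card_Vs: "card S.Vs \<le> length V"
  by (simp add: Vs card_length)

lemma row_exch:
  assumes b: "S.base (absY Y)" and sh: "shape Y" and i: "i < q" "p < k i" "s < k i"
  shows "movable (scaled D (its ! i)) (it_zero (its ! i))
      (filter (\<lambda>t. fst t ! s \<and> \<not> fst t ! p) (value_table (k i) (g i))) (Y ! i) \<longleftrightarrow> S.exch (absY Y) (i, p) (i, s)"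
  unfolding exch_iff[OF b sh i(1,2,1,3)] scaled_its[OF i(1)] G_def
  by (simp add: its_nth[OF i(1)] movable_iff)

lemma cands_iff:
  assumes b: "S.base (absY Y)" and sh: "shape Y" and i: "i < q"
  shows "r \<in> set (cands its D Y R (its ! i) (Y ! i)) \<longleftrightarrow> (\<exists>p<k i. \<exists>s<k i.
    r = (mask (k i) p, (mask (k i) s, filter (\<lambda>t. fst t ! s \<and> \<not> fst t ! p) (value_table (k i) (g i)))) \<and>
    S.exch (absY Y) (i, p) (i, s) \<and> 0 < S.ex (absY Y) (pv (i, p)) \<and> pv (i, s) \<in> set R)"
proof -
  have rw: "it_rows (its ! i) = rows (k i) (g i)" "it_args (its ! i) = x i" by (simp_all add: its_nth[OF i])
  define row where "row p s = (mask (k i) p, (mask (k i) s,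
    filter (\<lambda>t. fst t ! s \<and> \<not> fst t ! p) (value_table (k i) (g i))))" for p s
  have sr: "t \<in> set (rows (k i) (g i)) \<longleftrightarrow> (\<exists>p<k i. \<exists>s<k i. t = row p s)" for t
    by (simp only: set_rows row_def)
  have key: "movable (scaled D (its ! i)) (it_zero (its ! i)) (snd (snd (row p s))) (Y ! i) \<and>
     list_ex (\<lambda>u. exb its Y u < exa its Y u) (sel (fst (row p s)) (x i)) \<and>
     list_ex (\<lambda>u. elem u R) (sel (fst (snd (row p s))) (x i)) \<longleftrightarrow>
     S.exch (absY Y) (i, p) (i, s) \<and> 0 < S.ex (absY Y) (pv (i, p)) \<and> pv (i, s) \<in> set R"
    if "p < k i" "s < k i" for p s
    using row_exch[OF b sh i that] that
    by (simp add: row_def list_ex_iff set_sel_mask[OF len_x[OF i]] elem ex_eq[OF sh] pv_def)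
  show ?thesis unfolding cands_def set_filter mem_Collect_eq rw sr row_def[symmetric] using key by blast
qed

lemma try_push_cases:
  assumes b: "S.base (absY Y)" and sh: "shape Y"
  shows "(\<not> fst (try_push its D Y R) \<longrightarrow>
      \<not> (\<exists>s\<in>U. \<exists>t\<in>U. S.exch (absY Y) s t \<and> 0 < S.ex (absY Y) (pv s) \<and> pv t \<in> set R)) \<and>
    (fst (try_push its D Y R) \<longrightarrow> shape (rev (snd (try_push its D Y R))) \<and>
      (\<exists>s\<in>U. \<exists>t\<in>U. S.exch (absY Y) s t \<and> 0 < S.ex (absY Y) (pv s) \<and> pv t \<in> set R \<and>
         absY (rev (snd (try_push its D Y R))) = S.move (absY Y) s t))"
proof -
  let ?C = "\<lambda>z. cands its D Y R (fst z) (snd z)"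
  let ?zs = "zip its Y"
  have zl: "length ?zs = q" using shapeD(1)[OF sh] by simp
  have zn: "?zs ! n = (its ! n, Y ! n)" if "n < q" for n using that shapeD(1)[OF sh] by simp
  have ms: "map snd ?zs = Y" using shapeD(1)[OF sh] by simp
  have def: "try_push its D Y R = foldl (\<lambda>s z. case (if fst s then [] else ?C z) of
      [] \<Rightarrow> (fst s, snd z # snd s) | r # _ \<Rightarrow> (True, push_unit r (snd z) # snd s)) (False, []) ?zs"
    by (simp add: try_push_def)
  from foldl_first(2)[where zs = ?zs and C = ?C and h = snd and acc = "[]" and P = "\<lambda>r z. push_unit r (snd z)"]
  show ?thesis unfolding def[symmetric]
  proof
    assume a: "(\<forall>z\<in>set ?zs. ?C z = []) \<and> try_push its D Y R = (False, rev (map snd ?zs) @ [])"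
    have "\<not> (S.exch (absY Y) s t \<and> 0 < S.ex (absY Y) (pv s) \<and> pv t \<in> set R)" if st: "s \<in> U" "t \<in> U" for s t
    proof
      assume e: "S.exch (absY Y) s t \<and> 0 < S.ex (absY Y) (pv s) \<and> pv t \<in> set R"
      obtain i p j r where ip: "s = (i, p)" "t = (j, r)" "i < q" "p < k i" "j < q" "r < k j"
        using st by (auto simp: U_def)
      then have ij: "i = j" using e exch_iff[OF b sh ip(3-6)] by simp
      then have "cands its D Y R (its ! i) (Y ! i) \<noteq> []"
        using cands_iff[OF b sh ip(3), of _ R] e ip by (metis empty_iff list.set(1))
      moreover have "(its ! i, Y ! i) \<in> set ?zs" using zn[OF ip(3)] zl ip(3) nth_mem[of i ?zs] by simp
      ultimately show False using a by auto
    qed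
    then show ?thesis using a by auto
  next
    assume "\<exists>n<length ?zs. ?C (?zs ! n) \<noteq> [] \<and> try_push its D Y R =
      (True, rev ((map snd ?zs)[n := push_unit (hd (?C (?zs ! n))) (snd (?zs ! n))]) @ [])"
    then obtain n where n: "n < q" "cands its D Y R (its ! n) (Y ! n) \<noteq> []"
      "try_push its D Y R = (True, rev (Y[n := push_unit (hd (cands its D Y R (its ! n) (Y ! n))) (Y ! n)]))"
      using zn zl ms by auto
    obtain p s where ps: "p < k n" "s < k n" "hd (cands its D Y R (its ! n) (Y ! n)) =
        (mask (k n) p, (mask (k n) s, filter (\<lambda>t. fst t ! s \<and> \<not> fst t ! p) (value_table (k n) (g n))))"
      "S.exch (absY Y) (n, p) (n, s)" "0 < S.ex (absY Y) (pv (n, p))" "pv (n, s) \<in> set R"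
      using iffD1[OF cands_iff[OF b sh n(1)] hd_in_set[OF n(2)]] by blast
    define y' where "y' = push_unit (hd (cands its D Y R (its ! n) (Y ! n))) (Y ! n)"
    have y': "y' = map (\<lambda>j. (fst (Y ! n ! j) + (if j = s then 1 else 0), snd (Y ! n ! j) + (if j = p then 1 else 0))) [0..<k n]"
      unfolding y'_def ps(3) by (rule push_unit_mask) (use ps shapeD(2)[OF sh n(1)] in auto)
    have r: "rev (snd (try_push its D Y R)) = Y[n := y']" using n(3) by (simp add: y'_def)
    have "shape (Y[n := y'])"
      unfolding shape_def using n(1) by (auto simp: shapeD[OF sh] y' nth_list_update)
    moreover have "absY (Y[n := y']) = S.move (absY Y) (n, p) (n, s)"
    proof
      fix e :: "nat \<times> nat"
      obtain i j where e: "e = (i, j)" by (cases e)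
      show "absY (Y[n := y']) e = S.move (absY Y) (n, p) (n, s) e"
        using n(1) ps(1,2) shapeD(1)[OF sh] by (auto simp: e absY_def S.move_def U_def y' nth_list_update)
    qed
    moreover have "(n, p) \<in> U" "(n, s) \<in> U" using n ps by (auto simp: U_def)
    ultimately show ?thesis using ps n(3) unfolding r by auto
  qed
qed

lemma set_expand:
  assumes b: "S.base (absY Y)" and sh: "shape Y" and R: "set R = S.lev (absY Y) j"
  shows "set (expand its D Y R V) = S.lev (absY Y) (Suc j)"
proof -
  have mem: "(list_ex (\<lambda>z. list_ex (\<lambda>r. movable (scaled D (fst z)) (it_zero (fst z)) (snd (snd r)) (snd z) \<and>
     elem v (sel (fst r) (it_args (fst z))) \<and> list_ex (\<lambda>u. elem u R) (sel (fst (snd r)) (it_args (fst z)))) (it_rows (fst z))) (zip its Y))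
    \<longleftrightarrow> (\<exists>s\<in>U. \<exists>t\<in>U. pv s = v \<and> pv t \<in> set R \<and> S.exch (absY Y) s t)" (is "?l \<longleftrightarrow> ?r") for v
  proof -
    have 1: "list_ex (\<lambda>r. movable (scaled D (its ! i)) (it_zero (its ! i)) (snd (snd r)) (Y ! i) \<and>
       elem v (sel (fst r) (it_args (its ! i))) \<and> list_ex (\<lambda>u. elem u R) (sel (fst (snd r)) (it_args (its ! i)))) (it_rows (its ! i)) \<longleftrightarrow>
       (\<exists>p<k i. \<exists>s<k i. pv (i, p) = v \<and> pv (i, s) \<in> set R \<and> S.exch (absY Y) (i, p) (i, s))" if i: "i < q" for i
    proof -
      have rw: "it_rows (its ! i) = rows (k i) (g i)" "it_args (its ! i) = x i" by (simp_all add: its_nth[OF i])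
      define row where "row p s = (mask (k i) p, (mask (k i) s,
        filter (\<lambda>t. fst t ! s \<and> \<not> fst t ! p) (value_table (k i) (g i))))" for p s
      have sr: "t \<in> set (rows (k i) (g i)) \<longleftrightarrow> (\<exists>p<k i. \<exists>s<k i. t = row p s)" for t
        by (simp only: set_rows row_def)
      have key: "movable (scaled D (its ! i)) (it_zero (its ! i)) (snd (snd (row p s))) (Y ! i) \<and>
         elem v (sel (fst (row p s)) (x i)) \<and> list_ex (\<lambda>u. elem u R) (sel (fst (snd (row p s))) (x i)) \<longleftrightarrow>
         pv (i, p) = v \<and> pv (i, s) \<in> set R \<and> S.exch (absY Y) (i, p) (i, s)"
        if "p < k i" "s < k i" for p s
        using row_exch[OF b sh i that] that
        by (auto simp add: row_def list_ex_iff set_sel_mask[OF len_x[OF i]] elem pv_def)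
      show ?thesis unfolding rw list_ex_iff[of _ "rows (k i) (g i)"] Bex_def sr using key by blast
    qed
    have "?l \<longleftrightarrow> (\<exists>i<q. \<exists>p<k i. \<exists>s<k i. pv (i, p) = v \<and> pv (i, s) \<in> set R \<and> S.exch (absY Y) (i, p) (i, s))"
      unfolding zip_its[OF sh] list_ex_map_iff Bex_def using 1 by (simp cong: conj_cong)
    also have "\<dots> \<longleftrightarrow> ?r"
    proof
      assume ?r
      then obtain s t where st: "s \<in> U" "t \<in> U" "pv s = v" "pv t \<in> set R" "S.exch (absY Y) s t" by blast
      obtain i p j r where ip: "s = (i, p)" "t = (j, r)" "i < q" "p < k i" "j < q" "r < k j"
        using st(1,2) by (auto simp: U_def)
      have "i = j" using st(5) exch_iff[OF b sh ip(3-6)] ip by simp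
      then show "\<exists>i<q. \<exists>p<k i. \<exists>s<k i. pv (i, p) = v \<and> pv (i, s) \<in> set R \<and> S.exch (absY Y) (i, p) (i, s)"
        using st ip by blast
    qed (force simp: U_def)
    finally show ?thesis .
  qed
  show ?thesis unfolding expand_def set_filter mem by (auto simp: elem R Vs[symmetric])
qed

lemma search_steps:
  assumes b: "S.base (absY Y)" and sh: "shape Y"
  defines "s0 \<equiv> (False, (Y, filter (\<lambda>v. exa its Y v < exb its Y v) V))"
  shows "(\<exists>R. (search_step its D V ^^ n) s0 = (False, (Y, R)) \<and> (\<forall>j<n. \<not> S.hits (absY Y) j) \<and> set R = S.lev (absY Y) n) \<or>
    (\<exists>Y' R j s t. (search_step its D V ^^ n) s0 = (True, (Y', R)) \<and> shape Y' \<and> S.hit (absY Y) j s t \<and>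
      (\<forall>i<j. \<not> S.hits (absY Y) i) \<and> absY Y' = S.move (absY Y) s t)"
proof (induction n)
  case 0
  have "set (filter (\<lambda>v. exa its Y v < exb its Y v) V) = S.lev (absY Y) 0"
    by (auto simp: Vs[symmetric] ex_eq[OF sh])
  then show ?case by (simp add: s0_def)
next
  case (Suc n)
  from Suc show ?case
  proof
    assume "\<exists>R. (search_step its D V ^^ n) s0 = (False, (Y, R)) \<and> (\<forall>j<n. \<not> S.hits (absY Y) j) \<and> set R = S.lev (absY Y) n"
    then obtain R where R: "(search_step its D V ^^ n) s0 = (False, (Y, R))" "\<forall>j<n. \<not> S.hits (absY Y) j" "set R = S.lev (absY Y) n"
      by blast
    note t = try_push_cases[OF b sh, of R]
    show ?thesis
    proof (cases "fst (try_push its D Y R)")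
      case True
      then obtain s t where "s \<in> U" "t \<in> U" "S.exch (absY Y) s t" "0 < S.ex (absY Y) (pv s)" "pv t \<in> set R"
         "absY (rev (snd (try_push its D Y R))) = S.move (absY Y) s t" "shape (rev (snd (try_push its D Y R)))"
        using t by blast
      then have "S.hit (absY Y) n s t" using R(3) by (simp add: S.hit_def)
      moreover have "(search_step its D V ^^ Suc n) s0 = (True, (rev (snd (try_push its D Y R)), R))"
        using R(1) True by (simp add: search_step_def)
      ultimately show ?thesis using R(2) \<open>shape (rev (snd (try_push its D Y R)))\<close>
        \<open>absY (rev (snd (try_push its D Y R))) = S.move (absY Y) s t\<close> by (intro disjI2) blast
    next
      case False
      then have "\<not> S.hits (absY Y) n" using t R(3) by (auto simp: S.hits_def S.hit_def)
      moreover have "(search_step its D V ^^ Suc n) s0 = (False, (Y, expand its D Y R V))"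
        using R(1) False by (simp add: search_step_def)
      ultimately show ?thesis using R(2) set_expand[OF b sh R(3)]
        by (intro disjI1 exI[of _ "expand its D Y R V"]) (auto simp: less_Suc_eq simp del: funpow.simps S.lev.simps)
    qed
  next
    assume "\<exists>Y' R j s t. (search_step its D V ^^ n) s0 = (True, (Y', R)) \<and> shape Y' \<and> S.hit (absY Y) j s t \<and>
      (\<forall>i<j. \<not> S.hits (absY Y) i) \<and> absY Y' = S.move (absY Y) s t"
    then obtain Y' R j s t where r: "(search_step its D V ^^ n) s0 = (True, (Y', R))" and
      h: "shape Y' \<and> S.hit (absY Y) j s t \<and> (\<forall>i<j. \<not> S.hits (absY Y) i) \<and> absY Y' = S.move (absY Y) s t"
      by blast
    have "(search_step its D V ^^ Suc n) s0 = (True, (Y', R))" using r by (simp add: search_step_def)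
    then show ?thesis using h by blast
  qed
qed

lemma search_result:
  assumes b: "S.base (absY Y)" and sh: "shape Y"
  shows "shape (fst (snd (search its D V Y)))" "S.augments (absY Y) (absY (fst (snd (search its D V Y))))"
    "S.stuck (absY Y) \<Longrightarrow> set (snd (snd (search its D V Y))) = S.lev (absY Y) (Suc (length V))"
proof -
  have s: "search its D V Y = (search_step its D V ^^ Suc (length V)) (False, (Y, filter (\<lambda>v. exa its Y v < exb its Y v) V))"
    unfolding search_def foldl_funpow by simp
  have "shape (fst (snd (search its D V Y))) \<and> S.augments (absY Y) (absY (fst (snd (search its D V Y)))) \<and>
    (S.stuck (absY Y) \<longrightarrow> set (snd (snd (search its D V Y))) = S.lev (absY Y) (Suc (length V)))"
    using search_steps[OF b sh, of "Suc (length V)"] unfolding s[symmetric]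
  proof
    assume "\<exists>R. search its D V Y = (False, (Y, R)) \<and> (\<forall>j<Suc (length V). \<not> S.hits (absY Y) j) \<and> set R = S.lev (absY Y) (Suc (length V))"
    then obtain R where R: "search its D V Y = (False, (Y, R))" "\<forall>j<Suc (length V). \<not> S.hits (absY Y) j"
      "set R = S.lev (absY Y) (Suc (length V))" by blast
    have "S.stuck (absY Y)" using R(2) card_Vs by (auto simp: S.stuck_def)
    then show ?thesis using R sh by (simp add: S.augments_def del: S.lev.simps)
  next
    assume "\<exists>Y' R j s t. search its D V Y = (True, (Y', R)) \<and> shape Y' \<and> S.hit (absY Y) j s t \<and>
      (\<forall>i<j. \<not> S.hits (absY Y) i) \<and> absY Y' = S.move (absY Y) s t"
    then obtain Y' R j s t where R: "search its D V Y = (True, (Y', R))" "shape Y'" "S.hit (absY Y) j s t"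
      "\<forall>i<j. \<not> S.hits (absY Y) i" "absY Y' = S.move (absY Y) s t" by blast
    have "S.hits (absY Y) j" unfolding S.hits_def using R(3) by blast
    then have ns: "\<not> S.stuck (absY Y)" using S.hits_le unfolding S.stuck_def by blast
    have "S.augments (absY Y) (absY Y')" unfolding S.augments_def if_not_P[OF ns] using R(3-5) by blast
    then show ?thesis using R(1,2) ns by simp
  qed
  then show "shape (fst (snd (search its D V Y)))" "S.augments (absY Y) (absY (fst (snd (search its D V Y))))"
    "S.stuck (absY Y) \<Longrightarrow> set (snd (snd (search its D V Y))) = S.lev (absY Y) (Suc (length V))" by blast+
qed

lemma augment_rounds:
  assumes b: "S.base (absY Y)" and sh: "shape Y" and gap: "F (sw D) (S.pre A) - S.xm (absY Y) \<le> int m"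
    and r: "m * (length V + 1) + length V < length r"
  shows "shape (foldl (\<lambda>Y _. fst (snd (search its D V Y))) Y r) \<and>
    S.base (absY (foldl (\<lambda>Y _. fst (snd (search its D V Y))) Y r)) \<and>
    S.stuck (absY (foldl (\<lambda>Y _. fst (snd (search its D V Y))) Y r))"
proof -
  let ?f = "\<lambda>Y. fst (snd (search its D V Y))"
  have sb: "shape ((?f ^^ i) Y) \<and> S.base (absY ((?f ^^ i) Y))" for i
  proof (induction i)
    case (Suc i)
    let ?Z = "(?f ^^ i) Y"
    have a: "S.augments (absY ?Z) (absY (?f ?Z))" "shape (?f ?Z)" using search_result[of ?Z] Suc by auto
    have "S.base (absY (?f ?Z))"
    proof (cases "S.stuck (absY ?Z)")
      case False
      then obtain k0 s t where "S.hit (absY ?Z) k0 s t" "\<forall>j<k0. \<not> S.hits (absY ?Z) j" "absY (?f ?Z) = S.move (absY ?Z) s t"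
        using a(1) unfolding S.augments_def by metis
      then show ?thesis using S.progress(1)[of "absY ?Z" k0 s t] Suc by simp
    qed (use a(1) Suc in \<open>auto simp: S.augments_def\<close>)
    then show ?case using a(2) by simp
  qed (use b sh in simp)
  have "S.base (absY ((?f ^^ length r) Y)) \<and> S.stuck (absY ((?f ^^ length r) Y))"
  proof (rule S.augment_until_stuck[where ys = "\<lambda>i. absY ((?f ^^ i) Y)" and S = A and g = m])
    show "S.augments (absY ((?f ^^ i) Y)) (absY ((?f ^^ Suc i) Y))" for i
      using search_result(2)[of "(?f ^^ i) Y"] sb[of i] by simp
    show "m * (card S.Vs + 1) + card S.Vs < length r"
      using r card_Vs by (meson add_mono le_less_trans le_refl mult_le_mono)
  qed (use b gap in auto)
  then show ?thesis using sb unfolding foldl_funpow by blast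
qed

end

end

section \<open>Scaling: one more binary digit per phase\<close>

context item_list
begin

abbreviation Base :: "(nat \<Rightarrow> nat) \<Rightarrow> (nat \<times> nat \<Rightarrow> int) \<Rightarrow> bool" where "Base w \<equiv> submodular.base U (F w)"
abbreviation XM :: "(nat \<times> nat \<Rightarrow> int) \<Rightarrow> int" where "XM \<equiv> submodular.xm U pv"
abbreviation PRE :: "nat set \<Rightarrow> (nat \<times> nat) set" where "PRE \<equiv> submodular.pre U pv"

lemma F_pre: "F w (PRE A) = (\<Sum>i<q. int (w i) * G i (map (\<lambda>v. v \<in> A) (x i)))"
proof -
  interpret S: submodular U "F w" pv by (rule submod)
  have "bl i (PRE A) = map (\<lambda>v. v \<in> A) (x i)" if "i < q" for i
    by (rule nth_equalityI) (use that in \<open>simp_all add: bl_nth S.pre_def pv_def len_x\<close>, simp add: U_def)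
  then show ?thesis unfolding F_def by (intro sum.cong) auto
qed

definition zz :: "bool list \<Rightarrow> nat \<times> nat \<Rightarrow> int" where
  "zz D e = (if e \<in> U \<and> odd (sw D (fst e)) then int (fst (z (fst e) ! snd e)) - int (snd (z (fst e) ! snd e)) else 0)"

lemma len_z: "i < q \<Longrightarrow> length (z i) = k i"
  using bz by (simp add: basel_def)

lemma double_nth:
  assumes "shape Y" "i < q"
  shows "double its D Y ! i = map (\<lambda>p.
     (fst (Y ! i ! p) + fst (Y ! i ! p) + (if odd (sw D i) then fst (z i ! p) else 0),
      snd (Y ! i ! p) + snd (Y ! i ! p) + (if odd (sw D i) then snd (z i ! p) else 0))) [0..<k i]"
proof (rule nth_equalityI)
  have b: "it_base (its ! i) = z i" by (simp add: its_nth[OF assms(2)])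
  show l: "length (double its D Y ! i) = length (map (\<lambda>p.
     (fst (Y ! i ! p) + fst (Y ! i ! p) + (if odd (sw D i) then fst (z i ! p) else 0),
      snd (Y ! i ! p) + snd (Y ! i ! p) + (if odd (sw D i) then snd (z i ! p) else 0))) [0..<k i])"
    using assms by (simp add: double_def shapeD b len_z)
  fix p assume "p < length (double its D Y ! i)"
  then have "p < k i" using l by simp
  then show "double its D Y ! i ! p = map (\<lambda>p.
     (fst (Y ! i ! p) + fst (Y ! i ! p) + (if odd (sw D i) then fst (z i ! p) else 0),
      snd (Y ! i ! p) + snd (Y ! i ! p) + (if odd (sw D i) then snd (z i ! p) else 0))) [0..<k i] ! p"
    using assms by (simp add: double_def shapeD b len_z lowbit scaled_its)
qed

lemma shape_double: "shape Y \<Longrightarrow> shape (double its D Y)"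
  unfolding shape_def[of "double its D Y"] by (auto simp: double_nth) (simp add: double_def shapeD)

lemma absY_double: "shape Y \<Longrightarrow> absY (double its D Y) e = 2 * absY Y e + zz D e"
  by (cases e) (auto simp: absY_def zz_def double_nth U_def)

lemma dv_double:
  assumes "shape Y" "i < q" "length A = k i"
  shows "dv A (double its D Y ! i) = 2 * dv A (Y ! i) + (if odd (sw D i) then dv A (z i) else 0)"
proof -
  have "dv A (double its D Y ! i) = (\<Sum>p<k i. 2 * (if A ! p then int (fst (Y ! i ! p)) - int (snd (Y ! i ! p)) else 0) +
     (if odd (sw D i) then (if A ! p then int (fst (z i ! p)) - int (snd (z i ! p)) else 0) else 0))"
    using assms by (subst dv_sum) (auto simp: double_nth intro!: sum.cong)
  also have "\<dots> = 2 * dv A (Y ! i) + (if odd (sw D i) then dv A (z i) else 0)"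
    using assms by (auto simp: dv_sum[of A "Y ! i"] dv_sum[of A "z i"] shapeD len_z sum.distrib sum_distrib_left)
  finally show ?thesis .
qed

lemma sw_Cons: "sw D i = 2 * sw (b # D) i + (if odd (sw D i) then 1 else 0)"
proof -
  have "sw (b # D) i = sw D i div 2" by (simp add: sw_def div_mult2_eq[symmetric] mult.commute)
  moreover have "n = 2 * (n div 2) + (if odd n then 1 else 0)" for n :: nat by (auto elim!: oddE evenE)
  ultimately show ?thesis by metis
qed

text \<open>A weight doubles and gains its next digit; correspondingly the base doubles and
  \<open>z i\<close> is added exactly where this digit is 1.\<close>

lemma base_double:
  assumes sh: "shape Y" and b: "Base (sw (b # D)) (absY Y)"
  shows "Base (sw D) (absY (double its D Y))"
  unfolding base_iff[OF shape_double[OF sh]]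
proof (intro allI impI conjI)
  have o: "\<And>i A. i < q \<Longrightarrow> length A = k i \<Longrightarrow> dv A (Y ! i) \<le> int (sw (b # D) i) * G i A"
    "\<And>i. i < q \<Longrightarrow> dv (replicate (k i) True) (Y ! i) = int (sw (b # D) i) * G i (replicate (k i) True)"
    using b unfolding base_iff[OF sh] by blast+
  have sp: "int (sw D i) * m = 2 * (int (sw (b # D) i) * m) + (if odd (sw D i) then m else 0)" for i m
    by (subst sw_Cons[of D i b]) (simp add: algebra_simps)
  fix i assume i: "i < q"
  show "dv A (double its D Y ! i) \<le> int (sw D i) * G i A" if A: "length A = k i" for A
    unfolding sp dv_double[OF sh i A] using o(1)[OF i A] bz[OF i] A by (auto simp: basel_def G_def)
  show "dv (replicate (k i) True) (double its D Y ! i) = int (sw D i) * G i (replicate (k i) True)"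
    unfolding sp using dv_double[OF sh i, of "replicate (k i) True" D] o(2)[OF i] bz[OF i]
    by (auto simp: basel_def G_def)
qed

lemma sum_zz: "(\<Sum>e\<in>U. \<bar>zz D e\<bar>) \<le> int (q * c)"
proof -
  have "(\<Sum>e\<in>U. \<bar>zz D e\<bar>) = (\<Sum>i<q. \<Sum>p<k i. \<bar>zz D (i, p)\<bar>)"
    unfolding U_def by (subst sum.Sigma) auto
  also have "\<dots> \<le> (\<Sum>i<q. int c)"
  proof (rule sum_mono)
    fix i assume "i \<in> {..<q}"
    then have i: "i < q" by simp
    have "(\<Sum>p<k i. \<bar>zz D (i, p)\<bar>) \<le> (\<Sum>p<k i. \<bar>int (fst (z i ! p)) - int (snd (z i ! p))\<bar>)"
      by (intro sum_mono) (auto simp: zz_def)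
    then show "(\<Sum>p<k i. \<bar>zz D (i, p)\<bar>) \<le> int c" using cz[OF i] by linarith
  qed
  finally show ?thesis by simp
qed

text \<open>Doubling acts alike on both sides of the duality. The added bases lower the dual value
  by at most \<open>c\<close> per constraint, and the new digits raise \<open>F\<close> on
  \<open>PRE A\<close> by at most \<open>c\<close> per constraint.\<close>

lemma gap_double:
  assumes sh: "shape Y" and A: "F (sw (b # D)) (PRE A) = XM (absY Y)"
  shows "F (sw D) (PRE A) - XM (absY (double its D Y)) \<le> int (2 * q * c)"
proof -
  interpret S: submodular U "F (sw D)" pv by (rule submod)
  have ex: "S.ex (absY (double its D Y)) v = 2 * S.ex (absY Y) v + S.ex (zz D) v" for v
    unfolding S.ex_def by (simp add: absY_double[OF sh] sum.distrib sum_distrib_left)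
  have "(\<Sum>v\<in>S.Vs. \<bar>S.ex (zz D) v\<bar>) \<le> (\<Sum>v\<in>S.Vs. \<Sum>e\<in>{e \<in> U. pv e = v}. \<bar>zz D e\<bar>)"
    unfolding S.ex_def by (intro sum_mono sum_abs)
  also have "\<dots> = (\<Sum>e\<in>U. \<bar>zz D e\<bar>)"
    using finU by (intro sum.group) (auto simp: S.Vs_def)
  finally have z1: "(\<Sum>v\<in>S.Vs. \<bar>S.ex (zz D) v\<bar>) \<le> int (q * c)" using sum_zz[of D] by linarith
  have "(\<Sum>v\<in>S.Vs. 2 * min (S.ex (absY Y) v) 0 - \<bar>S.ex (zz D) v\<bar>) \<le> XM (absY (double its D Y))"
    unfolding S.xm_def ex by (intro sum_mono) (auto simp: min_def)
  then have x: "2 * XM (absY Y) - int (q * c) \<le> XM (absY (double its D Y))"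
    using z1 unfolding S.xm_def sum_subtractf sum_distrib_left[symmetric] by linarith
  have "F (sw D) (PRE A) = (\<Sum>i<q. 2 * (int (sw (b # D) i) * G i (map (\<lambda>v. v \<in> A) (x i))) +
      (if odd (sw D i) then G i (map (\<lambda>v. v \<in> A) (x i)) else 0))"
    unfolding F_pre
  proof (intro sum.cong refl)
    fix i
    show "int (sw D i) * G i (map (\<lambda>v. v \<in> A) (x i)) = 2 * (int (sw (b # D) i) * G i (map (\<lambda>v. v \<in> A) (x i))) +
      (if odd (sw D i) then G i (map (\<lambda>v. v \<in> A) (x i)) else 0)"
      by (subst sw_Cons[of D i b]) (simp add: algebra_simps)
  qed
  also have "\<dots> = 2 * F (sw (b # D)) (PRE A) + (\<Sum>i<q. if odd (sw D i) then G i (map (\<lambda>v. v \<in> A) (x i)) else 0)"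
    by (simp add: F_pre sum.distrib sum_distrib_left)
  also have "(\<Sum>i<q. if odd (sw D i) then G i (map (\<lambda>v. v \<in> A) (x i)) else 0) \<le> (\<Sum>i<q. int c)"
  proof (rule sum_mono)
    fix i assume "i \<in> {..<q}"
    then have "int (g i (map (\<lambda>v. v \<in> A) (x i))) \<le> int c" using cg[of i] len_x by simp
    then show "(if odd (sw D i) then G i (map (\<lambda>v. v \<in> A) (x i)) else 0) \<le> int c" by (simp add: G_def)
  qed
  finally show ?thesis using x A by simp
qed

text \<open>Equality in weak duality for some set certifies optimality; its existence bounds the gap
  after the next doubling.\<close>

definition inv :: "bool list \<Rightarrow> (nat \<times> nat) list list \<Rightarrow> bool" where
  "inv D Y \<longleftrightarrow> shape Y \<and> Base (sw D) (absY Y) \<and> (\<exists>A. F (sw D) (PRE A) = XM (absY Y))"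

lemma length_concat_const: "length (concat (map (\<lambda>_. l) xs)) = length xs * length l"
  by (induction xs) auto

context
  fixes V :: "nat list" and C :: "bool list"
  assumes V: "set V = (\<Union>i<q. set (x i))" and C: "2 * c + 1 \<le> length C"
begin

lemma length_rounds: "2 * q * c * (length V + 1) + length V < length (rounds its V C)"
proof -
  have "2 * q * c * (length V + 1) + length V < 2 * q * c * (length V + 1) + (length V + 1)" by simp
  also have "\<dots> \<le> (q + 1) * ((length V + 1) * (2 * c + 1))" by (simp add: algebra_simps)
  also have "\<dots> \<le> (q + 1) * ((length V + 1) * length C)" using C by (intro mult_le_mono le_refl)
  also have "\<dots> = length (rounds its V C)" unfolding rounds_def length_concat_const by simp
  finally show ?thesis .
qed

lemma phase_inv:
  assumes "inv (b # D) Y"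
  shows "inv D (snd (phase its V C (b # D, Y))) \<and>
    submodular.stuck U (F (sw D)) pv (absY (snd (phase its V C (b # D, Y))))"
proof -
  interpret S: submodular U "F (sw D)" pv by (rule submod)
  obtain A where sh: "shape Y" and b: "Base (sw (b # D)) (absY Y)" and A: "F (sw (b # D)) (PRE A) = XM (absY Y)"
    using assms unfolding inv_def by blast
  note r = augment_rounds[OF V base_double[OF sh b] shape_double[OF sh] gap_double[OF sh A] length_rounds]
  let ?Y = "foldl (\<lambda>Y _. fst (snd (search its D V Y))) (double its D Y) (rounds its V C)"
  have "F (sw D) (PRE (S.lev (absY ?Y) (card S.Vs))) = XM (absY ?Y)"
    using r by (intro S.no_hits_optimal) (auto simp: S.stuck_def)
  then have "inv D ?Y" unfolding inv_def using r by blast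
  then show ?thesis using r by (simp add: phase_def)
qed

lemma minset_optimal: "F W (PRE (set (minset its V C))) \<le> F W (PRE A)"
proof -
  interpret S: submodular U "F (sw [])" pv by (rule submod)
  let ?Y0 = "map (\<lambda>t. map (\<lambda>_. (0, 0)) (it_base t)) its"
  have sh0: "shape ?Y0" by (simp add: shape_def its_nth len_z)
  have ab0: "absY ?Y0 = (\<lambda>_. 0)" by (auto simp: absY_def fun_eq_iff U_def its_nth len_z)
  \<comment> \<open>Before the first phase all digits are left out: every scaled weight is 0, and
    the zero vector is an optimal base.\<close>
  have sw0: "sw (bits its) i = 0" if "i < q" for i
  proof -
    have "length (bin (W i)) \<le> length (bits its)"
    proof -
      have "length (bin (it_wt (its ! i))) \<in> set (map (length \<circ> (\<lambda>t. bin (it_wt t))) its)"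
        unfolding set_map using imageI[of "its ! i" "set its" "length \<circ> (\<lambda>t. bin (it_wt t))"] nth_mem[of i its] that
        by simp
      then have "length (bin (it_wt (its ! i))) \<le> length (bits its)"
        unfolding bits_def length_concat map_map by (rule member_le_sum_list) simp
      then show ?thesis using that by (simp add: its_nth)
    qed
    then have "W i < 2 ^ length (bits its)" using length_bin_le by blast
    then show ?thesis by (simp add: sw_def)
  qed
  have dv0: "dv A (?Y0 ! i) = 0" if "i < q" "length A = k i" for A i
    using that by (subst dv_sum) (auto simp: its_nth len_z intro!: sum.neutral)
  have "F (sw (bits its)) (PRE {}) = 0" unfolding F_pre by (simp add: sw0)
  moreover have "XM (\<lambda>_. 0) = 0" by (simp add: S.xm_def S.ex_def)
  moreover have "Base (sw (bits its)) (absY ?Y0)" unfolding base_iff[OF sh0]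
    by (intro allI impI conjI) (simp_all only: dv0 sw0 length_replicate of_nat_0 mult_zero_left order_refl)
  ultimately have inv0: "inv (bits its) ?Y0" unfolding inv_def using sh0 ab0 by metis
  have "inv (drop n (bits its)) (snd ((phase its V C ^^ n) (bits its, ?Y0))) \<and>
      fst ((phase its V C ^^ n) (bits its, ?Y0)) = drop n (bits its) \<and>
      (n > 0 \<longrightarrow> submodular.stuck U (F (sw (drop n (bits its)))) pv (absY (snd ((phase its V C ^^ n) (bits its, ?Y0)))))"
    if "n \<le> length (bits its)" for n
    using that
  proof (induction n)
    case (Suc n)
    let ?s = "(phase its V C ^^ n) (bits its, ?Y0)"
    obtain b D where bD: "drop n (bits its) = b # D" using Suc.prems by (cases "drop n (bits its)") auto
    then have D: "drop (Suc n) (bits its) = D" by (metis drop_Suc list.sel(3) tl_drop)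
    have s: "?s = (b # D, snd ?s)" using Suc bD by (metis Suc_leD prod.collapse)
    have "inv (b # D) (snd ?s)" using Suc bD by (simp del: funpow.simps)
    note p = phase_inv[OF this, folded s]
    have "fst (phase its V C ?s) = D" by (subst s) (simp add: phase_def)
    then show ?case using p D by simp
  qed (use inv0 in simp)
  from this[of "length (bits its)"]
  have fin: "inv [] (snd (solve its V C))" "bits its \<noteq> [] \<Longrightarrow> S.stuck (absY (snd (solve its V C)))"
    unfolding solve_def foldl_funpow by simp_all
  have swW: "sw [] = W" by (simp add: sw_def fun_eq_iff)
  show ?thesis
  proof (cases "bits its = []")
    \<comment> \<open>No phase is run, so there is no stuck base to read from; but then all weights
      are 0 and every set is a minimiser.\<close>
    case True
    have "W i = 0" if "i < q" for i using sw0[OF that] True by (simp add: sw_def)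
    then show ?thesis unfolding F_pre by simp
  next
    case False
    let ?Y = "snd (solve its V C)"
    have b: "S.base (absY ?Y)" and sh: "shape ?Y" using fin(1) by (auto simp: inv_def)
    have "set (minset its V C) = S.lev (absY ?Y) (Suc (length V))"
      unfolding minset_def by (rule search_result(3)[OF V b sh fin(2)[OF False]])
    moreover have "F (sw []) (PRE (S.lev (absY ?Y) (Suc (length V)))) = XM (absY ?Y)"
      using fin(2)[OF False] card_Vs[OF V] by (intro S.no_hits_optimal[OF b]) (auto simp: S.stuck_def)
    moreover have "XM (absY ?Y) \<le> F (sw []) (PRE A)" by (rule S.xm_le[OF b])
    ultimately show ?thesis by (simp add: swW)
  qed
qed

end

end

text \<open>Edmonds' greedy vertex for the natural order of the positions, each increment being a
  pair of naturals.\<close>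

definition greedy :: "nat \<Rightarrow> (bool list \<Rightarrow> nat) \<Rightarrow> (nat \<times> nat) list" where
  "greedy k g = map (\<lambda>p. (g (map (\<lambda>r. r \<le> p) [0..<k]), g (map (\<lambda>r. r < p) [0..<k]))) [0..<k]"

text \<open>Induction over the prefixes: when position \<open>n\<close> of \<open>A\<close> is
  added, submodularity for \<open>A\<close> restricted to the longer prefix and the shorter prefix
  shows that the increment in \<open>A\<close> is at least the increment along the chain of
  prefixes. On the full set the increments telescope.\<close>

lemma basel_greedy:
  assumes sm: "submodl k g"
  shows "basel k g (greedy k g)"
proof -
  have l: "length (greedy k g) = k" by (simp add: greedy_def)
  define P where "P n = map (\<lambda>r. r < n) [0..<k]" for n
  define s where "s A n = (\<Sum>p<n. if A ! p then int (g (P (Suc p))) - int (g (P p)) else 0)" for A :: "bool list" and n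
  have dv: "dv A (greedy k g) = s A k" if "length A = k" for A
    using that unfolding s_def by (subst dv_sum) (auto simp: l greedy_def P_def less_Suc_eq_le intro!: sum.cong)
  have le: "s A n \<le> int (g (map2 (\<and>) A (P n))) - int (g (replicate k False))" if A: "length A = k" and n: "n \<le> k" for A n
    using n
  proof (induction n)
    case 0
    have "map2 (\<and>) A (P 0) = replicate k False" by (rule nth_equalityI) (use A in \<open>auto simp: P_def\<close>)
    then show ?case by (simp add: s_def)
  next
    case (Suc n)
    let ?X = "map2 (\<and>) A (P (Suc n))"
    show ?case
    proof (cases "A ! n")
      case True
      have u: "map2 (\<or>) ?X (P n) = P (Suc n)"
        by (rule nth_equalityI) (use A True in \<open>auto simp: P_def less_Suc_eq\<close>)
      have i: "map2 (\<and>) ?X (P n) = map2 (\<and>) A (P n)"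
        by (rule nth_equalityI) (use A in \<open>auto simp: P_def\<close>)
      have "g (map2 (\<or>) ?X (P n)) + g (map2 (\<and>) ?X (P n)) \<le> g ?X + g (P n)"
        using sm A unfolding submodl_def by (simp add: P_def)
      then have "int (g (P (Suc n))) + int (g (map2 (\<and>) A (P n))) \<le> int (g ?X) + int (g (P n))"
        unfolding u i by linarith
      then show ?thesis using Suc True by (simp add: s_def)
    next
      case False
      have "?X = map2 (\<and>) A (P n)"
        by (rule nth_equalityI) (use A False in \<open>auto simp: P_def less_Suc_eq\<close>)
      then show ?thesis using Suc False by (simp add: s_def)
    qed
  qed
  have full: "s (replicate k True) n = int (g (P n)) - int (g (P 0))" if "n \<le> k" for n
    using that by (induction n) (auto simp: s_def)
  have P0: "P 0 = replicate k False" and Pk: "P k = replicate k True"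
    by (rule nth_equalityI; simp add: P_def)+
  have "map2 (\<and>) A (P k) = A" if "length A = k" for A
    by (rule nth_equalityI) (use that in \<open>auto simp: P_def\<close>)
  then show ?thesis unfolding basel_def using l dv le[of _ k] full[of k] P0 Pk by auto
qed

section \<open>Expressing disequality\<close>

text \<open>
  A gadget is a list of constraints with integer coefficients. The variables 2 and 3 are meant
  to carry the constants 0 and 1.
\<close>

type_synonym gadget = "(nat \<times> cost_fun \<times> nat list) list"

definition gval :: "gadget \<Rightarrow> (nat \<Rightarrow> bool) \<Rightarrow> rat" where
  "gval G h = (\<Sum>t\<leftarrow>G. of_nat (fst t) * snd (fst (snd t)) (map h (snd (snd t))))"

definition gwf :: "cost_fun set \<Rightarrow> nat set \<Rightarrow> gadget \<Rightarrow> bool" where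
  "gwf \<Delta> X G \<longleftrightarrow> (\<forall>t\<in>set G. fst (snd t) \<in> \<Delta> \<and> length (snd (snd t)) = fst (fst (snd t)) \<and> set (snd (snd t)) \<subseteq> X)"

definition gscale :: "nat \<Rightarrow> gadget \<Rightarrow> gadget" where
  "gscale m G = map (\<lambda>t. (m * fst t, snd t)) G"

definition gren :: "(nat \<Rightarrow> nat) \<Rightarrow> gadget \<Rightarrow> gadget" where
  "gren \<sigma> G = map (\<lambda>t. (fst t, (fst (snd t), map \<sigma> (snd (snd t))))) G"

lemma gval_append: "gval (G @ H) h = gval G h + gval H h"
  by (simp add: gval_def)

lemma gval_scale: "gval (gscale m G) h = of_nat m * gval G h"
  by (induction G) (simp_all add: gval_def gscale_def algebra_simps)

lemma gval_ren: "gval (gren \<sigma> G) h = gval G (\<lambda>i. h (\<sigma> i))"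
  by (simp add: gval_def gren_def o_def)

lemma gwf_append: "gwf \<Delta> X (G @ H) \<longleftrightarrow> gwf \<Delta> X G \<and> gwf \<Delta> X H"
  by (auto simp: gwf_def)

lemma gwf_scale: "gwf \<Delta> X G \<Longrightarrow> gwf \<Delta> X (gscale m G)"
  by (auto simp: gwf_def gscale_def)

lemma gwf_ren: "gwf \<Delta> X G \<Longrightarrow> \<sigma> ` X \<subseteq> X' \<Longrightarrow> gwf \<Delta> X' (gren \<sigma> G)"
  by (fastforce simp: gwf_def gren_def)

lemma gval_cong: "gwf \<Delta> X G \<Longrightarrow> (\<And>i. i \<in> X \<Longrightarrow> h i = h' i) \<Longrightarrow> gval G h = gval G h'"
  unfolding gval_def gwf_def
  by (intro arg_cong[of _ _ sum_list] map_cong refl arg_cong2[of _ _ _ _ "(*)"] arg_cong[where f = "snd _"]) auto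

lemma common_denominator:
  assumes "finite X" "X \<subseteq> {0 :: rat..}"
  shows "\<exists>m>0. \<forall>r\<in>X. \<exists>n. of_nat m * r = of_nat n"
  using assms
proof (induction X)
  case (insert r X)
  then obtain m where m: "m > 0" "\<forall>r\<in>X. \<exists>n. of_nat m * r = of_nat n" by auto
  obtain a b where ab: "quotient_of r = (a, b)" by (cases "quotient_of r")
  have b: "b > 0" and r: "r = of_int a / of_int b" using ab quotient_of_denom_pos quotient_of_div by auto
  have a: "a \<ge> 0" using insert.prems r b by (auto simp: zero_le_divide_iff)
  have "of_nat (m * nat b) * r = of_nat (m * nat a)" using a b by (simp add: r)
  moreover have "\<exists>n. of_nat (m * nat b) * s = of_nat n" if sX: "s \<in> X" for s
  proof -
    obtain n where "of_nat m * s = of_nat n" using m sX by blast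
    then have "of_nat (m * nat b) * s = of_nat (nat b * n)" by (simp add: mult.commute mult.left_commute)
    then show ?thesis by blast
  qed
  ultimately have "\<forall>s\<in>insert r X. \<exists>n. of_nat (m * nat b) * s = of_nat n" by blast
  moreover have "0 < m * nat b" using m b by simp
  ultimately show ?case by blast
qed auto

section \<open>From the three violations to the gadget\<close>

locale hard_case =
  fixes \<Delta> :: "cost_fun set" and f0 f1 fn :: cost_fun and t0 t1 s t :: "bool list"
  assumes fin: "finite \<Delta>" and fv: "\<Delta> \<subseteq> finite_valued_cost_functions"
    and f0: "f0 \<in> \<Delta>" "length t0 = fst f0" "snd f0 t0 < snd f0 (replicate (fst f0) False)"
    and f1: "f1 \<in> \<Delta>" "length t1 = fst f1" "snd f1 t1 < snd f1 (replicate (fst f1) True)"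
    and fn: "fn \<in> \<Delta>" "length s = fst fn" "length t = fst fn"
      "snd fn s + snd fn t < snd fn (map2 (\<and>) s t) + snd fn (map2 (\<or>) s t)"
begin

definition symm :: bool where
  "symm \<longleftrightarrow> (\<forall>f\<in>\<Delta>. \<forall>u. length u = fst f \<longrightarrow> snd f (map Not u) = snd f u)"

definition two :: "bool \<Rightarrow> bool \<Rightarrow> nat \<Rightarrow> bool" where
  "two a b i = (if i = 3 then b else a)"

lemma nonneg: "f \<in> \<Delta> \<Longrightarrow> length u = fst f \<Longrightarrow> 0 \<le> snd f u"
  using fv by (fastforce simp: finite_valued_cost_functions_def PiE_def Pi_def)

definition pat :: "cost_fun \<Rightarrow> bool list \<Rightarrow> gadget" where
  "pat f u = [(1, (f, map (\<lambda>b. if b then 3 else 2) u))]"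

lemma pat: "f \<in> \<Delta> \<Longrightarrow> length u = fst f \<Longrightarrow> gwf \<Delta> {2, 3} (pat f u)"
  "gval (pat f u) (two False True) = snd f u"
  "gval (pat f u) (two True False) = snd f (map Not u)"
  "length u = fst f \<Longrightarrow> gval (pat f u) (two b b) = snd f (replicate (fst f) b)"
proof -
  show "f \<in> \<Delta> \<Longrightarrow> length u = fst f \<Longrightarrow> gwf \<Delta> {2, 3} (pat f u)" by (auto simp: gwf_def pat_def)
  have v: "gval (pat f u) h = snd f (map (\<lambda>b. if b then h 3 else h 2) u)" for h
    by (simp add: gval_def pat_def o_def if_distrib cong: map_cong)
  have "(\<lambda>b. if b then two False True 3 else two False True 2) = (\<lambda>b. b)"
    "(\<lambda>b. if b then two True False 3 else two True False 2) = Not"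
    "(\<lambda>c. if c then two b b 3 else two b b 2) = (\<lambda>_. b)" for b
    by (auto simp: two_def fun_eq_iff)
  then show "gval (pat f u) (two False True) = snd f u" "gval (pat f u) (two True False) = snd f (map Not u)"
    "length u = fst f \<Longrightarrow> gval (pat f u) (two b b) = snd f (replicate (fst f) b)"
    unfolding v by (simp_all add: map_replicate_const)
qed

definition good :: "gadget \<Rightarrow> bool" where
  "good P \<longleftrightarrow> gwf \<Delta> {2, 3} P \<and> gval P (two False True) < gval P (two False False) \<and>
     gval P (two False True) < gval P (two True True)"

text \<open>The variables 2 and 3 are placed according to \<open>u\<close> or its complement,
  whichever is cheaper; both compete with the same two constant tuples.\<close>

lemma good_from_tuple:
  assumes "f \<in> \<Delta>" "length u = fst f" "snd f u < snd f (replicate (fst f) False)" "snd f u < snd f (replicate (fst f) True)"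
  shows "\<exists>P. good P \<and> gval P (two False True) \<le> gval P (two True False)"
proof -
  have n: "map Not (map Not u) = u" by (simp add: o_def)
  have "good (pat f u) \<and> gval (pat f u) (two False True) \<le> gval (pat f u) (two True False)" if "snd f u \<le> snd f (map Not u)"
    using that assms by (simp add: good_def pat)
  moreover have "good (pat f (map Not u)) \<and> gval (pat f (map Not u)) (two False True) \<le> gval (pat f (map Not u)) (two True False)"
    if "\<not> snd f u \<le> snd f (map Not u)"
    using that assms by (simp add: good_def pat n del: map_map)
  ultimately show ?thesis by blast
qed

text \<open>If one function prefers all-1 to all-0 and another the reverse, applying the first to
  copies of 3 and the second to copies of 2 works. Otherwise all functions lean weakly to one
  constant, and the tuple that beats the less costly of the two, given by \<open>f0\<close> or
  \<open>f1\<close>, beats both.\<close>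

lemma exists_good_le: "\<exists>P. good P \<and> gval P (two False True) \<le> gval P (two True False)"
proof -
  let ?c = "\<lambda>f b. snd f (replicate (fst f) b)"
  consider (A) f f' where "f \<in> \<Delta>" "f' \<in> \<Delta>" "?c f True < ?c f False" "?c f' False < ?c f' True"
    | (B) "\<forall>f\<in>\<Delta>. ?c f True \<le> ?c f False" | (C) "\<forall>f\<in>\<Delta>. ?c f False \<le> ?c f True"
    by (meson not_le)
  then show ?thesis
  proof cases
    case A
    define P where "P = ([(1, (f, replicate (fst f) 3)), (1, (f', replicate (fst f') 2))] :: gadget)"
    have v: "gval P (two a b) = ?c f b + ?c f' a" for a b by (simp add: P_def gval_def two_def)
    have "gwf \<Delta> {2, 3} P" using A by (auto simp: P_def gwf_def)
    then show ?thesis using A by (intro exI[of _ P]) (simp add: good_def v)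
  next
    case B
    then have "?c f1 True \<le> ?c f1 False" using f1 by blast
    then show ?thesis using f1 by (intro good_from_tuple[of f1 t1]) auto
  next
    case C
    then have "?c f0 False \<le> ?c f0 True" using f0 by blast
    then show ?thesis using f0 by (intro good_from_tuple[of f0 t0]) auto
  qed
qed

text \<open>A tie between the two nonconstant assignments is broken by one constraint that
  distinguishes a tuple from its complement. Before it is added, \<open>P\<close> is multiplied so
  far that its margin \<open>d\<close> against the constant assignments outweighs the added
  cost.\<close>

lemma exists_good: "\<exists>P. good P \<and> (symm \<or> gval P (two False True) < gval P (two True False))"
proof -
  obtain P where P: "good P" "gval P (two False True) \<le> gval P (two True False)" using exists_good_le by blast
  show ?thesis
  proof (cases "symm \<or> gval P (two False True) < gval P (two True False)")
    case False
    then have eq: "gval P (two False True) = gval P (two True False)" using P by simp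
    obtain f u where fu: "f \<in> \<Delta>" "length u = fst f" "snd f u < snd f (map Not u)"
    proof -
      obtain f u where fu: "f \<in> \<Delta>" "length u = fst f" "snd f (map Not u) \<noteq> snd f u" using False symm_def by blast
      have n: "map Not (map Not u) = u" by (simp add: o_def)
      show ?thesis
      proof (cases "snd f u < snd f (map Not u)")
        case True
        then show ?thesis using fu that by blast
      next
        case False
        then show ?thesis using fu that[of f "map Not u"] n by (simp del: map_map)
      qed
    qed
    define d where "d = min (gval P (two False False)) (gval P (two True True)) - gval P (two False True)"
    have d: "d > 0" using P by (simp add: d_def good_def)
    obtain n where n: "snd f u / d < of_nat n" using reals_Archimedean2 by blast
    then have n: "snd f u < of_nat n * d" using d by (simp add: pos_divide_less_eq)
    let ?P = "gscale n P @ pat f u"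
    have v: "gval ?P h = of_nat n * gval P h + gval (pat f u) h" for h by (simp add: gval_append gval_scale)
    have "gval ?P (two False True) < gval ?P (two b b)" for b
    proof -
      have "d \<le> gval P (two b b) - gval P (two False True)" by (cases b) (auto simp: d_def)
      then have "of_nat n * d \<le> of_nat n * (gval P (two b b) - gval P (two False True))" by (rule mult_left_mono) simp
      then have "of_nat n * gval P (two False True) + snd f u < of_nat n * gval P (two b b)" using n by (simp add: algebra_simps)
      moreover have "0 \<le> snd f (replicate (fst f) b)" using nonneg fu by simp
      ultimately show ?thesis using fu by (simp add: v pat)
    qed
    moreover have "gwf \<Delta> {2, 3} ?P" using P fu by (auto simp: gwf_append good_def intro: gwf_scale pat)
    moreover have "gval ?P (two False True) < gval ?P (two True False)" using fu eq by (simp add: v pat)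
    ultimately show ?thesis by (auto simp: good_def)
  qed (use P in blast)
qed

lemma gval_nonneg: "gwf \<Delta> X G \<Longrightarrow> 0 \<le> gval G h"
  unfolding gval_def gwf_def by (intro sum_list_nonneg) (auto intro!: mult_nonneg_nonneg nonneg)

lemma integral: "\<exists>m>0. \<forall>X G h. gwf \<Delta> X G \<longrightarrow> (\<exists>n. gval (gscale m G) h = of_nat n)"
proof -
  let ?X = "(\<Union>f\<in>\<Delta>. snd f ` {u. length u = fst f})"
  have "finite {u :: bool list. length u = n}" for n using finite_lists_length_eq[of "UNIV :: bool set" n] by simp
  then have "finite ?X" using fin by blast
  moreover have "?X \<subseteq> {0..}" using nonneg by auto
  ultimately obtain m where m: "m > 0" "\<forall>r\<in>?X. \<exists>n. of_nat m * r = of_nat n" using common_denominator by blast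
  have "\<exists>n. gval (gscale m G) h = of_nat n" if "gwf \<Delta> X G" for X G h
    using that
  proof (induction G)
    case Nil
    show ?case by (simp add: gval_def gscale_def)
  next
    case (Cons g G)
    obtain c f p where g: "g = (c, (f, p))" by (cases g) auto
    have "snd f (map h p) \<in> ?X" using Cons.prems by (intro UN_I[of f] imageI) (auto simp: gwf_def g)
    then obtain n where n: "of_nat m * snd f (map h p) = of_nat n" using m by blast
    obtain n' where n': "gval (gscale m G) h = of_nat n'" using Cons by (auto simp: gwf_def)
    have "gval (gscale m (g # G)) h = of_nat (c * n + n')"
      using n n' by (simp add: gval_def gscale_def g)
    then show ?case by blast
  qed
  then show ?thesis using m by blast
qed

text \<open>A violation of submodularity controls only the mean of the values at 00 and 11:
  symmetrised, it says 2 * b0 < a0 + a1. A unary term has to level a0 and a1. Putting an argument in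
  place of one of the constants in \<open>P\<close> gives such a term, in the direction that is
  needed.\<close>

lemma neq_gadget:
  "\<exists>G P a b c. gwf \<Delta> {..<4} G \<and> gwf \<Delta> {2, 3} P \<and> b < a \<and>
     (\<forall>h. \<not> h 2 \<longrightarrow> h 3 \<longrightarrow> gval G h = of_nat (if h 0 = h 1 then a else b)) \<and>
     (\<forall>h. \<not> h 2 \<longrightarrow> h 3 \<longrightarrow> gval P h = of_nat c) \<and>
     (\<forall>h. h 2 = h 3 \<longrightarrow> of_nat (c + 1) \<le> gval P h) \<and>
     (symm \<or> (\<forall>h. h 2 \<longrightarrow> \<not> h 3 \<longrightarrow> of_nat (c + 1) \<le> gval P h))"
proof -
  obtain P0 where P0: "good P0" "symm \<or> gval P0 (two False True) < gval P0 (two True False)"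
    using exists_good by blast
  obtain m where m: "m > 0" "\<And>X G h. gwf \<Delta> X G \<Longrightarrow> \<exists>n. gval (gscale m G) h = of_nat n" using integral by blast
  define P where "P = gscale m P0"
  have wP: "gwf \<Delta> {2, 3} P" using P0 by (auto simp: P_def good_def intro: gwf_scale)
  have wP0: "gwf \<Delta> {2, 3} P0" using P0 by (auto simp: good_def)
  define v where "v a b = (SOME n. gval P (two a b) = of_nat n)" for a b
  have v: "gval P (two a b) = of_nat (v a b)" for a b
    unfolding v_def by (rule someI_ex) (use m(2)[OF wP0] in \<open>simp add: P_def\<close>)
  have vh: "gval P h = of_nat (v (h 2) (h 3))" for h
  proof -
    have "gval P h = gval P (two (h 2) (h 3))" by (rule gval_cong[OF wP]) (auto simp: two_def)
    then show ?thesis by (simp only: v)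
  qed
  have lt: "v False True < v False False" "v False True < v True True" "symm \<or> v False True < v True False"
  proof -
    have "gval P (two False True) < gval P (two False False)" "gval P (two False True) < gval P (two True True)"
      "symm \<or> gval P (two False True) < gval P (two True False)"
      using P0 m(1) by (simp_all add: good_def P_def gval_scale)
    then show "v False True < v False False" "v False True < v True True" "symm \<or> v False True < v True False"
      unfolding v of_nat_less_iff .
  qed
  \<comment> \<open>Positions are sorted by their bits in \<open>s\<close> and \<open>t\<close>:
    agreeing ones become constants, the others one of the two arguments. The arguments 00, 11, 01
    and 10 then produce the meet, the join, \<open>s\<close> and \<open>t\<close>.\<close>
  define q where "q = map2 (\<lambda>a b. if a then if b then 3 else 1 else if b then 0 else (2 :: nat)) s t"
  \<comment> \<open>Adding the copy with the arguments exchanged makes the two mixed values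
    equal.\<close>
  define sw where "sw = (\<lambda>i :: nat. if i = 0 then 1 else if i = 1 then 0 else i)"
  define S0 where "S0 = ([(1, (fn, q)), (1, (fn, map sw q))] :: gadget)"
  have q4: "set q \<subseteq> {..<4}" by (auto simp: q_def)
  have sw4: "sw i < 4" if "i < 4" for i using that by (auto simp: sw_def)
  have wS0: "gwf \<Delta> {..<4} S0" using fn q4 sw4 by (auto simp: gwf_def S0_def q_def)
  define S where "S = gscale m S0"
  have wS: "gwf \<Delta> {..<4} S" using wS0 by (auto simp: S_def intro: gwf_scale)
  define hx where "hx x y i = (if i = 0 then x else if i = 1 then y else if i = 2 then False else True)"
    for x y and i :: nat
  obtain a0 where a0: "gval S (hx False False) = of_nat a0" using m(2)[OF wS0] unfolding S_def by blast
  obtain a1 where a1: "gval S (hx True True) = of_nat a1" using m(2)[OF wS0] unfolding S_def by blast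
  obtain b0 where b0: "gval S (hx False True) = of_nat b0" using m(2)[OF wS0] unfolding S_def by blast
  have len: "length s = length t" using fn by simp
  have e: "map (hx False False) q = map2 (\<and>) s t" "map (hx True True) q = map2 (\<or>) s t"
    "map (hx False True) q = s" "map (hx True False) q = t"
    by (rule nth_equalityI; simp add: q_def len hx_def)+
  have e': "map (hx x y) (map sw q) = map (hx y x) q" for x y
    using q4 by (auto simp: sw_def hx_def)
  have S: "gval S (hx x y) = of_nat m * (snd fn (map (hx x y) q) + snd fn (map (hx y x) q))" for x y
  proof -
    have "gval S0 (hx x y) = snd fn (map (hx x y) q) + snd fn (map (hx x y) (map sw q))"
      by (simp add: S0_def gval_def del: map_map)
    then show ?thesis unfolding S_def gval_scale e' by (rule arg_cong)
  qed
  have b0': "gval S (hx True False) = of_nat b0" using b0 unfolding S by (simp add: add.commute)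
  have ab: "2 * b0 < a0 + a1"
  proof -
    have "of_nat m * (snd fn s + snd fn t) < of_nat m * (snd fn (map2 (\<and>) s t) + snd fn (map2 (\<or>) s t))"
      using fn(4) m(1) by simp
    then have "(2 :: rat) * of_nat b0 < of_nat a0 + of_nat a1"
      unfolding a0[symmetric] a1[symmetric] b0[symmetric] S e by (simp add: algebra_simps)
    then show ?thesis by (metis of_nat_add of_nat_less_iff of_nat_mult of_nat_numeral)
  qed
  have Sh: "gval S h = of_nat (if h 0 then if h 1 then a1 else b0 else if h 1 then b0 else a0)"
    if "\<not> h 2" "h 3" for h
  proof -
    have "gval S h = gval S (hx (h 0) (h 1))"
    proof (rule gval_cong[OF wS])
      fix i :: nat assume "i \<in> {..<4}"
      then have "i = 0 \<or> i = 1 \<or> i = 2 \<or> i = 3" by auto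
      then show "h i = hx (h 0) (h 1) i" using that by (auto simp: hx_def)
    qed
    then show ?thesis using a0 a1 b0 b0' by (cases "h 0"; cases "h 1") simp_all
  qed
  have main: "\<exists>G a b. gwf \<Delta> {..<4} G \<and> b < a \<and>
     (\<forall>h. \<not> h 2 \<longrightarrow> h 3 \<longrightarrow> gval G h = of_nat (if h 0 = h 1 then a else b))"
  proof (cases "a1 \<le> a0")
    case True
    define d where "d = v True True - v False True"
    have vd: "v True True = v False True + d" "0 < d" using lt by (auto simp: d_def)
    obtain n where n: "a0 = a1 + n" using True le_Suc_ex by blast
    \<comment> \<open>\<open>P\<close> with an argument in place of the constant 0 costs
      \<open>d\<close> more at 1 than at 0. Taken \<open>n\<close> times for both arguments it adds
      an extra 2dn at 11 and dn at mixed pairs; the factor 2d on \<open>S\<close> turns the excess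
      \<open>n\<close> of a0 over a1 into the same 2dn.\<close>
    define G where "G = gscale (2 * d) S @ gscale n (gren (\<lambda>i. if i = 2 then 0 else i) P @ gren (\<lambda>i. if i = 2 then 1 else i) P)"
    have w: "gwf \<Delta> {..<4} G" unfolding G_def gwf_append
      using wS by (intro conjI gwf_scale gwf_append[THEN iffD2] gwf_ren[OF wP]) auto
    have "gval G h = of_nat (if h 0 = h 1 then 2 * d * a0 + 2 * n * v False True else 2 * d * b0 + n * (v False True + v True True))"
      if "\<not> h 2" "h 3" for h
      unfolding G_def gval_append gval_scale gval_ren Sh[OF that] vh using that
      by (cases "h 0"; cases "h 1") (simp_all add: n vd algebra_simps)
    moreover have "2 * d * b0 + n * (v False True + v True True) < 2 * d * a0 + 2 * n * v False True"
    proof -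
      have "d * (2 * b0) < d * (a0 + a1)" using ab vd(2) by simp
      then show ?thesis by (simp add: vd n algebra_simps)
    qed
    ultimately show ?thesis using w by blast
  next
    case False
    define d where "d = v False False - v False True"
    have vd: "v False False = v False True + d" "0 < d" using lt by (auto simp: d_def)
    obtain n where n: "a1 = a0 + n" using False le_Suc_ex nat_le_linear by blast
    \<comment> \<open>The mirror image: the argument replaces the constant 1, so the surcharge
      \<open>d\<close> falls on the value 0.\<close>
    define G where "G = gscale (2 * d) S @ gscale n (gren (\<lambda>i. if i = 3 then 0 else i) P @ gren (\<lambda>i. if i = 3 then 1 else i) P)"
    have w: "gwf \<Delta> {..<4} G" unfolding G_def gwf_append
      using wS by (intro conjI gwf_scale gwf_append[THEN iffD2] gwf_ren[OF wP]) auto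
    have "gval G h = of_nat (if h 0 = h 1 then 2 * d * a1 + 2 * n * v False True else 2 * d * b0 + n * (v False True + v False False))"
      if "\<not> h 2" "h 3" for h
      unfolding G_def gval_append gval_scale gval_ren Sh[OF that] vh using that
      by (cases "h 0"; cases "h 1") (simp_all add: n vd algebra_simps)
    moreover have "2 * d * b0 + n * (v False True + v False False) < 2 * d * a1 + 2 * n * v False True"
    proof -
      have "d * (2 * b0) < d * (a0 + a1)" using ab vd(2) by simp
      then show ?thesis by (simp add: vd n algebra_simps)
    qed
    ultimately show ?thesis using w by blast
  qed
  then obtain G a b where G: "gwf \<Delta> {..<4} G" "b < a"
     "\<forall>h. \<not> h 2 \<longrightarrow> h 3 \<longrightarrow> gval G h = of_nat (if h 0 = h 1 then a else b)" by blast
  have c1: "of_nat (v False True + 1) \<le> (of_nat (v x y) :: rat)" if "v False True < v x y" for x y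
    using that by (simp del: of_nat_add of_nat_Suc)
  have "\<forall>h. h 2 = h 3 \<longrightarrow> of_nat (v False True + 1) \<le> gval P h"
  proof (intro allI impI)
    fix h :: "nat \<Rightarrow> bool" assume "h 2 = h 3"
    then show "of_nat (v False True + 1) \<le> gval P h"
      unfolding vh using lt(1,2) by (intro c1) (cases "h 2"; simp)
  qed
  moreover have "symm \<or> (\<forall>h. h 2 \<longrightarrow> \<not> h 3 \<longrightarrow> of_nat (v False True + 1) \<le> gval P h)"
    unfolding vh using lt(3) c1[of True False] by (auto simp del: of_nat_add)
  moreover have "\<forall>h. \<not> h 2 \<longrightarrow> h 3 \<longrightarrow> gval P h = of_nat (v False True)" by (simp add: vh)
  ultimately show ?thesis using G wP by blast
qed

end

section \<open>The algorithm runs in polynomial time\<close>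

text \<open>Passes from a curried function to nested pairs, so that the closure rules can be applied
  to its body with projections as variables.\<close>

lemma polyf_comp2: "polyf (\<lambda>p. f (fst p) (snd p)) \<Longrightarrow> polyf a \<Longrightarrow> polyf b \<Longrightarrow> polyf (\<lambda>x. f (a x) (b x))"
  using polyf_comp[of "\<lambda>p. f (fst p) (snd p)" "\<lambda>x. (a x, b x)"] by (simp add: polyf_Pair)

lemma polyf_comp3: "polyf (\<lambda>p. f (fst p) (fst (snd p)) (snd (snd p))) \<Longrightarrow> polyf a \<Longrightarrow> polyf b \<Longrightarrow> polyf c \<Longrightarrow>
    polyf (\<lambda>x. f (a x) (b x) (c x))"
  using polyf_comp[of "\<lambda>p. f (fst p) (fst (snd p)) (snd (snd p))" "\<lambda>x. (a x, (b x, c x))"] by (simp add: polyf_Pair)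

lemma polyf_comp4: "polyf (\<lambda>p. f (fst p) (fst (snd p)) (fst (snd (snd p))) (snd (snd (snd p)))) \<Longrightarrow>
    polyf a \<Longrightarrow> polyf b \<Longrightarrow> polyf c \<Longrightarrow> polyf d \<Longrightarrow> polyf (\<lambda>x. f (a x) (b x) (c x) (d x))"
  using polyf_comp[of "\<lambda>p. f (fst p) (fst (snd p)) (fst (snd (snd p))) (snd (snd (snd p)))" "\<lambda>x. (a x, (b x, (c x, d x)))"]
  by (simp add: polyf_Pair)

lemma polyf_comp5: "polyf (\<lambda>p. f (fst p) (fst (snd p)) (fst (snd (snd p))) (fst (snd (snd (snd p)))) (snd (snd (snd (snd p))))) \<Longrightarrow>
    polyf a \<Longrightarrow> polyf b \<Longrightarrow> polyf c \<Longrightarrow> polyf d \<Longrightarrow> polyf e \<Longrightarrow> polyf (\<lambda>x. f (a x) (b x) (c x) (d x) (e x))"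
  using polyf_comp[of "\<lambda>p. f (fst p) (fst (snd p)) (fst (snd (snd p))) (fst (snd (snd (snd p)))) (snd (snd (snd (snd p))))"
      "\<lambda>x. (a x, (b x, (c x, (d x, e x))))"]
  by (simp add: polyf_Pair)

lemma polyf_comp6: "polyf (\<lambda>p. f (fst p) (fst (snd p)) (fst (snd (snd p))) (fst (snd (snd (snd p))))
      (fst (snd (snd (snd (snd p))))) (snd (snd (snd (snd (snd p)))))) \<Longrightarrow>
    polyf a \<Longrightarrow> polyf b \<Longrightarrow> polyf c \<Longrightarrow> polyf d \<Longrightarrow> polyf e \<Longrightarrow> polyf g \<Longrightarrow> polyf (\<lambda>x. f (a x) (b x) (c x) (d x) (e x) (g x))"
  using polyf_comp[of "\<lambda>p. f (fst p) (fst (snd p)) (fst (snd (snd p))) (fst (snd (snd (snd p))))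
      (fst (snd (snd (snd (snd p))))) (snd (snd (snd (snd (snd p)))))" "\<lambda>x. (a x, (b x, (c x, (d x, (e x, g x)))))"]
  by (simp add: polyf_Pair)

lemma polyf_dota [polyf_intros]: "polyf A \<Longrightarrow> polyf y \<Longrightarrow> polyf (\<lambda>x. dota (A x) (y x))"
  by (rule polyf_comp2) (unfold dota_def, intro polyf_intros)

lemma polyf_dotb [polyf_intros]: "polyf A \<Longrightarrow> polyf y \<Longrightarrow> polyf (\<lambda>x. dotb (A x) (y x))"
  by (rule polyf_comp2) (unfold dotb_def, intro polyf_intros)

lemma polyf_movable [polyf_intros]:
  "polyf w \<Longrightarrow> polyf z \<Longrightarrow> polyf A \<Longrightarrow> polyf y \<Longrightarrow> polyf (\<lambda>x. movable (w x) (z x) (A x) (y x))"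
  by (rule polyf_comp4) (unfold movable_def, intro polyf_intros)

lemma polyf_exa [polyf_intros]: "polyf its \<Longrightarrow> polyf Y \<Longrightarrow> polyf v \<Longrightarrow> polyf (\<lambda>x. exa (its x) (Y x) (v x))"
  by (rule polyf_comp3) (unfold exa_def, intro polyf_intros)

lemma polyf_exb [polyf_intros]: "polyf its \<Longrightarrow> polyf Y \<Longrightarrow> polyf v \<Longrightarrow> polyf (\<lambda>x. exb (its x) (Y x) (v x))"
  by (rule polyf_comp3) (unfold exb_def, intro polyf_intros)

lemma polyf_elem [polyf_intros]: "polyf v \<Longrightarrow> polyf R \<Longrightarrow> polyf (\<lambda>x. elem (v x) (R x))"
  by (rule polyf_comp2) (unfold elem_def, intro polyf_intros)

lemma polyf_sel [polyf_intros]: "polyf m \<Longrightarrow> polyf xs \<Longrightarrow> polyf (\<lambda>x. sel (m x) (xs x))"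
  by (rule polyf_comp2) (unfold sel_def, intro polyf_intros)

lemma polyf_scaled [polyf_intros]: "polyf D \<Longrightarrow> polyf t \<Longrightarrow> polyf (\<lambda>x. scaled (D x) (t x))"
  by (rule polyf_comp2) (unfold scaled_def, intro polyf_intros)

lemma polyf_cands [polyf_intros]: "polyf its \<Longrightarrow> polyf D \<Longrightarrow> polyf Y \<Longrightarrow> polyf R \<Longrightarrow> polyf t \<Longrightarrow> polyf y \<Longrightarrow>
    polyf (\<lambda>x. cands (its x) (D x) (Y x) (R x) (t x) (y x))"
  by (rule polyf_comp6) (unfold cands_def, intro polyf_intros)

lemma polyf_push_unit [polyf_intros]: "polyf r \<Longrightarrow> polyf y \<Longrightarrow> polyf (\<lambda>x. push_unit (r x) (y x))"
  by (rule polyf_comp2) (unfold push_unit_def, intro polyf_intros)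

text \<open>Growth is charged to the first list. In the uses below this is fixed data while the
  second list is being updated, so the growth is additive.\<close>

lemma wt_map_zip:
  assumes "\<And>z. z \<in> set (zip as bs) \<Longrightarrow> wt (f z) \<le> wt (snd z) + K * wt (fst z)"
  shows "wt (map f (zip as bs)) \<le> wt bs + K * wt as"
  using assms
proof (induction as arbitrary: bs)
  case Nil
  have "1 \<le> wt bs" by (simp add: Suc_leI)
  then show ?case by simp
next
  case (Cons a as)
  show ?case
  proof (cases bs)
    case (Cons b bs')
    have "wt (map f (zip as bs')) \<le> wt bs' + K * wt as" using Cons Cons.prems by (intro Cons.IH) auto
    moreover have "wt (f (a, b)) \<le> wt b + K * wt a" using Cons Cons.prems[of "(a, b)"] by simp
    ultimately show ?thesis using Cons by (simp add: algebra_simps)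
  qed simp
qed

lemma wt_Suc: "wt (Suc n) \<le> wt n + 4"
  using length_bin_le[of "Suc n" "Suc (length (bin n))"] less_two_power_length_bin[of n] by (simp add: wt_nat)

lemma wt_fst_le: "wt (fst p) \<le> wt p" and wt_snd_le: "wt (snd p) \<le> wt p"
  by (simp_all add: wt_prod_def)

lemma wt_push_unit: "wt (push_unit r y) \<le> wt y + 8 * wt r"
proof -
  let ?f = "\<lambda>z :: bool \<times> bool \<times> nat \<times> nat. (fst (snd (snd z)) + (if fst (snd z) then 1 else 0),
     snd (snd (snd z)) + (if fst z then 1 else 0))"
  have "wt (?f z) \<le> wt (snd z) + 8 * wt (fst z)" for z
    using wt_Suc[of "fst (snd (snd z))"] wt_Suc[of "snd (snd (snd z))"] by (cases z) (auto simp: wt_prod_def)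
  then have "wt (push_unit r y) \<le> wt (zip (fst (snd r)) y) + 8 * wt (fst r)"
    unfolding push_unit_def by (rule wt_map_zip)
  moreover have "wt (map (\<lambda>z. z) (zip (fst (snd r)) y)) \<le> wt y + 8 * wt (fst (snd r))"
    by (rule wt_map_zip) (auto simp: wt_prod_def)
  moreover have "wt r = 1 + wt (fst r) + (1 + wt (fst (snd r)) + wt (snd (snd r)))" by (simp add: wt_prod_def)
  ultimately show ?thesis by simp
qed

lemma polyf_try_push [polyf_intros]:
  "polyf its \<Longrightarrow> polyf D \<Longrightarrow> polyf Y \<Longrightarrow> polyf R \<Longrightarrow> polyf (\<lambda>x. try_push (its x) (D x) (Y x) (R x))"
proof (rule polyf_comp4[of try_push])
  let ?c = "\<lambda>x z. cands (fst x) (fst (snd x)) (fst (snd (snd x))) (snd (snd (snd x))) (fst z) (snd z)"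
  let ?zs = "\<lambda>x :: item list \<times> bool list \<times> (nat \<times> nat) list list \<times> nat list. zip (fst x) (fst (snd (snd x)))"
  let ?step = "\<lambda>x s z. case (if fst s then [] else ?c x z) of
      [] \<Rightarrow> (fst s, snd z # snd s) | r # _ \<Rightarrow> (True, push_unit r (snd z) # snd s)"
  have zs: "polyf ?zs" by (intro polyf_intros)
  show "polyf (\<lambda>x. try_push (fst x) (fst (snd x)) (fst (snd (snd x))) (snd (snd (snd x))))"
    unfolding try_push_def
  proof (rule polyf_foldl)
    obtain q1 where q1: "\<And>x e. e \<in> set (?zs x) \<Longrightarrow> wt (snd e) \<le> poly q1 (wt x)"
      using polyf_elem_size[of "\<lambda>x e. snd e", OF polyf_snd[OF polyf_snd[OF polyf_id]] zs] by blast
    have "polyf (\<lambda>p. case ?c (fst p) (snd p) of [] \<Rightarrow> [] | r # _ \<Rightarrow> push_unit r (snd (snd p)))"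
      by (intro polyf_intros)
    then obtain q2 where q2: "\<And>x e. e \<in> set (?zs x) \<Longrightarrow>
        wt (case ?c x e of [] \<Rightarrow> [] | r # _ \<Rightarrow> push_unit r (snd e)) \<le> poly q2 (wt x)"
      using polyf_elem_size[of "\<lambda>x e. case ?c x e of [] \<Rightarrow> [] | r # _ \<Rightarrow> push_unit r (snd e)", OF _ zs] by blast
    show "additive ?step ?zs"
    proof (rule additiveI[where q = "1 + q1 + q2"])
      fix x s e assume e: "e \<in> set (?zs x)"
      show "wt (?step x s e) \<le> wt s + poly (1 + q1 + q2) (wt x)"
        using q1[OF e] q2[OF e] by (cases s) (auto split: list.splits)
    qed
  qed (intro polyf_intros)+
qed

lemma polyf_expand [polyf_intros]: "polyf its \<Longrightarrow> polyf D \<Longrightarrow> polyf Y \<Longrightarrow> polyf R \<Longrightarrow> polyf V \<Longrightarrow>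
    polyf (\<lambda>x. expand (its x) (D x) (Y x) (R x) (V x))"
  by (rule polyf_comp5) (unfold expand_def, intro polyf_intros)

lemma polyf_search_step [polyf_intros]: "polyf its \<Longrightarrow> polyf D \<Longrightarrow> polyf V \<Longrightarrow> polyf s \<Longrightarrow>
    polyf (\<lambda>x. search_step (its x) (D x) (V x) (s x))"
  by (rule polyf_comp4) (unfold search_step_def, intro polyf_intros)

lemma wt_filter: "wt (filter P xs) \<le> wt xs"
  by (induction xs) auto

lemma wt_try_push: "wt (snd (try_push its D Y R)) \<le> wt Y + 8 * wt its"
proof -
  let ?C = "\<lambda>z. cands its D Y R (fst z) (snd z)"
  have cw: "wt (hd (?C z)) \<le> wt (fst z)" if "?C z \<noteq> []" for z
  proof -
    have "hd (?C z) \<in> set (it_rows (fst z))" using hd_in_set[OF that] by (auto simp: cands_def)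
    then have "wt (hd (?C z)) \<le> wt (it_rows (fst z))" by (rule less_imp_le[OF wt_mem])
    also have "\<dots> \<le> wt (fst z)" using wt_fst_le[of "fst (fst z)"] wt_fst_le[of "fst z"] by linarith
    finally show ?thesis .
  qed
  have pw: "wt (push_unit (hd (?C z)) (snd z)) \<le> wt (snd z) + 8 * wt (fst z)" if "?C z \<noteq> []" for z
    using wt_push_unit[of "hd (?C z)" "snd z"] cw[OF that] by linarith
  let ?zs = "zip its Y"
  from foldl_first(2)[where zs = ?zs and C = ?C and h = snd and acc = "[]" and P = "\<lambda>r z. push_unit r (snd z)"]
  show ?thesis unfolding try_push_def[symmetric]
  proof
    assume "(\<forall>z\<in>set ?zs. ?C z = []) \<and> try_push its D Y R = (False, rev (map snd ?zs) @ [])"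
    then have "wt (snd (try_push its D Y R)) = wt (map snd ?zs)" by (simp add: wt_rev)
    also have "\<dots> \<le> wt Y + 8 * wt its" by (rule wt_map_zip) simp
    finally show ?thesis .
  next
    assume "\<exists>n<length ?zs. ?C (?zs ! n) \<noteq> [] \<and> try_push its D Y R =
      (True, rev ((map snd ?zs)[n := push_unit (hd (?C (?zs ! n))) (snd (?zs ! n))]) @ [])"
    then obtain n where n: "n < length ?zs" "?C (?zs ! n) \<noteq> []" "try_push its D Y R =
      (True, rev ((map snd ?zs)[n := push_unit (hd (?C (?zs ! n))) (snd (?zs ! n))]))" by auto
    have le: "wt (ys[n := e]) + wt (ys ! n) = wt ys + wt e" if "n < length ys" for ys :: "(nat \<times> nat) list list" and e n
      using that
    proof (induction ys arbitrary: n)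
      case (Cons y ys)
      then show ?case by (cases n) auto
    qed simp
    have "wt (snd (try_push its D Y R)) + wt (snd (?zs ! n)) =
        wt (map snd ?zs) + wt (push_unit (hd (?C (?zs ! n))) (snd (?zs ! n)))"
      using n le[of n "map snd ?zs"] by (simp add: wt_rev)
    then have "wt (snd (try_push its D Y R)) \<le> wt (map snd ?zs) + 8 * wt (fst (?zs ! n))"
      using pw[OF n(2)] by linarith
    moreover have "wt (map snd ?zs) \<le> wt Y + 0 * wt its" by (rule wt_map_zip) simp
    moreover have "fst (?zs ! n) \<in> set its" using n(1) by simp
    then have "wt (fst (?zs ! n)) \<le> wt its" by (rule less_imp_le[OF wt_mem])
    ultimately show ?thesis by simp
  qed
qed

lemma wt_search_step: "wt (search_step its D V s) \<le> wt s + (8 * wt its + wt V)"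
proof -
  obtain b Y R where s: "s = (b, (Y, R))" by (cases s) auto
  show ?thesis using wt_try_push[of its D Y R] wt_filter[of _ V]
    by (auto simp: s search_step_def expand_def wt_rev intro: le_trans[OF wt_filter])
qed

definition search_growth :: "nat \<Rightarrow> nat" where
  "search_growth n = 5 + n + (n + 1) * (9 * n)"

text \<open>The increment depends on the items and the variables alone, not on \<open>Y\<close>;
  this makes the fold over all rounds of a phase \<open>additive\<close> in
  \<open>Y\<close>.\<close>

lemma wt_search:
  assumes "wt its \<le> n" "wt V \<le> n"
  shows "wt (fst (snd (search its D V Y))) \<le> wt Y + search_growth n"
proof -
  let ?i = "(False, (Y, filter (\<lambda>v. exa its Y v < exb its Y v) V))"
  have "wt (search its D V Y) \<le> wt ?i + length (0 # V) * (8 * wt its + wt V)"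
    unfolding search_def by (rule wt_foldl) (rule wt_search_step)
  also have "length (0 # V) * (8 * wt its + wt V) \<le> (n + 1) * (9 * n)"
    using assms length_lt_wt[of V] by (intro mult_le_mono) auto
  also have "wt ?i \<le> 5 + wt Y + n" using wt_filter[of "\<lambda>v. exa its Y v < exb its Y v" V] assms by simp
  finally have "wt (search its D V Y) \<le> wt Y + search_growth n" by (simp add: search_growth_def)
  then show ?thesis using wt_fst_le[of "snd (search its D V Y)"] wt_snd_le[of "search its D V Y"] by linarith
qed

lemma polyf_search [polyf_intros]: "polyf its \<Longrightarrow> polyf D \<Longrightarrow> polyf V \<Longrightarrow> polyf Y \<Longrightarrow>
    polyf (\<lambda>x. search (its x) (D x) (V x) (Y x))"
proof (rule polyf_comp4[of search])
  let ?V = "\<lambda>x :: item list \<times> bool list \<times> nat list \<times> (nat \<times> nat) list list. 0 # fst (snd (snd x))"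
  show "polyf (\<lambda>x. search (fst x) (fst (snd x)) (fst (snd (snd x))) (snd (snd (snd x))))"
    unfolding search_def
  proof (rule polyf_foldl)
    show "additive (\<lambda>x s _. search_step (fst x) (fst (snd x)) (fst (snd (snd x))) s) ?V"
    proof (rule additiveI[where q = "[:0, 9:]"])
      fix x :: "item list \<times> bool list \<times> nat list \<times> (nat \<times> nat) list list"
        and s :: "bool \<times> (nat \<times> nat) list list \<times> nat list"
      have "8 * wt (fst x) + wt (fst (snd (snd x))) \<le> 9 * wt x" by (simp add: wt_prod_def)
      then show "wt (search_step (fst x) (fst (snd x)) (fst (snd (snd x))) s) \<le> wt s + poly [:0, 9:] (wt x)"
        using wt_search_step[of "fst x" "fst (snd x)" "fst (snd (snd x))" s] by simp
    qed
  qed (intro polyf_intros)+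
qed

lemma polyf_lowbit [polyf_intros]: "polyf n \<Longrightarrow> polyf (\<lambda>x. lowbit (n x))"
  by (rule polyf_comp[of lowbit]) (unfold lowbit_def[abs_def], intro polyf_intros)

lemma polyf_double [polyf_intros]: "polyf its \<Longrightarrow> polyf D \<Longrightarrow> polyf Y \<Longrightarrow> polyf (\<lambda>x. double (its x) (D x) (Y x))"
  by (rule polyf_comp3) (unfold double_def, intro polyf_intros)

lemma wt_double_nat: "wt (a + a + (if b then d else 0)) \<le> wt a + 7 + wt (d :: nat)"
proof -
  have "wt (a + a) \<le> wt a + 4"
    using length_bin_le[of "a + a" "Suc (length (bin a))"] less_two_power_length_bin[of a] by (simp add: wt_nat)
  then show ?thesis using wt_add[of "a + a" d] by auto
qed

lemma wt_double: "wt (double its D Y) \<le> wt Y + 15 * wt its"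
  unfolding double_def
proof (rule wt_map_zip)
  fix z :: "item \<times> (nat \<times> nat) list"
  let ?b = "lowbit (scaled D (fst z))"
  have "wt (map (\<lambda>u. (fst (snd u) + fst (snd u) + (if ?b then fst (fst u) else 0),
      snd (snd u) + snd (snd u) + (if ?b then snd (fst u) else 0))) (zip (it_base (fst z)) (snd z))) \<le>
      wt (snd z) + 15 * wt (it_base (fst z))"
  proof (rule wt_map_zip)
    fix u :: "(nat \<times> nat) \<times> (nat \<times> nat)"
    show "wt (fst (snd u) + fst (snd u) + (if ?b then fst (fst u) else 0),
      snd (snd u) + snd (snd u) + (if ?b then snd (fst u) else 0)) \<le> wt (snd u) + 15 * wt (fst u)"
      using wt_double_nat[of "fst (snd u)" ?b "fst (fst u)"] wt_double_nat[of "snd (snd u)" ?b "snd (fst u)"]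
      by (simp add: wt_prod_def)
  qed
  also have "wt (it_base (fst z)) \<le> wt (fst z)" by (simp add: wt_prod_def)
  finally show "wt (map (\<lambda>u. (fst (snd u) + fst (snd u) + (if ?b then fst (fst u) else 0),
      snd (snd u) + snd (snd u) + (if ?b then snd (fst u) else 0))) (zip (it_base (fst z)) (snd z))) \<le>
      wt (snd z) + 15 * wt (fst z)" by simp
qed

lemma polyf_rounds [polyf_intros]: "polyf its \<Longrightarrow> polyf V \<Longrightarrow> polyf C \<Longrightarrow> polyf (\<lambda>x. rounds (its x) (V x) (C x))"
  by (rule polyf_comp3) (unfold rounds_def, intro polyf_intros)

lemma poly_search_growth: "poly ([:5, 1:] + [:1, 1:] * [:0, 9:]) n = search_growth n"
  by (simp add: search_growth_def algebra_simps)

lemma polyf_phase [polyf_intros]: "polyf its \<Longrightarrow> polyf V \<Longrightarrow> polyf C \<Longrightarrow> polyf s \<Longrightarrow>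
    polyf (\<lambda>x. phase (its x) (V x) (C x) (s x))"
proof (rule polyf_comp4[of phase])
  have "polyf (\<lambda>x :: item list \<times> nat list \<times> bool list \<times> (bool list \<times> (nat \<times> nat) list list).
      foldl (\<lambda>Y _. fst (snd (search (fst x) (tl (fst (snd (snd (snd x))))) (fst (snd x)) Y)))
      (double (fst x) (tl (fst (snd (snd (snd x))))) (snd (snd (snd (snd x))))) (rounds (fst x) (fst (snd x)) (fst (snd (snd x)))))"
  proof (rule polyf_foldl)
    show "additive (\<lambda>x Y _. fst (snd (search (fst x) (tl (fst (snd (snd (snd x))))) (fst (snd x)) Y)))
      (\<lambda>x :: item list \<times> nat list \<times> bool list \<times> (bool list \<times> (nat \<times> nat) list list). rounds (fst x) (fst (snd x)) (fst (snd (snd x))))"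
      by (rule additiveI[where q = "[:5, 1:] + [:1, 1:] * [:0, 9:]"])
        (unfold poly_search_growth, rule wt_search, auto simp: wt_prod_def)
  qed (intro polyf_intros)+
  then show "polyf (\<lambda>x. phase (fst x) (fst (snd x)) (fst (snd (snd x))) (snd (snd (snd x))))"
    unfolding phase_def by (intro polyf_intros)
qed

lemma wt_phase:
  assumes "wt its \<le> n" "wt V \<le> n" "wt C \<le> n"
  shows "wt (phase its V C s) \<le> wt s + (15 * n + (n + 1) * ((n + 1) * n) * search_growth n)"
proof -
  let ?D = "tl (fst s)"
  have "length (rounds its V C) = (length its + 1) * ((length V + 1) * length C)"
    unfolding rounds_def by (simp add: length_concat o_def sum_list_triv)
  also have "\<dots> \<le> (n + 1) * ((n + 1) * n)"
    using assms length_lt_wt[of its] length_lt_wt[of V] length_lt_wt[of C] by (intro mult_le_mono) auto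
  finally have r: "length (rounds its V C) \<le> (n + 1) * ((n + 1) * n)" .
  have "wt (foldl (\<lambda>Y _. fst (snd (search its ?D V Y))) (double its ?D (snd s)) (rounds its V C)) \<le>
    wt (double its ?D (snd s)) + length (rounds its V C) * search_growth n"
    by (rule wt_foldl) (rule wt_search[OF assms(1,2)])
  also have "\<dots> \<le> (wt (snd s) + 15 * n) + (n + 1) * ((n + 1) * n) * search_growth n"
    using wt_double[of its ?D "snd s"] assms(1) r by (intro add_mono mult_le_mono) auto
  finally show ?thesis using wt_tl[of "fst s"] by (simp add: phase_def wt_prod_def)
qed

lemma polyf_bits [polyf_intros]: "polyf its \<Longrightarrow> polyf (\<lambda>x. bits (its x))"
  by (rule polyf_comp[of bits]) (unfold bits_def[abs_def], intro polyf_intros)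

lemma polyf_solve [polyf_intros]: "polyf its \<Longrightarrow> polyf V \<Longrightarrow> polyf C \<Longrightarrow> polyf (\<lambda>x. solve (its x) (V x) (C x))"
proof (rule polyf_comp3[of solve])
  show "polyf (\<lambda>x. solve (fst x) (fst (snd x)) (snd (snd x)))"
    unfolding solve_def
  proof (rule polyf_foldl)
    let ?q = "[:0, 15:] + [:1, 1:] * ([:1, 1:] * [:0, 1:]) * ([:5, 1:] + [:1, 1:] * [:0, 9:])"
    show "additive (\<lambda>x s _. phase (fst x) (fst (snd x)) (snd (snd x)) s)
       (\<lambda>x :: item list \<times> nat list \<times> bool list. bits (fst x))"
    proof (rule additiveI[where q = ?q])
      fix x :: "item list \<times> nat list \<times> bool list" and s
      have eq: "poly ?q (wt x) = 15 * wt x + (wt x + 1) * ((wt x + 1) * wt x) * search_growth (wt x)"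
        unfolding poly_add poly_mult poly_search_growth[unfolded poly_add poly_mult] by (simp add: algebra_simps)
      have le: "wt (fst x) \<le> wt x" "wt (fst (snd x)) \<le> wt x" "wt (snd (snd x)) \<le> wt x"
        by (simp_all add: wt_prod_def)
      show "wt (phase (fst x) (fst (snd x)) (snd (snd x)) s) \<le> wt s + poly ?q (wt x)"
        unfolding eq by (rule wt_phase[OF le])
    qed
  qed (intro polyf_intros)+
qed

lemma polyf_minset [polyf_intros]: "polyf its \<Longrightarrow> polyf V \<Longrightarrow> polyf C \<Longrightarrow> polyf (\<lambda>x. minset (its x) (V x) (C x))"
  by (rule polyf_comp3) (unfold minset_def, intro polyf_intros)

text \<open>A sum in place of a search: in a table of all words of the right length exactly one
  entry matches.\<close>

definition eval_tab :: "(bool list \<times> nat) list \<Rightarrow> bool list \<Rightarrow> nat" where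
  "eval_tab tab A = sum_list (map (\<lambda>e. if list_all (\<lambda>z. fst z = snd z) (zip (fst e) A) then snd e else 0) tab)"

lemma polyf_eval_tab [polyf_intros]: "polyf tab \<Longrightarrow> polyf A \<Longrightarrow> polyf (\<lambda>x. eval_tab (tab x) (A x))"
  by (rule polyf_comp2) (unfold eval_tab_def, intro polyf_intros)

lemma distinct_n_lists_bool: "distinct (List.n_lists k [False, True])"
  by (rule distinct_n_lists) simp

lemma eval_tab:
  assumes "length A = k"
  shows "eval_tab (value_table k g) A = g A"
proof -
  have eq: "list_all (\<lambda>z. fst z = snd z) (zip B A) \<longleftrightarrow> B = A" if "length B = k" for B
    using assms that by (auto simp: list_all_length intro!: nth_equalityI)
  have "eval_tab (value_table k g) A = sum_list (map (\<lambda>B. if B = A then g B else 0) (List.n_lists k [False, True]))"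
    unfolding eval_tab_def value_table_def map_map
    by (intro arg_cong[of _ _ sum_list] map_cong refl) (auto simp: eq set_n_lists)
  also have "\<dots> = (\<Sum>B\<in>set (List.n_lists k [False, True]). if B = A then g B else 0)"
    by (rule sum_list_distinct_conv_sum_set[OF distinct_n_lists_bool])
  also have "\<dots> = g A"
  proof -
    have "A \<in> set (List.n_lists k [False, True])" using assms by (auto simp: set_n_lists)
    then show ?thesis by simp
  qed
  finally show ?thesis .
qed

section \<open>Instances with integer weights\<close>

abbreviation p_cons :: "pinst \<Rightarrow> ((bool \<times> nat \<times> nat) \<times> (nat \<times> (bool \<times> nat \<times> nat) list) \<times> nat list) list" where
  "p_cons p \<equiv> fst (snd p)"

definition dens :: "pinst \<Rightarrow> nat list" where
  "dens p = snd (snd (snd (snd p))) # map (\<lambda>c. snd (snd (fst c))) (p_cons p)"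

text \<open>The absolute value of a rational times the product of all denominators, obtained without
  division: one occurrence of its own denominator is left out of the product.\<close>

definition iw :: "pinst \<Rightarrow> (bool \<times> nat \<times> nat) \<Rightarrow> nat" where
  "iw p r = fst (snd r) * prod_list (remove1 (snd (snd r)) (dens p))"

lemma polyf_dens [polyf_intros]: "polyf p \<Longrightarrow> polyf (\<lambda>x. dens (p x))"
  by (rule polyf_comp[of dens]) (unfold dens_def[abs_def], intro polyf_intros)

lemma polyf_iw [polyf_intros]: "polyf p \<Longrightarrow> polyf r \<Longrightarrow> polyf (\<lambda>x. iw (p x) (r x))"
  by (rule polyf_comp2[of iw]) (unfold iw_def, intro polyf_intros)

lemma rho_rat_nonneg:
  assumes "0 \<le> r"
  shows "of_nat (fst (snd (rho_rat r))) = of_nat (snd (snd (rho_rat r))) * r"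
proof -
  obtain a b where ab: "quotient_of r = (a, b)" by (cases "quotient_of r")
  have b: "b > 0" and r: "r = of_int a / of_int b" using ab quotient_of_denom_pos quotient_of_div by auto
  have "a \<ge> 0" using assms r b by (auto simp: zero_le_divide_iff)
  have rr: "rho_rat r = (a < 0, (nat \<bar>a\<bar>, nat b))" by (simp add: rho_rat_def ab)
  show ?thesis unfolding rr using b \<open>a \<ge> 0\<close> by (simp add: r)
qed

lemma rho_rat_neg: "fst (rho_rat r) \<longleftrightarrow> r < 0"
proof -
  obtain a b where ab: "quotient_of r = (a, b)" by (cases "quotient_of r")
  have b: "b > 0" and r: "r = of_int a / of_int b" using ab quotient_of_denom_pos quotient_of_div by auto
  have rr: "rho_rat r = (a < 0, (nat \<bar>a\<bar>, nat b))" by (simp add: rho_rat_def ab)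
  show ?thesis unfolding rr using b by (simp add: r divide_less_0_iff)
qed

lemma rho_rat_den: "snd (snd (rho_rat r)) > 0"
  using quotient_of_denom_pos'[of r] by (simp add: rho_rat_def)

lemma rho_rat_inj: "rho_rat r = rho_rat r' \<Longrightarrow> r = r'"
proof -
  assume e: "rho_rat r = rho_rat r'"
  obtain a b where ab: "quotient_of r = (a, b)" by (cases "quotient_of r")
  obtain a' b' where ab': "quotient_of r' = (a', b')" by (cases "quotient_of r'")
  have "b > 0" "b' > 0" using quotient_of_denom_pos[OF ab] quotient_of_denom_pos[OF ab'] .
  then have "quotient_of r = quotient_of r'" using e by (auto simp: rho_rat_def ab ab')
  then show ?thesis by (rule quotient_of_inject)
qed

lemma prod_list_remove1: "d \<in> set ds \<Longrightarrow> d * prod_list (remove1 d ds) = prod_list (ds :: nat list)"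
  by (induction ds) (auto simp: mult.left_commute)

lemma iw:
  assumes "snd (snd (rho_rat r)) \<in> set (dens p)" "0 \<le> r"
  shows "of_nat (iw p (rho_rat r)) = of_nat (prod_list (dens p)) * r"
proof -
  have "of_nat (prod_list (dens p)) * r =
      of_nat (prod_list (remove1 (snd (snd (rho_rat r))) (dens p))) * (of_nat (snd (snd (rho_rat r))) * r)"
    unfolding prod_list_remove1[OF assms(1), symmetric] by simp
  then show ?thesis unfolding rho_rat_nonneg[OF assms(2), symmetric] by (simp add: iw_def)
qed

lemma dens_pos: "0 < prod_list (dens (rho_inst I))"
proof -
  have "\<forall>d\<in>set (dens (rho_inst I)). 0 < d"
    by (auto simp: dens_def rho_inst_def rho_con_def rho_rat_den)
  then show ?thesis by (induction "dens (rho_inst I)") (auto, metis prod_list_zero_iff gr0I less_irrefl)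
qed

lemma iw_con:
  assumes "t \<in> set (constraints I)" "0 \<le> fst t"
  shows "of_nat (iw (rho_inst I) (rho_rat (fst t))) = of_nat (prod_list (dens (rho_inst I))) * fst t"
  using assms by (intro iw) (auto simp: dens_def rho_inst_def rho_con_def)

lemma iw_bound:
  assumes "0 \<le> bound I"
  shows "of_nat (iw (rho_inst I) (rho_rat (bound I))) = of_nat (prod_list (dens (rho_inst I))) * bound I"
  using assms by (intro iw) (auto simp: dens_def rho_inst_def)

lemma of_nat_sum_list: "of_nat (sum_list xs) = (sum_list (map of_nat xs) :: 'a::semiring_1)"
  by (induction xs) auto

lemma objective_alt:
  "objective I h = (\<Sum>t\<leftarrow>constraints I. fst t * snd (fst (snd t)) (map h (snd (snd t))))"
  unfolding objective_def by (intro arg_cong[of _ _ sum_list] map_cong refl) auto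

text \<open>Both sides are multiplied by the product of all denominators.\<close>

lemma scaled_objective:
  assumes w: "\<And>t. t \<in> set (constraints I) \<Longrightarrow> 0 \<le> fst t"
    and v: "\<And>t. t \<in> set (constraints I) \<Longrightarrow> of_nat m * snd (fst (snd t)) (map h (snd (snd t))) = of_nat (v t)"
    and m: "0 < m" and b: "0 \<le> bound I"
  shows "objective I h \<le> bound I \<longleftrightarrow>
    (\<Sum>t\<leftarrow>constraints I. iw (rho_inst I) (rho_rat (fst t)) * v t) \<le> m * iw (rho_inst I) (rho_rat (bound I))"
proof -
  let ?d = "of_nat (prod_list (dens (rho_inst I))) :: rat"
  have d: "0 < ?d" using dens_pos[of I] by simp
  have "(of_nat (\<Sum>t\<leftarrow>constraints I. iw (rho_inst I) (rho_rat (fst t)) * v t) :: rat) =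
      (\<Sum>t\<leftarrow>constraints I. of_nat m * ?d * (fst t * snd (fst (snd t)) (map h (snd (snd t)))))"
    unfolding of_nat_sum_list map_map o_def
    by (intro arg_cong[of _ _ sum_list] map_cong refl) (simp add: iw_con[OF _ w] v[symmetric] algebra_simps)
  also have "\<dots> = of_nat m * ?d * objective I h"
    by (simp only: objective_alt sum_list_const_mult)
  finally have s: "(of_nat (\<Sum>t\<leftarrow>constraints I. iw (rho_inst I) (rho_rat (fst t)) * v t) :: rat) = of_nat m * ?d * objective I h" .
  have "(\<Sum>t\<leftarrow>constraints I. iw (rho_inst I) (rho_rat (fst t)) * v t) \<le> m * iw (rho_inst I) (rho_rat (bound I)) \<longleftrightarrow>
      (of_nat (\<Sum>t\<leftarrow>constraints I. iw (rho_inst I) (rho_rat (fst t)) * v t) :: rat) \<le> of_nat (m * iw (rho_inst I) (rho_rat (bound I)))"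
    by (simp only: of_nat_le_iff)
  also have "\<dots> \<longleftrightarrow> of_nat m * ?d * objective I h \<le> of_nat m * ?d * bound I"
    unfolding s of_nat_mult iw_bound[OF b] by (simp add: mult.assoc)
  also have "\<dots> \<longleftrightarrow> objective I h \<le> bound I" using d m by simp
  finally show ?thesis by blast
qed

lemma objective_nonneg:
  assumes "\<Delta> \<subseteq> finite_valued_cost_functions" "I \<in> vcsp_instances \<Delta>"
  shows "0 \<le> objective I h"
  unfolding objective_def
proof (rule sum_list_nonneg)
  fix r assume "r \<in> set (map (\<lambda>(w, f, xs). w * snd f (map h xs)) (constraints I))"
  then obtain w f xs where "(w, f, xs) \<in> set (constraints I)" "r = w * snd f (map h xs)" by auto
  then have "0 \<le> w" "f \<in> \<Delta>" "length xs = fst f" "r = w * snd f (map h xs)"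
    using assms(2) by (auto simp: vcsp_instances_def)
  moreover have "0 \<le> snd f (map h xs)" using calculation assms(1)
    by (fastforce simp: finite_valued_cost_functions_def PiE_def Pi_def)
  ultimately show "0 \<le> r" by simp
qed

section \<open>Compositions of machines\<close>

lemma trivial_machine: "\<exists>M. wf_tm M \<and> (\<forall>w. outputs_within M w (poly 1 (length w)) [])"
proof -
  let ?M = "\<lparr>ntapes = 2, nstates = 2, nsyms = 3, trans = (\<lambda>_ _. (1, [(0, 0), (0, 0)]))\<rparr>"
  have "wf_tm ?M" by (simp add: wf_tm_def)
  moreover have "outputs_within ?M w 1 []" for w
    by (auto simp: outputs_within_def Let_def tm_step_def init_config_def)
  ultimately show ?thesis by (intro exI[of _ ?M]) simp
qed

lemma polyf_after_machine:
  fixes p :: "bool list \<times> bool list \<Rightarrow> bool list"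
  assumes "wf_tm M" "\<And>w. outputs_within M w (poly q (length w)) (G w)" "polyf p"
  shows "\<exists>M' r. wf_tm M' \<and> (\<forall>w. outputs_within M' w (poly r (length w)) (p (w, G w)))"
proof -
  obtain F where F: "TP (range (tr :: bool list \<times> bool list \<Rightarrow> tree)) F" "\<forall>x. F (tr x) = tr (p x)"
    using assms(3) unfolding polyf_def TPF_def by blast
  have e: "N (trw w) (trw v) = tr (w, v)" for w v by (simp add: tr_prod_def tr_word)
  show ?thesis
    by (rule TP_to_TM[OF assms(1,2) F(1)]) (simp_all add: e F(2) tr_word)
qed

text \<open>Postprocessing of a machine that writes nothing.\<close>

lemma polyf_machine:
  fixes p :: "bool list \<Rightarrow> bool list"
  assumes "polyf p"
  shows "\<exists>M r. wf_tm M \<and> (\<forall>w. outputs_within M w (poly r (length w)) (p w))"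
proof -
  obtain M where M: "wf_tm M" "\<And>w. outputs_within M w (poly 1 (length w)) []" using trivial_machine by blast
  have "polyf (\<lambda>x. p (fst x))" by (rule polyf_comp[OF assms]) (intro polyf_intros)
  from polyf_after_machine[OF M this] show ?thesis by simp
qed

section \<open>Maximum cut is in NP\<close>

text \<open>The bits of the first word are doubled in \<open>pair_word\<close>, so the first unequal
  pair of bits is the separator.\<close>

definition unpair_step :: "bool list \<times> bool list \<times> bool \<Rightarrow> bool list \<times> bool list \<times> bool" where
  "unpair_step s = (if snd (snd s) then s else case fst (snd s) of [] \<Rightarrow> s | a # r \<Rightarrow>
     (case r of [] \<Rightarrow> s | b # u \<Rightarrow> if a = b then (a # fst s, (u, False)) else (fst s, (u, True))))"

definition unpair :: "bool list \<Rightarrow> bool list \<times> bool list" where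
  "unpair z = (rev (fst (foldl (\<lambda>s _. unpair_step s) ([], (z, False)) z)),
     fst (snd (foldl (\<lambda>s _. unpair_step s) ([], (z, False)) z)))"

lemma polyf_unpair: "polyf unpair"
proof -
  have "polyf unpair_step" unfolding unpair_step_def[abs_def] by (intro polyf_intros)
  then have 1: "polyf (\<lambda>t :: bool list \<times> (bool list \<times> bool list \<times> bool) \<times> bool. unpair_step (fst (snd t)))"
    by (rule polyf_comp) (intro polyf_intros)
  have "polyf (\<lambda>z :: bool list. foldl (\<lambda>s _. unpair_step s) ([], (z, False)) z)"
  proof (rule polyf_foldl)
    show "additive (\<lambda>_ s _. unpair_step s) (\<lambda>z :: bool list. z)"
    proof (rule additiveI[where q = 0])
      fix x :: "bool list" and s :: "bool list \<times> bool list \<times> bool" and e :: bool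
      obtain a b c where s: "s = (a, (b, c))" by (cases s) auto
      show "wt (unpair_step s) \<le> wt s + poly 0 (wt x)"
        by (auto simp: s unpair_step_def split: list.splits)
    qed
  qed (intro polyf_intros 1)+
  then show ?thesis unfolding unpair_def[abs_def] by (intro polyf_intros)
qed

lemma unpair_pair_word: "unpair (pair_word x y) = (x, y)"
proof -
  have fin: "(unpair_step ^^ n) (a, (u, True)) = (a, (u, True))" for n a u
    by (induction n) (auto simp: unpair_step_def)
  have it: "(unpair_step ^^ (Suc (length w) + n)) (a, (pair_word w y, False)) = (rev w @ a, (y, True))" for w n a
  proof (induction w arbitrary: a)
    case Nil
    have "unpair_step (a, (pair_word [] y, False)) = (a, (y, True))" by (simp add: unpair_step_def pair_word_def)
    then show ?case by (simp add: funpow_Suc_right fin del: funpow.simps)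
  next
    case (Cons b w)
    have "unpair_step (a, (pair_word (b # w) y, False)) = (b # a, (pair_word w y, False))"
      by (simp add: unpair_step_def pair_word_def)
    then show ?case using Cons[of "b # a"] by (simp add: funpow_Suc_right del: funpow.simps)
  qed
  have "length (concat (map (\<lambda>b. [b, b]) x)) = 2 * length x" by (induction x) auto
  then have l: "length (pair_word x y) = Suc (length x) + (length x + 1 + length y)" by (simp add: pair_word_def)
  show ?thesis unfolding unpair_def foldl_funpow l it by simp
qed

definition same_side :: "nat list \<Rightarrow> nat list \<Rightarrow> bool" where
  "same_side xs R = (case xs of [] \<Rightarrow> False | u # r \<Rightarrow> (case r of [] \<Rightarrow> False | v # _ \<Rightarrow> elem u R = elem v R))"

lemma polyf_same_side [polyf_intros]: "polyf xs \<Longrightarrow> polyf R \<Longrightarrow> polyf (\<lambda>x. same_side (xs x) (R x))"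
  by (rule polyf_comp2[of same_side]) (unfold same_side_def, intro polyf_intros)

text \<open>\<open>f_neq\<close> charges the edges that are not cut, so a small objective is a large
  cut.\<close>

definition small_cut :: "pinst \<Rightarrow> nat list \<Rightarrow> bool" where
  "small_cut p R \<longleftrightarrow> \<not> fst (snd (snd p)) \<and>
     sum_list (map (\<lambda>c. iw p (fst c) * (if same_side (snd (snd c)) R then 1 else 0)) (p_cons p)) \<le> iw p (snd (snd p))"

lemma polyf_small_cut [polyf_intros]: "polyf p \<Longrightarrow> polyf R \<Longrightarrow> polyf (\<lambda>x. small_cut (p x) (R x))"
  by (rule polyf_comp2[of small_cut]) (unfold small_cut_def, intro polyf_intros)

lemma f_neq_fv: "{f_neq} \<subseteq> finite_valued_cost_functions"
  by (auto simp: f_neq_def finite_valued_cost_functions_def)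

lemma neq_instanceD:
  assumes "I \<in> vcsp_instances {f_neq}" "t \<in> set (constraints I)"
  shows "0 \<le> fst t" "fst (snd t) = f_neq"
    "\<exists>u v. snd (snd t) = [u, v] \<and> u < nvars I \<and> v < nvars I"
proof -
  obtain w f xs where t: "t = (w, f, xs)" by (cases t) auto
  have "0 \<le> w \<and> f = f_neq \<and> length xs = 2 \<and> set xs \<subseteq> {..<nvars I}"
    using assms by (auto simp: vcsp_instances_def t f_neq_def)
  then show "0 \<le> fst t" "fst (snd t) = f_neq" "\<exists>u v. snd (snd t) = [u, v] \<and> u < nvars I \<and> v < nvars I"
    by (auto simp: t numeral_2_eq_2 length_Suc_conv)
qed

lemma f_neq_val: "snd f_neq [a, b] = (if a = b then 1 else 0)"
  by (simp add: f_neq_def)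

lemma small_cut:
  assumes I: "I \<in> vcsp_instances {f_neq}"
  shows "small_cut (rho_inst I) R \<longleftrightarrow> objective I (\<lambda>v. v \<in> set R) \<le> bound I"
proof (cases "bound I < 0")
  case True
  have "0 \<le> objective I (\<lambda>v. v \<in> set R)" by (rule objective_nonneg[OF f_neq_fv I])
  then show ?thesis using True by (simp add: small_cut_def rho_inst_def rho_rat_neg)
next
  case False
  have "objective I (\<lambda>v. v \<in> set R) \<le> bound I \<longleftrightarrow>
    (\<Sum>t\<leftarrow>constraints I. iw (rho_inst I) (rho_rat (fst t)) * (if same_side (snd (snd t)) R then 1 else 0)) \<le> 1 * iw (rho_inst I) (rho_rat (bound I))"
  proof (rule scaled_objective)
    fix t assume t: "t \<in> set (constraints I)"
    show "0 \<le> fst t" by (rule neq_instanceD[OF I t])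
    obtain u v where "snd (snd t) = [u, v]" using neq_instanceD(3)[OF I t] by blast
    then show "of_nat 1 * snd (fst (snd t)) (map (\<lambda>v. v \<in> set R) (snd (snd t))) = of_nat (if same_side (snd (snd t)) R then 1 else 0)"
      using neq_instanceD(2)[OF I t] by (simp add: f_neq_val same_side_def elem)
  qed (use False in auto)
  moreover have "small_cut (rho_inst I) R \<longleftrightarrow> (\<Sum>t\<leftarrow>constraints I. iw (rho_inst I) (rho_rat (fst t)) *
      (if same_side (snd (snd t)) R then 1 else 0)) \<le> iw (rho_inst I) (rho_rat (bound I))"
    using False unfolding small_cut_def by (simp add: rho_inst_def[of I] rho_rat_neg rho_con_def o_def)
  ultimately show ?thesis by simp
qed

lemma length_bin: "length (bin n) \<le> n"
  using length_bin_le[of n n] less_exp[of n] by blast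

lemma length_enc_nat: "length (enc_nat n) = 2 * length (bin n) + 1"
proof -
  have "length (concat (map (\<lambda>x. [True, x]) w)) = 2 * length w" for w by (induction w) auto
  then show ?thesis by (simp add: enc_nat_def enc_list_def)
qed

text \<open>The certificate is the coded list of the vertices on one side. Its length is at most
  quadratic in the number of variables, which is below the input length because that number is
  written in unary.\<close>

lemma max_cut_in_NP: "\<exists>A\<in>class_NP. \<forall>I\<in>vcsp_instances {f_neq}. enc_instance I \<in> A \<longleftrightarrow> (\<exists>h. objective I h \<le> bound I)"
proof -
  obtain PI where PI: "polyf PI" "\<And>I. PI (enc_instance I) = rho_inst I" using parsable_function[OF parsable_instance] by blast
  obtain PL where PL: "polyf PL" "\<And>l. PL (enc_list enc_nat l) = map (\<lambda>n. n) l"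
    using parsable_function[OF parsable_list[OF parsable_nat]] by blast
  define ver where "ver z = small_cut (PI (fst (unpair z))) (PL (snd (unpair z)))" for z
  have "polyf (\<lambda>z. PI (fst (unpair z)))" "polyf (\<lambda>z. PL (snd (unpair z)))"
    by (rule polyf_comp[OF PI(1)] polyf_comp[OF PL(1)], intro polyf_intros polyf_unpair)+
  then have "polyf ver" unfolding ver_def[abs_def] by (intro polyf_intros)
  then have "polyf (\<lambda>z. [ver z])" by (intro polyf_intros)
  from polyf_machine[OF this] have R: "{z. ver z} \<in> class_P"
    unfolding class_P_def polytime_computable_def by (simp add: case_prod_beta)
  define r where "r = ([:2, 5:] * [:2, 5:] :: nat poly)"
  define A where "A = {x. \<exists>y. length y \<le> poly r (length x) \<and> pair_word x y \<in> {z. ver z}}"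
  have "A \<in> class_NP" unfolding class_NP_def A_def using R by blast
  moreover have "enc_instance I \<in> A \<longleftrightarrow> (\<exists>h. objective I h \<le> bound I)" if I: "I \<in> vcsp_instances {f_neq}" for I
  proof
    assume "enc_instance I \<in> A"
    then obtain y where "ver (pair_word (enc_instance I) y)" by (auto simp: A_def)
    then have "small_cut (rho_inst I) (PL y)" by (simp add: ver_def unpair_pair_word PI)
    then show "\<exists>h. objective I h \<le> bound I" unfolding small_cut[OF I] by blast
  next
    assume "\<exists>h. objective I h \<le> bound I"
    then obtain h where h: "objective I h \<le> bound I" by blast
    define l where "l = filter h [0..<nvars I]"
    have "objective I (\<lambda>v. v \<in> set l) = objective I h"
      unfolding objective_def
    proof (intro arg_cong[of _ _ sum_list] map_cong refl)
      fix t assume t: "t \<in> set (constraints I)"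
      obtain u v where uv: "snd (snd t) = [u, v]" "u < nvars I" "v < nvars I" using neq_instanceD(3)[OF I t] by blast
      then show "(case t of (w, f, xs) \<Rightarrow> w * snd f (map (\<lambda>v. v \<in> set l) xs)) = (case t of (w, f, xs) \<Rightarrow> w * snd f (map h xs))"
        by (cases t) (simp add: l_def)
    qed
    then have "small_cut (rho_inst I) l" using h small_cut[OF I] by simp
    then have "ver (pair_word (enc_instance I) (enc_list enc_nat l))"
      by (simp add: ver_def unpair_pair_word PI PL)
    moreover have "length (enc_list enc_nat l) \<le> poly r (length (enc_instance I))"
    proof -
      let ?n = "nvars I"
      have "length (concat (map (\<lambda>x. True # enc_nat x) m)) \<le> length m * (2 * ?n + 2)" if "\<forall>x\<in>set m. x < ?n" for m
        using that
      proof (induction m)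
        case (Cons x m)
        then show ?case using length_bin[of x] by (simp add: length_enc_nat)
      qed simp
      from this[of l] have "length (enc_list enc_nat l) \<le> length l * (2 * ?n + 2) + 1" by (simp add: enc_list_def l_def)
      also have "\<dots> \<le> ?n * (2 * ?n + 2) + 1" using length_filter_le[of h "[0..<?n]"]
        by (intro add_le_mono mult_le_mono le_refl) (simp add: l_def)
      also have "\<dots> \<le> poly r ?n" by (simp add: r_def algebra_simps)
      also have "\<dots> \<le> poly r (length (enc_instance I))" by (rule poly_mono_nat) (simp add: enc_instance_def)
      finally show ?thesis .
    qed
    ultimately show "enc_instance I \<in> A" unfolding A_def by blast
  qed
  ultimately show ?thesis by blast
qed

section \<open>The tractable cases\<close>

text \<open>The result of the given reduction may have any number of variables, so only its answer
  is used. Without constraints the objective is 0, and the bound 0 or -1 makes a yes- or a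
  no-instance.\<close>

lemma reducible_if_decidable:
  assumes np: "np_hard (VCSP \<Delta>)" and dec: "polyf dec"
    and correct: "\<And>J. J \<in> vcsp_instances \<Delta> \<Longrightarrow> dec (enc_instance J) \<longleftrightarrow> (\<exists>h. objective J h \<le> bound J)"
  shows "VCSP {f_neq} \<le>\<^sub>C\<^sub>V VCSP \<Delta>"
proof -
  obtain A where A: "A \<in> class_NP" "\<And>I. I \<in> vcsp_instances {f_neq} \<Longrightarrow> enc_instance I \<in> A \<longleftrightarrow> (\<exists>h. objective I h \<le> bound I)"
    using max_cut_in_NP by blast
  obtain f where f: "\<And>w. f w \<in> vcsp_instances \<Delta>" "polytime_computable UNIV id enc_instance f"
     "\<And>w. w \<in> A \<longleftrightarrow> (\<exists>h. objective (f w) h \<le> bound (f w))"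
  proof -
    have "\<exists>f. (\<forall>w. f w \<in> vcsp_instances \<Delta>) \<and> polytime_computable UNIV id enc_instance f \<and>
      (\<forall>w. w \<in> A \<longleftrightarrow> (\<exists>h. objective (f w) h \<le> bound (f w)))"
      using np A(1) unfolding np_hard_def VCSP_def by (simp add: Pi_iff)
    then show ?thesis using that by blast
  qed
  obtain M q where M: "wf_tm M" "\<And>w. outputs_within M w (poly q (length w)) (enc_instance (f w))"
    using f(2) unfolding polytime_computable_def by auto
  obtain PI where PI: "polyf PI" "\<And>I. PI (enc_instance I) = rho_inst I" using parsable_function[OF parsable_instance] by blast
  \<comment> \<open>The first False ends the unary number of variables, the second is the empty list
    of constraints.\<close>
  define p where "p x = map (\<lambda>_. True) (fst (PI (fst x))) @ [False, False] @ (if dec (snd x) then enc_rat 0 else enc_rat (-1))"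
    for x :: "bool list \<times> bool list"
  have "polyf (\<lambda>x :: bool list \<times> bool list. PI (fst x))" by (rule polyf_comp[OF PI(1)]) (intro polyf_intros)
  moreover have "polyf (\<lambda>x :: bool list \<times> bool list. dec (snd x))" by (rule polyf_comp[OF dec]) (intro polyf_intros)
  ultimately have "polyf p" unfolding p_def[abs_def] by (intro polyf_intros)
  from polyf_after_machine[OF M this] obtain M' r where
    M': "wf_tm M'" "\<And>w. outputs_within M' w (poly r (length w)) (p (w, enc_instance (f w)))" by blast
  define red where "red I = \<lparr>nvars = nvars I, constraints = [],
    bound = (if dec (enc_instance (f (enc_instance I))) then 0 else -1)\<rparr>" for I :: vcsp_instance
  have "p (enc_instance I, enc_instance (f (enc_instance I))) = enc_instance (red I)" for I
  proof -
    have "map (\<lambda>_. True) (fst (rho_inst I)) = replicate (nvars I) True" by (simp add: rho_inst_def o_def map_replicate_const)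
    then show ?thesis unfolding p_def fst_conv snd_conv PI(2) enc_instance_def[of "red I"] by (simp add: red_def enc_list_def)
  qed
  then have "polytime_computable (vcsp_instances {f_neq}) enc_instance enc_instance red"
    unfolding polytime_computable_def using M' by metis
  moreover have "red I \<in> vcsp_instances \<Delta>" for I by (simp add: red_def vcsp_instances_def)
  moreover have "(\<exists>h. objective I h \<le> bound I) \<longleftrightarrow> (\<exists>h. objective (red I) h \<le> bound (red I))"
    if "I \<in> vcsp_instances {f_neq}" for I
    using A(2)[OF that] f(3)[of "enc_instance I"] correct[OF f(1)[of "enc_instance I"]]
    by (auto simp: red_def objective_def)
  ultimately have "cv_reduction (VCSP {f_neq}) (VCSP \<Delta>) red"
    unfolding cv_reduction_def by (auto simp: VCSP_def red_def intro!: exI[of _ 0])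
  then show ?thesis unfolding cv_reducible_def by blast
qed

section \<open>Finite languages as lookup tables, and the two easy kinds of languages\<close>

lemma rho_fun_inj:
  assumes "f \<in> finite_valued_cost_functions" "f' \<in> finite_valued_cost_functions" "rho_fun f = rho_fun f'"
  shows "f = f'"
proof -
  obtain k F k' F' where f: "f = (k, F)" "f' = (k', F')" by (cases f; cases f')
  have k: "k = k'" using assms(3) by (simp add: rho_fun_def f)
  have "rho_rat (F u) = rho_rat (F' u)" if "length u = k" for u
  proof -
    have "u \<in> set (List.n_lists k [False, True])" using that by (auto simp: set_n_lists)
    then show ?thesis using assms(3) by (simp add: rho_fun_def f k)
  qed
  then have e: "F u = F' u" if "length u = k" for u using rho_rat_inj that by blast
  have "F \<in> {u. length u = k} \<rightarrow>\<^sub>E {0..}" "F' \<in> {u. length u = k} \<rightarrow>\<^sub>E {0..}"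
    using assms(1,2) by (auto simp: finite_valued_cost_functions_def f k)
  then have "F = F'" by (rule PiE_ext) (use e in auto)
  then show ?thesis by (simp add: f k)
qed

text \<open>A parsed value table is compared with those of the finitely many members of \<Delta>,
  and a constant is returned. Whatever data a cost function needs can thus be attached to it without
  being computed.\<close>

lemma lookup_exists:
  fixes d :: "cost_fun \<Rightarrow> 'b::treeable"
  assumes "finite \<Delta>" "\<Delta> \<subseteq> finite_valued_cost_functions"
  shows "\<exists>look. polyf look \<and> (\<forall>f\<in>\<Delta>. look (rho_fun f) = d f)"
  using assms
proof (induction \<Delta>)
  case empty
  have "polyf (\<lambda>_ :: nat \<times> (bool \<times> nat \<times> nat) list. undefined :: 'b)" by (rule polyf_const)
  then show ?case by blast
next
  case (insert f \<Delta>)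
  then obtain look where l: "polyf look" "\<forall>f\<in>\<Delta>. look (rho_fun f) = d f" by auto
  have "polyf (\<lambda>x. if x = rho_fun f then d f else look x)" by (intro polyf_intros l)
  moreover have "(if rho_fun f' = rho_fun f then d f else look (rho_fun f')) = d f'" if "f' \<in> insert f \<Delta>" for f'
    using that l insert.prems rho_fun_inj[of f' f] by auto
  ultimately show ?case by blast
qed

lemma integer_values:
  assumes "finite \<Delta>" "\<Delta> \<subseteq> finite_valued_cost_functions"
  shows "\<exists>m>0. \<exists>g. \<forall>f\<in>\<Delta>. \<forall>u. length u = fst f \<longrightarrow> of_nat m * snd f u = of_nat (g f u)"
proof -
  let ?X = "(\<Union>f\<in>\<Delta>. snd f ` {u. length u = fst f})"
  have "finite {u :: bool list. length u = n}" for n using finite_lists_length_eq[of "UNIV :: bool set" n] by simp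
  then have "finite ?X" using assms by blast
  moreover have "?X \<subseteq> {0..}" using assms(2) by (fastforce simp: finite_valued_cost_functions_def PiE_def Pi_def)
  ultimately obtain m where m: "m > 0" "\<forall>r\<in>?X. \<exists>n. of_nat m * r = of_nat n" using common_denominator by blast
  have "of_nat m * snd f u = of_nat (SOME n. of_nat m * snd f u = of_nat n)" if "f \<in> \<Delta>" "length u = fst f" for f u
    by (rule someI_ex) (use m that in blast)
  then show ?thesis using m(1) by (intro exI[of _ m] conjI exI[of _ "\<lambda>f u. SOME n. of_nat m * snd f u = of_nat n"]) auto
qed

lemma instanceD:
  assumes "I \<in> vcsp_instances \<Delta>" "t \<in> set (constraints I)"
  shows "0 \<le> fst t" "fst (snd t) \<in> \<Delta>" "length (snd (snd t)) = fst (fst (snd t))"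
  using assms by (cases t; auto simp: vcsp_instances_def)+

lemma reducible_if_const_minimal:
  assumes fin: "finite \<Delta>" and fv: "\<Delta> \<subseteq> finite_valued_cost_functions" and np: "np_hard (VCSP \<Delta>)"
    and mn: "\<And>f u. f \<in> \<Delta> \<Longrightarrow> length u = fst f \<Longrightarrow> snd f (replicate (fst f) b) \<le> snd f u"
  shows "VCSP {f_neq} \<le>\<^sub>C\<^sub>V VCSP \<Delta>"
proof -
  obtain m g where m: "m > 0" and g: "\<And>f u. f \<in> \<Delta> \<Longrightarrow> length u = fst f \<Longrightarrow> of_nat m * snd f u = of_nat (g f u)"
    using integer_values[OF fin fv] by blast
  obtain look where l: "polyf look" "\<And>f. f \<in> \<Delta> \<Longrightarrow> look (rho_fun f) = g f (replicate (fst f) b)"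
    using lookup_exists[OF fin fv, of "\<lambda>f. g f (replicate (fst f) b)"] by blast
  obtain PI where PI: "polyf PI" "\<And>I. PI (enc_instance I) = rho_inst I" using parsable_function[OF parsable_instance] by blast
  define d where "d p \<longleftrightarrow> \<not> fst (snd (snd p)) \<and>
    sum_list (map (\<lambda>c. iw p (fst c) * look (fst (snd c))) (p_cons p)) \<le> m * iw p (snd (snd p))" for p
  have "polyf d" unfolding d_def[abs_def] by (intro polyf_intros polyf_comp[OF l(1)])
  then have "polyf (\<lambda>w. d (PI w))" by (rule polyf_comp[OF _ PI(1)])
  then show ?thesis
  proof (rule reducible_if_decidable[OF np])
    fix J assume J: "J \<in> vcsp_instances \<Delta>"
    note D = instanceD[OF J]
    show "d (PI (enc_instance J)) \<longleftrightarrow> (\<exists>h. objective J h \<le> bound J)"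
    proof (cases "bound J < 0")
      case True
      have "\<not> objective J h \<le> bound J" for h using objective_nonneg[OF fv J, of h] True by linarith
      moreover have "fst (rho_rat (bound J))" using True by (simp add: rho_rat_neg)
      ultimately show ?thesis by (simp add: PI d_def rho_inst_def)
    next
      case False
      have "objective J (\<lambda>_. b) \<le> bound J \<longleftrightarrow> (\<Sum>t\<leftarrow>constraints J. iw (rho_inst J) (rho_rat (fst t)) *
          look (rho_fun (fst (snd t)))) \<le> m * iw (rho_inst J) (rho_rat (bound J))"
        by (rule scaled_objective) (use False D m g l in \<open>auto simp: map_replicate_const\<close>)
      also have "\<dots> \<longleftrightarrow> d (rho_inst J)"
        using False unfolding d_def by (simp add: rho_inst_def[of J] rho_rat_neg rho_con_def o_def)
      finally have c: "d (rho_inst J) \<longleftrightarrow> objective J (\<lambda>_. b) \<le> bound J" by simp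
      have "objective J (\<lambda>_. b) \<le> objective J h" for h
        unfolding objective_alt
      proof (rule sum_list_mono)
        fix t assume t: "t \<in> set (constraints J)"
        then show "fst t * snd (fst (snd t)) (map (\<lambda>_. b) (snd (snd t))) \<le> fst t * snd (fst (snd t)) (map h (snd (snd t)))"
          using D[OF t] mn[of "fst (snd t)" "map h (snd (snd t))"] by (intro mult_left_mono) (simp_all add: map_replicate_const)
      qed
      then show ?thesis unfolding PI c using order_trans by blast
    qed
  qed
qed

lemma reducible_if_submodular:
  assumes fin: "finite \<Delta>" and fv: "\<Delta> \<subseteq> finite_valued_cost_functions" and np: "np_hard (VCSP \<Delta>)"
    and sm: "\<And>f u v. f \<in> \<Delta> \<Longrightarrow> length u = fst f \<Longrightarrow> length v = fst f \<Longrightarrow>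
      snd f (map2 (\<and>) u v) + snd f (map2 (\<or>) u v) \<le> snd f u + snd f v"
  shows "VCSP {f_neq} \<le>\<^sub>C\<^sub>V VCSP \<Delta>"
proof -
  obtain m g where m: "m > 0" and g: "\<And>f u. f \<in> \<Delta> \<Longrightarrow> length u = fst f \<Longrightarrow> of_nat m * snd f u = of_nat (g f u)"
    using integer_values[OF fin fv] by blast
  have sg: "submodl (fst f) (g f)" if f: "f \<in> \<Delta>" for f
    unfolding submodl_def
  proof (intro allI impI)
    fix A B :: "bool list" assume AB: "length A = fst f" "length B = fst f"
    have "of_nat m * (snd f (map2 (\<and>) A B) + snd f (map2 (\<or>) A B)) \<le> of_nat m * (snd f A + snd f B)"
      using sm[OF f AB] by (intro mult_left_mono) auto
    then have "(of_nat (g f (map2 (\<or>) A B) + g f (map2 (\<and>) A B)) :: rat) \<le> of_nat (g f A + g f B)"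
      using AB f by (simp add: g[symmetric] distrib_left add.commute)
    then show "g f (map2 (\<or>) A B) + g f (map2 (\<and>) A B) \<le> g f A + g f B" by (simp only: of_nat_le_iff)
  qed
  \<comment> \<open>All that the algorithm needs to know about a function, attached to it as a
    constant because \<Delta> is fixed.\<close>
  define sd where "sd f = (rows (fst f) (g f), (g f (replicate (fst f) False), (greedy (fst f) (g f), value_table (fst f) (g f))))" for f
  obtain look where l: "polyf look" "\<And>f. f \<in> \<Delta> \<Longrightarrow> look (rho_fun f) = sd f"
    using lookup_exists[OF fin fv, of sd] by blast
  define zs where "zs f = nat (\<Sum>p<fst f. \<bar>int (fst (greedy (fst f) (g f) ! p)) - int (snd (greedy (fst f) (g f) ! p))\<bar>)" for f
  \<comment> \<open>As \<Delta> is finite, one number bounds the values of all functions and the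
    total variation of all greedy bases, and the clock of length 2c + 1 is a constant word.\<close>
  obtain c where c: "\<And>f A. f \<in> \<Delta> \<Longrightarrow> length A = fst f \<Longrightarrow> g f A \<le> c" "\<And>f. f \<in> \<Delta> \<Longrightarrow> zs f \<le> c"
  proof -
    have "finite {u :: bool list. length u = n}" for n using finite_lists_length_eq[of "UNIV :: bool set" n] by simp
    then have "finite ((\<Union>f\<in>\<Delta>. g f ` {u. length u = fst f}) \<union> zs ` \<Delta>)" using fin by blast
    from iffD1[OF finite_nat_set_iff_bounded_le this]
    obtain c where c: "\<forall>n \<in> (\<Union>f\<in>\<Delta>. g f ` {u. length u = fst f}) \<union> zs ` \<Delta>. n \<le> c" ..
    show ?thesis
    proof (rule that[of c])
      show "g f A \<le> c" if "f \<in> \<Delta>" "length A = fst f" for f A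
        by (rule bspec[OF c], rule UnI1, rule UN_I[OF that(1)], rule imageI) (use that in simp)
      show "zs f \<le> c" if "f \<in> \<Delta>" for f
        by (rule bspec[OF c], rule UnI2, rule imageI[OF that])
    qed
  qed
  obtain PI where PI: "polyf PI" "\<And>I. PI (enc_instance I) = rho_inst I" using parsable_function[OF parsable_instance] by blast
  define its where "its p = map (\<lambda>t. (look (fst (snd t)), (snd (snd t), iw p (fst t)))) (p_cons p)" for p
  define mins where "mins p = minset (its p) (concat (map (\<lambda>t. snd (snd t)) (p_cons p))) (replicate (2 * c + 1) True)" for p :: pinst
  define d where "d p \<longleftrightarrow> \<not> fst (snd (snd p)) \<and>
    sum_list (map (\<lambda>t. it_wt t * eval_tab (it_tab t) (map (\<lambda>v. elem v (mins p)) (it_args t))) (its p)) \<le> m * iw p (snd (snd p))" for p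
  have pi: "polyf its" unfolding its_def[abs_def] by (intro polyf_intros polyf_comp[OF l(1)])
  have pm: "polyf mins" unfolding mins_def[abs_def] by (intro polyf_intros pi)
  have "polyf d" unfolding d_def[abs_def] by (intro polyf_intros polyf_comp[OF pi] polyf_comp[OF pm])
  then have "polyf (\<lambda>w. d (PI w))" by (rule polyf_comp[OF _ PI(1)])
  then show ?thesis
  proof (rule reducible_if_decidable[OF np])
    fix J assume J: "J \<in> vcsp_instances \<Delta>"
    note D = instanceD[OF J]
    show "d (PI (enc_instance J)) \<longleftrightarrow> (\<exists>h. objective J h \<le> bound J)"
    proof (cases "bound J < 0")
      case True
      have "\<not> objective J h \<le> bound J" for h using objective_nonneg[OF fv J, of h] True by linarith
      moreover have "fst (rho_rat (bound J))" using True by (simp add: rho_rat_neg)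
      ultimately show ?thesis by (simp add: PI d_def rho_inst_def)
    next
      case False
      let ?cs = "constraints J" and ?p = "rho_inst J"
      define q where "q = length ?cs"
      define f where "f i = fst (snd (?cs ! i))" for i
      define x where "x i = snd (snd (?cs ! i))" for i
      define W where "W i = iw ?p (rho_rat (fst (?cs ! i)))" for i
      have mem: "?cs ! i \<in> set ?cs" if "i < q" for i using that by (simp add: q_def)
      have fD: "f i \<in> \<Delta>" "length (x i) = fst (f i)" if "i < q" for i
        using D(2,3)[OF mem[OF that]] by (simp_all add: f_def x_def)
      interpret IL: item_list q "\<lambda>i. fst (f i)" "\<lambda>i. g (f i)" "\<lambda>i. greedy (fst (f i)) (g (f i))" x W c
      proof
        fix i assume i: "i < q"
        show "length (x i) = fst (f i)" "submodl (fst (f i)) (g (f i))" using fD[OF i] sg by auto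
        show "basel (fst (f i)) (g (f i)) (greedy (fst (f i)) (g (f i)))" using sg fD[OF i] by (intro basel_greedy) auto
        show "(\<Sum>p<fst (f i). \<bar>int (fst (greedy (fst (f i)) (g (f i)) ! p)) - int (snd (greedy (fst (f i)) (g (f i)) ! p))\<bar>) \<le> int c"
          using c(2)[OF fD(1)[OF i]] unfolding zs_def by (simp add: nat_le_iff)
        show "g (f i) A \<le> c" if "length A = fst (f i)" for A using c(1)[OF fD(1)[OF i] that] .
      qed
      have cs: "?cs = map (\<lambda>i. ?cs ! i) [0..<q]" by (simp add: q_def map_nth)
      have its: "its ?p = IL.its"
      proof -
        have "its ?p = map (\<lambda>t. (look (rho_fun (fst (snd t))), (snd (snd t), iw ?p (rho_rat (fst t))))) ?cs"
          unfolding its_def by (simp add: rho_inst_def[of J] rho_con_def o_def)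
        also have "\<dots> = IL.its" unfolding IL.its_def
          by (subst cs) (auto simp: l(2) D(2)[OF mem] sd_def f_def x_def W_def)
        finally show ?thesis .
      qed
      define V where "V = concat (map (\<lambda>t. snd (snd t)) (p_cons ?p))"
      have "V = concat (map x [0..<q])"
        unfolding V_def by (subst rho_inst_def) (simp add: rho_con_def o_def, subst cs, simp add: o_def x_def[abs_def])
      then have V: "set V = (\<Union>i<q. set (x i))" by (auto simp: atLeast0LessThan)
      let ?R = "set (mins ?p)"
      have R: "mins ?p = minset IL.its V (replicate (2 * c + 1) True)" by (simp add: mins_def its V_def)
      have opt: "IL.F W (IL.PRE ?R) \<le> IL.F W (IL.PRE A)" for A
        unfolding R by (rule IL.minset_optimal[OF V]) simp
      have sums: "(\<Sum>t\<leftarrow>?cs. iw ?p (rho_rat (fst t)) * g (fst (snd t)) (map h (snd (snd t)))) = (\<Sum>i<q. W i * g (f i) (map h (x i)))" for h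
        by (subst cs) (simp add: o_def interv_sum_list_conv_sum_set_nat atLeast0LessThan W_def f_def x_def)
      have sc: "objective J h \<le> bound J \<longleftrightarrow> (\<Sum>i<q. W i * g (f i) (map h (x i))) \<le> m * iw ?p (rho_rat (bound J))" for h
        unfolding sums[symmetric] by (rule scaled_objective) (use False D m g in auto)
      have le: "(\<Sum>i<q. W i * g (f i) (map (\<lambda>v. v \<in> ?R) (x i))) \<le> (\<Sum>i<q. W i * g (f i) (map h (x i)))" for h
      proof -
        \<comment> \<open>\<open>IL.F\<close> is normalised to 0 at the empty set; the offset is the
          same for all assignments and cancels.\<close>
        have "int (\<Sum>i<q. W i * g (f i) (map (\<lambda>v. v \<in> A) (x i))) = IL.F W (IL.PRE A) +
          (\<Sum>i<q. int (W i) * int (g (f i) (replicate (fst (f i)) False)))" for A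
          unfolding IL.F_pre IL.G_def by (simp add: algebra_simps sum.distrib[symmetric])
        from this[of ?R] this[of "{v. h v}"] opt[of "{v. h v}"]
        have "int (\<Sum>i<q. W i * g (f i) (map (\<lambda>v. v \<in> ?R) (x i))) \<le> int (\<Sum>i<q. W i * g (f i) (map (\<lambda>v. v \<in> {v. h v}) (x i)))"
          by (simp only: add_le_cancel_right)
        then show ?thesis by (simp only: of_nat_le_iff mem_Collect_eq)
      qed
      have "d ?p \<longleftrightarrow> (\<Sum>i<q. W i * g (f i) (map (\<lambda>v. v \<in> ?R) (x i))) \<le> m * iw ?p (rho_rat (bound J))"
      proof -
        have "sum_list (map (\<lambda>t. it_wt t * eval_tab (it_tab t) (map (\<lambda>v. elem v (mins ?p)) (it_args t))) (its ?p)) =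
          (\<Sum>i<q. W i * g (f i) (map (\<lambda>v. v \<in> ?R) (x i)))"
          unfolding its IL.its_def by (simp add: o_def interv_sum_list_conv_sum_set_nat atLeast0LessThan elem eval_tab fD(2))
        moreover have "snd (snd ?p) = rho_rat (bound J)" by (simp add: rho_inst_def)
        ultimately show ?thesis using False unfolding d_def by (simp add: rho_rat_neg)
      qed
      then show ?thesis unfolding PI sc using le order_trans by blast
    qed
  qed
qed

section \<open>The reduction in the hard case\<close>

definition hd0 :: "nat list \<Rightarrow> nat" where
  "hd0 xs = (case xs of [] \<Rightarrow> 0 | u # _ \<Rightarrow> u)"

lemma polyf_hd0 [polyf_intros]: "polyf xs \<Longrightarrow> polyf (\<lambda>x. hd0 (xs x))"
  by (rule polyf_comp[of hd0]) (unfold hd0_def[abs_def], intro polyf_intros)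

text \<open>The constants of all gadgets are the same two fresh variables \<open>n\<close> and
  \<open>n + 1\<close>.\<close>

definition place_var :: "nat \<Rightarrow> nat list \<Rightarrow> nat \<Rightarrow> nat" where
  "place_var n xs i = (if i = 0 then hd0 xs else if i = 1 then hd0 (tl xs) else if i = 2 then n else n + 1)"

definition place :: "nat \<Rightarrow> nat \<Rightarrow> nat list \<Rightarrow> gadget \<Rightarrow> (rat \<times> cost_fun \<times> nat list) list" where
  "place k n xs G = map (\<lambda>t. (of_nat (k * fst t), fst (snd t), map (place_var n xs) (snd (snd t)))) G"

text \<open>Writes constraints directly in coded form. The leading bits are the list marker and the
  sign, 1 is the denominator, and the cost functions arrive already encoded by
  \<open>tabulate\<close>, since only those of the fixed gadgets occur.\<close>

definition enc_place :: "nat \<Rightarrow> nat \<Rightarrow> nat list \<Rightarrow> (nat \<times> bool list \<times> nat list) list \<Rightarrow> bool list" where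
  "enc_place k n xs T = concat (map (\<lambda>t. True # False # (enc_nat (k * fst t) @ (enc_nat 1 @ (fst (snd t) @
     enc_list enc_nat (map (place_var n xs) (snd (snd t))))))) T)"

definition tabulate :: "gadget \<Rightarrow> (nat \<times> bool list \<times> nat list) list" where
  "tabulate G = map (\<lambda>t. (fst t, (enc_cost_fun (fst (snd t)), snd (snd t)))) G"

lemma polyf_place_var [polyf_intros]: "polyf n \<Longrightarrow> polyf xs \<Longrightarrow> polyf i \<Longrightarrow> polyf (\<lambda>x. place_var (n x) (xs x) (i x))"
  by (rule polyf_comp3) (unfold place_var_def, intro polyf_intros)

lemma polyf_enc_place [polyf_intros]:
  "polyf k \<Longrightarrow> polyf n \<Longrightarrow> polyf xs \<Longrightarrow> polyf T \<Longrightarrow> polyf (\<lambda>x. enc_place (k x) (n x) (xs x) (T x))"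
  by (rule polyf_comp4) (unfold enc_place_def, intro polyf_intros)

lemma enc_place: "enc_place k n xs (tabulate G) = concat (map (\<lambda>c. True # enc_constraint c) (place k n xs G))"
  unfolding enc_place_def tabulate_def place_def map_map o_def
  by (intro arg_cong[of _ _ concat] map_cong refl)
    (simp only: fst_conv snd_conv enc_constraint_def prod.case enc_rat_of_nat append_Cons append_assoc)

lemma place_value:
  "(\<Sum>t\<leftarrow>place k n xs G. fst t * snd (fst (snd t)) (map h (snd (snd t)))) = of_nat k * gval G (\<lambda>i. h (place_var n xs i))"
  by (simp add: place_def gval_def o_def sum_list_const_mult[symmetric] algebra_simps)

lemma place_wf:
  assumes "gwf \<Delta> X G" "place_var n xs ` X \<subseteq> {..<m}" "c \<in> set (place k n xs G)"
  shows "0 \<le> fst c \<and> fst (snd c) \<in> \<Delta> \<and> length (snd (snd c)) = fst (fst (snd c)) \<and> set (snd (snd c)) \<subseteq> {..<m}"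
  using assms unfolding gwf_def place_def by fastforce

context hard_case
begin

lemma gval_complement:
  assumes "symm" "gwf \<Delta> X G"
  shows "gval G (\<lambda>i. \<not> h i) = gval G h"
  unfolding gval_def
proof (intro arg_cong[of _ _ sum_list] map_cong refl)
  fix t assume "t \<in> set G"
  then have "fst (snd t) \<in> \<Delta>" "length (map h (snd (snd t))) = fst (fst (snd t))" using assms(2) by (auto simp: gwf_def)
  then have "snd (fst (snd t)) (map Not (map h (snd (snd t)))) = snd (fst (snd t)) (map h (snd (snd t)))"
    using assms(1) unfolding symm_def by blast
  then show "of_nat (fst t) * snd (fst (snd t)) (map (\<lambda>i. \<not> h i) (snd (snd t))) = of_nat (fst t) * snd (fst (snd t)) (map h (snd (snd t)))"
    by (simp add: o_def)
qed

text \<open>With the constants in place, the gadgets sum to an affine function of the total weight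
  of equal pairs, so their bound translates the original one. The weight of \<open>P\<close> is
  chosen so large that the constants must be in place, up to complement in the symmetric
  case.\<close>

lemma reducible: "VCSP {f_neq} \<le>\<^sub>C\<^sub>V VCSP \<Delta>"
proof -
  from neq_gadget obtain G P a b c where G: "gwf \<Delta> {..<4} G" and P: "gwf \<Delta> {2, 3} P" and ba: "b < a"
    and N: "\<forall>h. \<not> h 2 \<longrightarrow> h 3 \<longrightarrow> gval G h = of_nat (if h 0 = h 1 then a else b)"
      "\<forall>h. \<not> h 2 \<longrightarrow> h 3 \<longrightarrow> gval P h = of_nat c" "\<forall>h. h 2 = h 3 \<longrightarrow> of_nat (c + 1) \<le> gval P h"
    and Ps: "symm \<or> (\<forall>h. h 2 \<longrightarrow> \<not> h 3 \<longrightarrow> of_nat (c + 1) \<le> gval P h)"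
    by (elim exE conjE) (rule that)
  note Gv = N(1)[rule_format] and Pv = N(2)[rule_format] and Pe = N(3)[rule_format]
  define d where "d = a - b"
  have d: "0 < d" "a = b + d" using ba by (simp_all add: d_def)
  obtain PI where PI: "polyf PI" "\<And>I. PI (enc_instance I) = rho_inst I" using parsable_function[OF parsable_instance] by blast
  define nv where "nv p = sum_list (map (\<lambda>_. 1 :: nat) (fst p))" for p :: pinst
  \<comment> \<open>The largest acceptable value of the disequality gadgets: each contributes its
    weight times \<open>b\<close>, and \<open>d\<close> is charged for every unit of the scaled
    bound.\<close>
  define B where "B p = b * sum_list (map (\<lambda>e. iw p (fst e)) (p_cons p)) + d * iw p (snd (snd p))" for p :: pinst
  define out where "out p = map (\<lambda>_. True) (fst p) @ ([True, True, False] @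
     (if fst (snd (snd p)) then False # enc_rat (-1)
      else concat (map (\<lambda>e. enc_place (iw p (fst e)) (nv p) (snd (snd e)) (tabulate G)) (p_cons p)) @
        (enc_place (B p + 1) (nv p) [] (tabulate P) @ (False # False # (enc_nat (B p + (B p + 1) * c) @ enc_nat 1)))))" for p :: pinst
  \<comment> \<open>With weight B + 1, exceeding the value \<open>c\<close> of \<open>P\<close> by 1
    costs more than all gadgets together are allowed. A negative bound is treated apart, because
    \<open>iw\<close> ignores signs; it is sent to an unsolvable instance.\<close>
  define red where "red I = \<lparr>nvars = nvars I + 2,
     constraints = (if bound I < 0 then [] else
       concat (map (\<lambda>t. place (iw (rho_inst I) (rho_rat (fst t))) (nvars I) (snd (snd t)) G) (constraints I)) @
       place (B (rho_inst I) + 1) (nvars I) [] P),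
     bound = (if bound I < 0 then -1 else of_nat (B (rho_inst I) + (B (rho_inst I) + 1) * c))\<rparr>" for I :: vcsp_instance
  have nv: "polyf nv" unfolding nv_def[abs_def] by (intro polyf_intros)
  have pB: "polyf B" unfolding B_def[abs_def] by (intro polyf_intros)
  have "polyf out" unfolding out_def[abs_def] by (intro polyf_intros polyf_comp[OF nv] polyf_comp[OF pB])
  then have "polyf (\<lambda>w. out (PI w))" by (rule polyf_comp[OF _ PI(1)])
  from polyf_machine[OF this] obtain M r where M: "wf_tm M" "\<And>w. outputs_within M w (poly r (length w)) (out (PI w))" by blast
  have "out (PI (enc_instance I)) = enc_instance (red I)" for I
  proof -
    let ?p = "rho_inst I"
    have p: "map (\<lambda>_. True) (fst ?p) = replicate (nvars I) True" "nv ?p = nvars I" "fst (snd (snd ?p)) \<longleftrightarrow> bound I < 0"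
      by (simp_all add: rho_inst_def nv_def o_def map_replicate_const sum_list_replicate rho_rat_neg)
    have cs: "concat (map (\<lambda>e. enc_place (iw ?p (fst e)) (nvars I) (snd (snd e)) (tabulate G)) (p_cons ?p)) =
      concat (map (\<lambda>c. True # enc_constraint c)
        (concat (map (\<lambda>t. place (iw ?p (rho_rat (fst t))) (nvars I) (snd (snd t)) G) (constraints I))))"
    proof -
      have "p_cons ?p = map rho_con (constraints I)" by (simp add: rho_inst_def)
      moreover have "concat (map (\<lambda>t. concat (f t)) cs) = concat (concat (map f cs))"
        for f :: "rat \<times> cost_fun \<times> nat list \<Rightarrow> bool list list" and cs
        by (induction cs) simp_all
      ultimately show ?thesis by (simp add: enc_place rho_con_def o_def map_concat)
    qed
    show ?thesis
      unfolding PI(2) out_def p cs unfolding enc_place enc_instance_def[of "red I"]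
      by (simp add: red_def enc_list_def enc_rat_of_nat replicate_app_Cons_same del: of_nat_add of_nat_mult of_nat_Suc)
  qed
  then have "polytime_computable (vcsp_instances {f_neq}) enc_instance enc_instance red"
    unfolding polytime_computable_def using M by metis
  moreover have "red I \<in> vcsp_instances \<Delta>" if I: "I \<in> vcsp_instances {f_neq}" for I
  proof -
    have "0 \<le> fst e \<and> fst (snd e) \<in> \<Delta> \<and> length (snd (snd e)) = fst (fst (snd e)) \<and> set (snd (snd e)) \<subseteq> {..<nvars I + 2}"
      if e: "e \<in> set (constraints (red I))" for e
    proof -
      from e consider (P) "e \<in> set (place (B (rho_inst I) + 1) (nvars I) [] P)"
        | (G) t where "t \<in> set (constraints I)" "e \<in> set (place (iw (rho_inst I) (rho_rat (fst t))) (nvars I) (snd (snd t)) G)"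
        by (auto simp: red_def split: if_splits)
      then show ?thesis
      proof cases
        case P
        show ?thesis by (rule place_wf[OF \<open>gwf \<Delta> {2, 3} P\<close> _ P]) (auto simp: place_var_def)
      next
        case (G t)
        obtain u v where "snd (snd t) = [u, v]" "u < nvars I" "v < nvars I" using neq_instanceD(3)[OF I G(1)] by blast
        then show ?thesis by (intro place_wf[OF \<open>gwf \<Delta> {..<4} G\<close> _ G(2)]) (auto simp: place_var_def hd0_def)
      qed
    qed
    then show ?thesis unfolding vcsp_instances_def by (fastforce simp: red_def)
  qed
  moreover have "(\<exists>h. objective I h \<le> bound I) \<longleftrightarrow> (\<exists>h. objective (red I) h \<le> bound (red I))"
    if I: "I \<in> vcsp_instances {f_neq}" for I
  proof (cases "bound I < 0")
    case True
    have "\<not> objective I h \<le> bound I" for h using objective_nonneg[OF f_neq_fv I, of h] True by linarith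
    moreover have "\<not> objective (red I) h \<le> bound (red I)" for h using True by (simp add: red_def objective_def)
    ultimately show ?thesis by blast
  next
    case False
    let ?p = "rho_inst I" and ?n = "nvars I"
    define K where "K = iw ?p (rho_rat (bound I))"
    define W where "W t = iw ?p (rho_rat (fst t))" for t :: "rat \<times> cost_fun \<times> nat list"
    define S where "S = (\<Sum>t\<leftarrow>constraints I. W t)"
    define same where "same h t = (if h (hd0 (snd (snd t))) = h (hd0 (tl (snd (snd t)))) then 1 else 0 :: nat)"
      for h :: "nat \<Rightarrow> bool" and t :: "rat \<times> cost_fun \<times> nat list"
    define cut where "cut h = (\<Sum>t\<leftarrow>constraints I. W t * same h t)" for h
    have Bp: "B ?p = b * S + d * K"
      unfolding B_def S_def W_def K_def by (simp add: rho_inst_def[of I] rho_con_def o_def)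
    have cut: "objective I h \<le> bound I \<longleftrightarrow> cut h \<le> K" for h
    proof -
      have "objective I h \<le> bound I \<longleftrightarrow> (\<Sum>t\<leftarrow>constraints I. iw ?p (rho_rat (fst t)) * same h t) \<le> 1 * iw ?p (rho_rat (bound I))"
      proof (rule scaled_objective)
        fix t assume t: "t \<in> set (constraints I)"
        show "0 \<le> fst t" by (rule neq_instanceD[OF I t])
        obtain u v where "snd (snd t) = [u, v]" using neq_instanceD(3)[OF I t] by blast
        then show "of_nat 1 * snd (fst (snd t)) (map h (snd (snd t))) = of_nat (same h t)"
          using neq_instanceD(2)[OF I t] by (simp add: f_neq_val same_def hd0_def)
      qed (use False in auto)
      then show ?thesis by (simp add: cut_def W_def K_def)
    qed
    define GV where "GV h = (\<Sum>t\<leftarrow>constraints I. of_nat (W t) * gval G (\<lambda>i. h (place_var ?n (snd (snd t)) i)))" for h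
    define PV where "PV h = gval P (\<lambda>i. h (place_var ?n [] i))" for h
    have ob: "objective (red I) h = GV h + of_nat (B ?p + 1) * PV h" for h
    proof -
      have "(\<Sum>t\<leftarrow>concat (map (\<lambda>t. place (W t) ?n (snd (snd t)) G) cs). fst t * snd (fst (snd t)) (map h (snd (snd t)))) =
        (\<Sum>t\<leftarrow>cs. of_nat (W t) * gval G (\<lambda>i. h (place_var ?n (snd (snd t)) i)))" for cs
        by (induction cs) (simp_all add: place_value)
      then show ?thesis using False
        unfolding objective_alt GV_def PV_def W_def by (simp add: red_def place_value)
    qed
    have bd: "bound (red I) = of_nat (B ?p + (B ?p + 1) * c)" using False by (simp add: red_def)
    have good: "objective (red I) h \<le> bound (red I) \<longleftrightarrow> cut h \<le> K" if h: "\<not> h ?n" "h (?n + 1)" for h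
    proof -
      have "GV h = of_nat (\<Sum>t\<leftarrow>constraints I. W t * (b + d * same h t))"
        unfolding GV_def of_nat_sum_list map_map o_def
      proof (intro arg_cong[of _ _ sum_list] map_cong refl)
        fix t :: "rat \<times> cost_fun \<times> nat list"
        have "gval G (\<lambda>i. h (place_var ?n (snd (snd t)) i)) = of_nat (b + d * same h t)"
          using h by (subst Gv) (simp_all add: place_var_def same_def d)
        then show "of_nat (W t) * gval G (\<lambda>i. h (place_var ?n (snd (snd t)) i)) = of_nat (W t * (b + d * same h t))"
          by (simp only: of_nat_mult)
      qed
      also have "(\<Sum>t\<leftarrow>constraints I. W t * (b + d * same h t)) = b * S + d * cut h"
        unfolding S_def cut_def sum_list_const_mult[symmetric] sum_list_addf[symmetric] by (simp add: algebra_simps)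
      finally have "GV h = of_nat (b * S + d * cut h)" .
      moreover have "PV h = of_nat c" unfolding PV_def using h by (intro Pv) (simp_all add: place_var_def)
      ultimately have "objective (red I) h = of_nat (b * S + d * cut h + (B ?p + 1) * c)"
        unfolding ob by (simp only: of_nat_add of_nat_mult)
      then have "objective (red I) h \<le> bound (red I) \<longleftrightarrow> b * S + d * cut h + (B ?p + 1) * c \<le> B ?p + (B ?p + 1) * c"
        unfolding bd by (simp only: of_nat_le_iff)
      then show ?thesis using d(1) by (simp add: Bp)
    qed
    have bad: "\<not> objective (red I) h \<le> bound (red I)" if "of_nat (c + 1) \<le> PV h" for h
    proof -
      have "(of_nat (B ?p + (B ?p + 1) * c) :: rat) < of_nat ((B ?p + 1) * (c + 1))"
        unfolding of_nat_less_iff by simp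
      also have "\<dots> \<le> of_nat (B ?p + 1) * PV h"
        unfolding of_nat_mult by (rule mult_left_mono[OF that]) simp
      also have "\<dots> \<le> objective (red I) h"
      proof -
        have "0 \<le> GV h" unfolding GV_def by (intro sum_list_nonneg) (auto intro!: mult_nonneg_nonneg gval_nonneg[OF G])
        then show ?thesis by (simp add: ob)
      qed
      finally show ?thesis by (simp add: bd)
    qed
    show ?thesis
    proof
      assume "\<exists>h. objective I h \<le> bound I"
      then obtain h where h: "cut h \<le> K" using cut by blast
      define h' where "h' v = (if v = ?n then False else if v = ?n + 1 then True else h v)" for v
      have "cut h' = cut h"
        unfolding cut_def
      proof (intro arg_cong[of _ _ sum_list] map_cong refl)
        fix t assume "t \<in> set (constraints I)"
        then obtain u v where "snd (snd t) = [u, v]" "u < ?n" "v < ?n" using neq_instanceD(3)[OF I] by blast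
        then show "W t * same h' t = W t * same h t" by (simp add: same_def hd0_def h'_def)
      qed
      then show "\<exists>h. objective (red I) h \<le> bound (red I)" using good[of h'] h by (auto simp: h'_def)
    next
      assume "\<exists>h. objective (red I) h \<le> bound (red I)"
      then obtain h where h: "objective (red I) h \<le> bound (red I)" by blast
      \<comment> \<open>Equal constants are excluded by \<open>P\<close>. Exchanged constants are
        possible only if all of \<Delta> is invariant under complement, and then the complementary
        assignment has the same value.\<close>
      have "\<exists>h. \<not> h ?n \<and> h (?n + 1) \<and> objective (red I) h \<le> bound (red I)"
      proof (cases "\<not> h ?n \<and> h (?n + 1)")
        case False
        have "h ?n \<noteq> h (?n + 1)" using bad[of h] h Pe[of "\<lambda>i. h (place_var ?n [] i)"] by (auto simp: PV_def place_var_def)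
        then have n: "h ?n" "\<not> h (?n + 1)" using False by auto
        have "symm"
        proof (rule ccontr)
          assume "\<not> symm"
          then have "of_nat (c + 1) \<le> PV h" using Ps n unfolding PV_def by (auto simp: place_var_def)
          then show False using bad h by blast
        qed
        then have "objective (red I) (\<lambda>v. \<not> h v) = objective (red I) h"
          unfolding ob GV_def PV_def by (simp only: gval_complement[OF _ G] gval_complement[OF _ P])
        then show ?thesis using n h by (intro exI[of _ "\<lambda>v. \<not> h v"]) simp
      qed (use h in blast)
      then show "\<exists>h. objective I h \<le> bound I" using good cut by blast
    qed
  qed
  ultimately have "cv_reduction (VCSP {f_neq}) (VCSP \<Delta>) red"
    unfolding cv_reduction_def by (auto simp: VCSP_def red_def intro!: exI[of _ 2])
  then show ?thesis unfolding cv_reducible_def by blast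
qed

end

section \<open>The case distinction over \<Delta>\<close>

theorem theorem5:
  fixes \<Delta> :: "cost_fun set"
  assumes "finite \<Delta>"
    and "\<Delta> \<subseteq> finite_valued_cost_functions"
    and "np_hard (VCSP \<Delta>)"
  shows "VCSP {f_neq} \<le>\<^sub>C\<^sub>V VCSP \<Delta>"
proof (cases "(\<exists>b. \<forall>f\<in>\<Delta>. \<forall>u. length u = fst f \<longrightarrow> snd f (replicate (fst f) b) \<le> snd f u) \<or>
    (\<forall>f\<in>\<Delta>. \<forall>u v. length u = fst f \<longrightarrow> length v = fst f \<longrightarrow>
      snd f (map2 (\<and>) u v) + snd f (map2 (\<or>) u v) \<le> snd f u + snd f v)")
  case True
  then show ?thesis
  proof
    assume "\<exists>b. \<forall>f\<in>\<Delta>. \<forall>u. length u = fst f \<longrightarrow> snd f (replicate (fst f) b) \<le> snd f u"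
    then obtain b where "\<And>f u. f \<in> \<Delta> \<Longrightarrow> length u = fst f \<Longrightarrow> snd f (replicate (fst f) b) \<le> snd f u" by blast
    from reducible_if_const_minimal[OF assms this] show ?thesis .
  next
    assume "\<forall>f\<in>\<Delta>. \<forall>u v. length u = fst f \<longrightarrow> length v = fst f \<longrightarrow>
      snd f (map2 (\<and>) u v) + snd f (map2 (\<or>) u v) \<le> snd f u + snd f v"
    then show ?thesis by (intro reducible_if_submodular[OF assms]) auto
  qed
next
  case False
  then obtain f0 t0 f1 t1 fn s t where
    "f0 \<in> \<Delta>" "length t0 = fst f0" "snd f0 t0 < snd f0 (replicate (fst f0) False)"
    "f1 \<in> \<Delta>" "length t1 = fst f1" "snd f1 t1 < snd f1 (replicate (fst f1) True)"
    "fn \<in> \<Delta>" "length s = fst fn" "length t = fst fn"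
    "snd fn s + snd fn t < snd fn (map2 (\<and>) s t) + snd fn (map2 (\<or>) s t)"
    unfolding not_le[symmetric] by blast
  then interpret hard_case \<Delta> f0 f1 fn t0 t1 s t by unfold_locales (use assms in auto)
  show ?thesis by (rule reducible)
qed


end
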